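(* Fix $\xi\in\mathbb{R}$, $\xi\neq 0$. Then: (i) If $\xi\in(-\sqrt{\pi},0)\cup(0,\sqrt{\pi})$, then for any $f,g\in L^2_w(\mathbb{R})$ $$(f,g)_{L^2_w}=\int_{\mathbb{R}}(\mathcal{B}_\xi f)(\lambda)\,\overline{(\mathcal{U}_\xi g)(\lambda)}\,w(\lambda)\,d\lambda+(P_{\lambda^*}(\xi)f,g)_{L^2_w},$$ where $\lambda^*(\xi)\in(-1,0)$ is an isolated eigenvalue of $L_\xi$ and $P_{\lambda^*}(\xi)$ is the Riesz projection corresponding to the simple eigenvalue $\lambda^*(\xi)$ of $L_\xi$. (ii) If $\xi=\pm\sqrt{\pi}$, then for any $f,g\in H^1_w(\mathbb{R})$ $$(f,g)_{L^2_w}=\int_{\mp}(\mathcal{B}_\xi f)(\lambda)\,\overline{(\mathcal{U}_\xi g)(\lambda)}\,w(\lambda)\,d\lambda+\langle P_{-1^\pm}f,g\rangle .$$ (iii) If $\xi\notin[-\sqrt{\pi},\sqrt{\pi}]$, then for any $f,g\in L^2_w(\mathbb{R})$ $$(f,g)_{L^2_w}=\int_{\mathbb{R}}(\mathcal{B}_\xi f)(\lambda)\,\overline{(\mathcal{U}_\xi g)(\lambda)}\,w(\lambda)\,d\lambda .$$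
   Context: Let $w(v)=e^{-v^2}/\sqrt{\pi}$ and let $L^2_w=L^2_w(\mathbb{R})$ have inner product $(f,g)_{L^2_w}=\int_{\mathbb{R}}f\bar g\,w\,dv$; $H^1_w$ is the space of $f\in L^2_w$ with $f'\in L^2_w$. $\mathbb{1}$ is the constant function $1$ and $Vf=(f,\mathbb{1})_{L^2_w}\mathbb{1}$. For $\xi\in\mathbb{R}$, $(L_\xi f)(v)=(-iv\xi-1)f(v)+(Vf)(v)$ with maximal domain $\{f\in L^2_w: L_\xi f\in L^2_w\}$. Spectral determinant: $\omega(\lambda,\xi)=1-\int_{\mathbb{R}}\frac{w(v)\,dv}{iv\xi+1+\lambda}$ for $\mathrm{Re}\,\lambda\ne-1$. For $\xi\in(-\sqrt\pi,\sqrt\pi)$, $\lambda^*(\xi)\in(-1,0]$ is the unique zero of $\omega(\cdot,\xi)$; it is a simple isolated eigenvalue of $L_\xi$. For $\xi\neq0$ and $\lambda\in\mathbb{R}$ define the boundary values $\omega_+(-1-i\lambda\xi,\xi)=\lim_{\delta\to0^+}\omega(-1+\delta-i\lambda\xi,\xi)$ and $\omega_-(-1+i\lambda\xi,-\xi)=\lim_{\delta\to0^+}\omega(-1-\delta+i\lambda\xi,-\xi)$. The first vanishes for some real $\lambda$ only if $\xi=\pm\sqrt\pi$, and then only at $\lambda=0$; the second never vanishes. For $h\in L^2(\mathbb{R})$ let $(\hat{\mathcal S}_\pm h)(\lambda)=\lim_{\eta\to0^\pm}\int_{\mathbb{R}}\frac{h(z)}{z-(\lambda+i\eta)}\,dz$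 (a.e. $\lambda$, and in $L^2$). The generalized Fourier transforms are $$(\mathcal U_\xi f)(\lambda)=f(\lambda)-\frac{1}{i\xi\,\overline{\omega_+(-1-i\lambda\xi,\xi)}}\,(\hat{\mathcal S}_{-\mathrm{sgn}\,\xi}(fw))(\lambda),\qquad (\mathcal B_\xi f)(\lambda)=f(\lambda)+\frac{1}{i\xi\,\overline{\omega_-(-1+i\lambda\xi,-\xi)}}\,(\hat{\mathcal S}_{-\mathrm{sgn}\,\xi}(fw))(\lambda).$$ For $\xi=\pm\sqrt\pi$ (upper/lower signs corresponding), the regularized integral is $\int_{\mp}h\,\overline{\mathcal U_\xi g}\,w\,d\lambda:=\lim_{b\to0^\pm}\int_{\mathbb{R}}\frac{\lambda}{\lambda-ib}\,h(\lambda)\,\overline{(\mathcal U_\xi g)(\lambda)}\,w(\lambda)\,d\lambda$ (the contour passes below, respectively above, the singularity at $\lambda=0$). $P_{-1^\pm}$ is minus the residue at $\lambda=-1$ of the continuation through $\mathrm{Re}\,\lambda=-1$, from $\mathrm{Re}\,\lambda>-1$, of $(L_{\pm\sqrt\pi}-\lambda)^{-1}$ in the sense of sesquilinear forms; explicitly, for $f,g\in H^1_w$, $$\langle P_{-1^\pm}f,g\rangle=\frac{1}{\omega_+'(-1,\pm\sqrt\pi)}\Big(\lim_{b\to0^\pm}\int_{\mathbb{R}}\frac{f(v)w(v)\,dv}{\pm i\sqrt\pi\,(v-ib)}\Big)\Big(\lim_{b\to0^\pm}\int_{\mathbb{R}}\frac{\overline{g(v)}w(v)\,dv}{\pm i\sqrt\pi\,(v-ib)}\Big),$$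 where $\omega_+'(-1,\pm\sqrt\pi)=2/\pi$ is the $\lambda$-derivative at $\lambda=-1$ of the analytic continuation of $\omega(\cdot,\pm\sqrt\pi)$ from $\mathrm{Re}\,\lambda>-1$. *)

theory Defs
  imports "HOL-Complex_Analysis.Complex_Analysis"
begin

section \<open>The weighted space\<close>

definition wt :: "real \<Rightarrow> real" where
  "wt v = exp (- v\<^sup>2) / sqrt pi"

text \<open>Elements of the weighted spaces are represented by Borel measurable functions on the
  line; equality of elements is equality almost everywhere.\<close>

definition L2w :: "(real \<Rightarrow> complex) set" where
  "L2w = {f. f \<in> borel_measurable lborel \<and> integrable lborel (\<lambda>v. (cmod (f v))\<^sup>2 * wt v)}"

definition L2w_inner :: "(real \<Rightarrow> complex) \<Rightarrow> (real \<Rightarrow> complex) \<Rightarrow> complex" where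
  "L2w_inner f g = (LINT v|lborel. f v * cnj (g v) * complex_of_real (wt v))"

definition L2w_norm :: "(real \<Rightarrow> complex) \<Rightarrow> real" where
  "L2w_norm f = sqrt (LINT v|lborel. (cmod (f v))\<^sup>2 * wt v)"

text \<open>The derivative in \<open>H1w\<close> is the weak one, tested against compactly supported
  \<open>C\<^sup>1\<close> functions.\<close>

definition test_function :: "(real \<Rightarrow> real) \<Rightarrow> bool" where
  "test_function \<phi> \<longleftrightarrow> \<phi> C1_differentiable_on UNIV \<and> compact (closure {x. \<phi> x \<noteq> 0})"

definition weak_derivative :: "(real \<Rightarrow> complex) \<Rightarrow> (real \<Rightarrow> complex) \<Rightarrow> bool" where
  "weak_derivative f f' \<longleftrightarrow> (\<forall>\<phi>. test_function \<phi> \<longrightarrow>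
     (LINT v|lborel. f v * complex_of_real (deriv \<phi> v))
       = - (LINT v|lborel. f' v * complex_of_real (\<phi> v)))"

definition H1w :: "(real \<Rightarrow> complex) set" where
  "H1w = {f \<in> L2w. \<exists>f' \<in> L2w. weak_derivative f f'}"

section \<open>The operator and its spectral theory\<close>

definition V_op :: "(real \<Rightarrow> complex) \<Rightarrow> real \<Rightarrow> complex" where
  "V_op f = (\<lambda>v. L2w_inner f (\<lambda>_. 1) * 1)"

definition L_op :: "real \<Rightarrow> (real \<Rightarrow> complex) \<Rightarrow> real \<Rightarrow> complex" where
  "L_op \<xi> f = (\<lambda>v. (- \<i> * complex_of_real v * complex_of_real \<xi> - 1) * f v + V_op f v)"

definition L_dom :: "real \<Rightarrow> (real \<Rightarrow> complex) set" where
  "L_dom \<xi> = {f \<in> L2w. L_op \<xi> f \<in> L2w}"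

text \<open>The lower bound says that \<open>L_op \<xi> - z\<close> is injective and that its inverse is bounded.\<close>

definition resolvent_set :: "real \<Rightarrow> complex set" where
  "resolvent_set \<xi> = {z.
     (\<forall>g \<in> L2w. \<exists>f \<in> L_dom \<xi>. AE v in lborel. L_op \<xi> f v - z * f v = g v) \<and>
     (\<exists>C. \<forall>f \<in> L_dom \<xi>. L2w_norm f \<le> C * L2w_norm (\<lambda>v. L_op \<xi> f v - z * f v))}"

definition L_spectrum :: "real \<Rightarrow> complex set" where
  "L_spectrum \<xi> = - resolvent_set \<xi>"

definition eigenvalue :: "real \<Rightarrow> complex \<Rightarrow> bool" where
  "eigenvalue \<xi> z \<longleftrightarrow> (\<exists>f \<in> L_dom \<xi>. \<not> (AE v in lborel. f v = 0) \<and>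
     (AE v in lborel. L_op \<xi> f v = z * f v))"

definition isolated_eigenvalue :: "real \<Rightarrow> complex \<Rightarrow> bool" where
  "isolated_eigenvalue \<xi> z \<longleftrightarrow> eigenvalue \<xi> z \<and> z isolated_in L_spectrum \<xi>"

text \<open>A representative of \<open>(L_op \<xi> - z)\<close> inverted on \<open>g\<close>; for \<open>z\<close> in the resolvent set it is
  unique up to null sets.\<close>

definition resolvent :: "real \<Rightarrow> complex \<Rightarrow> (real \<Rightarrow> complex) \<Rightarrow> real \<Rightarrow> complex" where
  "resolvent \<xi> z g = (SOME f. f \<in> L_dom \<xi> \<and> (AE v in lborel. L_op \<xi> f v - z * f v = g v))"

text \<open>The Riesz projection is \<open>- 1 / (2 \<pi> \<i>)\<close> times the integral of the resolvent
  \<open>(L_op \<xi> - z)\<close> inverse over a small positively oriented circle about \<open>\<mu>\<close>. The integral of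
  the \<open>L2w\<close>-valued integrand is the weak one: it is determined by its inner products with
  all \<open>g\<close>. On a circle inside the resolvent set the resolvent is norm continuous, so this
  is the norm integral.\<close>

definition riesz_projection :: "real \<Rightarrow> complex \<Rightarrow> (real \<Rightarrow> complex) \<Rightarrow> real \<Rightarrow> complex" where
  "riesz_projection \<xi> \<mu> f = (SOME h. h \<in> L2w \<and>
     (\<forall>\<^sub>F r in at_right 0. \<forall>g \<in> L2w.
        (\<lambda>z. L2w_inner (resolvent \<xi> z f) g) contour_integrable_on circlepath \<mu> r \<and>
        L2w_inner h g =
          - 1 / (2 * complex_of_real pi * \<i>) *
            contour_integral (circlepath \<mu> r) (\<lambda>z. L2w_inner (resolvent \<xi> z f) g)))"

text \<open>Algebraic multiplicity one: the range of the Riesz projection has dimension one.\<close>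

definition simple_eigenvalue :: "real \<Rightarrow> complex \<Rightarrow> bool" where
  "simple_eigenvalue \<xi> \<mu> \<longleftrightarrow> eigenvalue \<xi> \<mu> \<and>
     (\<exists>f\<^sub>0 \<in> L2w. \<not> (AE v in lborel. riesz_projection \<xi> \<mu> f\<^sub>0 v = 0) \<and>
        (\<forall>f \<in> L2w. \<exists>c. AE v in lborel.
           riesz_projection \<xi> \<mu> f v = c * riesz_projection \<xi> \<mu> f\<^sub>0 v))"

section \<open>The spectral determinant\<close>

definition omega :: "complex \<Rightarrow> real \<Rightarrow> complex" where
  "omega z \<xi> = 1 - (LINT v|lborel.
     complex_of_real (wt v) / (\<i> * complex_of_real v * complex_of_real \<xi> + 1 + z))"

definition lambda_star :: "real \<Rightarrow> real" where
  "lambda_star \<xi> = (THE l. l \<in> {-1<..0} \<and>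
     (\<forall>z. Re z \<noteq> -1 \<longrightarrow> (omega z \<xi> = 0 \<longleftrightarrow> z = complex_of_real l)))"

text \<open>Boundary values on the line \<open>Re z = -1\<close>, from the right and from the left.\<close>

definition omega_plus :: "complex \<Rightarrow> real \<Rightarrow> complex" where
  "omega_plus z \<xi> = Lim (at_right 0) (\<lambda>\<delta>. omega (z + complex_of_real \<delta>) \<xi>)"

definition omega_minus :: "complex \<Rightarrow> real \<Rightarrow> complex" where
  "omega_minus z \<xi> = Lim (at_right 0) (\<lambda>\<delta>. omega (z - complex_of_real \<delta>) \<xi>)"

text \<open>For \<open>\<xi> \<noteq> 0\<close> the restriction of \<open>omega\<close> to \<open>Re z > -1\<close> extends to an entire
  function.\<close>

definition omega_continuation :: "real \<Rightarrow> complex \<Rightarrow> complex" where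
  "omega_continuation \<xi> = (THE F. F holomorphic_on UNIV \<and> (\<forall>z. Re z > -1 \<longrightarrow> F z = omega z \<xi>))"

section \<open>Generalized Fourier transforms\<close>

definition side :: "real \<Rightarrow> real filter" where
  "side \<sigma> = (if \<sigma> > 0 then at_right 0 else at_left 0)"

text \<open>Defined pointwise; the limit exists for almost every \<open>l\<close>, and the value of \<open>Lim\<close> at the
  exceptional points is immaterial.\<close>

definition S_hat :: "real \<Rightarrow> (real \<Rightarrow> complex) \<Rightarrow> real \<Rightarrow> complex" where
  "S_hat \<sigma> h l = Lim (side \<sigma>) (\<lambda>\<eta>. LINT z|lborel.
     h z / (complex_of_real z - (complex_of_real l + \<i> * complex_of_real \<eta>)))"

definition U_tr :: "real \<Rightarrow> (real \<Rightarrow> complex) \<Rightarrow> real \<Rightarrow> complex" where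
  "U_tr \<xi> f l = f l -
     1 / (\<i> * complex_of_real \<xi> *
          cnj (omega_plus (- 1 - \<i> * complex_of_real l * complex_of_real \<xi>) \<xi>)) *
     S_hat (- sgn \<xi>) (\<lambda>z. f z * complex_of_real (wt z)) l"

definition B_tr :: "real \<Rightarrow> (real \<Rightarrow> complex) \<Rightarrow> real \<Rightarrow> complex" where
  "B_tr \<xi> f l = f l +
     1 / (\<i> * complex_of_real \<xi> *
          cnj (omega_minus (- 1 + \<i> * complex_of_real l * complex_of_real \<xi>) (- \<xi>))) *
     S_hat (- sgn \<xi>) (\<lambda>z. f z * complex_of_real (wt z)) l"

section \<open>The critical wave numbers\<close>

text \<open>Here \<open>\<xi>\<close> is \<open>sqrt pi\<close> or \<open>- sqrt pi\<close>, and \<open>side \<xi>\<close> selects the sign of the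
  regularization parameter.\<close>

definition reg_integrand ::
  "real \<Rightarrow> (real \<Rightarrow> complex) \<Rightarrow> (real \<Rightarrow> complex) \<Rightarrow> real \<Rightarrow> complex" where
  "reg_integrand b h k l =
     complex_of_real l / (complex_of_real l - \<i> * complex_of_real b) *
       h l * cnj (k l) * complex_of_real (wt l)"

definition reg_integrable :: "real \<Rightarrow> (real \<Rightarrow> complex) \<Rightarrow> (real \<Rightarrow> complex) \<Rightarrow> bool" where
  "reg_integrable \<xi> h k \<longleftrightarrow>
     (\<forall>\<^sub>F b in side \<xi>. integrable lborel (reg_integrand b h k)) \<and>
     (\<exists>I. ((\<lambda>b. integral\<^sup>L lborel (reg_integrand b h k)) \<longlongrightarrow> I) (side \<xi>))"

definition reg_integral :: "real \<Rightarrow> (real \<Rightarrow> complex) \<Rightarrow> (real \<Rightarrow> complex) \<Rightarrow> complex" where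
  "reg_integral \<xi> h k = Lim (side \<xi>) (\<lambda>b. integral\<^sup>L lborel (reg_integrand b h k))"

definition P_minus_one :: "real \<Rightarrow> (real \<Rightarrow> complex) \<Rightarrow> (real \<Rightarrow> complex) \<Rightarrow> complex" where
  "P_minus_one \<xi> f g =
     1 / deriv (omega_continuation \<xi>) (- 1) *
     Lim (side \<xi>) (\<lambda>b. LINT v|lborel. f v * complex_of_real (wt v) /
       (\<i> * complex_of_real \<xi> * (complex_of_real v - \<i> * complex_of_real b))) *
     Lim (side \<xi>) (\<lambda>b. LINT v|lborel. cnj (g v) * complex_of_real (wt v) /
       (\<i> * complex_of_real \<xi> * (complex_of_real v - \<i> * complex_of_real b)))"

end

theory Submission
  imports Defs "HOL-Probability.Probability"
begin

text \<open>Let \<open>F\<close>, \<open>K\<close>, \<open>W\<close> be the Cauchy transforms of \<open>f w\<close>, of the conjugate of \<open>g\<close> times \<open>w\<close>, and of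
  \<open>w\<close>, and let \<open>D = \<i> \<xi> - W\<close>, so that \<open>\<omega>(z, \<xi>) = D(\<i> (1 + z) / \<xi>) / (\<i> \<xi>)\<close>. For \<open>\<xi> > 0\<close> the jump
  relations of \<open>F\<close>, \<open>K\<close>, \<open>W\<close> across the real line show that the integrand
  of the transform identity is almost everywhere the one of \<open>(f, g)\<close> plus
  \<open>(F\<^sub>+ K\<^sub>+ / D\<^sub>+ - F\<^sub>- K\<^sub>- / D\<^sub>-) / (2 \<pi> \<i>)\<close>. Each of the two terms is the boundary value of a
  product of Hardy functions. The lower one integrates to \<open>0\<close>, since \<open>D\<close> has no zero in the lower
  half-plane; the upper one contributes the residue at the zero \<open>\<i> y\<^sub>0\<close> of \<open>D\<close>, which exists only for
  \<open>\<xi> \<le> sqrt \<pi>\<close> and is the pole of the resolvent: it yields the Riesz projection, or the term \<open>P\<close> at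
  \<open>-1\<close> once \<open>y\<^sub>0\<close> has reached the real line. The case \<open>\<xi> < 0\<close> follows by complex conjugation.

  Boundary values in \<open>L\<^sup>2\<close> and almost everywhere exist because the imaginary part of the Cauchy
  transform of a real function is a Poisson mean, while the real part has
  the same \<open>L\<^sup>2\<close> norm. Zeros and lower bounds of \<open>D\<close> are read off from the differential equation
  \<open>W' = - 2 - 2 z W\<close>, which extends \<open>W\<close> from the upper half-plane to an entire function.\<close>

section \<open>Integrals over the boundary of a half-plane\<close>

text \<open>The boundary values exist only almost everywhere and in L^2, so no contour can be moved
  up to the real line directly. Every residue is computed on a line Im z = y with y > 0, where the
  Cauchy transforms are bounded and holomorphic beyond the line, and is carried to the boundary by
  L^2 convergence. The residue calculus is a single formula: the integral of G times the Blaschke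
  quotient (x - cnj b) / (x - b) is -4 pi (Im b) G(b), which is the Poisson formula for G(z) (z -
  cnj b)^2. The quotient has modulus 1 on the line, so 1 / D is split at the zero of D into a
  bounded holomorphic function and a Blaschke quotient. At the critical frequency the zero is 0
  itself; the factor l / (l - i b) of the regularized integral cancels it and puts the pole at i b,
  so the same formula applies before b tends to 0. What remains are limits of the two transforms at
  the single point 0. Almost everywhere statements do not reach a single point, and here H^1 enters:
  1 / (t - i b) is integrated by parts into a logarithm and an arctangent, which are square
  integrable near 0 uniformly in b.\<close>

lemma poisson_kernel_integral:
  fixes x y :: real
  assumes "y > 0"
  shows "integrable lborel (\<lambda>t. y / ((t - x)\<^sup>2 + y\<^sup>2))" (is ?A)
    and "(LINT t|lborel. y / ((t - x)\<^sup>2 + y\<^sup>2)) = pi" (is ?B)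
proof -
  have pos: "(t - x)\<^sup>2 + y\<^sup>2 > 0" for t using assms by (simp add: add_nonneg_pos)
  let ?F = "\<lambda>t. arctan ((t - x) / y)"
  have d: "(?F has_real_derivative y / ((t - x)\<^sup>2 + y\<^sup>2)) (at t)" for t
  proof -
    have "1 / y * inverse (1 + ((t - x) / y)\<^sup>2) = y / ((t - x)\<^sup>2 + y\<^sup>2)"
      using assms pos[of t] by (simp add: field_simps power2_eq_square)
    moreover have "(?F has_real_derivative 1 / y * inverse (1 + ((t - x) / y)\<^sup>2)) (at t)"
      using assms by (auto intro!: derivative_eq_intros)
    ultimately show ?thesis by simp
  qed
  have c: "isCont (\<lambda>t. y / ((t - x)\<^sup>2 + y\<^sup>2)) t" for t
    using pos[of t] by (intro continuous_intros) auto
  have top: "filterlim (\<lambda>t. (t - x) / y) at_top at_top"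
    using assms by real_asymp
  have bot: "filterlim (\<lambda>t. (t - x) / y) at_bot at_bot"
    using assms by real_asymp
  have t: "((?F \<circ> real_of_ereal) \<longlongrightarrow> pi / 2) (at_left \<infinity>)"
    by (simp add: ereal_tendsto_simps) (rule filterlim_compose[OF tendsto_arctan_at_top top])
  have b: "((?F \<circ> real_of_ereal) \<longlongrightarrow> - (pi / 2)) (at_right (-\<infinity>))"
    by (simp add: ereal_tendsto_simps) (rule filterlim_compose[OF tendsto_arctan_at_bot bot])
  have nn: "0 \<le> y / ((t - x)\<^sup>2 + y\<^sup>2)" for t using assms pos[of t] by simp
  note FTC = interval_integral_FTC_nonneg[of "-\<infinity>" "\<infinity>" ?F "\<lambda>t. y / ((t - x)\<^sup>2 + y\<^sup>2)" "- (pi / 2)" "pi / 2"]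
  show ?A using FTC(1) d c b t nn by (simp add: set_integrable_def)
  show ?B using FTC(2) d c b t nn
    by (simp add: interval_lebesgue_integral_def set_lebesgue_integral_def)
qed

text \<open>The segment [-n, n] is closed by the upper semicircle of radius n, which contributes at
  most M pi / n by the quadratic decay. The strip below the real line puts the closed contour inside
  a convex domain of holomorphy.\<close>

lemma half_plane_cauchy:
  fixes q :: "complex \<Rightarrow> complex"
  assumes hol: "q holomorphic_on {z. Im z > - e}" and e: "e > 0"
    and bd: "\<And>z. 0 \<le> Im z \<Longrightarrow> R0 \<le> cmod z \<Longrightarrow> cmod (q z) \<le> M / (cmod z)\<^sup>2"
  shows "integrable lborel (\<lambda>x. q (complex_of_real x))" (is ?A)
    and "(LINT x|lborel. q (complex_of_real x)) = 0" (is ?B)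
proof -
  let ?S = "{z. Im z > - e}"
  have cont: "continuous_on ?S q" using hol by (rule holomorphic_on_imp_continuous_on)
  have conr: "continuous_on UNIV (\<lambda>x. q (complex_of_real x))"
    by (rule continuous_on_compose2[OF cont]) (use e in \<open>auto intro!: continuous_intros\<close>)
  hence meas[measurable]: "(\<lambda>x. q (complex_of_real x)) \<in> borel_measurable borel"
    by (rule borel_measurable_continuous_onI)
  define R where "R = max R0 1"
  have R1: "R \<ge> 1" "R \<ge> R0" by (auto simp: R_def)
  have M0: "M \<ge> 0"
  proof -
    have "cmod (q (complex_of_real R)) \<le> M / R\<^sup>2"
      using bd[of "complex_of_real R"] R1 by simp
    hence "0 \<le> M / R\<^sup>2" using norm_ge_zero order_trans by metis
    moreover have "R\<^sup>2 > 0" using R1 by simp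
    ultimately show ?thesis by (simp add: zero_le_divide_iff)
  qed
  have "compact ((\<lambda>x. cmod (q (complex_of_real x))) ` {-R..R})"
    by (intro compact_continuous_image continuous_on_norm continuous_on_subset[OF conr]) auto
  then obtain K where K: "\<And>x. x \<in> {-R..R} \<Longrightarrow> cmod (q (complex_of_real x)) \<le> K"
    by (fastforce dest!: compact_imp_bounded simp: bounded_iff)
  have K0: "K \<ge> 0" using K[of 0] norm_ge_zero[of "q 0"] R1(1) by auto (meson order_trans norm_ge_zero)
  \<comment> \<open>Inside the radius R the function is bounded by K; outside, |x| \<ge> 1 turns M /
    x^2 into 2 M / (1 + x^2). The sum of the two constants dominates in either case.\<close>
  have dom: "cmod (q (complex_of_real x)) \<le> (K * (1 + R\<^sup>2) + 2 * M) * (1 / (1 + x\<^sup>2))" for x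
  proof (cases "\<bar>x\<bar> \<le> R")
    case True
    hence "x\<^sup>2 \<le> R\<^sup>2" using abs_le_square_iff[of x R] by (simp add: R_def)
    hence "K * (1 + x\<^sup>2) \<le> K * (1 + R\<^sup>2)" using K0 by (intro mult_left_mono) auto
    hence "K * (1 + x\<^sup>2) \<le> K * (1 + R\<^sup>2) + 2 * M" using M0 by simp
    hence "K \<le> (K * (1 + R\<^sup>2) + 2 * M) * (1 / (1 + x\<^sup>2))"
      by (simp add: pos_le_divide_eq add_pos_nonneg)
    thus ?thesis using K[of x] True by (simp add: abs_le_iff)
  next
    case False
    hence x1: "\<bar>x\<bar> \<ge> 1" by (simp add: R_def)
    hence x2: "x\<^sup>2 \<ge> 1" using one_le_power[of "\<bar>x\<bar>" 2] by simp
    have "cmod (q (complex_of_real x)) \<le> M / x\<^sup>2"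
      using bd[of "complex_of_real x"] False by (simp add: R_def)
    also have "M / x\<^sup>2 \<le> 2 * M / (1 + x\<^sup>2)"
    proof -
      have "M * (1 + x\<^sup>2) \<le> M * (2 * x\<^sup>2)" using x2 M0 by (intro mult_left_mono) auto
      moreover have "x\<^sup>2 > 0" "1 + x\<^sup>2 > 0" using x2 by auto
      ultimately show ?thesis by (simp add: divide_le_eq pos_le_divide_eq mult.commute mult.left_commute)
    qed
    also have "\<dots> \<le> (K * (1 + R\<^sup>2) + 2 * M) * (1 / (1 + x\<^sup>2))"
      using K0 M0 by (simp add: divide_right_mono)
    finally show ?thesis .
  qed
  have int1: "integrable lborel (\<lambda>x. (K * (1 + R\<^sup>2) + 2 * M) * (1 / (1 + x\<^sup>2)))"
    using poisson_kernel_integral(1)[of 1 0] by (intro integrable_mult_right) (simp add: add.commute)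
  show A: ?A
    by (rule Bochner_Integration.integrable_bound[OF int1]) (use dom K0 M0 in \<open>auto intro!: AE_I2\<close>)
  have eq: "(LINT x|lborel. indicator {-real n..real n} x *\<^sub>R q (complex_of_real x))
      = - contour_integral (part_circlepath 0 (real n) 0 pi) q" if n: "n > 0" for n
  proof -
    let ?l = "linepath (complex_of_real (- real n)) (complex_of_real (real n))"
    let ?c = "part_circlepath 0 (real n) 0 pi"
    have cS: "path_image ?c \<subseteq> ?S"
      using e n by (auto simp: path_image_part_circlepath' closed_segment_eq_real_ivl sin_ge_zero)
        (smt (verit) mult_nonneg_nonneg of_nat_0_le_iff sin_ge_zero)
    have lS: "path_image ?l \<subseteq> ?S"
      using e by (auto simp: path_image_linepath closed_segment_def)
    \<comment> \<open>The arc runs from n back to -n, so the segment integral is minus the arc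
      integral.\<close>
    have q0: "(q has_contour_integral 0) (?l +++ ?c)"
      by (rule Cauchy_theorem_convex_simple[OF hol])
        (use cS lS in \<open>auto simp: path_image_join exp_eq_polar intro!: convex_halfspace_Im_gt valid_path_join\<close>)
    have qc: "q contour_integrable_on ?c"
      by (rule contour_integrable_continuous_part_circlepath) (rule continuous_on_subset[OF cont cS])
    have ql: "q contour_integrable_on ?l"
      by (rule contour_integrable_continuous_linepath) (use continuous_on_subset[OF cont lS] in \<open>simp add: path_image_linepath\<close>)
    have "contour_integral ?l q + contour_integral ?c q = 0"
      using contour_integral_unique[OF q0] contour_integral_join[OF ql qc] by simp
    moreover have "contour_integral ?l q = integral {-real n..real n} (\<lambda>x. q (complex_of_real x))"
      using n by (subst contour_integral_linepath_Reals_eq) auto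
    moreover have "integral {-real n..real n} (\<lambda>x. q (complex_of_real x)) = 
      (LINT x|lborel. indicator {-real n..real n} x *\<^sub>R q (complex_of_real x))"
    proof -
      have "set_integrable lborel {-real n..real n} (\<lambda>x. q (complex_of_real x))"
        by (rule set_integrable_subset[of _ UNIV]) (use A in \<open>auto simp: set_integrable_def\<close>)
      from set_borel_integral_eq_integral(2)[OF this] show ?thesis by (simp add: set_lebesgue_integral_def)
    qed
    ultimately show ?thesis by (simp add: eq_neg_iff_add_eq_0)
  qed
  have "(\<lambda>n. LINT x|lborel. indicator {-real n..real n} x *\<^sub>R q (complex_of_real x)) 
      \<longlonglongrightarrow> (LINT x|lborel. q (complex_of_real x))"
  proof (rule integral_dominated_convergence[where w="\<lambda>x. cmod (q (complex_of_real x))"])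
    show "AE x in lborel. (\<lambda>n. indicator {-real n..real n} x *\<^sub>R q (complex_of_real x)) \<longlonglongrightarrow> q (complex_of_real x)"
    proof (intro AE_I2 tendsto_eventually)
      fix x :: real
      obtain N :: nat where N: "\<bar>x\<bar> \<le> N" using real_arch_simple by blast
      show "eventually (\<lambda>n. indicator {-real n..real n} x *\<^sub>R q (complex_of_real x) = q (complex_of_real x)) sequentially"
        unfolding eventually_sequentially using N by (intro exI[of _ N]) (auto simp: indicator_def abs_le_iff)
    qed
  qed (use A in \<open>auto simp: indicator_def\<close>)
  moreover have "(\<lambda>n. LINT x|lborel. indicator {-real n..real n} x *\<^sub>R q (complex_of_real x)) \<longlonglongrightarrow> 0"
  proof (rule Lim_null_comparison)
    show "(\<lambda>n. M * pi / real n) \<longlonglongrightarrow> 0" by real_asymp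
    obtain N :: nat where N: "R \<le> N" using real_arch_simple by blast
    show "\<forall>\<^sub>F n in sequentially. cmod (LINT x|lborel. indicator {-real n..real n} x *\<^sub>R q (complex_of_real x)) \<le> M * pi / real n"
      unfolding eventually_sequentially
    proof (intro exI[of _ "Suc N"] allI impI)
      fix n assume n: "Suc N \<le> n"
      hence nR: "real n \<ge> R" "n > 0" using N by auto
      let ?c = "part_circlepath 0 (real n) 0 pi"
      have im: "Im z \<ge> 0" "cmod z = real n" if "z \<in> path_image ?c" for z
        using that nR by (auto simp: path_image_part_circlepath' closed_segment_eq_real_ivl norm_mult sin_ge_zero)
      have cS: "path_image ?c \<subseteq> ?S" using im e by fastforce
      have "cmod (contour_integral ?c q) \<le> M / (real n)\<^sup>2 * real n * \<bar>pi - 0\<bar>"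
      proof (rule contour_integral_bound_part_circlepath)
        show "q contour_integrable_on ?c"
          by (rule contour_integrable_continuous_part_circlepath) (rule continuous_on_subset[OF cont cS])
        show "cmod (q z) \<le> M / (real n)\<^sup>2" if "z \<in> path_image ?c" for z
          using bd[of z] im[OF that] nR by (auto simp: R_def)
      qed (use M0 in auto)
      also have "\<dots> = M * pi / real n" using nR by (simp add: power2_eq_square)
      finally show "cmod (LINT x|lborel. indicator {-real n..real n} x *\<^sub>R q (complex_of_real x)) \<le> M * pi / real n"
        using eq[OF nR(2)] by simp
    qed
  qed
  ultimately show ?B using LIMSEQ_unique by blast
qed

text \<open>Split P into P(b) and P - P(b). The constant integrates to P(b) times the mass pi / Im b
  of the kernel. The rest is (P(z) - P(b)) / (z - b), with a removable singularity at b, divided by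
  z - cnj b; it decays quadratically and integrates to 0 by
  \<open>half_plane_cauchy\<close>.\<close>

lemma poisson_formula:
  fixes P :: "complex \<Rightarrow> complex"
  assumes hol: "P holomorphic_on {z. Im z > - e}" and e: "e > 0"
    and bd: "\<And>z. 0 \<le> Im z \<Longrightarrow> cmod (P z) \<le> M" and b: "Im b > 0"
  shows "integrable lborel (\<lambda>x. P (complex_of_real x) / ((complex_of_real x - b) * (complex_of_real x - cnj b)))"
    and "(LINT x|lborel. P (complex_of_real x) / ((complex_of_real x - b) * (complex_of_real x - cnj b)))
      = complex_of_real (pi / Im b) * P b"
proof -
  \<comment> \<open>With \<open>e' \<le> Im b\<close> the other pole, cnj b, stays outside the
    domain.\<close>
  define e' where "e' = min e (Im b)"
  have e': "e' > 0" "e' \<le> e" "e' \<le> Im b" using e b by (auto simp: e'_def)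
  let ?S = "{z. Im z > - e'}"
  have op: "open ?S" by (rule open_halfspace_Im_gt)
  have holS: "P holomorphic_on ?S" by (rule holomorphic_on_subset[OF hol]) (use e' in auto)
  define d where "d = (\<lambda>z. if z = b then deriv P b else (P z - P b) / (z - b))"
  define q where "q = (\<lambda>z. d z / (z - cnj b))"
  have dh: "d holomorphic_on ?S" unfolding d_def by (rule pole_lemma_open[OF holS op])
  have nz: "z - cnj b \<noteq> 0" if "z \<in> ?S" for z using that e' by (auto simp: complex_eq_iff)
  have qh: "q holomorphic_on ?S"
    unfolding q_def using dh nz by (intro holomorphic_intros) auto
  have M0: "M \<ge> 0" using bd[of b] b norm_ge_zero order_trans less_imp_le by metis
  \<comment> \<open>Beyond 2 |b| + 1 both |z - b| and |z - cnj b| are at least |z| / 2, and |P(z) -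
    P(b)| \<le> 2 M; hence 2 M / (|z| / 2)^2 = 8 M / |z|^2.\<close>
  have bdq: "cmod (q z) \<le> (8 * M) / (cmod z)\<^sup>2" if z: "0 \<le> Im z" "2 * cmod b + 1 \<le> cmod z" for z
  proof -
    have zb: "cmod z / 2 \<le> cmod (z - b)" "cmod z / 2 \<le> cmod (z - cnj b)"
      using z norm_triangle_ineq2[of z b] norm_triangle_ineq2[of z "cnj b"] by auto
    have z0: "cmod z > 0" using z(2) norm_ge_zero[of b] by linarith
    have ne: "z \<noteq> b" using zb z0 by auto
    have "cmod (P z - P b) \<le> 2 * M" using bd[OF z(1)] bd[of b] b norm_triangle_ineq4[of "P z" "P b"] by auto
    hence "cmod (P z - P b) / (cmod (z - b) * cmod (z - cnj b)) \<le> (2 * M) / ((cmod z / 2) * (cmod z / 2))"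
      using zb z0 M0 by (intro frac_le mult_mono) auto
    moreover have "cmod (q z) = cmod (P z - P b) / (cmod (z - b) * cmod (z - cnj b))"
      using ne by (simp only: q_def d_def if_False norm_divide norm_mult divide_divide_eq_left)
    ultimately show ?thesis by (simp add: power2_eq_square)
  qed
  have H: "integrable lborel (\<lambda>x. q (complex_of_real x))" "(LINT x|lborel. q (complex_of_real x)) = 0"
    by (rule half_plane_cauchy[OF qh e'(1) bdq]; assumption)+
  have ker: "1 / ((complex_of_real x - b) * (complex_of_real x - cnj b)) = 
      complex_of_real (1 / Im b * (Im b / ((x - Re b)\<^sup>2 + (Im b)\<^sup>2)))" for x
  proof -
    have "(complex_of_real x - b) * (complex_of_real x - cnj b) = complex_of_real ((x - Re b)\<^sup>2 + (Im b)\<^sup>2)"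
      by (auto simp: complex_eq_iff power2_eq_square algebra_simps)
    thus ?thesis using b by simp
  qed
  have K: "integrable lborel (\<lambda>x. 1 / ((complex_of_real x - b) * (complex_of_real x - cnj b)))"
     "(LINT x|lborel. 1 / ((complex_of_real x - b) * (complex_of_real x - cnj b))) = complex_of_real (pi / Im b)"
    unfolding ker integral_complex_of_real
    by (intro integrable_of_real integrable_mult_right poisson_kernel_integral b)
      (simp only: integral_mult_right_zero poisson_kernel_integral[OF b], simp)
  have dec: "P (complex_of_real x) / ((complex_of_real x - b) * (complex_of_real x - cnj b)) =
      q (complex_of_real x) + P b * (1 / ((complex_of_real x - b) * (complex_of_real x - cnj b)))" for x
  proof -
    have "complex_of_real x \<noteq> b" "complex_of_real x \<noteq> cnj b" using b by (auto simp: complex_eq_iff)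
    thus ?thesis by (simp add: q_def d_def diff_divide_distrib)
  qed
  show "integrable lborel (\<lambda>x. P (complex_of_real x) / ((complex_of_real x - b) * (complex_of_real x - cnj b)))"
    unfolding dec by (intro Bochner_Integration.integrable_add integrable_mult_right H(1) K(1))
  show "(LINT x|lborel. P (complex_of_real x) / ((complex_of_real x - b) * (complex_of_real x - cnj b)))
      = complex_of_real (pi / Im b) * P b"
    unfolding dec
    using Bochner_Integration.integral_add[OF H(1) integrable_mult_right[OF K(1), of "P b"]]
    unfolding H(2) integral_mult_right_zero K(2) by (simp only: add_0_left mult.commute[of "P b"])
qed

text \<open>This is the Poisson formula at b for G(z) (z - cnj b)^2: one of the two factors cancels
  z - cnj b in the kernel, and (b - cnj b)^2 = -4 (Im b)^2 gives the constant. Since that function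
  may grow quadratically, it is first damped by \<open>r n\<close>.\<close>

lemma half_plane_blaschke:
  fixes G :: "complex \<Rightarrow> complex"
  assumes hol: "G holomorphic_on {z. Im z > - e}" and e: "e > 0"
    and bd: "\<And>z. 0 \<le> Im z \<Longrightarrow> cmod (G z) \<le> M" and b: "Im b > 0"
    and int: "integrable lborel (\<lambda>x. G (complex_of_real x))"
  shows "(LINT x|lborel. G (complex_of_real x) * ((complex_of_real x - cnj b) / (complex_of_real x - b)))
      = - 4 * complex_of_real (pi * Im b) * G b"
proof -
  \<comment> \<open>At most 1 in modulus on the closed upper half-plane, of order 1 / z^2 at
    infinity for each n, and tending to 1 pointwise. Its pole -i (n + 1) lies outside the domain
    because \<open>e' \<le> 1\<close>.\<close>
  define r where "r = (\<lambda>(n::nat) z. (\<i> * of_nat (Suc n) / (z + \<i> * of_nat (Suc n)))\<^sup>2)"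
  define e' where "e' = min e 1"
  have e': "e' > 0" "e' \<le> e" "e' \<le> 1" using e by (auto simp: e'_def)
  let ?S = "{z. Im z > - e'}"
  have nz: "z + \<i> * of_nat (Suc n) \<noteq> 0" if "z \<in> ?S" for z n
    using that e' by (auto simp: complex_eq_iff)
  have nrm: "cmod z \<le> cmod (z + \<i> * of_nat (Suc n))" "real (Suc n) \<le> cmod (z + \<i> * of_nat (Suc n))"
    if "Im z \<ge> 0" for z n
  proof -
    have "(Im z)\<^sup>2 \<le> (Im z + (1 + real n))\<^sup>2" using that by (intro power_mono) auto
    thus "cmod z \<le> cmod (z + \<i> * of_nat (Suc n))"
      by (auto simp: cmod_def)
    have "real (Suc n) \<le> \<bar>Im (z + \<i> * of_nat (Suc n))\<bar>" using that by simp
    thus "real (Suc n) \<le> cmod (z + \<i> * of_nat (Suc n))" using abs_Im_le_cmod order_trans by blast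
  qed
  have r1: "cmod (r n z) \<le> 1" if "Im z \<ge> 0" for n z
  proof -
    have "real (Suc n) / cmod (z + \<i> * of_nat (Suc n)) \<le> 1"
      using nrm(2)[OF that, of n] by (simp add: divide_le_eq_1)
    hence "(real (Suc n) / cmod (z + \<i> * of_nat (Suc n)))\<^sup>2 \<le> 1"
      by (intro power_le_one) auto
    thus ?thesis by (simp add: r_def norm_power norm_divide norm_mult del: of_nat_Suc)
  qed
  have rlim: "(\<lambda>n. r n z) \<longlonglongrightarrow> 1" for z
  proof -
    have "(\<lambda>n. 1 / (1 + z / (\<i> * of_nat (Suc n)))) \<longlonglongrightarrow> 1 / (1 + 0)"
    proof (intro tendsto_intros)
      have "(\<lambda>n. (z / \<i>) * inverse (of_nat (Suc n))) \<longlonglongrightarrow> (z / \<i>) * 0"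
        by (intro tendsto_intros LIMSEQ_Suc[OF lim_inverse_n])
      thus "(\<lambda>n. z / (\<i> * of_nat (Suc n))) \<longlonglongrightarrow> 0" by (simp add: divide_inverse mult.assoc del: of_nat_Suc)
    qed auto
    hence "(\<lambda>n. (1 / (1 + z / (\<i> * of_nat (Suc n))))\<^sup>2) \<longlonglongrightarrow> (1 / (1 + 0))\<^sup>2" by (rule tendsto_power)
    moreover have "(1 / (1 + z / (\<i> * of_nat (Suc n)))) = \<i> * of_nat (Suc n) / (z + \<i> * of_nat (Suc n))" for n
    proof -
      have "1 + z / (\<i> * of_nat (Suc n)) = (z + \<i> * of_nat (Suc n)) / (\<i> * of_nat (Suc n))"
        by (simp add: field_simps del: of_nat_Suc)
      thus ?thesis by (simp del: of_nat_Suc)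
    qed
    ultimately show ?thesis unfolding r_def by (simp del: of_nat_Suc)
  qed
  have M0: "M \<ge> 0" using bd[of b] b norm_ge_zero order_trans less_imp_le by metis
  have P: "(LINT x|lborel. (G (complex_of_real x) * (complex_of_real x - cnj b)\<^sup>2 * r n (complex_of_real x)) / ((complex_of_real x - b) * (complex_of_real x - cnj b)))
      = complex_of_real (pi / Im b) * (G b * (b - cnj b)\<^sup>2 * r n b)" for n
  proof (rule poisson_formula(2)[where P="\<lambda>z. G z * (z - cnj b)\<^sup>2 * r n z", OF _ e'(1) _ b])
    show "(\<lambda>z. G z * (z - cnj b)\<^sup>2 * r n z) holomorphic_on {z. - e' < Im z}"
      unfolding r_def using nz
      by (intro holomorphic_intros holomorphic_on_subset[OF hol]) (use e' in \<open>auto simp del: of_nat_Suc\<close>)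
    show "cmod (G z * (z - cnj b)\<^sup>2 * r n z) \<le> M * (real (Suc n) * (1 + cmod b))\<^sup>2" if z: "0 \<le> Im z" for z
    proof -
      let ?w = "z + \<i> * of_nat (Suc n)"
      have w0: "cmod ?w > 0" "cmod ?w \<ge> 1" using nrm(2)[OF z, of n] by auto
      have "cmod (z - cnj b) \<le> cmod z + cmod b" using norm_triangle_ineq4[of z "cnj b"] by simp
      also have "\<dots> \<le> cmod ?w + cmod ?w * cmod b"
        using nrm(1)[OF z, of n] w0 by (intro add_mono) (auto simp: mult_le_cancel_right1)
      finally have "cmod (z - cnj b) / cmod ?w \<le> 1 + cmod b"
        using w0 by (simp add: divide_le_eq algebra_simps)
      hence "(real (Suc n) * (cmod (z - cnj b) / cmod ?w))\<^sup>2 \<le> (real (Suc n) * (1 + cmod b))\<^sup>2"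
        by (intro power_mono mult_left_mono) auto
      hence "cmod ((z - cnj b)\<^sup>2 * r n z) \<le> (real (Suc n) * (1 + cmod b))\<^sup>2"
        by (simp add: r_def norm_mult norm_power norm_divide power_mult_distrib power_divide mult.commute mult.left_commute del: of_nat_Suc)
      hence "cmod (G z) * cmod ((z - cnj b)\<^sup>2 * r n z) \<le> M * (real (Suc n) * (1 + cmod b))\<^sup>2"
        using bd[OF z] M0 by (intro mult_mono) auto
      thus ?thesis by (simp add: norm_mult mult.assoc)
    qed
  qed
  have ne: "complex_of_real x \<noteq> b" "complex_of_real x \<noteq> cnj b" for x using b by (auto simp: complex_eq_iff)
  have lhs: "(G (complex_of_real x) * (complex_of_real x - cnj b)\<^sup>2 * r n (complex_of_real x)) / ((complex_of_real x - b) * (complex_of_real x - cnj b))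
     = G (complex_of_real x) * ((complex_of_real x - cnj b) / (complex_of_real x - b)) * r n (complex_of_real x)" for x n
    using ne[of x] by (simp add: power2_eq_square)
  have n1: "cmod ((complex_of_real x - cnj b) / (complex_of_real x - b)) = 1" for x
  proof -
    have "cmod (complex_of_real x - cnj b) = cmod (complex_of_real x - b)"
      by (metis complex_cnj_complex_of_real complex_cnj_diff complex_mod_cnj)
    thus ?thesis using ne by (simp add: norm_divide)
  qed
  have [measurable]: "(\<lambda>x. G (complex_of_real x)) \<in> borel_measurable borel" 
    using borel_measurable_integrable[OF int] by simp
  have "(\<lambda>n. LINT x|lborel. G (complex_of_real x) * ((complex_of_real x - cnj b) / (complex_of_real x - b)) * r n (complex_of_real x))
     \<longlonglongrightarrow> (LINT x|lborel. G (complex_of_real x) * ((complex_of_real x - cnj b) / (complex_of_real x - b)))"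
  proof (rule integral_dominated_convergence[where w="\<lambda>x. cmod (G (complex_of_real x))"])
    show "AE x in lborel. (\<lambda>n. G (complex_of_real x) * ((complex_of_real x - cnj b) / (complex_of_real x - b)) * r n (complex_of_real x))
      \<longlonglongrightarrow> G (complex_of_real x) * ((complex_of_real x - cnj b) / (complex_of_real x - b))"
    proof (intro AE_I2)
      fix x show "(\<lambda>n. G (complex_of_real x) * ((complex_of_real x - cnj b) / (complex_of_real x - b)) * r n (complex_of_real x))
      \<longlonglongrightarrow> G (complex_of_real x) * ((complex_of_real x - cnj b) / (complex_of_real x - b))"
        using tendsto_mult_left[OF rlim, of "G (complex_of_real x) * ((complex_of_real x - cnj b) / (complex_of_real x - b))"] by simp
    qed
    show "AE x in lborel. cmod (G (complex_of_real x) * ((complex_of_real x - cnj b) / (complex_of_real x - b)) * r n (complex_of_real x))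
      \<le> cmod (G (complex_of_real x))" for n
      using r1[of "complex_of_real x" n for x] n1
      by (intro AE_I2) (simp only: norm_mult, simp add: mult_left_le)
  qed (use int in \<open>auto simp: r_def\<close>)
  moreover have "(\<lambda>n. complex_of_real (pi / Im b) * (G b * (b - cnj b)\<^sup>2 * r n b)) \<longlonglongrightarrow> complex_of_real (pi / Im b) * (G b * (b - cnj b)\<^sup>2 * 1)"
    by (intro tendsto_intros rlim)
  ultimately have "(LINT x|lborel. G (complex_of_real x) * ((complex_of_real x - cnj b) / (complex_of_real x - b)))
     = complex_of_real (pi / Im b) * (G b * (b - cnj b)\<^sup>2)"
    using P unfolding lhs by (simp add: LIMSEQ_unique)
  moreover have "b - cnj b = \<i> * complex_of_real (2 * Im b)" by (simp add: complex_eq_iff)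
  ultimately show ?thesis using b by (simp add: power2_eq_square)
qed

text \<open>The factor (z - i) / (z + i) vanishes at i, and on the line it is the reciprocal of the
  Blaschke quotient for b = i. Inserting it into \<open>half_plane_blaschke\<close> leaves G^2 on
  the line and 0 on the right-hand side.\<close>

lemma half_plane_integral_square_zero:
  fixes G :: "complex \<Rightarrow> complex"
  assumes hol: "G holomorphic_on {z. Im z > - e}" and e: "e > 0"
    and bd: "\<And>z. 0 \<le> Im z \<Longrightarrow> cmod (G z) \<le> M"
    and int: "integrable lborel (\<lambda>x. (cmod (G (complex_of_real x)))\<^sup>2)"
  shows "(LINT x|lborel. (G (complex_of_real x))\<^sup>2) = 0"
proof -
  define e' where "e' = min e (1/2)"
  have e': "e' > 0" "e' \<le> e" "e' \<le> 1/2" using e by (auto simp: e'_def)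
  have nz: "z + \<i> \<noteq> 0" if "Im z > - e'" for z using that e' by (auto simp: complex_eq_iff)
  let ?H = "\<lambda>z. (G z)\<^sup>2 * ((z - \<i>) / (z + \<i>))"
  have hH: "?H holomorphic_on {z. Im z > - e'}"
    using nz by (intro holomorphic_intros holomorphic_on_subset[OF hol]) (use e' in auto)
  have fr: "cmod ((z - \<i>) / (z + \<i>)) \<le> 1" if "Im z \<ge> 0" for z
  proof -
    have "cmod (z - \<i>) \<le> cmod (z + \<i>)" using that by (auto simp: cmod_def power2_eq_square algebra_simps)
    thus ?thesis by (simp add: norm_divide divide_le_eq_1)
  qed
  have bH: "cmod (?H z) \<le> M\<^sup>2" if "Im z \<ge> 0" for z
  proof -
    have "(cmod (G z))\<^sup>2 * cmod ((z - \<i>) / (z + \<i>)) \<le> M\<^sup>2 * 1"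
      using bd[OF that] fr[OF that] by (intro mult_mono power_mono) auto
    thus ?thesis by (simp only: norm_mult norm_power mult_1_right)
  qed
  have "continuous_on UNIV (\<lambda>x. G (complex_of_real x))"
    by (rule continuous_on_compose2[OF holomorphic_on_imp_continuous_on[OF hol]]) (use e in \<open>auto intro!: continuous_intros\<close>)
  hence [measurable]: "(\<lambda>x. G (complex_of_real x)) \<in> borel_measurable borel"
    by (rule borel_measurable_continuous_onI)
  have iH: "integrable lborel (\<lambda>x. ?H (complex_of_real x))"
    by (rule Bochner_Integration.integrable_bound[OF int])
      (use fr in \<open>auto simp only: norm_mult norm_power Im_complex_of_real real_norm_def abs_power2 abs_norm_cancel intro!: AE_I2 mult_left_le, auto\<close>)
  have "(LINT x|lborel. ?H (complex_of_real x) * ((complex_of_real x - cnj \<i>) / (complex_of_real x - \<i>))) = 0"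
    using half_plane_blaschke[OF hH e'(1) bH _ iH, of \<i>] by simp
  moreover have "?H (complex_of_real x) * ((complex_of_real x - cnj \<i>) / (complex_of_real x - \<i>)) = (G (complex_of_real x))\<^sup>2" for x
  proof -
    have "complex_of_real x - \<i> \<noteq> 0" "complex_of_real x + \<i> \<noteq> 0" by (auto simp: complex_eq_iff)
    thus ?thesis by simp
  qed
  ultimately show ?thesis by simp
qed

text \<open>Dominated convergence speaks of sequences; this transfers it to one-sided limits at
  0.\<close>

lemma at_right_0_seqI:
  fixes f :: "real \<Rightarrow> 'a::topological_space"
  assumes "\<And>X. (\<And>n. X n > 0) \<Longrightarrow> X \<longlonglongrightarrow> 0 \<Longrightarrow> (\<lambda>n. f (X n)) \<longlonglongrightarrow> L"
  shows "(f \<longlongrightarrow> L) (at_right 0)"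
  unfolding tendsto_at_iff_sequentially using assms by (auto simp: o_def)

lemma quadratic_nonneg_discriminant:
  fixes a b c :: real
  assumes "\<And>t. 0 \<le> a * t\<^sup>2 + 2 * b * t + c" "a \<ge> 0"
  shows "b\<^sup>2 \<le> a * c"
proof (cases "a = 0")
  case True
  have "b = 0"
  proof (rule ccontr)
    assume "b \<noteq> 0"
    \<comment> \<open>For a = 0 the expression is affine in t, and at this t it equals -1.\<close>
    thus False using assms(1)[of "- (c + 1) / (2 * b)"] True by (simp add: field_simps)
  qed
  thus ?thesis using True by simp
next
  case False
  hence a: "a > 0" using assms(2) by simp
  have "0 \<le> a * (- b / a)\<^sup>2 + 2 * b * (- b / a) + c" by (rule assms)
  also have "\<dots> = (a * c - b\<^sup>2) / a" using a by (simp add: field_simps power2_eq_square)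
  finally show ?thesis using a by (simp add: zero_le_divide_iff)
qed

section \<open>Poisson means of square integrable functions\<close>

lemma integrable_mult_square_integrable:
  fixes f g :: "'a \<Rightarrow> real"
  assumes [measurable]: "f \<in> borel_measurable M" "g \<in> borel_measurable M"
    and i: "integrable M (\<lambda>x. (f x)\<^sup>2)" "integrable M (\<lambda>x. (g x)\<^sup>2)"
  shows "integrable M (\<lambda>x. f x * g x)"
proof (rule Bochner_Integration.integrable_bound[OF Bochner_Integration.integrable_add[OF i]])
  show "AE x in M. norm (f x * g x) \<le> norm ((f x)\<^sup>2 + (g x)\<^sup>2)"
  proof (intro AE_I2)
    fix x
    have "0 \<le> (\<bar>f x\<bar> - \<bar>g x\<bar>)\<^sup>2" by simp
    hence "2 * (\<bar>f x\<bar> * \<bar>g x\<bar>) \<le> (f x)\<^sup>2 + (g x)\<^sup>2" by (simp add: power2_diff)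
    moreover have "0 \<le> \<bar>f x\<bar> * \<bar>g x\<bar>" by simp
    ultimately have "\<bar>f x\<bar> * \<bar>g x\<bar> \<le> (f x)\<^sup>2 + (g x)\<^sup>2" by linarith
    thus "norm (f x * g x) \<le> norm ((f x)\<^sup>2 + (g x)\<^sup>2)" by (simp add: abs_mult)
  qed
qed auto

lemma integral_Cauchy_Schwarz:
  fixes f g :: "'a \<Rightarrow> real"
  assumes [measurable]: "f \<in> borel_measurable M" "g \<in> borel_measurable M"
    and i: "integrable M (\<lambda>x. (f x)\<^sup>2)" "integrable M (\<lambda>x. (g x)\<^sup>2)"
  shows "(integral\<^sup>L M (\<lambda>x. f x * g x))\<^sup>2 \<le> integral\<^sup>L M (\<lambda>x. (f x)\<^sup>2) * integral\<^sup>L M (\<lambda>x. (g x)\<^sup>2)"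
proof (rule quadratic_nonneg_discriminant)
  fix t :: real
  have fg: "integrable M (\<lambda>x. f x * g x)" by (rule integrable_mult_square_integrable) (use i in auto)
  have "0 \<le> integral\<^sup>L M (\<lambda>x. (t * f x + g x)\<^sup>2)" by (intro integral_nonneg_AE) auto
  also have "\<dots> = integral\<^sup>L M (\<lambda>x. t\<^sup>2 * (f x)\<^sup>2 + 2 * t * (f x * g x) + (g x)\<^sup>2)"
    by (intro Bochner_Integration.integral_cong) (auto simp: power2_eq_square algebra_simps)
  also have "\<dots> = t\<^sup>2 * integral\<^sup>L M (\<lambda>x. (f x)\<^sup>2) + 2 * t * integral\<^sup>L M (\<lambda>x. f x * g x) + integral\<^sup>L M (\<lambda>x. (g x)\<^sup>2)"
    using i fg by (simp add: integrable_mult_right)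
  finally show "0 \<le> integral\<^sup>L M (\<lambda>x. (f x)\<^sup>2) * t\<^sup>2 + 2 * integral\<^sup>L M (\<lambda>x. f x * g x) * t + integral\<^sup>L M (\<lambda>x. (g x)\<^sup>2)"
    by (simp add: mult_ac)
qed (intro integral_nonneg_AE, auto)

text \<open>Cauchy-Schwarz for sqrt k and sqrt k |f|. The weight k will be the Poisson kernel, the
  modulus of an integrable function, and the Gaussian.\<close>

lemma integral_Cauchy_Schwarz_weighted:
  fixes f :: "'a \<Rightarrow> complex" and k :: "'a \<Rightarrow> real"
  assumes [measurable]: "f \<in> borel_measurable M" "k \<in> borel_measurable M"
    and k: "\<And>x. k x \<ge> 0" and i: "integrable M k" "integrable M (\<lambda>x. k x * (cmod (f x))\<^sup>2)"
  shows "integrable M (\<lambda>x. complex_of_real (k x) * f x)"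
    and "(cmod (integral\<^sup>L M (\<lambda>x. complex_of_real (k x) * f x)))\<^sup>2 \<le> integral\<^sup>L M k * integral\<^sup>L M (\<lambda>x. k x * (cmod (f x))\<^sup>2)"
proof -
  let ?a = "\<lambda>x. sqrt (k x)" and ?b = "\<lambda>x. sqrt (k x) * cmod (f x)"
  have sq: "(?a x)\<^sup>2 = k x" "(?b x)\<^sup>2 = k x * (cmod (f x))\<^sup>2" "?a x * ?b x = cmod (complex_of_real (k x) * f x)" for x
    using k[of x] by (auto simp: power_mult_distrib norm_mult)
  have m: "integrable M (\<lambda>x. ?a x * ?b x)"
    by (rule integrable_mult_square_integrable) (use i in \<open>simp_all add: sq(1,2)\<close>)
  show "integrable M (\<lambda>x. complex_of_real (k x) * f x)"
    by (rule Bochner_Integration.integrable_bound[OF m]) (auto simp: sq(3))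
  have "(cmod (integral\<^sup>L M (\<lambda>x. complex_of_real (k x) * f x)))\<^sup>2 \<le> (integral\<^sup>L M (\<lambda>x. ?a x * ?b x))\<^sup>2"
    unfolding sq(3) by (intro power_mono integral_norm_bound) auto
  also have "\<dots> \<le> integral\<^sup>L M (\<lambda>x. (?a x)\<^sup>2) * integral\<^sup>L M (\<lambda>x. (?b x)\<^sup>2)"
    by (rule integral_Cauchy_Schwarz) (use i in \<open>simp_all add: sq(1,2)\<close>)
  finally show "(cmod (integral\<^sup>L M (\<lambda>x. complex_of_real (k x) * f x)))\<^sup>2 \<le> integral\<^sup>L M k * integral\<^sup>L M (\<lambda>x. k x * (cmod (f x))\<^sup>2)"
    by (simp add: sq(1,2))
qed

section \<open>Lebesgue differentiation on the line, one-sided and symmetric\<close>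

lemma AE_lborel_not_negligible:
  assumes "negligible (N :: real set)"
  shows "AE x in lborel. x \<notin> N"
proof -
  have "AE x in lebesgue. x \<notin> N"
    using assms by (simp add: negligible_iff_null_sets AE_not_in)
  thus ?thesis by (simp add: AE_completion_iff)
qed

lemma lebesgue_differentiation_right:
  fixes f :: "real \<Rightarrow> complex"
  assumes "\<And>a b. set_integrable lborel {a..b} f"
  obtains N where "negligible N"
    "\<And>x. x \<notin> N \<Longrightarrow> ((\<lambda>h. (LINT t:{x..x+h}|lborel. f t) / complex_of_real h) \<longlongrightarrow> f x) (at_right 0)"
proof -
  have "f integrable_on cbox a b" for a b
    using set_borel_integral_eq_integral(1)[OF assms, of a b] by simp
  note hk = this
  obtain N where N: "negligible N"
    "\<And>x e. x \<notin> N \<Longrightarrow> 0 < e \<Longrightarrow> \<exists>d>0. \<forall>h. 0 < h \<and> h < d \<longrightarrow>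
       norm (integral (cbox x (x + h *\<^sub>R One)) f /\<^sub>R h ^ DIM(real) - f x) < e"
    by (rule integrable_ccontinuous_explicit[of f, OF hk], rule that) auto
  show thesis
  proof (rule that[OF N(1)])
    fix x assume x: "x \<notin> N"
    have eq: "integral {x..x+h} f = (LINT t:{x..x+h}|lborel. f t)" for h
      using set_borel_integral_eq_integral(2)[OF assms] by simp
    show "((\<lambda>h. (LINT t:{x..x+h}|lborel. f t) / complex_of_real h) \<longlongrightarrow> f x) (at_right 0)"
      unfolding tendsto_iff
    proof (intro allI impI)
      fix e :: real assume "e > 0"
      from N(2)[OF x this] obtain d where d: "d > 0" "\<And>h. 0 < h \<Longrightarrow> h < d \<Longrightarrow> 
         norm (integral {x..x+h} f /\<^sub>R h - f x) < e" by auto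
      show "\<forall>\<^sub>F h in at_right 0. dist ((LINT t:{x..x+h}|lborel. f t) / complex_of_real h) (f x) < e"
        unfolding eventually_at_right_field using d
        by (intro exI[of _ d]) (auto simp: dist_norm eq scaleR_conv_of_real divide_inverse mult.commute)
    qed
  qed
qed

text \<open>The right-sided means of f and of its reflection cover the two halves of the interval,
  and each contributes f x. The reflected exceptional set is again negligible.\<close>

lemma lebesgue_differentiation_symmetric:
  fixes f :: "real \<Rightarrow> complex"
  assumes int: "\<And>a b. set_integrable lborel {a..b} f"
  shows "AE x in lborel. ((\<lambda>h. (LINT t:{x-h..x+h}|lborel. f t) / complex_of_real h) \<longlongrightarrow> 2 * f x) (at_right 0)"
proof -
  obtain N where N: "negligible N"
    "\<And>x. x \<notin> N \<Longrightarrow> ((\<lambda>h. (LINT t:{x..x+h}|lborel. f t) / complex_of_real h) \<longlongrightarrow> f x) (at_right 0)"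
    by (rule lebesgue_differentiation_right[OF int], rule that)
  have int': "set_integrable lborel {a..b} (\<lambda>x. f (- x))" for a b
  proof -
    have "integrable lborel (\<lambda>x. indicator {-b..-a} (0 + (-1) * x) *\<^sub>R f (0 + (-1) * x))"
      by (rule lborel_integrable_real_affine) (use int[of "-b" "-a"] in \<open>auto simp: set_integrable_def\<close>)
    moreover have "indicator {-b..-a} (0 + (-1) * x) = (indicator {a..b} x :: real)" for x
      by (auto simp: indicator_def)
    ultimately show ?thesis by (simp add: set_integrable_def)
  qed
  obtain N' where N': "negligible N'"
    "\<And>x. x \<notin> N' \<Longrightarrow> ((\<lambda>h. (LINT t:{x..x+h}|lborel. f (- t)) / complex_of_real h) \<longlongrightarrow> f (- x)) (at_right 0)"
    by (rule lebesgue_differentiation_right[OF int'], rule that)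
  have refl: "(LINT t:{-x..-x+h}|lborel. f (- t)) = (LINT t:{x-h..x}|lborel. f t)" for x h
    unfolding set_lebesgue_integral_def
    by (subst lborel_integral_real_affine[where c="-1" and t=0])
      (auto intro!: Bochner_Integration.integral_cong simp: indicator_def)
  have "negligible (uminus ` N')"
    by (rule negligible_differentiable_image_negligible[OF order_refl N'(1)])
      (auto intro!: derivative_intros simp: differentiable_on_def)
  hence "AE x in lborel. x \<notin> N \<union> uminus ` N'"
    using N(1) by (intro AE_lborel_not_negligible) auto
  thus ?thesis
  proof eventually_elim
    case (elim x)
    hence x: "x \<notin> N" "- x \<notin> N'" by (auto simp: image_iff)
    have "((\<lambda>h. (LINT t:{x..x+h}|lborel. f t) / complex_of_real h + (LINT t:{x-h..x}|lborel. f t) / complex_of_real h)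
       \<longlongrightarrow> f x + f x) (at_right 0)"
      using tendsto_add[OF N(2)[OF x(1)] N'(2)[OF x(2)]] unfolding refl by simp
    moreover have "\<forall>\<^sub>F h in at_right (0::real). (LINT t:{x..x+h}|lborel. f t) / complex_of_real h + (LINT t:{x-h..x}|lborel. f t) / complex_of_real h
       = (LINT t:{x-h..x+h}|lborel. f t) / complex_of_real h"
      unfolding eventually_at_right_field
    proof (intro exI[of _ 1] conjI allI impI)
      fix h :: real assume h: "0 < h"
      have u: "{x-h..x+h} = {x-h..x} \<union> {x..x+h}" using h by auto
      have "(LINT t:{x-h..x+h}|lborel. f t) = (LINT t:{x-h..x}|lborel. f t) + (LINT t:{x..x+h}|lborel. f t)"
        unfolding u
      proof (rule set_integral_Un_AE)
        show "AE t in lborel. \<not> (t \<in> {x-h..x} \<and> t \<in> {x..x+h})"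
          using AE_lborel_singleton[of x] by eventually_elim auto
      qed (use int in auto)
      thus "(LINT t:{x..x+h}|lborel. f t) / complex_of_real h + (LINT t:{x-h..x}|lborel. f t) / complex_of_real h
       = (LINT t:{x-h..x+h}|lborel. f t) / complex_of_real h" by (simp add: add_divide_distrib)
    qed auto
    ultimately show ?case unfolding mult_2 by (rule Lim_transform_eventually)
  qed
qed

text \<open>The density 2 s / (1 + s^2)^2 is minus the derivative of 1 / (1 + s^2), so the even
  decreasing kernel is a superposition of indicators of the intervals (-s, s). A Poisson mean
  thereby becomes an average of interval means, which Lebesgue differentiation controls.\<close>

lemma cauchy_kernel_layer_cake:
  "integrable lborel (\<lambda>s. indicator {0<..} s * (indicator {-s<..<s} t * (2 * s / (1 + s\<^sup>2)\<^sup>2)))" (is ?A)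
  "(LINT s|lborel. indicator {0<..} s * (indicator {-s<..<s} t * (2 * s / (1 + s\<^sup>2)\<^sup>2))) = 1 / (1 + (t::real)\<^sup>2)" (is ?B)
proof -
  have pos: "1 + s\<^sup>2 > 0" for s :: real by (simp add: add_pos_nonneg)
  have n: "(\<integral>\<^sup>+ s. ennreal (2 * s / (1 + s\<^sup>2)\<^sup>2) * indicator {\<bar>t\<bar>..} s \<partial>lborel) = ennreal (0 - (- 1 / (1 + \<bar>t\<bar>\<^sup>2)))"
  proof (rule nn_integral_FTC_atLeast[where F="\<lambda>s. - 1 / (1 + s\<^sup>2)"])
    show "((\<lambda>s. - 1 / (1 + s\<^sup>2)) has_real_derivative 2 * x / (1 + x\<^sup>2)\<^sup>2) (at x)" for x :: real
      using pos[of x] by (auto intro!: derivative_eq_intros simp: power2_eq_square field_simps)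
    show "((\<lambda>s::real. - 1 / (1 + s\<^sup>2)) \<longlongrightarrow> 0) at_top" by real_asymp
  qed auto
  have eq: "indicator {0<..} s * (indicator {-s<..<s} t * (2 * s / (1 + s\<^sup>2)\<^sup>2)) = indicator {\<bar>t\<bar><..} s * (2 * s / (1 + s\<^sup>2)\<^sup>2)" for s
    by (auto simp: indicator_def)
  have "(\<integral>\<^sup>+ s. ennreal (indicator {\<bar>t\<bar><..} s * (2 * s / (1 + s\<^sup>2)\<^sup>2)) \<partial>lborel) = 
     (\<integral>\<^sup>+ s. ennreal (2 * s / (1 + s\<^sup>2)\<^sup>2) * indicator {\<bar>t\<bar>..} s \<partial>lborel)"
  proof (rule nn_integral_cong_AE)
    show "AE s in lborel. ennreal (indicator {\<bar>t\<bar><..} s * (2 * s / (1 + s\<^sup>2)\<^sup>2)) = ennreal (2 * s / (1 + s\<^sup>2)\<^sup>2) * indicator {\<bar>t\<bar>..} s"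
      using AE_lborel_singleton[of "\<bar>t\<bar>"] by eventually_elim (auto simp: indicator_def)
  qed
  hence "has_bochner_integral lborel (\<lambda>s. indicator {\<bar>t\<bar><..} s * (2 * s / (1 + s\<^sup>2)\<^sup>2)) (1 / (1 + t\<^sup>2))"
    using n by (intro has_bochner_integral_nn_integral) (auto simp: indicator_def)
  thus ?A ?B unfolding eq by (auto simp: has_bochner_integral_iff)
qed

lemma cauchy_mean_layer_cake:
  fixes \<psi> :: "real \<Rightarrow> complex"
  assumes [measurable]: "\<psi> \<in> borel_measurable borel"
    and i: "integrable lborel (\<lambda>t. \<psi> t * complex_of_real (1 / (1 + t\<^sup>2)))"
  shows "(LINT t|lborel. \<psi> t * complex_of_real (1 / (1 + t\<^sup>2))) =
     (LINT s|lborel. complex_of_real (indicator {0<..} s * (2 * s / (1 + s\<^sup>2)\<^sup>2)) * (LINT t:{-s<..<s}|lborel. \<psi> t))"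
proof -
  let ?k = "\<lambda>t s. indicator {0<..} s * (indicator {-s<..<s} t * (2 * s / (1 + s\<^sup>2)\<^sup>2)) :: real"
  let ?f = "\<lambda>(t, s). \<psi> t * complex_of_real (?k t s)"
  have knn: "?k t s \<ge> 0" for t s by (auto simp: indicator_def)
  have kif: "?k t s = (if 0 < s \<and> - s < t \<and> t < s then 2 * s / (1 + s\<^sup>2)\<^sup>2 else 0)" for t s
    by (auto simp: indicator_def)
  have m: "?f \<in> borel_measurable (lborel \<Otimes>\<^sub>M lborel)"
    unfolding kif by measurable
  have I: "integrable (lborel \<Otimes>\<^sub>M lborel) ?f"
  proof (rule lborel_pair.Fubini_integrable[OF m])
    have "(LINT s|lborel. norm (?f (t, s))) = norm (\<psi> t * complex_of_real (1 / (1 + t\<^sup>2)))" for t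
    proof -
      have "(LINT s|lborel. norm (?f (t, s))) = (LINT s|lborel. cmod (\<psi> t) * ?k t s)"
        using knn by (intro Bochner_Integration.integral_cong refl) (simp only: prod.case norm_mult norm_of_real abs_of_nonneg)
      also have "\<dots> = cmod (\<psi> t) * (1 / (1 + t\<^sup>2))"
        by (simp only: integral_mult_right_zero cauchy_kernel_layer_cake(2))
      finally show ?thesis by (simp only: norm_mult norm_of_real, simp)
    qed
    thus "integrable lborel (\<lambda>t. LINT s|lborel. norm (?f (t, s)))" using i by (simp only: integrable_norm)
    show "AE t in lborel. integrable lborel (\<lambda>s. ?f (t, s))"
      unfolding prod.case
      by (intro AE_I2 integrable_mult_right integrable_of_real cauchy_kernel_layer_cake)
  qed
  have "(LINT t|lborel. \<psi> t * complex_of_real (1 / (1 + t\<^sup>2))) = (LINT t|lborel. LINT s|lborel. \<psi> t * complex_of_real (?k t s))"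
    by (simp only: integral_mult_right_zero integral_complex_of_real cauchy_kernel_layer_cake(2))
  also have "\<dots> = (LINT s|lborel. LINT t|lborel. \<psi> t * complex_of_real (?k t s))"
    using lborel_pair.Fubini_integral[of "\<lambda>t s. \<psi> t * complex_of_real (?k t s)"] I by simp
  also have "\<dots> = (LINT s|lborel. complex_of_real (indicator {0<..} s * (2 * s / (1 + s\<^sup>2)\<^sup>2)) * (LINT t:{-s<..<s}|lborel. \<psi> t))"
    unfolding set_lebesgue_integral_def
    by (subst integral_mult_right_zero[symmetric], intro Bochner_Integration.integral_cong refl) (simp add: indicator_def)
  finally show ?thesis .
qed

section \<open>The Poisson mean and its bound on L^2 of the line\<close>

definition L2_fun :: "(real \<Rightarrow> complex) \<Rightarrow> bool" where
  "L2_fun f \<longleftrightarrow> f \<in> borel_measurable borel \<and> integrable lborel (\<lambda>x. (cmod (f x))\<^sup>2)"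

definition L2_sq :: "(real \<Rightarrow> complex) \<Rightarrow> real" where
  "L2_sq f = (LINT x|lborel. (cmod (f x))\<^sup>2)"

text \<open>Not normalised: this is the imaginary part of 1 / (t - (x + i y)), of total mass pi.
  Limits of Poisson means therefore carry a factor pi.\<close>

definition poisson_kernel :: "real \<Rightarrow> real \<Rightarrow> real \<Rightarrow> real" where
  "poisson_kernel y x t = y / ((t - x)\<^sup>2 + y\<^sup>2)"

definition poisson_mean :: "real \<Rightarrow> (real \<Rightarrow> complex) \<Rightarrow> real \<Rightarrow> complex" where
  "poisson_mean y f x = (LINT t|lborel. complex_of_real (poisson_kernel y x t) * f t)"

lemma poisson_kernel_measurable [measurable]:
  "(\<lambda>p. poisson_kernel y (fst p) (snd p)) \<in> borel_measurable (borel \<Otimes>\<^sub>M borel)"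
  "poisson_kernel y x \<in> borel_measurable borel"
  unfolding poisson_kernel_def by measurable

lemma poisson_kernel_sym: "poisson_kernel y x t = poisson_kernel y t x"
  by (simp add: poisson_kernel_def power2_commute)

lemma poisson_kernel_nonneg: "y > 0 \<Longrightarrow> poisson_kernel y x t \<ge> 0"
  by (simp add: poisson_kernel_def)

lemma poisson_kernel_le: "y > 0 \<Longrightarrow> poisson_kernel y x t \<le> 1 / y"
proof -
  assume y: "y > 0"
  have "y / ((t - x)\<^sup>2 + y\<^sup>2) \<le> y / y\<^sup>2" using y by (intro divide_left_mono) (auto simp: add_nonneg_pos)
  thus ?thesis using y by (simp add: poisson_kernel_def power2_eq_square)
qed

lemma integrable_poisson_kernel_mult:
  fixes f :: "real \<Rightarrow> 'a::{real_normed_algebra_1, banach, second_countable_topology}"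
  assumes y: "y > 0" and f: "integrable lborel f"
  shows "integrable lborel (\<lambda>t. of_real (poisson_kernel y x t) * f t)"
proof (rule Bochner_Integration.integrable_bound)
  show "integrable lborel (\<lambda>t. (1 / y) * norm (f t))" using f by (intro integrable_mult_right integrable_norm)
  have [measurable]: "f \<in> borel_measurable borel" using f by (auto dest: borel_measurable_integrable)
  show "(\<lambda>t. of_real (poisson_kernel y x t) * f t) \<in> borel_measurable lborel" by measurable
  show "AE t in lborel. norm (of_real (poisson_kernel y x t) * f t) \<le> norm (1 / y * norm (f t))"
  proof (intro AE_I2)
    fix t
    have "norm (of_real (poisson_kernel y x t) * f t) \<le> norm (of_real (poisson_kernel y x t) :: 'a) * norm (f t)"
      by (rule norm_mult_ineq)
    also have "\<dots> \<le> 1 / y * norm (f t)"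
      using poisson_kernel_le[OF y, of x t] poisson_kernel_nonneg[OF y, of x t] by (intro mult_right_mono) auto
    finally show "norm (of_real (poisson_kernel y x t) * f t) \<le> norm (1 / y * norm (f t))" using y by simp
  qed
qed

lemma poisson_kernel_total:
  assumes "y > 0"
  shows "integrable lborel (poisson_kernel y x)" "(LINT t|lborel. poisson_kernel y x t) = pi"
  using poisson_kernel_integral[OF assms] unfolding poisson_kernel_def[abs_def] by auto

text \<open>The kernel is symmetric in x and t, so integrating over x first produces the mass pi at
  every t.\<close>

lemma poisson_kernel_Tonelli:
  fixes \<rho> :: "real \<Rightarrow> real"
  assumes y: "y > 0" and i: "integrable lborel \<rho>" and nn: "\<And>t. \<rho> t \<ge> 0"
  shows "integrable lborel (\<lambda>x. LINT t|lborel. poisson_kernel y x t * \<rho> t)"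
    and "(LINT x|lborel. LINT t|lborel. poisson_kernel y x t * \<rho> t) = pi * (LINT t|lborel. \<rho> t)"
proof -
  have [measurable]: "\<rho> \<in> borel_measurable borel" using i by (auto dest: borel_measurable_integrable)
  let ?f = "\<lambda>(t, x). poisson_kernel y x t * \<rho> t"
  have m: "?f \<in> borel_measurable (lborel \<Otimes>\<^sub>M lborel)"
    unfolding poisson_kernel_def by measurable
  have tot: "(LINT x|lborel. poisson_kernel y x t * \<rho> t) = pi * \<rho> t" for t
    using poisson_kernel_total[OF y, of t] by (simp add: poisson_kernel_sym[of y _ t])
  have I: "integrable (lborel \<Otimes>\<^sub>M lborel) ?f"
  proof (rule lborel_pair.Fubini_integrable[OF m])
    have "(LINT x|lborel. norm (?f (t, x))) = pi * \<rho> t" for t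
      using tot[of t] nn[of t] poisson_kernel_nonneg[OF y] by simp
    thus "integrable lborel (\<lambda>t. LINT x|lborel. norm (?f (t, x)))" using i by simp
    show "AE t in lborel. integrable lborel (\<lambda>x. ?f (t, x))"
      using poisson_kernel_total(1)[OF y] by (simp add: poisson_kernel_sym[of y])
  qed
  have I': "integrable (lborel \<Otimes>\<^sub>M lborel) (\<lambda>(x, t). poisson_kernel y x t * \<rho> t)"
    using lborel_pair.integrable_product_swap[OF I] by (simp add: case_prod_unfold)
  show "integrable lborel (\<lambda>x. LINT t|lborel. poisson_kernel y x t * \<rho> t)"
    using lborel_pair.integrable_fst'[OF I'] by simp
  have "(LINT x|lborel. LINT t|lborel. poisson_kernel y x t * \<rho> t) = (LINT t|lborel. LINT x|lborel. poisson_kernel y x t * \<rho> t)"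
    using lborel_pair.Fubini_integral[of "\<lambda>t x. poisson_kernel y x t * \<rho> t"] I by simp
  thus "(LINT x|lborel. LINT t|lborel. poisson_kernel y x t * \<rho> t) = pi * (LINT t|lborel. \<rho> t)"
    by (simp only: tot integral_mult_right_zero)
qed

lemma L2_fun_borel [measurable_dest]: "L2_fun f \<Longrightarrow> f \<in> borel_measurable borel"
  by (simp add: L2_fun_def)

lemma L2_fun_poisson_integrable:
  assumes y: "y > 0" and f: "L2_fun f"
  shows "integrable lborel (\<lambda>t. complex_of_real (poisson_kernel y x t) * f t)"
    and "(cmod (poisson_mean y f x))\<^sup>2 \<le> pi * (LINT t|lborel. poisson_kernel y x t * (cmod (f t))\<^sup>2)"
proof -
  have [measurable]: "f \<in> borel_measurable borel" using f by (rule L2_fun_borel)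
  have i: "integrable lborel (\<lambda>t. poisson_kernel y x t * (cmod (f t))\<^sup>2)"
    using integrable_poisson_kernel_mult[OF y, of "\<lambda>t. (cmod (f t))\<^sup>2" x] f by (simp add: L2_fun_def)
  note CS = integral_Cauchy_Schwarz_weighted[of f lborel "poisson_kernel y x", OF _ _ poisson_kernel_nonneg[OF y] poisson_kernel_total(1)[OF y] i]
  show "integrable lborel (\<lambda>t. complex_of_real (poisson_kernel y x t) * f t)" by (rule CS) auto
  show "(cmod (poisson_mean y f x))\<^sup>2 \<le> pi * (LINT t|lborel. poisson_kernel y x t * (cmod (f t))\<^sup>2)"
    using CS(2) poisson_kernel_total(2)[OF y, of x] by (simp add: poisson_mean_def)
qed

text \<open>One factor pi comes from Cauchy-Schwarz against the kernel, the other from integrating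
  the kernel over x. The bound is exactly the \<open>L2_sq\<close> of the limit pi f, as
  \<open>L2_convergence\<close> requires.\<close>

lemma poisson_mean_L2:
  assumes y: "y > 0" and f: "L2_fun f"
  shows "L2_fun (poisson_mean y f)" and "L2_sq (poisson_mean y f) \<le> pi\<^sup>2 * L2_sq f"
proof -
  have [measurable]: "f \<in> borel_measurable borel" using f by (rule L2_fun_borel)
  have i: "integrable lborel (\<lambda>t. (cmod (f t))\<^sup>2)" using f by (simp add: L2_fun_def)
  note T = poisson_kernel_Tonelli[OF y i]
  have [measurable]: "poisson_mean y f \<in> borel_measurable borel"
    unfolding poisson_mean_def[abs_def] poisson_kernel_def by measurable
  have le: "(cmod (poisson_mean y f x))\<^sup>2 \<le> pi * (LINT t|lborel. poisson_kernel y x t * (cmod (f t))\<^sup>2)" for x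
    by (rule L2_fun_poisson_integrable[OF y f])
  have ri: "integrable lborel (\<lambda>x. pi * (LINT t|lborel. poisson_kernel y x t * (cmod (f t))\<^sup>2))"
    by (intro integrable_mult_right T) auto
  have li: "integrable lborel (\<lambda>x. (cmod (poisson_mean y f x))\<^sup>2)"
    by (rule Bochner_Integration.integrable_bound[OF ri])
      (use le in \<open>auto intro!: AE_I2 intro: order_trans[OF _ abs_ge_self]\<close>)
  show "L2_fun (poisson_mean y f)" using li by (simp add: L2_fun_def)
  have "L2_sq (poisson_mean y f) \<le> (LINT x|lborel. pi * (LINT t|lborel. poisson_kernel y x t * (cmod (f t))\<^sup>2))"
    unfolding L2_sq_def by (intro integral_mono li ri le)
  also have "\<dots> = pi\<^sup>2 * L2_sq f"
    using T(2) by (simp add: L2_sq_def power2_eq_square)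
  finally show "L2_sq (poisson_mean y f) \<le> pi\<^sup>2 * L2_sq f" .
qed

lemma L2_fun_set_integrable:
  assumes f: "L2_fun f"
  shows "set_integrable lborel {a..b} f"
    and "cmod (LINT t:{x-h..x+h}|lborel. f t) \<le> 2 * max h 0 + L2_sq f"
proof -
  have [measurable]: "f \<in> borel_measurable borel" using f by (rule L2_fun_borel)
  have i: "integrable lborel (\<lambda>t. (cmod (f t))\<^sup>2)" using f by (simp add: L2_fun_def)
  have le: "cmod (indicator {a..b} t *\<^sub>R f t) \<le> indicator {a..b} t + (cmod (f t))\<^sup>2" for t a b
  proof -
    have "2 * cmod (f t) \<le> 1 + (cmod (f t))\<^sup>2"
      using zero_le_power2[of "cmod (f t) - 1"] norm_ge_zero[of "f t"] unfolding power2_diff by simp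
    hence "cmod (f t) \<le> 1 + (cmod (f t))\<^sup>2" using norm_ge_zero[of "f t"] by linarith
    thus ?thesis by (auto simp: indicator_def)
  qed
  have ii: "integrable lborel (\<lambda>t. indicator {a..b} t + (cmod (f t))\<^sup>2)" for a b :: real
    using i by (intro Bochner_Integration.integrable_add integrable_real_indicator) (auto simp: emeasure_lborel_Icc_eq)
  show s: "set_integrable lborel {a..b} f" for a b
    unfolding set_integrable_def
    by (rule Bochner_Integration.integrable_bound[OF ii[of a b]])
      (use le[of a b] in \<open>auto intro!: AE_I2 intro: order_trans[OF _ abs_ge_self]\<close>)
  have "cmod (LINT t:{x-h..x+h}|lborel. f t) \<le> (LINT t|lborel. indicator {x-h..x+h} t + (cmod (f t))\<^sup>2)"
    unfolding set_lebesgue_integral_def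
    by (rule order_trans[OF integral_norm_bound])
      (intro integral_mono integrable_norm ii le s[unfolded set_integrable_def])
  also have "\<dots> = 2 * max h 0 + L2_sq f"
    using i by (subst Bochner_Integration.integral_add) (auto simp: L2_sq_def max_def measure_def emeasure_lborel_Icc_eq)
  finally show "cmod (LINT t:{x-h..x+h}|lborel. f t) \<le> 2 * max h 0 + L2_sq f" .
qed

lemma poisson_mean_layer_cake:
  assumes y: "y > 0" and f: "L2_fun f"
  shows "poisson_mean y f x = (LINT s|lborel. complex_of_real (indicator {0<..} s * (2 * s / (1 + s\<^sup>2)\<^sup>2)) *
     ((LINT t:{x - y * s..x + y * s}|lborel. f t) / complex_of_real y))"
proof -
  have [measurable]: "f \<in> borel_measurable borel" using f by (rule L2_fun_borel)
  have k: "y * poisson_kernel y x (x + y * t) = 1 / (1 + t\<^sup>2)" for t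
  proof -
    have "(x + y * t - x)\<^sup>2 + y\<^sup>2 = y\<^sup>2 * (1 + t\<^sup>2)" by (simp add: power_mult_distrib algebra_simps)
    thus ?thesis using y by (simp add: poisson_kernel_def power2_eq_square)
  qed
  have kc: "complex_of_real y * (complex_of_real (poisson_kernel y x (x + y * t)) * f (x + y * t)) = f (x + y * t) * complex_of_real (1 / (1 + t\<^sup>2))" for t
    unfolding k[symmetric] by simp
  have "integrable lborel (\<lambda>t. complex_of_real y * (complex_of_real (poisson_kernel y x (x + y * t)) * f (x + y * t)))"
    using lborel_integrable_real_affine[OF L2_fun_poisson_integrable(1)[OF y f], of y x x] y
    by (intro integrable_mult_right) auto
  hence i: "integrable lborel (\<lambda>t. f (x + y * t) * complex_of_real (1 / (1 + t\<^sup>2)))"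
    unfolding kc .
  have "poisson_mean y f x = (LINT t|lborel. complex_of_real y * (complex_of_real (poisson_kernel y x (x + y * t)) * f (x + y * t)))"
    unfolding poisson_mean_def using y
    by (subst lborel_integral_real_affine[where c=y and t=x]) (auto simp: scaleR_conv_of_real)
  also have "\<dots> = (LINT t|lborel. f (x + y * t) * complex_of_real (1 / (1 + t\<^sup>2)))" unfolding kc ..
  also have "\<dots> = (LINT s|lborel. complex_of_real (indicator {0<..} s * (2 * s / (1 + s\<^sup>2)\<^sup>2)) * (LINT t:{-s<..<s}|lborel. f (x + y * t)))"
    by (rule cauchy_mean_layer_cake[OF _ i]) measurable
  also have "(\<lambda>s. LINT t:{-s<..<s}|lborel. f (x + y * t)) = (\<lambda>s. (LINT t:{x - y * s..x + y * s}|lborel. f t) / complex_of_real y)"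
  proof (rule ext)
    fix s
    have ind: "indicator {x - y * s<..<x + y * s} (x + y * t) = (indicator {-s<..<s} t :: real)" for t
    proof -
      have "x - y * s < x + y * t \<longleftrightarrow> - s < t" "x + y * t < x + y * s \<longleftrightarrow> t < s"
        using y mult_less_cancel_left_pos[of y "-s" t] by auto
      thus ?thesis by (auto simp: indicator_def)
    qed
    have "(LINT t:{x - y * s..x + y * s}|lborel. f t) = (LINT t:{x - y * s<..<x + y * s}|lborel. f t)"
      unfolding set_lebesgue_integral_def
    proof (rule integral_cong_AE)
      show "AE t in lborel. indicator {x - y * s..x + y * s} t *\<^sub>R f t = indicator {x - y * s<..<x + y * s} t *\<^sub>R f t"
        using AE_lborel_singleton[of "x - y * s"] AE_lborel_singleton[of "x + y * s"]
        by eventually_elim (auto simp: indicator_def)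
    qed auto
    also have "\<dots> = complex_of_real y * (LINT t:{-s<..<s}|lborel. f (x + y * t))"
      unfolding set_lebesgue_integral_def
      using y by (subst lborel_integral_real_affine[where c=y and t=x]) (auto simp: ind scaleR_conv_of_real)
    finally show "(LINT t:{-s<..<s}|lborel. f (x + y * t)) = (LINT t:{x - y * s..x + y * s}|lborel. f t) / complex_of_real y"
      using y by simp
  qed
  finally show ?thesis .
qed

text \<open>In the layer cake form the integral over [x - y s, x + y s], divided by y, tends to 2 s
  f(x) at every point of symmetric differentiation. A bound J(h) = O(h) valid for all h > 0 makes
  the integrand at most 2 C s^2 / (1 + s^2)^2, which is dominated by 2 C / (1 + s^2).\<close>

theorem poisson_mean_tendsto_AE:
  fixes f :: "real \<Rightarrow> complex"
  assumes f: "L2_fun f"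
  shows "AE x in lborel. ((\<lambda>y. poisson_mean y f x) \<longlongrightarrow> complex_of_real pi * f x) (at_right 0)"
  using lebesgue_differentiation_symmetric[OF L2_fun_set_integrable(1)[OF f]]
proof eventually_elim
  case (elim x)
  have [measurable]: "f \<in> borel_measurable borel" using f by (rule L2_fun_borel)
  define J where "J = (\<lambda>h. (LINT t:{x-h..x+h}|lborel. f t))"
  let ?k = "\<lambda>s::real. indicator {0<..} s * (2 * s / (1 + s\<^sup>2)\<^sup>2)"
  have Jlim: "((\<lambda>h. J h / complex_of_real h) \<longlongrightarrow> 2 * f x) (at_right 0)" using elim by (simp add: J_def)
  obtain d where d: "d > 0" "\<And>h. 0 < h \<Longrightarrow> h < d \<Longrightarrow> cmod (J h / complex_of_real h) < cmod (2 * f x) + 1"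
  proof -
    have "\<forall>\<^sub>F h in at_right 0. cmod (J h / complex_of_real h) < cmod (2 * f x) + 1"
      by (rule order_tendstoD(2)[OF tendsto_norm[OF Jlim]]) simp
    thus thesis using that by (auto simp: eventually_at_right_field)
  qed
  \<comment> \<open>For h < d the difference quotient is close to 2 f(x). For h \<ge> d the bound 2
    h + \<open>L2_sq f\<close> is at most (2 + \<open>L2_sq f\<close> / d) h. Their sum serves both
    ranges.\<close>
  define C where "C = cmod (2 * f x) + 1 + (2 + L2_sq f / d)"
  have L0: "L2_sq f \<ge> 0" by (simp add: L2_sq_def integral_nonneg_AE)
  have Jb: "cmod (J h) \<le> C * h" if h: "h > 0" for h
  proof (cases "h < d")
    case True
    hence "cmod (J h) \<le> (cmod (2 * f x) + 1) * h"
      using d(2)[OF h True] h by (simp add: norm_divide pos_divide_less_eq less_imp_le)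
    also have "\<dots> \<le> C * h" using h d L0 by (intro mult_right_mono) (auto simp: C_def)
    finally show ?thesis .
  next
    case False
    have "cmod (J h) \<le> 2 * h + L2_sq f" using L2_fun_set_integrable(2)[OF f, of x h] h by (simp add: J_def)
    also have "L2_sq f \<le> L2_sq f / d * h" using False d L0 by (simp add: pos_le_divide_eq mult_left_mono)
    hence "2 * h + L2_sq f \<le> (2 + L2_sq f / d) * h" by (simp add: algebra_simps)
    also have "\<dots> \<le> C * h" using h by (intro mult_right_mono) (auto simp: C_def add_nonneg_nonneg)
    finally show ?thesis .
  qed
  have C0: "C \<ge> 0" using d L0 by (auto simp: C_def intro!: add_nonneg_nonneg)
  show ?case
  proof (rule at_right_0_seqI)
    fix Y :: "nat \<Rightarrow> real" assume Y: "\<And>n. Y n > 0" "Y \<longlonglongrightarrow> 0"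
    have "(\<lambda>n. LINT s|lborel. complex_of_real (?k s) * (J (Y n * s) / complex_of_real (Y n)))
       \<longlonglongrightarrow> (LINT s|lborel. complex_of_real (?k s) * (complex_of_real (2 * s) * f x))"
    proof (rule integral_dominated_convergence[where w="\<lambda>s. 2 * C * (1 / (1 + s\<^sup>2))"])
      show "integrable lborel (\<lambda>s. 2 * C * (1 / (1 + s\<^sup>2)))"
        using poisson_kernel_integral(1)[of 1 0] by (intro integrable_mult_right) (simp add: add.commute)
      show "(\<lambda>s. complex_of_real (?k s) * (J (Y n * s) / complex_of_real (Y n))) \<in> borel_measurable lborel" for n
      proof -
        have "J = (\<lambda>h. LINT t|lborel. (if x - h \<le> t \<and> t \<le> x + h then f t else 0))"
          unfolding J_def set_lebesgue_integral_def
          by (intro ext Bochner_Integration.integral_cong) (auto simp: indicator_def)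
        hence [measurable]: "J \<in> borel_measurable borel" by simp
        show ?thesis by measurable
      qed
      show "AE s in lborel. (\<lambda>n. complex_of_real (?k s) * (J (Y n * s) / complex_of_real (Y n)))
         \<longlonglongrightarrow> complex_of_real (?k s) * (complex_of_real (2 * s) * f x)"
      proof (intro AE_I2)
        fix s :: real
        show "(\<lambda>n. complex_of_real (?k s) * (J (Y n * s) / complex_of_real (Y n)))
         \<longlonglongrightarrow> complex_of_real (?k s) * (complex_of_real (2 * s) * f x)"
        proof (cases "s > 0")
          case True
          have "filterlim (\<lambda>n. Y n * s) (at_right 0) sequentially"
            unfolding filterlim_at_right_to_0 
            using Y True less_imp_neq[OF Y(1), symmetric] by (auto simp: filterlim_at intro!: tendsto_mult_left_zero)
          from filterlim_compose[OF Jlim this]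
          have "(\<lambda>n. J (Y n * s) / complex_of_real (Y n * s) * complex_of_real s) \<longlonglongrightarrow> 2 * f x * complex_of_real s"
            by (intro tendsto_mult_right)
          moreover have "J (Y n * s) / complex_of_real (Y n * s) * complex_of_real s = J (Y n * s) / complex_of_real (Y n)" for n
            using True by simp
          ultimately have "(\<lambda>n. J (Y n * s) / complex_of_real (Y n)) \<longlonglongrightarrow> complex_of_real (2 * s) * f x" by (simp add: mult_ac)
          thus ?thesis by (rule tendsto_mult_left)
        qed auto
      qed
      show "AE s in lborel. cmod (complex_of_real (?k s) * (J (Y n * s) / complex_of_real (Y n))) \<le> 2 * C * (1 / (1 + s\<^sup>2))" for n
      proof (intro AE_I2)
        fix s :: real
        show "cmod (complex_of_real (?k s) * (J (Y n * s) / complex_of_real (Y n))) \<le> 2 * C * (1 / (1 + s\<^sup>2))"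
        proof (cases "s > 0")
          case True
          have p: "1 + s\<^sup>2 > 0" by (simp add: add_pos_nonneg)
          have "cmod (J (Y n * s) / complex_of_real (Y n)) \<le> C * s"
            using Jb[of "Y n * s"] True Y(1)[of n] by (simp add: norm_divide divide_le_eq mult_ac)
          hence "?k s * cmod (J (Y n * s) / complex_of_real (Y n)) \<le> (2 * s / (1 + s\<^sup>2)\<^sup>2) * (C * s)"
            using True by (intro mult_mono) auto
          hence "cmod (complex_of_real (?k s) * (J (Y n * s) / complex_of_real (Y n))) \<le> (2 * s / (1 + s\<^sup>2)\<^sup>2) * (C * s)"
            using True by (simp only: norm_mult norm_of_real) simp
          also have "\<dots> = 2 * C * (s\<^sup>2 / (1 + s\<^sup>2)) * (1 / (1 + s\<^sup>2))" using p by (simp add: power2_eq_square)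
          also have "\<dots> \<le> 2 * C * 1 * (1 / (1 + s\<^sup>2))"
            using p C0 by (intro mult_right_mono mult_left_mono) (auto simp: divide_le_eq_1)
          finally show ?thesis by simp
        qed (use C0 in auto)
      qed
    qed auto
    moreover have "(LINT s|lborel. complex_of_real (?k s) * (J (Y n * s) / complex_of_real (Y n))) = poisson_mean (Y n) f x" for n
      using poisson_mean_layer_cake[OF Y(1) f] by (simp only: J_def)
    \<comment> \<open>The value of the limit is read off the layer cake identity for the constant
      function f x, whose integral over (-s, s) is 2 s f x.\<close>
    moreover have "(LINT s|lborel. complex_of_real (?k s) * (complex_of_real (2 * s) * f x)) = complex_of_real pi * f x"
    proof -
      have pk: "integrable lborel (\<lambda>t::real. 1 / (1 + t\<^sup>2))" "(LINT t::real|lborel. 1 / (1 + t\<^sup>2)) = pi"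
        using poisson_kernel_integral[of 1 0] by (simp_all add: add.commute)
      have "(LINT t|lborel. f x * complex_of_real (1 / (1 + t\<^sup>2))) = (LINT s|lborel. complex_of_real (?k s) * (LINT t:{-s<..<s}|lborel. f x))"
        by (rule cauchy_mean_layer_cake) (simp, intro integrable_mult_right integrable_of_real pk)
      also have "\<dots> = (LINT s|lborel. complex_of_real (?k s) * (complex_of_real (2 * s) * f x))"
        by (intro Bochner_Integration.integral_cong refl) (auto simp: indicator_def set_integral_const scaleR_conv_of_real)
      finally show ?thesis
        by (simp only: integral_mult_right_zero integral_complex_of_real pk mult.commute)
    qed
    ultimately show "(\<lambda>n. poisson_mean (Y n) f x) \<longlonglongrightarrow> complex_of_real pi * f x" by (simp only:)
  qed
qed

section \<open>Convergence and completeness in L^2\<close>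

lemma cmod_add_power2_le: "(cmod (a + b))\<^sup>2 \<le> 2 * (cmod a)\<^sup>2 + 2 * (cmod b)\<^sup>2"
proof -
  have "(cmod (a + b))\<^sup>2 \<le> (cmod a + cmod b)\<^sup>2" by (intro power_mono norm_triangle_ineq) auto
  also have "\<dots> \<le> 2 * (cmod a)\<^sup>2 + 2 * (cmod b)\<^sup>2"
    using zero_le_power2[of "cmod a - cmod b"] by (simp add: power2_eq_square algebra_simps)
  finally show ?thesis .
qed

lemma L2_fun_add:
  assumes "L2_fun f" "L2_fun g"
  shows "L2_fun (\<lambda>x. f x + g x)" "L2_sq (\<lambda>x. f x + g x) \<le> 2 * L2_sq f + 2 * L2_sq g"
proof -
  have [measurable]: "f \<in> borel_measurable borel" "g \<in> borel_measurable borel" using assms by (auto simp: L2_fun_def)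
  have i: "integrable lborel (\<lambda>x. 2 * (cmod (f x))\<^sup>2 + 2 * (cmod (g x))\<^sup>2)"
    using assms by (auto simp: L2_fun_def intro!: Bochner_Integration.integrable_add integrable_mult_right)
  have j: "integrable lborel (\<lambda>x. (cmod (f x + g x))\<^sup>2)"
    by (rule Bochner_Integration.integrable_bound[OF i])
      (use cmod_add_power2_le in \<open>auto intro!: AE_I2 intro: order_trans[OF _ abs_ge_self]\<close>)
  show "L2_fun (\<lambda>x. f x + g x)" using j by (simp add: L2_fun_def)
  have "L2_sq (\<lambda>x. f x + g x) \<le> (LINT x|lborel. 2 * (cmod (f x))\<^sup>2 + 2 * (cmod (g x))\<^sup>2)"
    unfolding L2_sq_def by (intro integral_mono i j cmod_add_power2_le)
  also have "\<dots> = 2 * L2_sq f + 2 * L2_sq g"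
    using assms by (simp add: L2_fun_def L2_sq_def)
  finally show "L2_sq (\<lambda>x. f x + g x) \<le> 2 * L2_sq f + 2 * L2_sq g" .
qed

lemma L2_fun_cmult:
  assumes "L2_fun f"
  shows "L2_fun (\<lambda>x. c * f x)" "L2_sq (\<lambda>x. c * f x) = (cmod c)\<^sup>2 * L2_sq f"
  using assms by (auto simp: L2_fun_def L2_sq_def norm_mult power_mult_distrib)

lemma L2_fun_diff:
  assumes "L2_fun f" "L2_fun g"
  shows "L2_fun (\<lambda>x. f x - g x)" "L2_sq (\<lambda>x. f x - g x) \<le> 2 * L2_sq f + 2 * L2_sq g"
  using L2_fun_add[OF assms(1) L2_fun_cmult(1)[OF assms(2), of "-1"]] L2_fun_cmult(2)[OF assms(2), of "-1"] by auto

lemma L2_sq_nonneg: "L2_sq f \<ge> 0"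
  by (simp add: L2_sq_def integral_nonneg_AE)

lemma nn_integral_L2: "L2_fun f \<Longrightarrow> (\<integral>\<^sup>+ x. ennreal ((cmod (f x))\<^sup>2) \<partial>lborel) = ennreal (L2_sq f)"
  unfolding L2_sq_def by (rule nn_integral_eq_integral) (auto simp: L2_fun_def)

text \<open>Fatou's lemma for the nonnegative functions 2 |X n|^2 + 2 |f|^2 - |X n - f|^2, which
  tend to 4 |f|^2 almost everywhere: by the norm hypothesis their integrals are at most 4
  \<open>L2_sq f\<close> minus the squared error, so the error tends to 0.\<close>

lemma L2_convergence:
  assumes X: "\<And>n. L2_fun (X n)" and f: "L2_fun f"
    and lim: "AE x in lborel. (\<lambda>n. X n x) \<longlonglongrightarrow> f x" and le: "\<And>n. L2_sq (X n) \<le> L2_sq f"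
  shows "(\<lambda>n. L2_sq (\<lambda>x. X n x - f x)) \<longlonglongrightarrow> 0"
proof -
  have [measurable]: "f \<in> borel_measurable borel" "X n \<in> borel_measurable borel" for n using X f by (auto simp: L2_fun_def)
  let ?d = "\<lambda>n. L2_sq (\<lambda>x. X n x - f x)"
  let ?B = "4 * L2_sq f"
  define g where "g = (\<lambda>n x. 2 * (cmod (X n x))\<^sup>2 + 2 * (cmod (f x))\<^sup>2 - (cmod (X n x - f x))\<^sup>2)"
  have g0: "g n x \<ge> 0" for n x using cmod_add_power2_le[of "X n x" "- f x"] by (simp add: g_def)
  have ig: "integrable lborel (g n)" "(LINT x|lborel. g n x) \<le> ?B - ?d n" for n
  proof -
    have i: "integrable lborel (\<lambda>x. 2 * (cmod (X n x))\<^sup>2)" "integrable lborel (\<lambda>x. 2 * (cmod (f x))\<^sup>2)" "integrable lborel (\<lambda>x. (cmod (X n x - f x))\<^sup>2)"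
      using X[of n] f L2_fun_diff(1)[OF X f, of n] by (auto simp: L2_fun_def)
    show "integrable lborel (g n)" unfolding g_def using i by auto
    have "(LINT x|lborel. g n x) = 2 * L2_sq (X n) + 2 * L2_sq f - ?d n"
      unfolding g_def L2_sq_def using i by simp
    thus "(LINT x|lborel. g n x) \<le> ?B - ?d n" using le[of n] by simp
  qed
  have "ennreal ?B = (\<integral>\<^sup>+ x. ennreal (4 * (cmod (f x))\<^sup>2) \<partial>lborel)"
    using nn_integral_L2[OF L2_fun_cmult(1)[OF f, of 2]] L2_fun_cmult(2)[OF f, of 2] by (simp add: norm_mult power_mult_distrib)
  also have "\<dots> = (\<integral>\<^sup>+ x. liminf (\<lambda>n. ennreal (g n x)) \<partial>lborel)"
  proof (rule nn_integral_cong_AE)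
    show "AE x in lborel. ennreal (4 * (cmod (f x))\<^sup>2) = liminf (\<lambda>n. ennreal (g n x))"
      using lim
    proof eventually_elim
      case (elim x)
      have "(\<lambda>n. g n x) \<longlonglongrightarrow> 2 * (cmod (f x))\<^sup>2 + 2 * (cmod (f x))\<^sup>2 - (cmod (f x - f x))\<^sup>2"
        unfolding g_def by (intro tendsto_intros elim)
      hence "(\<lambda>n. ennreal (g n x)) \<longlonglongrightarrow> ennreal (4 * (cmod (f x))\<^sup>2)" by (intro tendsto_ennrealI) simp
      thus ?case by (simp add: lim_imp_Liminf)
    qed
  qed
  also have "\<dots> \<le> liminf (\<lambda>n. \<integral>\<^sup>+ x. ennreal (g n x) \<partial>lborel)"
    by (rule nn_integral_liminf) (auto simp: g_def)
  also have "(\<lambda>n. \<integral>\<^sup>+ x. ennreal (g n x) \<partial>lborel) = (\<lambda>n. ennreal (LINT x|lborel. g n x))"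
    using ig(1) g0 by (auto simp: nn_integral_eq_integral)
  finally have main: "ennreal ?B \<le> liminf (\<lambda>n. ennreal (LINT x|lborel. g n x))" .
  show ?thesis
  proof (rule order_tendstoI)
    fix e :: real assume e: "e > 0"
    show "\<forall>\<^sub>F n in sequentially. ?d n < e"
    \<comment> \<open>The number \<open>?B - e\<close> enters as an \<open>ennreal\<close> and has
      to be nonnegative; when it is negative, the crude bound of the error by \<open>?B\<close>
      suffices.\<close>
    proof (cases "?B < e")
      case True
      have "?d n \<le> ?B" for n using L2_fun_diff(2)[OF X[of n] f] le[of n] by simp
      from le_less_trans[OF this True] show ?thesis by (intro always_eventually allI)
    next
      case False
      hence "ennreal (?B - e) < ennreal ?B" using e by (intro ennreal_lessI) auto
      hence "ennreal (?B - e) < liminf (\<lambda>n. ennreal (LINT x|lborel. g n x))" using main by (rule less_le_trans)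
      hence "\<forall>\<^sub>F n in sequentially. ennreal (?B - e) < ennreal (LINT x|lborel. g n x)" by (rule less_LiminfD)
      thus ?thesis
      proof eventually_elim
        case (elim n)
        hence "?B - e < (LINT x|lborel. g n x)" using False by (subst (asm) ennreal_less_iff) auto
        thus ?case using ig(2)[of n] by simp
      qed
    qed
  next
    fix e :: real assume "e < 0" thus "\<forall>\<^sub>F n in sequentially. e < ?d n"
      by (intro always_eventually allI less_le_trans[OF _ L2_sq_nonneg])
  qed
qed

theorem poisson_mean_tendsto_L2:
  assumes f: "L2_fun f"
  shows "((\<lambda>y. L2_sq (\<lambda>x. poisson_mean y f x - complex_of_real pi * f x)) \<longlongrightarrow> 0) (at_right 0)"
proof (rule at_right_0_seqI)
  fix Y :: "nat \<Rightarrow> real" assume Y: "\<And>n. Y n > 0" "Y \<longlonglongrightarrow> 0"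
  have Y': "filterlim Y (at_right 0) sequentially"
    using Y less_imp_neq[OF Y(1), symmetric] by (auto simp: filterlim_at)
  show "(\<lambda>n. L2_sq (\<lambda>x. poisson_mean (Y n) f x - complex_of_real pi * f x)) \<longlonglongrightarrow> 0"
  proof (rule L2_convergence)
    show "AE x in lborel. (\<lambda>n. poisson_mean (Y n) f x) \<longlonglongrightarrow> complex_of_real pi * f x"
      using poisson_mean_tendsto_AE[OF f] by eventually_elim (rule filterlim_compose[OF _ Y'])
    show "L2_sq (poisson_mean (Y n) f) \<le> L2_sq (\<lambda>x. complex_of_real pi * f x)" for n
      using poisson_mean_L2(2)[OF Y(1) f] L2_fun_cmult(2)[OF f] by simp
  qed (use poisson_mean_L2(1)[OF Y(1) f] L2_fun_cmult(1)[OF f] in auto)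
qed

text \<open>Riesz-Fischer: a subsequence with geometrically small steps converges almost everywhere,
  and Fatou's lemma shows that its pointwise limit is the L^2 limit of the whole sequence.\<close>

lemma L2_complete:
  assumes X: "\<And>n. L2_fun (X n)"
    and cau: "\<And>e. e > 0 \<Longrightarrow> \<exists>N. \<forall>m\<ge>N. \<forall>n\<ge>N. L2_sq (\<lambda>x. X m x - X n x) < e"
  obtains \<phi> where "L2_fun \<phi>" "(\<lambda>n. L2_sq (\<lambda>x. X n x - \<phi> x)) \<longlonglongrightarrow> 0"
proof -
  have [measurable]: "X n \<in> borel_measurable borel" for n using X by (auto simp: L2_fun_def)
  have "\<exists>N. \<forall>k. (\<forall>m\<ge>N k. \<forall>n\<ge>N k. L2_sq (\<lambda>x. X m x - X n x) < (1/4) ^ k)"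
    by (intro choice allI cau) simp
  then obtain N where N: "\<And>k m n. m \<ge> N k \<Longrightarrow> n \<ge> N k \<Longrightarrow> L2_sq (\<lambda>x. X m x - X n x) < (1/4) ^ k" by blast
  \<comment> \<open>Summing N and adding k makes r monotone with both \<open>N k \<le> r k\<close>
    and \<open>k \<le> r k\<close>.\<close>
  define r where "r = (\<lambda>k. (\<Sum>j\<le>k. N j) + k)"
  have r: "N k \<le> r k" "k \<le> r k" "r k \<le> r (Suc k)" for k
    unfolding r_def by (intro trans_le_add1 member_le_sum; simp) simp_all
  define a where "a = (\<lambda>k. X (r k))"
  have [measurable]: "a k \<in> borel_measurable borel" for k by (simp add: a_def)
  have step: "L2_sq (\<lambda>x. a (Suc k) x - a k x) \<le> (1/4) ^ k" for k
    unfolding a_def using N[of k "r (Suc k)" "r k"] r[of k] by (intro less_imp_le) auto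
  \<comment> \<open>The weight 2^k still leaves integrals of at most (1/2)^k, while a finite sum K
    at x bounds the k-th step there by sqrt K times (sqrt (1/2))^k, which is summable.\<close>
  let ?t = "\<lambda>k x. 2 ^ k * (cmod (a (Suc k) x - a k x))\<^sup>2"
  have "(\<integral>\<^sup>+ x. (\<Sum>k. ennreal (?t k x)) \<partial>lborel) = (\<Sum>k. \<integral>\<^sup>+ x. ennreal (?t k x) \<partial>lborel)"
    by (rule nn_integral_suminf) auto
  also have "\<dots> \<le> (\<Sum>k. ennreal ((1/2) ^ k))"
  proof (intro suminf_le)
    fix k
    have "(\<integral>\<^sup>+ x. ennreal (?t k x) \<partial>lborel) = ennreal (2 ^ k) * ennreal (L2_sq (\<lambda>x. a (Suc k) x - a k x))"
      by (subst nn_integral_L2[symmetric])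
        (auto simp: nn_integral_cmult[symmetric] ennreal_mult a_def intro!: L2_fun_diff X)
    also have "\<dots> \<le> ennreal (2 ^ k) * ennreal ((1/4) ^ k)" using step[of k] by (intro mult_left_mono ennreal_leI) auto
    also have "\<dots> = ennreal ((1/2) ^ k)" by (simp add: ennreal_mult[symmetric] power_mult_distrib[symmetric])
    finally show "(\<integral>\<^sup>+ x. ennreal (?t k x) \<partial>lborel) \<le> ennreal ((1/2) ^ k)" .
  qed auto
  also have "\<dots> < \<infinity>"
  proof -
    have "(\<Sum>k. ennreal ((1/2) ^ k)) = ennreal (\<Sum>k. (1/2) ^ k)" by (rule suminf_ennreal2) auto
    thus ?thesis by simp
  qed
  finally have "AE x in lborel. (\<Sum>k. ennreal (?t k x)) \<noteq> \<infinity>"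
    by (intro nn_integral_noteq_infinite) auto
  hence conv: "AE x in lborel. convergent (\<lambda>k. a k x)"
  proof eventually_elim
    case (elim x)
    define f where "f = (\<lambda>k. ennreal (?t k x))"
    have "suminf f \<noteq> \<infinity>" using elim by (simp only: f_def not_False_eq_True)
    then obtain K where K: "suminf f = ennreal K" "K \<ge> 0"
      by (cases "suminf f") simp_all
    have t: "?t k x \<le> K" for k
    proof -
      have "sum f {k} \<le> suminf f" by (rule sum_le_suminf) simp_all
      hence "ennreal (?t k x) \<le> ennreal K" unfolding K by (simp only: f_def sum.insert sum.empty finite.emptyI empty_iff not_False_eq_True add_0_right)
      thus ?thesis using K(2) by (simp only: ennreal_le_iff)
    qed
    have d: "cmod (a (Suc k) x - a k x) \<le> sqrt K * (sqrt (1/2)) ^ k" for k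
    proof -
      have "(cmod (a (Suc k) x - a k x))\<^sup>2 \<le> K * (1/2) ^ k" using t[of k] by (simp add: power_one_over pos_le_divide_eq mult.commute)
      also have "\<dots> = (sqrt K * (sqrt (1/2)) ^ k)\<^sup>2"
      proof -
        have "(sqrt (1/2) ^ k)\<^sup>2 = ((sqrt (1/2))\<^sup>2) ^ k" by (simp only: power_mult[symmetric] mult.commute)
        thus ?thesis using K(2) by (simp add: power_mult_distrib)
      qed
      finally show ?thesis by (rule power2_le_imp_le) (use K in auto)
    qed
    have "summable (\<lambda>k. sqrt K * (sqrt (1/2)) ^ k)"
      by (intro summable_mult summable_geometric) (simp add: real_sqrt_divide)
    hence "summable (\<lambda>k. a (Suc k) x - a k x)"
      by (rule summable_comparison_test[rotated]) (use d in auto)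
    from summable_LIMSEQ[OF this] have "convergent (\<lambda>n. a n x - a 0 x)"
      unfolding sum_lessThan_telescope[of "\<lambda>i. a i x"] by (rule convergentI)
    from convergent_add[OF this convergent_const[of "a 0 x"]] show ?case by simp
  qed
  define \<phi> where "\<phi> = (\<lambda>x. lim (\<lambda>k. a k x))"
  have [measurable]: "\<phi> \<in> borel_measurable borel" unfolding \<phi>_def by measurable
  \<comment> \<open>Fatou along the subsequence: the limit inherits every bound that holds between
    late members of X.\<close>
  have fat: "(\<integral>\<^sup>+ x. ennreal ((cmod (X n x - \<phi> x))\<^sup>2) \<partial>lborel) \<le> ennreal e" 
    if N: "\<And>m m'. m \<ge> n0 \<Longrightarrow> m' \<ge> n0 \<Longrightarrow> L2_sq (\<lambda>x. X m x - X m' x) < e" and n: "n \<ge> n0" for n n0 e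
  proof -
    have "(\<integral>\<^sup>+ x. ennreal ((cmod (X n x - \<phi> x))\<^sup>2) \<partial>lborel) = (\<integral>\<^sup>+ x. liminf (\<lambda>k. ennreal ((cmod (X n x - a k x))\<^sup>2)) \<partial>lborel)"
    proof (rule nn_integral_cong_AE)
      show "AE x in lborel. ennreal ((cmod (X n x - \<phi> x))\<^sup>2) = liminf (\<lambda>k. ennreal ((cmod (X n x - a k x))\<^sup>2))"
        using conv
      proof eventually_elim
        case (elim x)
        hence "(\<lambda>k. a k x) \<longlonglongrightarrow> \<phi> x" unfolding \<phi>_def by (simp add: convergent_LIMSEQ_iff)
        hence "(\<lambda>k. ennreal ((cmod (X n x - a k x))\<^sup>2)) \<longlonglongrightarrow> ennreal ((cmod (X n x - \<phi> x))\<^sup>2)"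
          by (intro tendsto_intros)
        from lim_imp_Liminf[OF sequentially_bot this] show ?case by (rule sym)
      qed
    qed
    also have "\<dots> \<le> liminf (\<lambda>k. \<integral>\<^sup>+ x. ennreal ((cmod (X n x - a k x))\<^sup>2) \<partial>lborel)"
      by (rule nn_integral_liminf) auto
    also have "\<dots> \<le> liminf (\<lambda>k. ennreal e)"
    proof (rule Liminf_mono)
      show "\<forall>\<^sub>F k in sequentially. (\<integral>\<^sup>+ x. ennreal ((cmod (X n x - a k x))\<^sup>2) \<partial>lborel) \<le> ennreal e"
        unfolding eventually_sequentially
      proof (intro exI[of _ n0] allI impI)
        fix k assume "n0 \<le> k"
        hence "L2_sq (\<lambda>x. X n x - a k x) < e" unfolding a_def using N[of n "r k"] n r(2)[of k] by simp
        thus "(\<integral>\<^sup>+ x. ennreal ((cmod (X n x - a k x))\<^sup>2) \<partial>lborel) \<le> ennreal e"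
          unfolding a_def nn_integral_L2[OF L2_fun_diff(1)[OF X X]] by (intro ennreal_leI less_imp_le)
      qed
    qed
    also have "\<dots> = ennreal e" by (simp add: Liminf_const)
    finally show ?thesis .
  qed
  have dif: "L2_fun (\<lambda>x. X n x - \<phi> x)" "L2_sq (\<lambda>x. X n x - \<phi> x) \<le> e" 
    if N: "\<And>m m'. m \<ge> n0 \<Longrightarrow> m' \<ge> n0 \<Longrightarrow> L2_sq (\<lambda>x. X m x - X m' x) < e" and n: "n \<ge> n0" and e: "e > 0" for n n0 e
  proof -
    note F = fat[OF N n]
    show L: "L2_fun (\<lambda>x. X n x - \<phi> x)"
      unfolding L2_fun_def
    proof
      show "integrable lborel (\<lambda>x. (cmod (X n x - \<phi> x))\<^sup>2)"
        by (rule integrableI_bounded) (simp_all add: le_less_trans[OF F])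
    qed measurable
    show "L2_sq (\<lambda>x. X n x - \<phi> x) \<le> e"
      using F e unfolding nn_integral_L2[OF L] by (simp add: ennreal_le_iff)
  qed
  have "L2_fun (\<lambda>x. X (N 0) x - \<phi> x)"
    by (rule dif(1)[of "N 0" 1]) (use N[of 0] in auto)
  from L2_fun_diff(1)[OF X[of "N 0"] this] have L: "L2_fun \<phi>" by simp
  moreover have "(\<lambda>n. L2_sq (\<lambda>x. X n x - \<phi> x)) \<longlonglongrightarrow> 0"
  proof (rule LIMSEQ_I)
    fix e :: real assume e: "e > 0"
    have "\<exists>N. \<forall>m\<ge>N. \<forall>n\<ge>N. L2_sq (\<lambda>x. X m x - X n x) < e / 2" by (rule cau) (use e in simp)
    then obtain n0 where n0: "\<And>m m'. m \<ge> n0 \<Longrightarrow> m' \<ge> n0 \<Longrightarrow> L2_sq (\<lambda>x. X m x - X m' x) < e / 2"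
      by blast
    show "\<exists>no. \<forall>n\<ge>no. norm (L2_sq (\<lambda>x. X n x - \<phi> x) - 0) < e"
    proof (intro exI[of _ n0] allI impI)
      fix n assume "n0 \<le> n"
      hence "L2_sq (\<lambda>x. X n x - \<phi> x) \<le> e / 2" using e by (intro dif(2)[OF n0]) auto
      thus "norm (L2_sq (\<lambda>x. X n x - \<phi> x) - 0) < e" using e L2_sq_nonneg[of "\<lambda>x. X n x - \<phi> x"] by simp
    qed
  qed
  ultimately show thesis by (rule that)
qed

section \<open>Cauchy transforms and their boundary values\<close>

text \<open>Without the factor 1 / (2 pi i), so that the jump across the real line is 2 pi i
  h.\<close>

definition cauchy_tr :: "(real \<Rightarrow> complex) \<Rightarrow> complex \<Rightarrow> complex" where
  "cauchy_tr h \<zeta> = (LINT t|lborel. h t / (complex_of_real t - \<zeta>))"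

lemma cmod_of_real_minus_ge: "\<bar>Im \<zeta>\<bar> \<le> cmod (complex_of_real t - \<zeta>)"
  using abs_Im_le_cmod[of "complex_of_real t - \<zeta>"] by simp

lemma of_real_minus_nonzero: "Im \<zeta> \<noteq> 0 \<Longrightarrow> complex_of_real t - \<zeta> \<noteq> 0"
  by (auto simp: complex_eq_iff)

lemma integrable_bounded_mult:
  fixes h g :: "real \<Rightarrow> complex"
  assumes h: "integrable lborel h" and [measurable]: "g \<in> borel_measurable borel"
    and b: "\<And>t. cmod (g t) \<le> B"
  shows "integrable lborel (\<lambda>t. h t * g t)"
    and "cmod (LINT t|lborel. h t * g t) \<le> B * (LINT t|lborel. cmod (h t))"
proof -
  have [measurable]: "h \<in> borel_measurable borel" using h by (auto dest: borel_measurable_integrable)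
  have le: "cmod (h t * g t) \<le> B * cmod (h t)" for t
    using b[of t] by (simp add: norm_mult mult.commute mult_right_mono)
  have i: "integrable lborel (\<lambda>t. B * cmod (h t))" using h by (intro integrable_mult_right integrable_norm)
  show j: "integrable lborel (\<lambda>t. h t * g t)"
    by (rule Bochner_Integration.integrable_bound[OF i])
      (simp, intro AE_I2, rule order_trans[OF le], simp)
  have "cmod (LINT t|lborel. h t * g t) \<le> (LINT t|lborel. B * cmod (h t))"
    by (rule order_trans[OF integral_norm_bound]) (intro integral_mono integrable_norm i j le)
  thus "cmod (LINT t|lborel. h t * g t) \<le> B * (LINT t|lborel. cmod (h t))" by simp
qed

lemma cauchy_tr_integrable:
  assumes "integrable lborel h" "Im \<zeta> \<noteq> 0"
  shows "integrable lborel (\<lambda>t. h t / (complex_of_real t - \<zeta>))"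
    and "cmod (cauchy_tr h \<zeta>) \<le> (LINT t|lborel. cmod (h t)) / \<bar>Im \<zeta>\<bar>"
proof -
  have b: "cmod (1 / (complex_of_real t - \<zeta>)) \<le> 1 / \<bar>Im \<zeta>\<bar>" for t
    unfolding norm_divide norm_one
    by (intro divide_left_mono cmod_of_real_minus_ge mult_pos_pos)
      (use assms(2) of_real_minus_nonzero[OF assms(2)] in auto)
  note B = integrable_bounded_mult[OF assms(1) _ b]
  show "integrable lborel (\<lambda>t. h t / (complex_of_real t - \<zeta>))" using B(1) by simp
  show "cmod (cauchy_tr h \<zeta>) \<le> (LINT t|lborel. cmod (h t)) / \<bar>Im \<zeta>\<bar>" using B(2) by (simp add: cauchy_tr_def)
qed

text \<open>The difference quotient is exactly
  \<open>?D + (\<zeta>' - \<zeta>) * E \<zeta>'\<close>, because 1 / (a b) = 1 / b^2 + (b - a) / (a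
  b^2). On the ball whose radius is half the distance to the real line E stays bounded, so the
  second term vanishes in the limit.\<close>

lemma cauchy_tr_has_field_derivative:
  assumes h: "integrable lborel h" and z: "Im \<zeta> \<noteq> 0"
  shows "(cauchy_tr h has_field_derivative (LINT t|lborel. h t / (complex_of_real t - \<zeta>)\<^sup>2)) (at \<zeta>)"
  unfolding has_field_derivative_iff
proof (rule Lim_transform_within_open)
  define d where "d = \<bar>Im \<zeta>\<bar>"
  have d: "d > 0" using z by (simp add: d_def)
  let ?D = "LINT t|lborel. h t / (complex_of_real t - \<zeta>)\<^sup>2"
  let ?I = "LINT t|lborel. cmod (h t)"
  define E where "E = (\<lambda>\<zeta>'. LINT t|lborel. h t * (1 / ((complex_of_real t - \<zeta>') * (complex_of_real t - \<zeta>)\<^sup>2)))"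
  have far: "Im \<zeta>' \<noteq> 0" "d / 2 \<le> cmod (complex_of_real t - \<zeta>')" if "\<zeta>' \<in> ball \<zeta> (d/2)" for \<zeta>' t
  proof -
    have "\<bar>Im \<zeta> - Im \<zeta>'\<bar> \<le> cmod (\<zeta> - \<zeta>')" using abs_Im_le_cmod[of "\<zeta> - \<zeta>'"] by simp
    hence *: "\<bar>Im \<zeta>'\<bar> \<ge> d / 2" using that by (auto simp: dist_norm d_def)
    thus "Im \<zeta>' \<noteq> 0" using d by auto
    show "d / 2 \<le> cmod (complex_of_real t - \<zeta>')" using * cmod_of_real_minus_ge[of \<zeta>' t] by linarith
  qed
  have near: "d \<le> cmod (complex_of_real t - \<zeta>)" for t using cmod_of_real_minus_ge[of \<zeta> t] by (simp add: d_def)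
  have EB: "integrable lborel (\<lambda>t. h t * (1 / ((complex_of_real t - \<zeta>') * (complex_of_real t - \<zeta>)\<^sup>2)))"
     "cmod (E \<zeta>') \<le> 1 / (d / 2 * d\<^sup>2) * ?I" if "\<zeta>' \<in> ball \<zeta> (d/2)" for \<zeta>'
  proof -
    have "cmod (1 / ((complex_of_real t - \<zeta>') * (complex_of_real t - \<zeta>)\<^sup>2)) \<le> 1 / (d / 2 * d\<^sup>2)" for t
      unfolding norm_divide norm_one norm_mult norm_power
      using far(2)[OF that, of t] near[of t] d by (intro frac_le mult_mono power_mono) auto
    from integrable_bounded_mult[OF h _ this] show "integrable lborel (\<lambda>t. h t * (1 / ((complex_of_real t - \<zeta>') * (complex_of_real t - \<zeta>)\<^sup>2)))"
     "cmod (E \<zeta>') \<le> 1 / (d / 2 * d\<^sup>2) * ?I" unfolding E_def by simp_all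
  qed
  have Di: "integrable lborel (\<lambda>t. h t * (1 / (complex_of_real t - \<zeta>)\<^sup>2))"
  proof (rule integrable_bounded_mult[OF h])
    show "cmod (1 / (complex_of_real t - \<zeta>)\<^sup>2) \<le> 1 / d\<^sup>2" for t
      unfolding norm_divide norm_one norm_power
      using near[of t] d by (intro frac_le power_mono) auto
  qed simp
  show "((\<lambda>\<zeta>'. ?D + (\<zeta>' - \<zeta>) * E \<zeta>') \<longlongrightarrow> ?D) (at \<zeta>)"
  proof -
    have "((\<lambda>\<zeta>'. (\<zeta>' - \<zeta>) * E \<zeta>') \<longlongrightarrow> 0) (at \<zeta>)"
    proof (rule Lim_null_comparison)
      show "\<forall>\<^sub>F \<zeta>' in at \<zeta>. cmod ((\<zeta>' - \<zeta>) * E \<zeta>') \<le> cmod (\<zeta>' - \<zeta>) * (1 / (d / 2 * d\<^sup>2) * ?I)"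
        using eventually_at_in_open'[of "ball \<zeta> (d/2)" \<zeta>] d
        by (auto elim!: eventually_mono simp: norm_mult simp del: times_divide_eq_left intro!: mult_left_mono EB(2))
      show "((\<lambda>\<zeta>'. cmod (\<zeta>' - \<zeta>) * (1 / (d / 2 * d\<^sup>2) * ?I)) \<longlongrightarrow> 0) (at \<zeta>)"
        by (intro tendsto_mult_left_zero tendsto_norm_zero) (simp add: LIM_zero)
    qed
    from tendsto_add[OF tendsto_const this] show ?thesis by simp
  qed
  show "?D + (\<zeta>' - \<zeta>) * E \<zeta>' = (cauchy_tr h \<zeta>' - cauchy_tr h \<zeta>) / (\<zeta>' - \<zeta>)" if z': "\<zeta>' \<in> ball \<zeta> (d/2)" "\<zeta>' \<noteq> \<zeta>" for \<zeta>'
  proof -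
    note f = far[OF z'(1)]
    have pt: "(\<zeta>' - \<zeta>) * (h t * (1 / (complex_of_real t - \<zeta>)\<^sup>2) + (\<zeta>' - \<zeta>) * (h t * (1 / ((complex_of_real t - \<zeta>') * (complex_of_real t - \<zeta>)\<^sup>2))))
       = h t / (complex_of_real t - \<zeta>') - h t / (complex_of_real t - \<zeta>)" for t
    proof -
      have "complex_of_real t - \<zeta>' \<noteq> 0" "complex_of_real t - \<zeta> \<noteq> 0"
        using of_real_minus_nonzero[OF f(1)] of_real_minus_nonzero[OF z] by auto
      moreover have "(v - u) * (H * (1 / b\<^sup>2) + (v - u) * (H * (1 / (a * b\<^sup>2)))) = H / a - H / b"
        if "a = T - v" "b = T - u" "a \<noteq> 0" "b \<noteq> 0" for a b u v T H :: complex
      proof -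
        have vu: "v - u = b - a" using that by simp
        show ?thesis unfolding vu using that(3,4) by (simp add: divide_simps power2_eq_square) (simp add: algebra_simps)
      qed
      ultimately show ?thesis by blast
    qed
    have "cauchy_tr h \<zeta>' - cauchy_tr h \<zeta> = (LINT t|lborel. h t / (complex_of_real t - \<zeta>') - h t / (complex_of_real t - \<zeta>))"
      unfolding cauchy_tr_def by (rule Bochner_Integration.integral_diff[symmetric]) (intro cauchy_tr_integrable h z f(1))+
    also have "\<dots> = (\<zeta>' - \<zeta>) * (LINT t|lborel. h t * (1 / (complex_of_real t - \<zeta>)\<^sup>2) + (\<zeta>' - \<zeta>) * (h t * (1 / ((complex_of_real t - \<zeta>') * (complex_of_real t - \<zeta>)\<^sup>2))))"
      unfolding pt[symmetric] by (rule integral_mult_right_zero)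
    also have "(LINT t|lborel. h t * (1 / (complex_of_real t - \<zeta>)\<^sup>2) + (\<zeta>' - \<zeta>) * (h t * (1 / ((complex_of_real t - \<zeta>') * (complex_of_real t - \<zeta>)\<^sup>2))))
       = ?D + (\<zeta>' - \<zeta>) * E \<zeta>'"
      unfolding E_def
      by (subst Bochner_Integration.integral_add[OF Di integrable_mult_right[OF EB(1)[OF z'(1)]]])
        (simp only: integral_mult_right_zero, simp)
    finally show ?thesis using z'(2) by simp
  qed
  show "open (ball \<zeta> (d/2))" "\<zeta> \<in> ball \<zeta> (d/2)" using d by auto
qed

lemma cauchy_tr_holomorphic:
  assumes "integrable lborel h" "\<And>z. z \<in> S \<Longrightarrow> Im z \<noteq> 0"
  shows "cauchy_tr h holomorphic_on S"
  unfolding holomorphic_on_def field_differentiable_def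
  using cauchy_tr_has_field_derivative[OF assms(1) assms(2)] has_field_derivative_at_within by blast

lemma cauchy_tr_continuous_line:
  assumes "integrable lborel h" "y \<noteq> 0"
  shows "continuous_on UNIV (\<lambda>x. cauchy_tr h (complex_of_real x + \<i> * complex_of_real y))"
  by (rule continuous_on_compose2[OF holomorphic_on_imp_continuous_on[OF cauchy_tr_holomorphic[OF assms(1), of "{z. Im z = y}"]]])
    (use assms(2) in \<open>auto intro!: continuous_intros\<close>)

lemma cauchy_tr_measurable:
  assumes "integrable lborel h" "y \<noteq> 0"
  shows "(\<lambda>x. cauchy_tr h (complex_of_real x + \<i> * complex_of_real y)) \<in> borel_measurable borel"
  by (rule borel_measurable_continuous_onI[OF cauchy_tr_continuous_line[OF assms]])

lemma cauchy_tr_cnj: "cauchy_tr (\<lambda>t. cnj (h t)) (cnj \<zeta>) = cnj (cauchy_tr h \<zeta>)"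
proof -
  have "cnj (cauchy_tr h \<zeta>) = (LINT t|lborel. cnj (h t / (complex_of_real t - \<zeta>)))"
    unfolding cauchy_tr_def by (rule Bochner_Integration.integral_cnj[symmetric])
  thus ?thesis by (simp add: cauchy_tr_def)
qed

lemma cauchy_tr_add:
  assumes "integrable lborel h" "integrable lborel k" "Im \<zeta> \<noteq> 0"
  shows "cauchy_tr (\<lambda>t. h t + c * k t) \<zeta> = cauchy_tr h \<zeta> + c * cauchy_tr k \<zeta>"
proof -
  have "cauchy_tr (\<lambda>t. h t + c * k t) \<zeta> = (LINT t|lborel. h t / (complex_of_real t - \<zeta>) + c * (k t / (complex_of_real t - \<zeta>)))"
    unfolding cauchy_tr_def by (simp add: add_divide_distrib)
  also have "\<dots> = cauchy_tr h \<zeta> + c * cauchy_tr k \<zeta>"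
    unfolding cauchy_tr_def integral_mult_right_zero[symmetric]
    by (rule Bochner_Integration.integral_add[OF cauchy_tr_integrable(1)[OF assms(1,3)] integrable_mult_right[OF cauchy_tr_integrable(1)[OF assms(2,3)]]])
  finally show ?thesis .
qed

text \<open>The two kernels differ by 2 i y / ((t - x)^2 + y^2). The jump between the heights y and
  -y is thus a Poisson mean before any limit is taken.\<close>

lemma poisson_mean_cauchy_tr:
  assumes h: "integrable lborel h" and y: "y > 0"
  shows "cauchy_tr h (complex_of_real x + \<i> * complex_of_real y) - cauchy_tr h (complex_of_real x - \<i> * complex_of_real y)
     = 2 * \<i> * poisson_mean y h x"
proof -
  have pt: "h t / (complex_of_real t - (complex_of_real x + \<i> * complex_of_real y)) - h t / (complex_of_real t - (complex_of_real x - \<i> * complex_of_real y))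
     = 2 * \<i> * (complex_of_real (poisson_kernel y x t) * h t)" for t
  proof -
    have ne: "complex_of_real t - (complex_of_real x + \<i> * complex_of_real y) \<noteq> 0"
      "complex_of_real t - (complex_of_real x - \<i> * complex_of_real y) \<noteq> 0"
      using y by (auto simp: complex_eq_iff)
    have "(complex_of_real t - (complex_of_real x + \<i> * complex_of_real y)) * (complex_of_real t - (complex_of_real x - \<i> * complex_of_real y))
      = complex_of_real ((t - x)\<^sup>2 + y\<^sup>2)" by (auto simp: complex_eq_iff power2_eq_square algebra_simps)
    hence "complex_of_real (poisson_kernel y x t) = complex_of_real y / ((complex_of_real t - (complex_of_real x + \<i> * complex_of_real y)) * (complex_of_real t - (complex_of_real x - \<i> * complex_of_real y)))"
      by (simp only: poisson_kernel_def of_real_divide)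
    moreover have "H / a - H / b = 2 * \<i> * (Y / (a * b) * H)"
      if "a \<noteq> 0" "b \<noteq> 0" "b - a = 2 * \<i> * Y" for a b H Y :: complex
    proof -
      have "H / a - H / b = (b - a) * H / (a * b)" using that(1,2) by (simp add: divide_simps) (simp add: algebra_simps)
      thus ?thesis using that(3) by simp
    qed
    ultimately show ?thesis using ne by simp
  qed
  show ?thesis unfolding cauchy_tr_def poisson_mean_def
    by (subst Bochner_Integration.integral_diff[symmetric])
      (use y in \<open>auto simp: pt intro!: cauchy_tr_integrable h\<close>)
qed

text \<open>Cauchy-Schwarz with weight |h| bounds the squared modulus by the L^1 norm of h times the
  integral of |h| / |t - z|^2. The latter is 1 / y times a Poisson mean of |h|, and this is
  integrable in x by Tonelli.\<close>

lemma cauchy_tr_L2_line: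
  assumes h: "integrable lborel h" and y: "y > 0"
  shows "L2_fun (\<lambda>x. cauchy_tr h (complex_of_real x + \<i> * complex_of_real y))"
proof -
  have [measurable]: "h \<in> borel_measurable borel" using h by (auto dest: borel_measurable_integrable)
  let ?I = "LINT t|lborel. cmod (h t)"
  note T = poisson_kernel_Tonelli[OF y integrable_norm[OF h] norm_ge_zero]
  have nrm: "(1 / cmod (complex_of_real t - (complex_of_real x + \<i> * complex_of_real y)))\<^sup>2 = (1 / y) * poisson_kernel y x t" for t x
    using y by (simp add: power_divide cmod_power2 poisson_kernel_def)
  have le: "(cmod (cauchy_tr h (complex_of_real x + \<i> * complex_of_real y)))\<^sup>2 
      \<le> ?I * (1 / y) * (LINT t|lborel. poisson_kernel y x t * cmod (h t))" for x
  proof -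
    let ?z = "complex_of_real x + \<i> * complex_of_real y"
    let ?f = "\<lambda>t. complex_of_real (1 / cmod (complex_of_real t - ?z))"
    have sq: "cmod (h t) * (cmod (?f t))\<^sup>2 = (1 / y) * (poisson_kernel y x t * cmod (h t))" for t
      unfolding norm_of_real power2_abs nrm by simp
    have i: "integrable lborel (\<lambda>t. cmod (h t) * (cmod (?f t))\<^sup>2)"
      unfolding sq using integrable_poisson_kernel_mult[OF y integrable_norm[OF h], of x] by (intro integrable_mult_right) simp
    have CS: "(cmod (LINT t|lborel. complex_of_real (cmod (h t)) * ?f t))\<^sup>2 \<le> ?I * (LINT t|lborel. cmod (h t) * (cmod (?f t))\<^sup>2)"
      by (rule integral_Cauchy_Schwarz_weighted(2)) (use h i in auto)
    have "cmod (cauchy_tr h ?z) \<le> (LINT t|lborel. cmod (h t / (complex_of_real t - ?z)))"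
      unfolding cauchy_tr_def by (rule integral_norm_bound)
    also have "\<dots> = cmod (LINT t|lborel. complex_of_real (cmod (h t)) * ?f t)"
    proof -
      have "(LINT t|lborel. complex_of_real (cmod (h t)) * ?f t) = complex_of_real (LINT t|lborel. cmod (h t / (complex_of_real t - ?z)))"
        by (simp add: norm_divide integral_complex_of_real[symmetric] del: integral_complex_of_real)
      thus ?thesis by (simp only: norm_of_real) (rule abs_of_nonneg[symmetric], intro integral_nonneg_AE, simp)
    qed
    finally have "(cmod (cauchy_tr h ?z))\<^sup>2 \<le> (cmod (LINT t|lborel. complex_of_real (cmod (h t)) * ?f t))\<^sup>2"
      by (intro power_mono) auto
    also note CS
    also have "(LINT t|lborel. cmod (h t) * (cmod (?f t))\<^sup>2) = (1 / y) * (LINT t|lborel. poisson_kernel y x t * cmod (h t))"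
      unfolding sq by (rule integral_mult_right_zero)
    finally show ?thesis by (simp add: mult_ac)
  qed
  have [measurable]: "(\<lambda>x. cauchy_tr h (complex_of_real x + \<i> * complex_of_real y)) \<in> borel_measurable borel"
    using cauchy_tr_measurable[OF h] y by simp
  have "integrable lborel (\<lambda>x. (cmod (cauchy_tr h (complex_of_real x + \<i> * complex_of_real y)))\<^sup>2)"
  proof (rule Bochner_Integration.integrable_bound)
    show "integrable lborel (\<lambda>x. ?I * (1 / y) * (LINT t|lborel. poisson_kernel y x t * cmod (h t)))"
      by (intro integrable_mult_right T)
    show "AE x in lborel. norm ((cmod (cauchy_tr h (complex_of_real x + \<i> * complex_of_real y)))\<^sup>2)
         \<le> norm (?I * (1 / y) * (LINT t|lborel. poisson_kernel y x t * cmod (h t)))"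
      by (intro AE_I2) (simp only: real_norm_def abs_power2 order_trans[OF le abs_ge_self])
  qed simp
  thus ?thesis by (simp add: L2_fun_def)
qed

text \<open>Both modes of convergence are used: the pointwise one identifies the values of
  \<open>S_hat\<close>, the L^2 one passes to the limit in integrals of products.\<close>

definition hardy_boundary :: "(real \<Rightarrow> complex) \<Rightarrow> (real \<Rightarrow> complex) \<Rightarrow> bool" where
  "hardy_boundary h \<phi> \<longleftrightarrow> L2_fun \<phi> \<and>
     (AE x in lborel. ((\<lambda>y. cauchy_tr h (complex_of_real x + \<i> * complex_of_real y)) \<longlongrightarrow> \<phi> x) (at_right 0)) \<and>
     ((\<lambda>y. L2_sq (\<lambda>x. cauchy_tr h (complex_of_real x + \<i> * complex_of_real y) - \<phi> x)) \<longlongrightarrow> 0) (at_right 0)"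

text \<open>The upward shift makes the transform bounded on the closed half-plane and holomorphic
  across the real line, as the half-plane integrals require.\<close>

lemma cauchy_tr_shift_holomorphic:
  assumes h: "integrable lborel h" and y: "y > 0"
  shows "(\<lambda>z. cauchy_tr h (z + \<i> * complex_of_real y)) holomorphic_on {z. Im z > - y}"
    and "0 \<le> Im z \<Longrightarrow> cmod (cauchy_tr h (z + \<i> * complex_of_real y)) \<le> (LINT t|lborel. cmod (h t)) / y"
proof -
  have "(cauchy_tr h \<circ> (\<lambda>z. z + \<i> * complex_of_real y)) holomorphic_on {z. Im z > - y}"
    by (rule holomorphic_on_compose_gen[OF _ cauchy_tr_holomorphic[OF h, of "{z. Im z > 0}"]])
      (auto intro!: holomorphic_intros)
  thus "(\<lambda>z. cauchy_tr h (z + \<i> * complex_of_real y)) holomorphic_on {z. Im z > - y}" by (simp add: o_def)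
  assume z: "0 \<le> Im z"
  have "cmod (cauchy_tr h (z + \<i> * complex_of_real y)) \<le> (LINT t|lborel. cmod (h t)) / \<bar>Im (z + \<i> * complex_of_real y)\<bar>"
    by (rule cauchy_tr_integrable(2)[OF h]) (use z y in auto)
  also have "\<dots> \<le> (LINT t|lborel. cmod (h t)) / y"
    using z y by (intro divide_left_mono) (auto intro!: integral_nonneg_AE)
  finally show "cmod (cauchy_tr h (z + \<i> * complex_of_real y)) \<le> (LINT t|lborel. cmod (h t)) / y" .
qed

lemma cauchy_tr_real_Im:
  assumes h: "integrable lborel h" and real: "\<And>t. cnj (h t) = h t" and y: "y > 0"
  shows "complex_of_real (Im (cauchy_tr h (complex_of_real x + \<i> * complex_of_real y))) = poisson_mean y h x"
proof -
  let ?F = "cauchy_tr h (complex_of_real x + \<i> * complex_of_real y)"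
  have "cauchy_tr h (complex_of_real x - \<i> * complex_of_real y) = cnj ?F"
    using cauchy_tr_cnj[of h "complex_of_real x + \<i> * complex_of_real y"] by (simp add: real)
  hence "?F - cnj ?F = 2 * \<i> * poisson_mean y h x" using poisson_mean_cauchy_tr[OF h y, of x] by simp
  moreover have "?F - cnj ?F = 2 * \<i> * complex_of_real (Im ?F)" by (simp add: complex_eq_iff)
  ultimately show ?thesis by simp
qed

text \<open>The square of a function in the Hardy space integrates to zero, so its real and imaginary
  parts have the same \<open>L\<^sup>2\<close> norm; the imaginary part of the Cauchy transform of a real function is
  a Poisson mean.\<close>

lemma cauchy_tr_real_L2_diff:
  assumes h: "integrable lborel h" and real: "\<And>t. cnj (h t) = h t" and y: "y > 0" "y' > 0"
  shows "L2_sq (\<lambda>x. cauchy_tr h (complex_of_real x + \<i> * complex_of_real y) - cauchy_tr h (complex_of_real x + \<i> * complex_of_real y'))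
    = 2 * L2_sq (\<lambda>x. poisson_mean y h x - poisson_mean y' h x)"
proof -
  define G where "G = (\<lambda>z. cauchy_tr h (z + \<i> * complex_of_real y) - cauchy_tr h (z + \<i> * complex_of_real y'))"
  define g where "g = (\<lambda>x. G (complex_of_real x))"
  have L: "L2_fun g"
    unfolding g_def G_def by (intro L2_fun_diff cauchy_tr_L2_line h y)
  have [measurable]: "g \<in> borel_measurable borel" using L by (simp add: L2_fun_def)
  have i: "integrable lborel (\<lambda>x. (cmod (g x))\<^sup>2)" using L by (simp add: L2_fun_def)
  have "(LINT x|lborel. (G (complex_of_real x))\<^sup>2) = 0"
  proof (rule half_plane_integral_square_zero)
    show "G holomorphic_on {z. Im z > - min y y'}"
      unfolding G_def
      by (intro holomorphic_intros holomorphic_on_subset[OF cauchy_tr_shift_holomorphic(1)[OF h]]) (use y in auto)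
    show "cmod (G z) \<le> (LINT t|lborel. cmod (h t)) / y + (LINT t|lborel. cmod (h t)) / y'" if "0 \<le> Im z" for z
      unfolding G_def
      by (rule order_trans[OF norm_triangle_ineq4]) (intro add_mono cauchy_tr_shift_holomorphic h y that)
    show "integrable lborel (\<lambda>x. (cmod (G (complex_of_real x)))\<^sup>2)" using i by (simp add: g_def)
  qed (use y in auto)
  hence z: "(LINT x|lborel. (g x)\<^sup>2) = 0" by (simp add: g_def)
  have ig2: "integrable lborel (\<lambda>x. (g x)\<^sup>2)"
    by (rule Bochner_Integration.integrable_bound[OF i]) (auto simp: norm_power)
  have iIm: "integrable lborel (\<lambda>x. (Im (g x))\<^sup>2)"
    by (rule Bochner_Integration.integrable_bound[OF i]) (auto simp: cmod_power2)
  \<comment> \<open>Pointwise |g|^2 = 2 (Im g)^2 + Re (g^2), and the last term integrates to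
    0.\<close>
  have "L2_sq g = (LINT x|lborel. 2 * (Im (g x))\<^sup>2 + Re ((g x)\<^sup>2))"
    unfolding L2_sq_def by (intro Bochner_Integration.integral_cong refl) (simp only: cmod_power2, simp add: power2_eq_square)
  also have "\<dots> = 2 * (LINT x|lborel. (Im (g x))\<^sup>2) + Re (LINT x|lborel. (g x)\<^sup>2)"
    using iIm ig2 by (subst Bochner_Integration.integral_add) auto
  also have "\<dots> = 2 * (LINT x|lborel. (Im (g x))\<^sup>2)" by (simp add: z)
  also have "(LINT x|lborel. (Im (g x))\<^sup>2) = L2_sq (\<lambda>x. poisson_mean y h x - poisson_mean y' h x)"
    unfolding L2_sq_def
  proof (intro Bochner_Integration.integral_cong refl)
    fix x
    have "poisson_mean y h x - poisson_mean y' h x = complex_of_real (Im (g x))"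
      unfolding g_def G_def
      by (simp add: cauchy_tr_real_Im[OF h real y(1), symmetric] cauchy_tr_real_Im[OF h real y(2), symmetric])
    thus "(Im (g x))\<^sup>2 = (cmod (poisson_mean y h x - poisson_mean y' h x))\<^sup>2" by simp
  qed
  finally show ?thesis by (simp add: g_def G_def)
qed

text \<open>The Poisson formula at x + i y for the shifted transform. Through this semigroup
  property a boundary function that is only known as an L^2 limit reproduces the transform by its
  Poisson mean.\<close>

lemma cauchy_tr_poisson:
  assumes h: "integrable lborel h" and y: "y > 0" "y' > 0"
  shows "poisson_mean y (\<lambda>t. cauchy_tr h (complex_of_real t + \<i> * complex_of_real y')) x
     = complex_of_real pi * cauchy_tr h (complex_of_real x + \<i> * complex_of_real (y + y'))"
proof -
  let ?b = "complex_of_real x + \<i> * complex_of_real y"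
  have P: "(LINT t|lborel. cauchy_tr h (complex_of_real t + \<i> * complex_of_real y') / ((complex_of_real t - ?b) * (complex_of_real t - cnj ?b)))
      = complex_of_real (pi / Im ?b) * cauchy_tr h (?b + \<i> * complex_of_real y')"
    by (rule poisson_formula(2)[OF cauchy_tr_shift_holomorphic(1)[OF h y(2)] y(2) cauchy_tr_shift_holomorphic(2)[OF h y(2)]]) (use y in auto)
  have ker: "complex_of_real (poisson_kernel y x t) * H = complex_of_real y * (H / ((complex_of_real t - ?b) * (complex_of_real t - cnj ?b)))" for t H
  proof -
    have "(complex_of_real t - ?b) * (complex_of_real t - cnj ?b) = complex_of_real ((t - x)\<^sup>2 + y\<^sup>2)"
      by (auto simp: complex_eq_iff power2_eq_square algebra_simps)
    thus ?thesis by (simp add: poisson_kernel_def)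
  qed
  have "poisson_mean y (\<lambda>t. cauchy_tr h (complex_of_real t + \<i> * complex_of_real y')) x
    = complex_of_real y * (complex_of_real (pi / Im ?b) * cauchy_tr h (?b + \<i> * complex_of_real y'))"
    unfolding poisson_mean_def ker integral_mult_right_zero P ..
  also have "\<dots> = complex_of_real pi * cauchy_tr h (?b + \<i> * complex_of_real y')" using y by simp
  finally show ?thesis by (simp add: algebra_simps)
qed

lemma poisson_mean_diff:
  assumes "y > 0" "L2_fun f" "L2_fun g"
  shows "poisson_mean y (\<lambda>t. f t - g t) x = poisson_mean y f x - poisson_mean y g x"
  unfolding poisson_mean_def right_diff_distrib
  by (rule Bochner_Integration.integral_diff[OF L2_fun_poisson_integrable(1)[OF assms(1,2)] L2_fun_poisson_integrable(1)[OF assms(1,3)]])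

lemma poisson_mean_le_L2:
  assumes y: "y > 0" and f: "L2_fun f"
  shows "(cmod (poisson_mean y f x))\<^sup>2 \<le> pi / y * L2_sq f"
proof -
  have i: "integrable lborel (\<lambda>t. (cmod (f t))\<^sup>2)" using f by (simp add: L2_fun_def)
  have "(LINT t|lborel. poisson_kernel y x t * (cmod (f t))\<^sup>2) \<le> (LINT t|lborel. 1 / y * (cmod (f t))\<^sup>2)"
    using integrable_poisson_kernel_mult[OF y i, of x]
    by (intro integral_mono integrable_mult_right i mult_right_mono poisson_kernel_le y) auto
  hence "(LINT t|lborel. poisson_kernel y x t * (cmod (f t))\<^sup>2) \<le> L2_sq f / y" by (simp add: L2_sq_def)
  hence "pi * (LINT t|lborel. poisson_kernel y x t * (cmod (f t))\<^sup>2) \<le> pi * (L2_sq f / y)" by (intro mult_left_mono) auto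
  thus ?thesis using L2_fun_poisson_integrable(2)[OF y f, of x] by simp
qed

text \<open>By \<open>cauchy_tr_real_L2_diff\<close> the traces at heights 1 / (n + 1) differ in L^2
  no more than Poisson means of h do, up to a constant, so they form a Cauchy sequence. Their limit
  \<phi> has Poisson mean pi times the trace at every height, and the convergence theorems for
  Poisson means of \<phi> then cover all y \<rightarrow> 0, both in L^2 and almost
  everywhere.\<close>

lemma hardy_boundary_real_exists:
  assumes h: "integrable lborel h" "L2_fun h" and real: "\<And>t. cnj (h t) = h t"
  obtains \<phi> where "hardy_boundary h \<phi>"
proof -
  define Y where "Y = (\<lambda>n. inverse (real (Suc n)))"
  have Y: "Y n > 0" "Y \<longlonglongrightarrow> 0" for n unfolding Y_def by (simp, rule LIMSEQ_inverse_real_of_nat)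
  have Y': "filterlim Y (at_right 0) sequentially"
    using Y less_imp_neq[OF Y(1), symmetric] by (auto simp: filterlim_at)
  define F where "F = (\<lambda>y x. cauchy_tr h (complex_of_real x + \<i> * complex_of_real y))"
  define X where "X = (\<lambda>n. F (Y n))"
  have X: "L2_fun (X n)" for n unfolding X_def F_def by (rule cauchy_tr_L2_line[OF h(1) Y(1)])
  have cau: "\<exists>N. \<forall>m\<ge>N. \<forall>n\<ge>N. L2_sq (\<lambda>x. X m x - X n x) < e" if e: "e > 0" for e
  proof -
    define D where "D = (\<lambda>n x. poisson_mean (Y n) h x - complex_of_real pi * h x)"
    have DL: "L2_fun (D n)" for n unfolding D_def by (intro L2_fun_diff poisson_mean_L2 Y L2_fun_cmult h)
    have "(\<lambda>n. L2_sq (D n)) \<longlonglongrightarrow> 0"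
      unfolding D_def by (rule filterlim_compose[OF poisson_mean_tendsto_L2[OF h(2)] Y'])
    hence "\<forall>\<^sub>F n in sequentially. L2_sq (D n) < e / 8" by (rule order_tendstoD) (use e in simp)
    then obtain N where N: "\<And>n. n \<ge> N \<Longrightarrow> L2_sq (D n) < e / 8" unfolding eventually_sequentially by blast
    show ?thesis
    proof (intro exI[of _ N] allI impI)
      fix m n assume mn: "N \<le> m" "N \<le> n"
      have "L2_sq (\<lambda>x. X m x - X n x) = 2 * L2_sq (\<lambda>x. poisson_mean (Y m) h x - poisson_mean (Y n) h x)"
        unfolding X_def F_def by (rule cauchy_tr_real_L2_diff[OF h(1) real Y(1) Y(1)])
      also have "(\<lambda>x. poisson_mean (Y m) h x - poisson_mean (Y n) h x) = (\<lambda>x. D m x - D n x)" by (simp add: D_def)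
      also have "2 * L2_sq (\<lambda>x. D m x - D n x) \<le> 2 * (2 * L2_sq (D m) + 2 * L2_sq (D n))"
        by (intro mult_left_mono L2_fun_diff(2) DL) auto
      also have "\<dots> < e" using N[OF mn(1)] N[OF mn(2)] by simp
      finally show "L2_sq (\<lambda>x. X m x - X n x) < e" .
    qed
  qed
  obtain \<phi> where phi: "L2_fun \<phi>" "(\<lambda>n. L2_sq (\<lambda>x. X n x - \<phi> x)) \<longlonglongrightarrow> 0"
    by (rule L2_complete[of X, OF X cau], assumption, rule that)
  \<comment> \<open>The Poisson mean at a fixed point is continuous on L^2, so n may tend to
    infinity in the semigroup property.\<close>
  have Fp: "poisson_mean y \<phi> x = complex_of_real pi * F y x" if y: "y > 0" for y x
  proof -
    have "(\<lambda>n. poisson_mean y (X n) x - poisson_mean y \<phi> x) \<longlonglongrightarrow> 0"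
    proof (rule Lim_null_comparison)
      show "\<forall>\<^sub>F n in sequentially. cmod (poisson_mean y (X n) x - poisson_mean y \<phi> x) \<le> sqrt (pi / y * L2_sq (\<lambda>x. X n x - \<phi> x))"
        using poisson_mean_le_L2[OF y L2_fun_diff(1)[OF X phi(1)], where x=x] poisson_mean_diff[OF y X phi(1)]
        by (intro always_eventually allI real_le_rsqrt) simp
      show "(\<lambda>n. sqrt (pi / y * L2_sq (\<lambda>x. X n x - \<phi> x))) \<longlonglongrightarrow> 0"
        using tendsto_real_sqrt[OF tendsto_mult_left[OF phi(2), of "pi / y"]] by simp
    qed
    hence "(\<lambda>n. poisson_mean y (X n) x) \<longlonglongrightarrow> poisson_mean y \<phi> x" by (rule LIM_zero_cancel)
    moreover have "poisson_mean y (X n) x = complex_of_real pi * F (y + Y n) x" for n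
      unfolding X_def F_def using cauchy_tr_poisson[OF h(1) y Y(1), of n x] by simp
    moreover have lim: "(\<lambda>n. complex_of_real pi * F (y + Y n) x) \<longlonglongrightarrow> complex_of_real pi * F y x"
    proof (intro tendsto_mult_left)
      have "isCont (cauchy_tr h) (complex_of_real x + \<i> * complex_of_real (y + 0))"
        by (rule DERIV_isCont[OF cauchy_tr_has_field_derivative[OF h(1)]]) (use y in simp)
      moreover have "(\<lambda>n. complex_of_real x + \<i> * complex_of_real (y + Y n)) \<longlonglongrightarrow> complex_of_real x + \<i> * complex_of_real (y + 0)"
        by (intro tendsto_intros Y)
      ultimately have "(\<lambda>n. cauchy_tr h (complex_of_real x + \<i> * complex_of_real (y + Y n))) \<longlonglongrightarrow> cauchy_tr h (complex_of_real x + \<i> * complex_of_real (y + 0))"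
        by (rule isCont_tendsto_compose)
      thus "(\<lambda>n. F (y + Y n) x) \<longlonglongrightarrow> F y x" unfolding F_def by simp
    qed
    ultimately have "(\<lambda>n. complex_of_real pi * F (y + Y n) x) \<longlonglongrightarrow> poisson_mean y \<phi> x" by (simp only:)
    from LIMSEQ_unique[OF this lim] show ?thesis .
  qed
  have FP: "F y x = poisson_mean y \<phi> x / complex_of_real pi" if "y > 0" for y x
    using Fp[OF that, of x] by simp
  have ev: "\<forall>\<^sub>F y in at_right (0::real). y > 0" by (simp add: eventually_at_right_less)
  have "hardy_boundary h \<phi>"
    unfolding hardy_boundary_def F_def[symmetric]
  proof (intro conjI phi(1))
    have "AE x in lborel. ((\<lambda>y. F y x) \<longlongrightarrow> \<phi> x) (at_right 0)"
      using poisson_mean_tendsto_AE[OF phi(1)]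
    proof eventually_elim
      case (elim x)
      have "((\<lambda>y. poisson_mean y \<phi> x / complex_of_real pi) \<longlongrightarrow> complex_of_real pi * \<phi> x / complex_of_real pi) (at_right 0)"
        by (intro tendsto_intros elim) auto
      moreover have "\<forall>\<^sub>F y in at_right 0. poisson_mean y \<phi> x / complex_of_real pi = F y x"
        using ev by eventually_elim (simp add: FP)
      ultimately have "((\<lambda>y. F y x) \<longlongrightarrow> complex_of_real pi * \<phi> x / complex_of_real pi) (at_right 0)"
        by (rule Lim_transform_eventually)
      thus ?case by simp
    qed
    thus "AE x in lborel. ((\<lambda>y. cauchy_tr h (complex_of_real x + \<i> * complex_of_real y)) \<longlongrightarrow> \<phi> x) (at_right 0)" by (simp add: F_def)
    have "((\<lambda>y. (1/pi)\<^sup>2 * L2_sq (\<lambda>x. poisson_mean y \<phi> x - complex_of_real pi * \<phi> x)) \<longlongrightarrow> 0) (at_right 0)"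
      using tendsto_mult_left[OF poisson_mean_tendsto_L2[OF phi(1)], of "(1/pi)\<^sup>2"] by simp
    moreover have "\<forall>\<^sub>F y in at_right 0. (1/pi)\<^sup>2 * L2_sq (\<lambda>x. poisson_mean y \<phi> x - complex_of_real pi * \<phi> x) = L2_sq (\<lambda>x. F y x - \<phi> x)"
      using ev
    proof eventually_elim
      case (elim y)
      have "L2_sq (\<lambda>x. (1 / complex_of_real pi) * (poisson_mean y \<phi> x - complex_of_real pi * \<phi> x))
         = (cmod (1 / complex_of_real pi))\<^sup>2 * L2_sq (\<lambda>x. poisson_mean y \<phi> x - complex_of_real pi * \<phi> x)"
        by (intro L2_fun_cmult L2_fun_diff poisson_mean_L2 elim phi)
      moreover have "(\<lambda>x. (1 / complex_of_real pi) * (poisson_mean y \<phi> x - complex_of_real pi * \<phi> x)) = (\<lambda>x. F y x - \<phi> x)"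
        by (simp add: FP[OF elim] field_simps)
      ultimately show ?case by (simp add: norm_divide)
    qed
    ultimately have "((\<lambda>y. L2_sq (\<lambda>x. F y x - \<phi> x)) \<longlongrightarrow> 0) (at_right 0)" by (rule Lim_transform_eventually)
    thus "((\<lambda>y. L2_sq (\<lambda>x. cauchy_tr h (complex_of_real x + \<i> * complex_of_real y) - \<phi> x)) \<longlongrightarrow> 0) (at_right 0)" by (simp add: F_def)
  qed
  thus thesis by (rule that)
qed

lemma hardy_boundary_add:
  assumes h: "integrable lborel h" "hardy_boundary h \<phi>" and k: "integrable lborel k" "hardy_boundary k \<kappa>"
  shows "hardy_boundary (\<lambda>t. h t + c * k t) (\<lambda>x. \<phi> x + c * \<kappa> x)"
proof -
  let ?z = "\<lambda>x y. complex_of_real x + \<i> * complex_of_real y"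
  have add: "cauchy_tr (\<lambda>t. h t + c * k t) (?z x y) = cauchy_tr h (?z x y) + c * cauchy_tr k (?z x y)" if "y > 0" for x y
    by (rule cauchy_tr_add) (use h k that in auto)
  have ev: "\<forall>\<^sub>F y in at_right (0::real). y > 0" by (simp add: eventually_at_right_less)
  have L: "L2_fun \<phi>" "L2_fun \<kappa>" using h k by (auto simp: hardy_boundary_def)
  show ?thesis
    unfolding hardy_boundary_def
  proof (intro conjI)
    show "L2_fun (\<lambda>x. \<phi> x + c * \<kappa> x)" by (intro L2_fun_add L2_fun_cmult L)
    have ae: "AE x in lborel. ((\<lambda>y. cauchy_tr h (?z x y)) \<longlongrightarrow> \<phi> x) (at_right 0)"
       "AE x in lborel. ((\<lambda>y. cauchy_tr k (?z x y)) \<longlongrightarrow> \<kappa> x) (at_right 0)" using h k by (auto simp: hardy_boundary_def)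
    show "AE x in lborel. ((\<lambda>y. cauchy_tr (\<lambda>t. h t + c * k t) (?z x y)) \<longlongrightarrow> \<phi> x + c * \<kappa> x) (at_right 0)"
      using ae
    proof eventually_elim
      case (elim x)
      have "((\<lambda>y. cauchy_tr h (?z x y) + c * cauchy_tr k (?z x y)) \<longlongrightarrow> \<phi> x + c * \<kappa> x) (at_right 0)"
        by (intro tendsto_intros elim)
      thus ?case by (rule Lim_transform_eventually) (use ev in \<open>eventually_elim, simp add: add\<close>)
    qed
    have l: "((\<lambda>y. L2_sq (\<lambda>x. cauchy_tr h (?z x y) - \<phi> x)) \<longlongrightarrow> 0) (at_right 0)"
       "((\<lambda>y. L2_sq (\<lambda>x. cauchy_tr k (?z x y) - \<kappa> x)) \<longlongrightarrow> 0) (at_right 0)" using h k by (auto simp: hardy_boundary_def)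
    show "((\<lambda>y. L2_sq (\<lambda>x. cauchy_tr (\<lambda>t. h t + c * k t) (?z x y) - (\<phi> x + c * \<kappa> x))) \<longlongrightarrow> 0) (at_right 0)"
    proof (rule Lim_null_comparison)
      show "((\<lambda>y. 2 * L2_sq (\<lambda>x. cauchy_tr h (?z x y) - \<phi> x) + 2 * ((cmod c)\<^sup>2 * L2_sq (\<lambda>x. cauchy_tr k (?z x y) - \<kappa> x))) \<longlongrightarrow> 0) (at_right 0)"
        by (intro tendsto_add_zero tendsto_mult_right_zero l)
      show "\<forall>\<^sub>F y in at_right 0. norm (L2_sq (\<lambda>x. cauchy_tr (\<lambda>t. h t + c * k t) (?z x y) - (\<phi> x + c * \<kappa> x)))
         \<le> 2 * L2_sq (\<lambda>x. cauchy_tr h (?z x y) - \<phi> x) + 2 * ((cmod c)\<^sup>2 * L2_sq (\<lambda>x. cauchy_tr k (?z x y) - \<kappa> x))"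
        using ev
      proof eventually_elim
        case (elim y)
        have d: "L2_fun (\<lambda>x. cauchy_tr h (?z x y) - \<phi> x)" "L2_fun (\<lambda>x. cauchy_tr k (?z x y) - \<kappa> x)"
          by (intro L2_fun_diff cauchy_tr_L2_line h k elim L)+
        have "(\<lambda>x. cauchy_tr (\<lambda>t. h t + c * k t) (?z x y) - (\<phi> x + c * \<kappa> x)) =
           (\<lambda>x. (cauchy_tr h (?z x y) - \<phi> x) + c * (cauchy_tr k (?z x y) - \<kappa> x))"
          by (simp add: add[OF elim] algebra_simps)
        thus ?case using L2_fun_add(2)[OF d(1) L2_fun_cmult(1)[OF d(2), of c]] L2_fun_cmult(2)[OF d(2), of c] L2_sq_nonneg
          by simp
      qed
    qed
  qed
qed

text \<open>Real and imaginary part are treated separately, since the comparison with Poisson means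
  concerns real functions.\<close>

theorem hardy_boundary_exists:
  assumes h: "integrable lborel h" "L2_fun h"
  obtains \<phi> where "hardy_boundary h \<phi>"
proof -
  have [measurable]: "h \<in> borel_measurable borel" using h by (simp add: L2_fun_def)
  let ?r = "\<lambda>t. complex_of_real (Re (h t))" and ?i = "\<lambda>t. complex_of_real (Im (h t))"
  have sq: "integrable lborel (\<lambda>x. (cmod (h x))\<^sup>2)" using h by (simp add: L2_fun_def)
  have ri: "integrable lborel ?r" "integrable lborel ?i" using h by auto
  have "integrable lborel (\<lambda>x. (cmod (?r x))\<^sup>2)" "integrable lborel (\<lambda>x. (cmod (?i x))\<^sup>2)"
    by (rule Bochner_Integration.integrable_bound[OF sq]; simp add: cmod_power2)+
  hence L: "L2_fun ?r" "L2_fun ?i" by (simp_all add: L2_fun_def)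
  obtain \<phi> where phi: "hardy_boundary ?r \<phi>" by (rule hardy_boundary_real_exists[OF ri(1) L(1)]) simp_all
  obtain \<kappa> where kappa: "hardy_boundary ?i \<kappa>" by (rule hardy_boundary_real_exists[OF ri(2) L(2)]) simp_all
  from hardy_boundary_add[OF ri(1) phi ri(2) kappa, of \<i>]
  have "hardy_boundary (\<lambda>t. ?r t + \<i> * ?i t) (\<lambda>x. \<phi> x + \<i> * \<kappa> x)" .
  moreover have "(\<lambda>t. ?r t + \<i> * ?i t) = h" by (simp add: complex_eq_iff fun_eq_iff)
  ultimately show thesis using that by simp
qed

section \<open>Integrals of products of boundary values\<close>

lemma L2_product:
  assumes f: "L2_fun f" and g: "L2_fun g"
  shows "integrable lborel (\<lambda>x. f x * g x)" "(LINT x|lborel. cmod (f x * g x)) \<le> sqrt (L2_sq f * L2_sq g)"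
proof -
  have [measurable]: "f \<in> borel_measurable borel" "g \<in> borel_measurable borel" using f g by (auto simp: L2_fun_def)
  have i: "integrable lborel (\<lambda>x. (cmod (f x))\<^sup>2)" "integrable lborel (\<lambda>x. (cmod (g x))\<^sup>2)"
    using f g by (auto simp: L2_fun_def)
  have j: "integrable lborel (\<lambda>x. cmod (f x) * cmod (g x))"
    by (rule integrable_mult_square_integrable[OF _ _ i]) auto
  show "integrable lborel (\<lambda>x. f x * g x)"
    by (rule Bochner_Integration.integrable_bound[OF j]) (auto simp: norm_mult)
  have "(LINT x|lborel. cmod (f x) * cmod (g x))\<^sup>2 \<le> L2_sq f * L2_sq g"
    unfolding L2_sq_def by (rule integral_Cauchy_Schwarz[OF _ _ i]) auto
  hence "(LINT x|lborel. cmod (f x) * cmod (g x)) \<le> sqrt (L2_sq f * L2_sq g)" by (rule real_le_rsqrt)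
  thus "(LINT x|lborel. cmod (f x * g x)) \<le> sqrt (L2_sq f * L2_sq g)" by (simp add: norm_mult)
qed

text \<open>Write X Z - f g = (X - f) Z + f (Z - g) and apply Cauchy-Schwarz to each product; the
  norms of Z are bounded in terms of g and the error.\<close>

lemma L2_product_tendsto:
  assumes X: "\<And>n. L2_fun (X n)" and Z: "\<And>n. L2_fun (Z n)" and f: "L2_fun f" and g: "L2_fun g"
    and lim: "(\<lambda>n. L2_sq (\<lambda>x. X n x - f x)) \<longlonglongrightarrow> 0" "(\<lambda>n. L2_sq (\<lambda>x. Z n x - g x)) \<longlonglongrightarrow> 0"
  shows "(\<lambda>n. LINT x|lborel. cmod (X n x * Z n x - f x * g x)) \<longlonglongrightarrow> 0"
proof (rule Lim_null_comparison)
  let ?a = "\<lambda>n. L2_sq (\<lambda>x. X n x - f x)" and ?b = "\<lambda>n. L2_sq (\<lambda>x. Z n x - g x)"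
  let ?B = "\<lambda>n. sqrt (?a n * (2 * ?b n + 2 * L2_sq g)) + sqrt (L2_sq f * ?b n)"
  have "?B \<longlonglongrightarrow> sqrt (0 * (2 * 0 + 2 * L2_sq g)) + sqrt (L2_sq f * 0)"
    by (intro tendsto_intros lim)
  thus "?B \<longlonglongrightarrow> 0" by simp
  show "\<forall>\<^sub>F n in sequentially. norm (LINT x|lborel. cmod (X n x * Z n x - f x * g x)) \<le> ?B n"
  proof (intro always_eventually allI)
    fix n
    have dX: "L2_fun (\<lambda>x. X n x - f x)" and dZ: "L2_fun (\<lambda>x. Z n x - g x)" by (intro L2_fun_diff X Z f g)+
    have Zb: "L2_sq (Z n) \<le> 2 * ?b n + 2 * L2_sq g" using L2_fun_add(2)[OF dZ g] by simp
    have pt: "cmod (X n x * Z n x - f x * g x) \<le> cmod ((X n x - f x) * Z n x) + cmod (f x * (Z n x - g x))" for x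
      using norm_triangle_ineq[of "(X n x - f x) * Z n x" "f x * (Z n x - g x)"] by (simp add: algebra_simps)
    have "(LINT x|lborel. cmod (X n x * Z n x - f x * g x)) \<le> (LINT x|lborel. cmod ((X n x - f x) * Z n x) + cmod (f x * (Z n x - g x)))"
      by (intro integral_mono pt integrable_norm Bochner_Integration.integrable_diff Bochner_Integration.integrable_add L2_product X Z f g dX dZ)
    also have "\<dots> = (LINT x|lborel. cmod ((X n x - f x) * Z n x)) + (LINT x|lborel. cmod (f x * (Z n x - g x)))"
      by (intro Bochner_Integration.integral_add integrable_norm L2_product X Z f g dX dZ)
    also have "\<dots> \<le> sqrt (?a n * L2_sq (Z n)) + sqrt (L2_sq f * ?b n)"
      by (intro add_mono L2_product X Z f g dX dZ)
    also have "\<dots> \<le> ?B n"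
      using Zb by (intro add_mono real_sqrt_le_mono mult_left_mono L2_sq_nonneg) auto
    finally show "norm (LINT x|lborel. cmod (X n x * Z n x - f x * g x)) \<le> ?B n"
      by (simp add: integral_nonneg_AE)
  qed
qed

text \<open>On each line Im z = Y n the formula is \<open>half_plane_blaschke\<close>. On the
  boundary p has values only almost everywhere, but it is bounded, and the product of the two traces
  converges in L^1 because each factor converges in L^2.\<close>

theorem hardy_blaschke_integral:
  fixes p :: "complex \<Rightarrow> complex" and p0 :: "real \<Rightarrow> complex"
  assumes h: "integrable lborel h" "hardy_boundary h \<phi>" and k: "integrable lborel k" "hardy_boundary k \<kappa>"
    and p: "p holomorphic_on {z. Im z > 0}" "\<And>z. Im z > 0 \<Longrightarrow> cmod (p z) \<le> M"
    and p0: "p0 \<in> borel_measurable borel" 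
      "AE x in lborel. ((\<lambda>y. p (complex_of_real x + \<i> * complex_of_real y)) \<longlongrightarrow> p0 x) (at_right 0)"
    and b: "Im b > 0"
  shows "integrable lborel (\<lambda>x. \<phi> x * \<kappa> x * p0 x)"
    and "(LINT x|lborel. \<phi> x * \<kappa> x * p0 x * ((complex_of_real x - cnj b) / (complex_of_real x - b)))
      = - 4 * complex_of_real (pi * Im b) * (p b * cauchy_tr h b * cauchy_tr k b)"
proof -
  define Y where "Y = (\<lambda>n. inverse (real (Suc n)))"
  have Y: "Y n > 0" "Y \<longlonglongrightarrow> 0" for n unfolding Y_def by (simp, rule LIMSEQ_inverse_real_of_nat)
  have Y': "filterlim Y (at_right 0) sequentially"
    using Y less_imp_neq[OF Y(1), symmetric] by (auto simp: filterlim_at)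
  let ?z = "\<lambda>x n. complex_of_real x + \<i> * complex_of_real (Y n)"
  define u where "u = (\<lambda>x. (complex_of_real x - cnj b) / (complex_of_real x - b))"
  have u1: "cmod (u x) = 1" for x
  proof -
    have "cmod (complex_of_real x - cnj b) = cmod (complex_of_real x - b)"
      by (metis complex_cnj_complex_of_real complex_cnj_diff complex_mod_cnj)
    moreover have "complex_of_real x \<noteq> b" using b by (auto simp: complex_eq_iff)
    ultimately show ?thesis by (simp add: u_def norm_divide)
  qed
  have [measurable]: "u \<in> borel_measurable borel" unfolding u_def by measurable
  note [measurable] = p0(1)
  define F where "F = (\<lambda>n x. cauchy_tr h (?z x n))"
  define K where "K = (\<lambda>n x. cauchy_tr k (?z x n))"
  define q where "q = (\<lambda>n x. p (?z x n))"
  have F: "L2_fun (F n)" and K: "L2_fun (K n)" for n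
    unfolding F_def K_def by (intro cauchy_tr_L2_line h k Y)+
  have L: "L2_fun \<phi>" "L2_fun \<kappa>" using h k by (auto simp: hardy_boundary_def)
  have ik: "integrable lborel (\<lambda>x. \<phi> x * \<kappa> x)" by (intro L2_product L)
  have M0: "M \<ge> 0" using order_trans[OF norm_ge_zero p(2)[OF b]] .
  have qb: "cmod (q n x) \<le> M" for n x unfolding q_def by (rule p(2)) (use Y(1)[of n] in simp)
  have "continuous_on UNIV (q n)" for n
    unfolding q_def
    by (rule continuous_on_compose2[OF holomorphic_on_imp_continuous_on[OF p(1)]]) (use Y(1)[of n] in \<open>auto intro!: continuous_intros\<close>)
  hence qm [measurable]: "q n \<in> borel_measurable borel" for n by (rule borel_measurable_continuous_onI)
  have qlim: "AE x in lborel. (\<lambda>n. q n x) \<longlonglongrightarrow> p0 x"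
    using p0(2) by eventually_elim (unfold q_def, rule filterlim_compose[OF _ Y'])
  have p0b: "AE x in lborel. cmod (p0 x) \<le> M"
    using qlim by eventually_elim (rule Lim_norm_ubound[OF sequentially_bot], assumption, use qb in auto)
  have [measurable]: "\<phi> \<in> borel_measurable borel" "\<kappa> \<in> borel_measurable borel" using L by (auto simp: L2_fun_def)
  show int: "integrable lborel (\<lambda>x. \<phi> x * \<kappa> x * p0 x)"
  proof (rule Bochner_Integration.integrable_bound)
    show "integrable lborel (\<lambda>x. M * cmod (\<phi> x * \<kappa> x))" by (intro integrable_mult_right integrable_norm ik)
    show "AE x in lborel. norm (\<phi> x * \<kappa> x * p0 x) \<le> norm (M * cmod (\<phi> x * \<kappa> x))"
      using p0b by eventually_elim (use M0 in \<open>simp add: norm_mult abs_mult mult.commute mult_right_mono\<close>)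
  qed measurable
  have bi: "integrable lborel (\<lambda>x. f x * q n x * u x)" "cmod (LINT x|lborel. f x * q n x * u x) \<le> M * (LINT x|lborel. cmod (f x))"
    if "integrable lborel f" for f n
  proof -
    have "cmod (q n x * u x) \<le> M" for x using qb[of n x] u1[of x] by (simp add: norm_mult)
    from integrable_bounded_mult[OF that _ this] show "integrable lborel (\<lambda>x. f x * q n x * u x)"
      "cmod (LINT x|lborel. f x * q n x * u x) \<le> M * (LINT x|lborel. cmod (f x))" by (simp_all add: mult.assoc)
  qed
  have val: "(LINT x|lborel. F n x * K n x * q n x * u x) = - 4 * complex_of_real (pi * Im b) * 
     (p (b + \<i> * complex_of_real (Y n)) * cauchy_tr h (b + \<i> * complex_of_real (Y n)) * cauchy_tr k (b + \<i> * complex_of_real (Y n)))" for n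
  proof -
    let ?G = "\<lambda>z. p (z + \<i> * complex_of_real (Y n)) * cauchy_tr h (z + \<i> * complex_of_real (Y n)) * cauchy_tr k (z + \<i> * complex_of_real (Y n))"
    have "(p \<circ> (\<lambda>z. z + \<i> * complex_of_real (Y n))) holomorphic_on {z. Im z > - Y n}"
      by (rule holomorphic_on_compose_gen[OF _ p(1)]) (auto intro!: holomorphic_intros)
    hence hp: "(\<lambda>z. p (z + \<i> * complex_of_real (Y n))) holomorphic_on {z. Im z > - Y n}" by (simp add: o_def)
    have "(LINT x|lborel. ?G (complex_of_real x) * ((complex_of_real x - cnj b) / (complex_of_real x - b)))
      = - 4 * complex_of_real (pi * Im b) * ?G b"
    proof (rule half_plane_blaschke[OF _ Y(1) _ b])
      show "?G holomorphic_on {z. - Y n < Im z}"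
        by (intro holomorphic_intros hp cauchy_tr_shift_holomorphic h k Y)
      show "cmod (?G z) \<le> M * ((LINT t|lborel. cmod (h t)) / Y n) * ((LINT t|lborel. cmod (k t)) / Y n)" if z: "0 \<le> Im z" for z
      proof -
        have "cmod (p (z + \<i> * complex_of_real (Y n))) \<le> M" by (rule p(2)) (use z Y(1)[of n] in simp)
        thus ?thesis unfolding norm_mult
          by (intro mult_mono cauchy_tr_shift_holomorphic h k Y z mult_nonneg_nonneg M0 divide_nonneg_pos integral_nonneg_AE AE_I2 norm_ge_zero)
      qed
      have e: "?G (complex_of_real x) = F n x * K n x * q n x" for x by (simp add: F_def K_def q_def)
      show "integrable lborel (\<lambda>x. ?G (complex_of_real x))"
        unfolding e by (rule integrable_bounded_mult(1)[OF L2_product(1)[OF F K] qm qb])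
    qed
    thus ?thesis by (simp add: F_def K_def q_def u_def mult_ac)
  qed
  have lim1: "(\<lambda>n. LINT x|lborel. F n x * K n x * q n x * u x) \<longlonglongrightarrow> - 4 * complex_of_real (pi * Im b) * (p b * cauchy_tr h b * cauchy_tr k b)"
  proof -
    have bl: "(\<lambda>n. b + \<i> * complex_of_real (Y n)) \<longlonglongrightarrow> b"
      using tendsto_add[OF tendsto_const tendsto_mult_left[OF tendsto_of_real[OF Y(2)]], of b \<i>] by simp
    have "isCont p b" using holomorphic_on_imp_continuous_on[OF p(1)] b
      by (simp add: continuous_on_eq_continuous_at open_halfspace_Im_gt)
    moreover have "isCont (cauchy_tr h) b" "isCont (cauchy_tr k) b"
      using b by (auto intro!: DERIV_isCont cauchy_tr_has_field_derivative h k)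
    ultimately show ?thesis unfolding val
      by (intro tendsto_mult tendsto_const isCont_tendsto_compose[OF _ bl])
  qed
  have lim2: "(\<lambda>n. LINT x|lborel. F n x * K n x * q n x * u x) \<longlonglongrightarrow> (LINT x|lborel. \<phi> x * \<kappa> x * p0 x * u x)"
  proof -
    have d: "(\<lambda>n. LINT x|lborel. \<phi> x * \<kappa> x * q n x * u x) \<longlonglongrightarrow> (LINT x|lborel. \<phi> x * \<kappa> x * p0 x * u x)"
    proof (rule integral_dominated_convergence[where w="\<lambda>x. M * cmod (\<phi> x * \<kappa> x)"])
      show "integrable lborel (\<lambda>x. M * cmod (\<phi> x * \<kappa> x))" by (intro integrable_mult_right integrable_norm ik)
      show "AE x in lborel. (\<lambda>n. \<phi> x * \<kappa> x * q n x * u x) \<longlonglongrightarrow> \<phi> x * \<kappa> x * p0 x * u x"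
        using qlim by eventually_elim (intro tendsto_intros)
      show "AE x in lborel. cmod (\<phi> x * \<kappa> x * q n x * u x) \<le> M * cmod (\<phi> x * \<kappa> x)" for n
        using qb u1 by (intro AE_I2) (simp add: norm_mult mult.commute mult_right_mono)
    qed measurable
    \<comment> \<open>The trace product is replaced by its limit while p stays at height Y n: the
      error is at most M times the L^1 distance of the products. The step \<open>d\<close> above
      then lets p reach the boundary under a fixed majorant.\<close>
    have z: "(\<lambda>n. (LINT x|lborel. F n x * K n x * q n x * u x) - (LINT x|lborel. \<phi> x * \<kappa> x * q n x * u x)) \<longlonglongrightarrow> 0"
    proof (rule Lim_null_comparison)
      have "(\<lambda>n. LINT x|lborel. cmod (F n x * K n x - \<phi> x * \<kappa> x)) \<longlonglongrightarrow> 0"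
      proof (rule L2_product_tendsto[OF F K L])
        show "(\<lambda>n. L2_sq (\<lambda>x. F n x - \<phi> x)) \<longlonglongrightarrow> 0" "(\<lambda>n. L2_sq (\<lambda>x. K n x - \<kappa> x)) \<longlonglongrightarrow> 0"
          unfolding F_def K_def using h(2) k(2) filterlim_compose[OF _ Y'] unfolding hardy_boundary_def by blast+
      qed
      from tendsto_mult_left[OF this, of M]
      show "(\<lambda>n. M * (LINT x|lborel. cmod (F n x * K n x - \<phi> x * \<kappa> x))) \<longlonglongrightarrow> 0" by simp
      show "\<forall>\<^sub>F n in sequentially. cmod ((LINT x|lborel. F n x * K n x * q n x * u x) - (LINT x|lborel. \<phi> x * \<kappa> x * q n x * u x))
          \<le> M * (LINT x|lborel. cmod (F n x * K n x - \<phi> x * \<kappa> x))"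
      proof (intro always_eventually allI)
        fix n
        have "(LINT x|lborel. F n x * K n x * q n x * u x) - (LINT x|lborel. \<phi> x * \<kappa> x * q n x * u x)
          = (LINT x|lborel. (F n x * K n x - \<phi> x * \<kappa> x) * q n x * u x)"
          using Bochner_Integration.integral_diff[OF bi(1)[OF L2_product(1)[OF F K], of n n n] bi(1)[OF ik, of n]]
          by (simp add: left_diff_distrib)
        thus "cmod ((LINT x|lborel. F n x * K n x * q n x * u x) - (LINT x|lborel. \<phi> x * \<kappa> x * q n x * u x))
          \<le> M * (LINT x|lborel. cmod (F n x * K n x - \<phi> x * \<kappa> x))"
          using bi(2)[OF Bochner_Integration.integrable_diff[OF L2_product(1)[OF F K] ik], of n n n] by simp
      qed
    qed
    from tendsto_add[OF z d] show ?thesis by simp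
  qed
  from LIMSEQ_unique[OF lim2 lim1]
  show "(LINT x|lborel. \<phi> x * \<kappa> x * p0 x * ((complex_of_real x - cnj b) / (complex_of_real x - b)))
      = - 4 * complex_of_real (pi * Im b) * (p b * cauchy_tr h b * cauchy_tr k b)" by (simp add: u_def)
qed

text \<open>As in \<open>half_plane_integral_square_zero\<close>, an extra factor (z - i) / (z + i)
  cancels the Blaschke quotient for b = i on the line and vanishes at i.\<close>

corollary hardy_integral_zero:
  fixes p :: "complex \<Rightarrow> complex" and p0 :: "real \<Rightarrow> complex"
  assumes h: "integrable lborel h" "hardy_boundary h \<phi>" and k: "integrable lborel k" "hardy_boundary k \<kappa>"
    and p: "p holomorphic_on {z. Im z > 0}" "\<And>z. Im z > 0 \<Longrightarrow> cmod (p z) \<le> M"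
    and p0: "p0 \<in> borel_measurable borel" 
      "AE x in lborel. ((\<lambda>y. p (complex_of_real x + \<i> * complex_of_real y)) \<longlongrightarrow> p0 x) (at_right 0)"
  shows "integrable lborel (\<lambda>x. \<phi> x * \<kappa> x * p0 x)" "(LINT x|lborel. \<phi> x * \<kappa> x * p0 x) = 0"
proof -
  show "integrable lborel (\<lambda>x. \<phi> x * \<kappa> x * p0 x)" by (rule hardy_blaschke_integral(1)[OF h k p p0, of \<i>]) simp_all
  let ?v = "\<lambda>z. (z - \<i>) / (z + \<i>)"
  have nz: "z + \<i> \<noteq> 0" if "Im z > - 1" for z using that by (auto simp: complex_eq_iff)
  have le: "cmod (?v z) \<le> 1" if "Im z > 0" for z
  proof -
    have "cmod (z - \<i>) \<le> cmod (z + \<i>)" using that by (auto simp: cmod_def power2_eq_square algebra_simps)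
    thus ?thesis by (simp add: norm_divide divide_le_eq_1)
  qed
  have "(LINT x|lborel. \<phi> x * \<kappa> x * (p0 x * ?v (complex_of_real x)) * ((complex_of_real x - cnj \<i>) / (complex_of_real x - \<i>)))
      = - 4 * complex_of_real (pi * Im \<i>) * (p \<i> * ?v \<i> * cauchy_tr h \<i> * cauchy_tr k \<i>)"
  proof (rule hardy_blaschke_integral(2)[OF h k, of "\<lambda>z. p z * ?v z" M])
    show "(\<lambda>z. p z * ?v z) holomorphic_on {z. 0 < Im z}" using nz by (intro holomorphic_intros p) auto
    show "cmod (p z * ?v z) \<le> M" if "0 < Im z" for z
    proof -
      have "cmod (p z) * cmod (?v z) \<le> M * 1"
        using p(2)[OF that] le[OF that] order_trans[OF norm_ge_zero p(2)[OF that]] by (intro mult_mono) auto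
      thus ?thesis by (simp only: norm_mult mult_1_right)
    qed
    show "(\<lambda>x. p0 x * ?v (complex_of_real x)) \<in> borel_measurable borel" using p0(1) by measurable
    show "AE x in lborel. ((\<lambda>y. p (complex_of_real x + \<i> * complex_of_real y) * ?v (complex_of_real x + \<i> * complex_of_real y))
       \<longlongrightarrow> p0 x * ?v (complex_of_real x)) (at_right 0)"
      using p0(2)
    proof eventually_elim
      case (elim x)
      have "((\<lambda>y. ?v (complex_of_real x + \<i> * complex_of_real y)) \<longlongrightarrow> ?v (complex_of_real x + \<i> * complex_of_real 0)) (at_right 0)"
        by (intro tendsto_intros) (auto simp: complex_eq_iff)
      from tendsto_mult[OF elim this] show ?case by simp
    qed
  qed (simp only: imaginary_unit.sel zero_less_one)
  moreover have "\<phi> x * \<kappa> x * (p0 x * ?v (complex_of_real x)) * ((complex_of_real x - cnj \<i>) / (complex_of_real x - \<i>)) = \<phi> x * \<kappa> x * p0 x" for x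
  proof -
    have "complex_of_real x - \<i> \<noteq> 0" "complex_of_real x + \<i> \<noteq> 0" by (auto simp: complex_eq_iff)
    thus ?thesis by simp
  qed
  ultimately show "(LINT x|lborel. \<phi> x * \<kappa> x * p0 x) = 0" by simp
qed

text \<open>The jump at height y is 2 i times a Poisson mean, which tends to pi h. The lower
  boundary value appears as the conjugate of an upper one, that of the conjugate function, because
  \<open>hardy_boundary\<close> looks at the upper half-plane only.\<close>

theorem plemelj:
  assumes h: "integrable lborel h" "L2_fun h" "hardy_boundary h \<phi>" and h': "hardy_boundary (\<lambda>t. cnj (h t)) \<phi>'"
  shows "AE x in lborel. \<phi> x - cnj (\<phi>' x) = 2 * \<i> * complex_of_real pi * h x"
proof -
  have "AE x in lborel. ((\<lambda>y. cauchy_tr h (complex_of_real x + \<i> * complex_of_real y)) \<longlongrightarrow> \<phi> x) (at_right 0)"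
    "AE x in lborel. ((\<lambda>y. cauchy_tr (\<lambda>t. cnj (h t)) (complex_of_real x + \<i> * complex_of_real y)) \<longlongrightarrow> \<phi>' x) (at_right 0)"
    using h h' by (auto simp: hardy_boundary_def)
  thus ?thesis using poisson_mean_tendsto_AE[OF h(2)]
  proof eventually_elim
    case (elim x)
    have "((\<lambda>y. cauchy_tr h (complex_of_real x + \<i> * complex_of_real y) - cnj (cauchy_tr (\<lambda>t. cnj (h t)) (complex_of_real x + \<i> * complex_of_real y)))
      \<longlongrightarrow> \<phi> x - cnj (\<phi>' x)) (at_right 0)"
      by (intro tendsto_intros elim)
    moreover have "\<forall>\<^sub>F y in at_right 0. cauchy_tr h (complex_of_real x + \<i> * complex_of_real y) - cnj (cauchy_tr (\<lambda>t. cnj (h t)) (complex_of_real x + \<i> * complex_of_real y))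
       = 2 * \<i> * poisson_mean y h x"
      using eventually_at_right_less[of 0]
    proof eventually_elim
      case (elim y)
      have "cnj (cauchy_tr (\<lambda>t. cnj (h t)) (complex_of_real x + \<i> * complex_of_real y)) = cauchy_tr h (complex_of_real x - \<i> * complex_of_real y)"
        using cauchy_tr_cnj[of "\<lambda>t. cnj (h t)" "complex_of_real x + \<i> * complex_of_real y"] by simp
      thus ?case using poisson_mean_cauchy_tr[OF h(1) elim, of x] by simp
    qed
    ultimately have "((\<lambda>y. 2 * \<i> * poisson_mean y h x) \<longlongrightarrow> \<phi> x - cnj (\<phi>' x)) (at_right 0)"
      by (rule Lim_transform_eventually)
    moreover have "((\<lambda>y. 2 * \<i> * poisson_mean y h x) \<longlongrightarrow> 2 * \<i> * (complex_of_real pi * h x)) (at_right 0)"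
      by (intro tendsto_mult_left elim)
    ultimately have "\<phi> x - cnj (\<phi>' x) = 2 * \<i> * (complex_of_real pi * h x)"
      by (intro tendsto_unique[OF trivial_limit_at_right_real])
    thus ?case by simp
  qed
qed

section \<open>The Gaussian and the dispersion function\<close>

definition gauss :: "real \<Rightarrow> complex" where
  "gauss t = complex_of_real (wt t)"

lemma wt_normal_density: "wt = normal_density 0 (1 / sqrt 2)"
proof
  fix v show "wt v = normal_density 0 (1 / sqrt 2) v"
    by (simp add: wt_def normal_density_def power_divide real_sqrt_divide)
qed

lemma wt_measurable [measurable]: "wt \<in> borel_measurable borel"
  unfolding wt_def[abs_def] by measurable

lemma wt_pos: "wt v > 0" by (simp add: wt_def)

lemma wt_nonneg: "wt v \<ge> 0" using wt_pos[of v] by simp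

lemma wt_even: "wt (- v) = wt v" by (simp add: wt_def)

lemma wt_le: "wt v \<le> 1 / sqrt pi"
  by (simp add: wt_def divide_right_mono)

lemma wt_less: "v \<noteq> 0 \<Longrightarrow> wt v < 1 / sqrt pi"
  by (simp add: wt_def divide_strict_right_mono)

lemma wt_le_cauchy: "wt v \<le> (1 / sqrt pi) * (1 / (1 + v\<^sup>2))"
proof -
  have "1 + v\<^sup>2 \<le> exp (v\<^sup>2)" by (rule exp_ge_add_one_self)
  hence "exp (- v\<^sup>2) \<le> 1 / (1 + v\<^sup>2)"
    by (simp add: exp_minus field_simps add_pos_nonneg)
  hence "exp (- v\<^sup>2) / sqrt pi \<le> 1 / (1 + v\<^sup>2) / sqrt pi" by (intro divide_right_mono) auto
  thus ?thesis by (simp add: wt_def mult.commute)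
qed

lemma wt_moment_integrable: "integrable lborel (\<lambda>v. wt v * v ^ k)"
proof -
  have "integrable lborel (\<lambda>v. normal_density 0 (1 / sqrt 2) v * (v - 0) ^ k)"
    by (rule integrable_normal_moment) simp
  thus ?thesis by (simp add: wt_normal_density)
qed

lemma wt_integrable: "integrable lborel wt" and wt_integral: "(LINT v|lborel. wt v) = 1"
  unfolding wt_normal_density by (auto intro!: integrable_normal_density integral_normal_density)

lemma gauss_measurable [measurable]: "gauss \<in> borel_measurable borel"
  unfolding gauss_def[abs_def] by measurable

lemma gauss_integrable: "integrable lborel gauss" and gauss_integral: "(LINT v|lborel. gauss v) = 1"
  unfolding gauss_def using wt_integrable wt_integral by auto

lemma gauss_cnj: "cnj (gauss t) = gauss t" by (simp add: gauss_def)

lemma gauss_has_vector_derivative: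
  "(gauss has_vector_derivative (- 2 * complex_of_real t * gauss t)) (at t)"
proof -
  have "((\<lambda>v. exp (- v\<^sup>2)) has_real_derivative (- 2 * t * exp (- t\<^sup>2))) (at t)"
    by (auto intro!: derivative_eq_intros)
  from DERIV_cdivide[OF this, of "sqrt pi"]
  have "(wt has_real_derivative (- 2 * t * wt t)) (at t)"
    unfolding wt_def[abs_def] by simp
  from has_vector_derivative_of_real[OF this] show ?thesis by (simp add: gauss_def[abs_def])
qed

lemma wt_tendsto: "(wt \<longlongrightarrow> 0) at_top" "(wt \<longlongrightarrow> 0) at_bot"
  unfolding wt_def[abs_def] by real_asymp+

lemma gauss_moment_integrable: "integrable lborel (\<lambda>t. complex_of_real t * gauss t)"
proof -
  have "integrable lborel (\<lambda>t. complex_of_real (wt t * t ^ 1))"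
    by (intro integrable_of_real wt_moment_integrable)
  thus ?thesis by (simp add: gauss_def mult.commute)
qed

text \<open>The derivative of w(t) / (t - \<zeta>) integrates to 0 over the line. With w' = -2 t w
  this expresses the integral of w / (t - \<zeta>)^2, which is the derivative of the transform,
  through that of t w / (t - \<zeta>), and t / (t - \<zeta>) = 1 + \<zeta> / (t - \<zeta>).\<close>

lemma cauchy_tr_gauss_ODE:
  assumes z: "Im \<zeta> \<noteq> 0"
  shows "(cauchy_tr gauss has_field_derivative (- 2 - 2 * \<zeta> * cauchy_tr gauss \<zeta>)) (at \<zeta>)"
proof -
  have ne: "complex_of_real t - \<zeta> \<noteq> 0" for t by (rule of_real_minus_nonzero[OF z])
  let ?g = "\<lambda>t. gauss t / (complex_of_real t - \<zeta>)"
  let ?g' = "\<lambda>t. - 2 * (complex_of_real t * gauss t / (complex_of_real t - \<zeta>)) - gauss t / (complex_of_real t - \<zeta>)\<^sup>2"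
  have d: "(?g has_vector_derivative ?g' t) (at t)" for t
  proof -
    have "((\<lambda>z. 1 / (z - \<zeta>)) has_field_derivative (- 1 / (complex_of_real t - \<zeta>)\<^sup>2)) (at (complex_of_real t))"
      using ne[of t] by (auto intro!: derivative_eq_intros simp: power2_eq_square)
    hence "((\<lambda>t. 1 / (complex_of_real t - \<zeta>)) has_vector_derivative (- 1 / (complex_of_real t - \<zeta>)\<^sup>2)) (at t)"
      by (rule has_vector_derivative_real_field)
    from has_vector_derivative_mult[OF gauss_has_vector_derivative this]
    have "(?g has_vector_derivative (gauss t * (- 1 / (complex_of_real t - \<zeta>)\<^sup>2) + (- 2 * complex_of_real t * gauss t) * (1 / (complex_of_real t - \<zeta>)))) (at t)"
      by simp
    moreover have "gauss t * (- 1 / (complex_of_real t - \<zeta>)\<^sup>2) + (- 2 * complex_of_real t * gauss t) * (1 / (complex_of_real t - \<zeta>)) = ?g' t"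
      by simp
    ultimately show ?thesis by (simp only:)
  qed
  have sq: "integrable lborel (\<lambda>t. gauss t / (complex_of_real t - \<zeta>)\<^sup>2)"
  proof -
    have b: "cmod (1 / (complex_of_real t - \<zeta>)\<^sup>2) \<le> 1 / \<bar>Im \<zeta>\<bar>\<^sup>2" for t
      unfolding norm_divide norm_one norm_power using z
      by (intro frac_le power_mono cmod_of_real_minus_ge) auto
    show ?thesis using integrable_bounded_mult(1)[OF gauss_integrable _ b] by simp
  qed
  have m: "integrable lborel (\<lambda>t. complex_of_real t * gauss t / (complex_of_real t - \<zeta>))"
    by (rule cauchy_tr_integrable(1)[OF gauss_moment_integrable z])
  have int: "integrable lborel ?g'"
    by (intro Bochner_Integration.integrable_diff integrable_mult_right m sq)
  have gc: "isCont gauss t" for t using gauss_has_vector_derivative has_vector_derivative_continuous by blast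
  have lim: "(?g \<longlongrightarrow> 0) F" if "(wt \<longlongrightarrow> 0) F" for F
  proof (rule Lim_null_comparison)
    show "((\<lambda>t. wt t / \<bar>Im \<zeta>\<bar>) \<longlongrightarrow> 0) F" using tendsto_divide[OF that tendsto_const[of "\<bar>Im \<zeta>\<bar>"]] z by simp
    show "\<forall>\<^sub>F t in F. cmod (?g t) \<le> wt t / \<bar>Im \<zeta>\<bar>"
      using z by (intro always_eventually allI) (auto simp: norm_divide gauss_def wt_nonneg intro!: frac_le cmod_of_real_minus_ge)
  qed
  have "(LBINT t=-\<infinity>..\<infinity>. ?g' t) = 0 - 0"
  proof (rule interval_integral_FTC_integrable)
    show "isCont ?g' t" for t using ne gc by (intro continuous_intros) auto
    show "set_integrable lborel (einterval (-\<infinity>) \<infinity>) ?g'" using int by (simp add: set_integrable_def)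
    show "((?g \<circ> real_of_ereal) \<longlongrightarrow> 0) (at_right (-\<infinity>))"
      by (simp only: ereal_tendsto_simps) (rule lim[OF wt_tendsto(2)])
    show "((?g \<circ> real_of_ereal) \<longlongrightarrow> 0) (at_left \<infinity>)"
      by (simp only: ereal_tendsto_simps) (rule lim[OF wt_tendsto(1)])
  qed (use d in auto)
  hence "(LINT t|lborel. ?g' t) = 0"
    by (simp add: interval_lebesgue_integral_def set_lebesgue_integral_def)
  hence e1: "(LINT t|lborel. gauss t / (complex_of_real t - \<zeta>)\<^sup>2) = - 2 * (LINT t|lborel. complex_of_real t * gauss t / (complex_of_real t - \<zeta>))"
    by (subst (asm) Bochner_Integration.integral_diff[OF integrable_mult_right[OF m] sq]) (simp only: integral_mult_right_zero, simp)
  have "(LINT t|lborel. complex_of_real t * gauss t / (complex_of_real t - \<zeta>)) = (LINT t|lborel. gauss t + \<zeta> * ?g t)"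
  proof (intro Bochner_Integration.integral_cong refl)
    fix t
    have "gauss t + \<zeta> * ?g t = (gauss t * (complex_of_real t - \<zeta>) + \<zeta> * gauss t) / (complex_of_real t - \<zeta>)"
      using ne[of t] by (simp add: add_divide_distrib)
    also have "gauss t * (complex_of_real t - \<zeta>) + \<zeta> * gauss t = complex_of_real t * gauss t" by (simp add: algebra_simps)
    finally show "complex_of_real t * gauss t / (complex_of_real t - \<zeta>) = gauss t + \<zeta> * ?g t" ..
  qed
  also have "\<dots> = 1 + \<zeta> * cauchy_tr gauss \<zeta>"
    by (subst Bochner_Integration.integral_add[OF gauss_integrable integrable_mult_right[OF cauchy_tr_integrable(1)[OF gauss_integrable z]]])
      (simp only: integral_mult_right_zero gauss_integral cauchy_tr_def)
  finally have "(LINT t|lborel. gauss t / (complex_of_real t - \<zeta>)\<^sup>2) = - 2 - 2 * \<zeta> * cauchy_tr gauss \<zeta>"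
    using e1 by (simp add: algebra_simps)
  thus ?thesis using cauchy_tr_has_field_derivative[OF gauss_integrable z] by simp
qed

lemma cauchy_tr_gauss_neg: "cauchy_tr gauss (- \<zeta>) = - cauchy_tr gauss \<zeta>"
proof -
  have "cauchy_tr gauss (- \<zeta>) = (LINT t|lborel. gauss (- t) / (complex_of_real (- t) - (- \<zeta>)))"
    unfolding cauchy_tr_def by (subst lborel_integral_real_affine[where c="-1" and t=0]) auto
  also have "\<dots> = (LINT t|lborel. - (gauss t / (complex_of_real t - \<zeta>)))"
  proof (intro Bochner_Integration.integral_cong refl)
    fix t
    have "complex_of_real (- t) - (- \<zeta>) = - (complex_of_real t - \<zeta>)" by simp
    thus "gauss (- t) / (complex_of_real (- t) - (- \<zeta>)) = - (gauss t / (complex_of_real t - \<zeta>))"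
      by (simp only: gauss_def wt_even minus_divide_right)
  qed
  finally show ?thesis by (simp add: cauchy_tr_def)
qed

lemma cauchy_tr_gauss_cnj: "cauchy_tr gauss (cnj \<zeta>) = cnj (cauchy_tr gauss \<zeta>)"
  using cauchy_tr_cnj[of gauss \<zeta>] by (simp add: gauss_cnj)

lemma Re_cauchy_tr_gauss_imag: "Re (cauchy_tr gauss (\<i> * complex_of_real y)) = 0"
proof -
  have "cnj (cauchy_tr gauss (\<i> * complex_of_real y)) = - cauchy_tr gauss (\<i> * complex_of_real y)"
    using cauchy_tr_gauss_cnj[of "\<i> * complex_of_real y"] cauchy_tr_gauss_neg[of "\<i> * complex_of_real y"] by simp
  thus ?thesis by (simp add: complex_eq_iff)
qed

section \<open>Bounds for the transform of the Gaussian in the upper half-plane\<close>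

lemma Im_cauchy_tr_gauss:
  assumes y: "Im \<zeta> > 0"
  shows "Im (cauchy_tr gauss \<zeta>) = (LINT t|lborel. poisson_kernel (Im \<zeta>) (Re \<zeta>) t * wt t)"
    and "integrable lborel (\<lambda>t. poisson_kernel (Im \<zeta>) (Re \<zeta>) t * wt t)"
proof -
  have "complex_of_real (Im (cauchy_tr gauss (complex_of_real (Re \<zeta>) + \<i> * complex_of_real (Im \<zeta>)))) = poisson_mean (Im \<zeta>) gauss (Re \<zeta>)"
    by (rule cauchy_tr_real_Im[OF gauss_integrable gauss_cnj y])
  also have "\<dots> = complex_of_real (LINT t|lborel. poisson_kernel (Im \<zeta>) (Re \<zeta>) t * wt t)"
    unfolding poisson_mean_def gauss_def of_real_mult[symmetric] by (rule integral_complex_of_real)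
  finally show "Im (cauchy_tr gauss \<zeta>) = (LINT t|lborel. poisson_kernel (Im \<zeta>) (Re \<zeta>) t * wt t)"
    by (simp add: complex_eq[symmetric])
  show "integrable lborel (\<lambda>t. poisson_kernel (Im \<zeta>) (Re \<zeta>) t * wt t)"
    using integrable_poisson_kernel_mult[OF y wt_integrable] by simp
qed

lemma integral_pos:
  fixes f :: "real \<Rightarrow> real"
  assumes i: "integrable lborel f" and p: "\<And>x. x \<noteq> c \<Longrightarrow> f x > 0"
  shows "(LINT x|lborel. f x) > 0"
proof -
  have ae: "AE x in lborel. f x > 0" using AE_lborel_singleton[of c] by eventually_elim (rule p)
  hence nn: "AE x in lborel. f x \<ge> 0" by eventually_elim simp
  have "(LINT x|lborel. f x) \<noteq> 0"
  proof
    assume "(LINT x|lborel. f x) = 0"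
    hence "AE x in lborel. f x = 0" using integral_nonneg_eq_0_iff_AE[OF i nn] by simp
    hence "AE x in (lborel :: real measure). False" using ae by eventually_elim simp
    thus False by (simp add: eventually_False ae_filter_eq_bot_iff)
  qed
  thus ?thesis using integral_nonneg_AE[OF nn] by simp
qed

text \<open>The imaginary part is a Poisson mean of w, where 0 < w < 1 / sqrt pi off the origin and
  the kernel has mass pi. The upper bound is the critical frequency: pi / sqrt pi = sqrt pi.\<close>

lemma Im_cauchy_tr_gauss_bounds:
  assumes y: "Im \<zeta> > 0"
  shows "0 < Im (cauchy_tr gauss \<zeta>)" "Im (cauchy_tr gauss \<zeta>) < sqrt pi"
proof -
  note I = Im_cauchy_tr_gauss[OF y]
  have pp: "poisson_kernel (Im \<zeta>) (Re \<zeta>) t > 0" for t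
    using y by (simp add: poisson_kernel_def add_nonneg_pos)
  show "0 < Im (cauchy_tr gauss \<zeta>)"
    unfolding I(1) by (rule integral_pos[OF I(2), of 0]) (simp add: pp wt_pos)
  have j: "integrable lborel (\<lambda>t. poisson_kernel (Im \<zeta>) (Re \<zeta>) t * (1 / sqrt pi))"
    using poisson_kernel_total(1)[OF y] by simp
  have "0 < (LINT t|lborel. poisson_kernel (Im \<zeta>) (Re \<zeta>) t * (1 / sqrt pi) - poisson_kernel (Im \<zeta>) (Re \<zeta>) t * wt t)"
    by (rule integral_pos[OF Bochner_Integration.integrable_diff[OF j I(2)], of 0])
      (simp only: diff_gt_0_iff_gt, intro mult_strict_left_mono wt_less pp)
  also have "\<dots> = pi / sqrt pi - Im (cauchy_tr gauss \<zeta>)"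
    using Bochner_Integration.integral_diff[OF j I(2)] poisson_kernel_total(2)[OF y, of "Re \<zeta>"] I(1) by simp
  also have "pi / sqrt pi = sqrt pi" by (simp add: real_div_sqrt)
  finally show "Im (cauchy_tr gauss \<zeta>) < sqrt pi" by simp
qed

text \<open>Multiplied by y, the kernel centred at 0 is y^2 / (t^2 + y^2) < 1 off the origin, and w
  has mass 1. Through the differential equation this makes the transform strictly decreasing along
  the imaginary axis and the zero of D simple.\<close>

lemma Im_cauchy_tr_gauss_imag_less:
  assumes y: "y > 0"
  shows "y * Im (cauchy_tr gauss (\<i> * complex_of_real y)) < 1"
proof -
  have y': "Im (\<i> * complex_of_real y) > 0" using y by simp
  note I = Im_cauchy_tr_gauss[OF y', simplified]
  have "0 < (LINT t|lborel. wt t - y * (poisson_kernel y 0 t * wt t))"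
  proof (rule integral_pos[of _ 0])
    show "integrable lborel (\<lambda>t. wt t - y * (poisson_kernel y 0 t * wt t))"
      by (intro Bochner_Integration.integrable_diff integrable_mult_right wt_integrable I)
    fix t :: real assume "t \<noteq> 0"
    hence "t * t > 0" "y * y > 0" using y by (auto simp: zero_less_mult_iff)
    hence "y * poisson_kernel y 0 t < 1" by (simp add: poisson_kernel_def power2_eq_square divide_less_eq_1 add_pos_pos)
    hence "y * poisson_kernel y 0 t * wt t < 1 * wt t" by (intro mult_strict_right_mono wt_pos)
    thus "0 < wt t - y * (poisson_kernel y 0 t * wt t)" by (simp add: mult.assoc)
  qed
  also have "\<dots> = 1 - y * Im (cauchy_tr gauss (\<i> * complex_of_real y))"
    by (subst Bochner_Integration.integral_diff[OF wt_integrable integrable_mult_right[OF I(2)]])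
      (simp only: integral_mult_right_zero wt_integral I(1))
  finally show ?thesis by simp
qed

text \<open>The Gaussian is at most (1 / sqrt pi) / (1 + t^2), and 1 / (1 + t^2) is the real part of
  i / (t + i), which is holomorphic in the upper half-plane, so the Poisson formula gives its mean
  exactly.\<close>

lemma Im_cauchy_tr_gauss_decay:
  assumes y: "Im \<zeta> > 0"
  shows "Im (cauchy_tr gauss \<zeta>) \<le> sqrt pi / cmod (\<zeta> + \<i>)"
proof -
  note I = Im_cauchy_tr_gauss[OF y]
  have nz: "z + \<i> \<noteq> 0" if "Im z > - 1" for z using that by (auto simp: complex_eq_iff)
  have P: "(LINT x|lborel. (\<i> / (complex_of_real x + \<i>)) / ((complex_of_real x - \<zeta>) * (complex_of_real x - cnj \<zeta>)))
      = complex_of_real (pi / Im \<zeta>) * (\<i> / (\<zeta> + \<i>))"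
  proof (rule poisson_formula(2)[OF _ _ _ y, of _ 1 1])
    show "(\<lambda>z. \<i> / (z + \<i>)) holomorphic_on {z. - 1 < Im z}" using nz by (intro holomorphic_intros) auto
    fix z assume z: "0 \<le> Im z"
    have "1 \<le> \<bar>Im (z + \<i>)\<bar>" using z by simp
    also have "\<dots> \<le> cmod (z + \<i>)" by (rule abs_Im_le_cmod)
    finally have "1 \<le> cmod (z + \<i>)" .
    thus "cmod (\<i> / (z + \<i>)) \<le> 1" by (simp add: norm_divide divide_le_eq_1)
  qed simp
  have Pi: "integrable lborel (\<lambda>x. (\<i> / (complex_of_real x + \<i>)) / ((complex_of_real x - \<zeta>) * (complex_of_real x - cnj \<zeta>)))"
  proof (rule poisson_formula(1)[OF _ _ _ y, of _ 1 1])
    show "(\<lambda>z. \<i> / (z + \<i>)) holomorphic_on {z. - 1 < Im z}" using nz by (intro holomorphic_intros) auto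
    fix z assume z: "0 \<le> Im z"
    have "1 \<le> \<bar>Im (z + \<i>)\<bar>" using z by simp
    also have "\<dots> \<le> cmod (z + \<i>)" by (rule abs_Im_le_cmod)
    finally have "1 \<le> cmod (z + \<i>)" .
    thus "cmod (\<i> / (z + \<i>)) \<le> 1" by (simp add: norm_divide divide_le_eq_1)
  qed simp
  have ker: "Re ((\<i> / (complex_of_real x + \<i>)) / ((complex_of_real x - \<zeta>) * (complex_of_real x - cnj \<zeta>)))
     = (1 / Im \<zeta>) * (poisson_kernel (Im \<zeta>) (Re \<zeta>) x * (1 / (1 + x\<^sup>2)))" for x
  proof -
    have "(complex_of_real x - \<zeta>) * (complex_of_real x - cnj \<zeta>) = complex_of_real ((x - Re \<zeta>)\<^sup>2 + (Im \<zeta>)\<^sup>2)"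
      by (auto simp: complex_eq_iff power2_eq_square algebra_simps)
    moreover have "Re (\<i> / (complex_of_real x + \<i>)) = 1 / (1 + x\<^sup>2)"
      by (simp add: Re_divide power2_eq_square add.commute)
    ultimately have "Re ((\<i> / (complex_of_real x + \<i>)) / ((complex_of_real x - \<zeta>) * (complex_of_real x - cnj \<zeta>)))
      = 1 / (1 + x\<^sup>2) / ((x - Re \<zeta>)\<^sup>2 + (Im \<zeta>)\<^sup>2)" by (simp only: Re_divide_of_real)
    thus ?thesis using y by (simp add: poisson_kernel_def)
  qed
  have i2: "integrable lborel (\<lambda>x. poisson_kernel (Im \<zeta>) (Re \<zeta>) x * (1 / (1 + x\<^sup>2)))"
  proof -
    have "Im \<zeta> * ((1 / Im \<zeta>) * r) = r" for r using y by simp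
    thus ?thesis using integrable_mult_right[OF integrable_Re[OF Pi, unfolded ker], of "Im \<zeta>"] by (simp only:)
  qed
  have "(1 / Im \<zeta>) * (LINT x|lborel. poisson_kernel (Im \<zeta>) (Re \<zeta>) x * (1 / (1 + x\<^sup>2)))
     = Re (complex_of_real (pi / Im \<zeta>) * (\<i> / (\<zeta> + \<i>)))"
    unfolding P[symmetric] integral_Re[OF Pi, symmetric] ker by (rule integral_mult_right_zero[symmetric])
  also have "\<dots> \<le> (pi / Im \<zeta>) * (1 / cmod (\<zeta> + \<i>))"
    by (rule order_trans[OF complex_Re_le_cmod]) (use y in \<open>simp add: norm_mult norm_divide\<close>)
  finally have "(LINT x|lborel. poisson_kernel (Im \<zeta>) (Re \<zeta>) x * (1 / (1 + x\<^sup>2))) \<le> pi / cmod (\<zeta> + \<i>)"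
    using y by (simp add: field_simps)
  note A = this
  have "Im (cauchy_tr gauss \<zeta>) \<le> (LINT x|lborel. (1 / sqrt pi) * (poisson_kernel (Im \<zeta>) (Re \<zeta>) x * (1 / (1 + x\<^sup>2))))"
    unfolding I(1)
  proof (intro integral_mono I(2) integrable_mult_right i2)
    fix x
    show "poisson_kernel (Im \<zeta>) (Re \<zeta>) x * wt x \<le> 1 / sqrt pi * (poisson_kernel (Im \<zeta>) (Re \<zeta>) x * (1 / (1 + x\<^sup>2)))"
      using mult_left_mono[OF wt_le_cauchy[of x] poisson_kernel_nonneg[OF y, of "Re \<zeta>" x]] by (simp add: mult_ac)
  qed
  hence "Im (cauchy_tr gauss \<zeta>) \<le> (1 / sqrt pi) * (LINT x|lborel. poisson_kernel (Im \<zeta>) (Re \<zeta>) x * (1 / (1 + x\<^sup>2)))"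
    by (simp only: integral_mult_right_zero)
  also have "\<dots> \<le> (1 / sqrt pi) * (pi / cmod (\<zeta> + \<i>))"
    by (rule mult_left_mono[OF A]) simp
  also have "(1 / sqrt pi) * (pi / cmod (\<zeta> + \<i>)) = (pi / sqrt pi) / cmod (\<zeta> + \<i>)" by simp
  also have "\<dots> = sqrt pi / cmod (\<zeta> + \<i>)" by (simp only: real_div_sqrt pi_ge_zero)
  finally show ?thesis .
qed

text \<open>Since 1 - exp (- t^2) is at most both t^2 and 1, its product with 1 + t^2 is at most 2
  t^2. Replacing w by its maximum 1 / sqrt pi therefore costs at most the integral of (1 / sqrt pi)
  2 y / (1 + t^2), that is 2 sqrt pi y.\<close>

lemma Im_cauchy_tr_gauss_imag_lower:
  assumes y: "y > 0"
  shows "sqrt pi - 2 * sqrt pi * y \<le> Im (cauchy_tr gauss (\<i> * complex_of_real y))"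
proof -
  have y': "Im (\<i> * complex_of_real y) > 0" using y by simp
  note I = Im_cauchy_tr_gauss[OF y', simplified]
  have pk: "integrable lborel (\<lambda>t::real. 1 / (1 + t\<^sup>2))" "(LINT t::real|lborel. 1 / (1 + t\<^sup>2)) = pi"
    using poisson_kernel_integral[of 1 0] by (simp_all add: add.commute)
  have j: "integrable lborel (\<lambda>t. (1 / sqrt pi) * poisson_kernel y 0 t)" by (intro integrable_mult_right poisson_kernel_total y)
  have j2: "integrable lborel (\<lambda>t. (1 / sqrt pi) * (2 * y) * (1 / (1 + t\<^sup>2)))" by (intro integrable_mult_right pk)
  have pt: "(1 / sqrt pi) * poisson_kernel y 0 t - (1 / sqrt pi) * (2 * y) * (1 / (1 + t\<^sup>2)) \<le> poisson_kernel y 0 t * wt t" for t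
  proof -
    have p1: "1 + t\<^sup>2 > 0" "t\<^sup>2 + y\<^sup>2 > 0" using y by (auto simp: add_pos_nonneg add_nonneg_pos)
    define e where "e = exp (- t\<^sup>2)"
    have e: "0 < e" "1 - e \<le> t\<^sup>2" "1 - e \<le> 1" using exp_ge_add_one_self[of "- t\<^sup>2"] by (auto simp: e_def)
    have "(1 - e) * (1 + t\<^sup>2) = (1 - e) + (1 - e) * t\<^sup>2" by (simp add: algebra_simps)
    also have "\<dots> \<le> t\<^sup>2 + 1 * t\<^sup>2" using e by (intro add_mono mult_right_mono) auto
    also have "\<dots> \<le> 2 * (t\<^sup>2 + y\<^sup>2)" by simp
    finally have "(1 - e) / (t\<^sup>2 + y\<^sup>2) \<le> 2 / (1 + t\<^sup>2)" using p1 by (simp add: divide_le_eq pos_le_divide_eq mult.commute)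
    hence "y * ((1 - e) / (t\<^sup>2 + y\<^sup>2)) \<le> y * (2 / (1 + t\<^sup>2))" using y by (intro mult_left_mono) auto
    hence "y / (t\<^sup>2 + y\<^sup>2) - 2 * y * (1 / (1 + t\<^sup>2)) \<le> y / (t\<^sup>2 + y\<^sup>2) * e"
      by (simp add: right_diff_distrib diff_divide_distrib mult_ac)
    hence "(1 / sqrt pi) * (y / (t\<^sup>2 + y\<^sup>2) - 2 * y * (1 / (1 + t\<^sup>2))) \<le> (1 / sqrt pi) * (y / (t\<^sup>2 + y\<^sup>2) * e)" by (intro mult_left_mono) auto
    thus ?thesis by (simp add: poisson_kernel_def wt_def e_def right_diff_distrib diff_divide_distrib mult_ac)
  qed
  have "(LINT t|lborel. (1 / sqrt pi) * poisson_kernel y 0 t - (1 / sqrt pi) * (2 * y) * (1 / (1 + t\<^sup>2))) \<le> Im (cauchy_tr gauss (\<i> * complex_of_real y))"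
    unfolding I(1) by (intro integral_mono Bochner_Integration.integrable_diff j j2 I(2) pt)
  moreover have "(LINT t|lborel. (1 / sqrt pi) * poisson_kernel y 0 t - (1 / sqrt pi) * (2 * y) * (1 / (1 + t\<^sup>2)))
     = pi / sqrt pi - 2 * (pi / sqrt pi) * y"
    by (subst Bochner_Integration.integral_diff[OF j j2])
      (simp only: integral_mult_right_zero pk poisson_kernel_total(2)[OF y], simp)
  ultimately show ?thesis by (simp add: real_div_sqrt)
qed

text \<open>The substitutions t = x + u and t = x - u, added, give an integrand (w(x + u) - w(x -
  u)) u / (u^2 + y^2). Because (x + u)^2 - (x - u)^2 = 4 x u, its sign is opposite to that of x for
  every u except 0. Zeros of D are thereby confined to the imaginary axis.\<close>

lemma Re_cauchy_tr_gauss: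
  assumes y: "y > 0" and x: "x \<noteq> 0"
  shows "Re (cauchy_tr gauss (complex_of_real x + \<i> * complex_of_real y)) \<noteq> 0"
proof -
  let ?\<zeta> = "complex_of_real x + \<i> * complex_of_real y"
  have z: "Im ?\<zeta> \<noteq> 0" using y by simp
  have re: "Re (gauss t / (complex_of_real t - ?\<zeta>)) = wt t * (t - x) / ((t - x)\<^sup>2 + y\<^sup>2)" for t
    by (simp add: gauss_def Re_divide)
  have i: "integrable lborel (\<lambda>t. wt t * (t - x) / ((t - x)\<^sup>2 + y\<^sup>2))"
    using integrable_Re[OF cauchy_tr_integrable(1)[OF gauss_integrable z]] unfolding re .
  have R: "Re (cauchy_tr gauss ?\<zeta>) = (LINT t|lborel. wt t * (t - x) / ((t - x)\<^sup>2 + y\<^sup>2))"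
    unfolding cauchy_tr_def integral_Re[OF cauchy_tr_integrable(1)[OF gauss_integrable z], symmetric] re ..
  have R1: "Re (cauchy_tr gauss ?\<zeta>) = (LINT u|lborel. wt (x + u) * u / (u\<^sup>2 + y\<^sup>2))"
    unfolding R by (subst lborel_integral_real_affine[where c=1 and t=x]) auto
  have R2: "Re (cauchy_tr gauss ?\<zeta>) = (LINT u|lborel. - (wt (x - u) * u / (u\<^sup>2 + y\<^sup>2)))"
    unfolding R by (subst lborel_integral_real_affine[where c="-1" and t=x]) auto
  have i1: "integrable lborel (\<lambda>u. wt (x + u) * u / (u\<^sup>2 + y\<^sup>2))"
    using lborel_integrable_real_affine[OF i, of 1 x] by simp
  have i2: "integrable lborel (\<lambda>u. - (wt (x - u) * u / (u\<^sup>2 + y\<^sup>2)))"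
    using lborel_integrable_real_affine[OF i, of "-1" x] by simp
  define f where "f = (\<lambda>u. wt (x + u) * u / (u\<^sup>2 + y\<^sup>2) + - (wt (x - u) * u / (u\<^sup>2 + y\<^sup>2)))"
  have f: "integrable lborel f" "(LINT u|lborel. f u) = 2 * Re (cauchy_tr gauss ?\<zeta>)"
  proof -
    show "integrable lborel f" unfolding f_def by (rule Bochner_Integration.integrable_add[OF i1 i2])
    show "(LINT u|lborel. f u) = 2 * Re (cauchy_tr gauss ?\<zeta>)"
      unfolding f_def Bochner_Integration.integral_add[OF i1 i2] R1[symmetric] R2[symmetric] by simp
  qed
  have feq: "f u = (wt (x + u) - wt (x - u)) * u / (u\<^sup>2 + y\<^sup>2)" for u
    by (simp add: f_def diff_divide_distrib left_diff_distrib)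
  have mono: "wt a < wt b \<longleftrightarrow> b\<^sup>2 < a\<^sup>2" for a b
    by (simp add: wt_def divide_less_cancel)
  have sg: "x * f u < 0" if u: "u \<noteq> 0" for u
  proof -
    have "(x + u)\<^sup>2 - (x - u)\<^sup>2 = 4 * (x * u)" by (simp add: power2_eq_square algebra_simps)
    have "(x * u) * (wt (x + u) - wt (x - u)) < 0"
    proof (cases "x * u > 0")
      case True thus ?thesis using \<open>(x + u)\<^sup>2 - (x - u)\<^sup>2 = 4 * (x * u)\<close> by (intro mult_pos_neg) (auto simp: mono)
    next
      case False
      hence xu: "x * u < 0" using x u by (simp add: less_le)
      have "wt (x + u) - wt (x - u) > 0" using xu \<open>(x + u)\<^sup>2 - (x - u)\<^sup>2 = 4 * (x * u)\<close> by (simp add: mono)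
      thus ?thesis using xu by (rule mult_neg_pos[rotated])
    qed
    moreover have "u\<^sup>2 + y\<^sup>2 > 0" using y by (simp add: add_nonneg_pos)
    ultimately have "(x * u) * (wt (x + u) - wt (x - u)) / (u\<^sup>2 + y\<^sup>2) < 0" by (rule divide_neg_pos)
    thus ?thesis by (simp add: feq mult_ac)
  qed
  have "0 < (LINT u|lborel. - x * f u)"
    by (rule integral_pos[of _ 0]) (use f sg in auto)
  hence "- x * (2 * Re (cauchy_tr gauss ?\<zeta>)) > 0" using f(2) by simp
  thus ?thesis by auto
qed

text \<open>Up to the factor sqrt pi / 2 this is the imaginary error function erfi. The value at 0
  fixes the additive constant.\<close>

definition exp_square_primitive :: "complex \<Rightarrow> complex" where
  "exp_square_primitive = (SOME E. E 0 = 0 \<and> (\<forall>z. (E has_field_derivative exp (z\<^sup>2)) (at z)))"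

lemma exp_square_primitive:
  "exp_square_primitive 0 = 0" "(exp_square_primitive has_field_derivative exp (z\<^sup>2)) (at z)"
proof -
  have "\<exists>g. \<forall>x::complex. (g has_field_derivative exp (x\<^sup>2)) (at x)"
    by (rule holomorphic_convex_primitive'[of UNIV "\<lambda>z. exp (z\<^sup>2)"]) (auto intro!: holomorphic_intros)
  then obtain g where g: "\<And>x::complex. (g has_field_derivative exp (x\<^sup>2)) (at x)" by blast
  have "\<exists>E. E 0 = 0 \<and> (\<forall>z::complex. (E has_field_derivative exp (z\<^sup>2)) (at z))"
  proof (intro exI[of _ "\<lambda>z. g z - g 0"] conjI allI)
    fix z :: complex show "((\<lambda>z. g z - g 0) has_field_derivative exp (z\<^sup>2)) (at z)"
      using DERIV_diff[OF g[of z] DERIV_const] by simp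
  qed simp
  from someI_ex[OF this] show "exp_square_primitive 0 = 0" "(exp_square_primitive has_field_derivative exp (z\<^sup>2)) (at z)"
    unfolding exp_square_primitive_def by blast+
qed

text \<open>The entire extension of the Cauchy transform of the Gaussian from the upper half-plane
  (the plasma dispersion function).\<close>

definition plasma :: "complex \<Rightarrow> complex" where
  "plasma z = exp (- z\<^sup>2) * (\<i> * complex_of_real (sqrt pi) - 2 * exp_square_primitive z)"

lemma plasma_ODE: "(plasma has_field_derivative (- 2 - 2 * z * plasma z)) (at z)"
proof -
  have "exp (- z\<^sup>2) * exp (z\<^sup>2) = 1" by (simp add: exp_minus)
  hence e: "exp (- z\<^sup>2) * (0 - 2 * exp (z\<^sup>2)) = - 2" by simp
  have "(plasma has_field_derivative (exp (- z\<^sup>2) * (- (2 * z)) * (\<i> * complex_of_real (sqrt pi) - 2 * exp_square_primitive z) + 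
     exp (- z\<^sup>2) * (0 - 2 * exp (z\<^sup>2)))) (at z)"
    unfolding plasma_def[abs_def]
    by (auto intro!: derivative_eq_intros exp_square_primitive(2) simp: algebra_simps)
  thus ?thesis unfolding e by (simp add: plasma_def algebra_simps)
qed

lemma plasma_0: "plasma 0 = \<i> * complex_of_real (sqrt pi)"
  by (simp add: plasma_def exp_square_primitive)

lemma plasma_isCont: "isCont plasma z" by (rule DERIV_isCont[OF plasma_ODE])

text \<open>The initial value that singles out the transform among the solutions of its differential
  equation.\<close>

lemma tendsto_cauchy_tr_gauss_0:
  "((\<lambda>y. cauchy_tr gauss (\<i> * complex_of_real y)) \<longlongrightarrow> \<i> * complex_of_real (sqrt pi)) (at_right 0)"
proof -
  have "((\<lambda>y. Im (cauchy_tr gauss (\<i> * complex_of_real y))) \<longlongrightarrow> sqrt pi) (at_right 0)"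
  proof (rule tendsto_sandwich)
    show "\<forall>\<^sub>F y in at_right 0. sqrt pi - 2 * sqrt pi * y \<le> Im (cauchy_tr gauss (\<i> * complex_of_real y))"
      using eventually_at_right_less[of "0::real"] by eventually_elim (rule Im_cauchy_tr_gauss_imag_lower)
    show "\<forall>\<^sub>F y in at_right 0. Im (cauchy_tr gauss (\<i> * complex_of_real y)) \<le> sqrt pi"
      using eventually_at_right_less[of "0::real"]
      by eventually_elim (rule less_imp_le[OF Im_cauchy_tr_gauss_bounds(2)], simp)
    have "((\<lambda>y. sqrt pi - 2 * sqrt pi * y) \<longlongrightarrow> sqrt pi - 2 * sqrt pi * 0) (at_right 0)" by (intro tendsto_intros)
    thus "((\<lambda>y. sqrt pi - 2 * sqrt pi * y) \<longlongrightarrow> sqrt pi) (at_right 0)" by simp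
  qed simp
  hence "((\<lambda>y. \<i> * complex_of_real (Im (cauchy_tr gauss (\<i> * complex_of_real y)))) \<longlongrightarrow> \<i> * complex_of_real (sqrt pi)) (at_right 0)"
    by (intro tendsto_intros)
  moreover have "\<i> * complex_of_real (Im (cauchy_tr gauss (\<i> * complex_of_real y))) = cauchy_tr gauss (\<i> * complex_of_real y)" for y
    using Re_cauchy_tr_gauss_imag[of y] by (simp add: complex_eq_iff)
  ultimately show ?thesis by simp
qed

text \<open>Both functions solve W' = -2 - 2 z W, so exp (z^2) times their difference has derivative
  0 and is constant on the half-plane. Its limit along the imaginary axis at 0 is 0.\<close>

theorem cauchy_tr_gauss_plasma:
  assumes "Im \<zeta> > 0"
  shows "cauchy_tr gauss \<zeta> = plasma \<zeta>"
proof -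
  let ?S = "{z. Im z > 0}"
  let ?c = "\<lambda>z. exp (z\<^sup>2) * (cauchy_tr gauss z - plasma z)"
  have d: "(?c has_field_derivative 0) (at z within ?S)" if "z \<in> ?S" for z
  proof -
    have z: "Im z \<noteq> 0" using that by simp
    have "(?c has_field_derivative (exp (z\<^sup>2) * (2 * z) * (cauchy_tr gauss z - plasma z) + exp (z\<^sup>2) * ((- 2 - 2 * z * cauchy_tr gauss z) - (- 2 - 2 * z * plasma z)))) (at z)"
      by (auto intro!: derivative_eq_intros cauchy_tr_gauss_ODE[OF z] plasma_ODE simp: algebra_simps)
    hence "(?c has_field_derivative 0) (at z)" by (rule DERIV_cong) (simp add: algebra_simps)
    thus ?thesis by (rule has_field_derivative_at_within)
  qed
  obtain c where c: "\<And>z. z \<in> ?S \<Longrightarrow> ?c z = c"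
    using has_field_derivative_zero_constant[of ?S ?c] d convex_halfspace_Im_gt by blast
  have "((\<lambda>y. ?c (\<i> * complex_of_real y)) \<longlongrightarrow> exp ((\<i> * complex_of_real 0)\<^sup>2) * (\<i> * complex_of_real (sqrt pi) - plasma (\<i> * complex_of_real 0))) (at_right 0)"
    by (intro tendsto_intros tendsto_cauchy_tr_gauss_0 isCont_tendsto_compose[OF plasma_isCont])
  hence "((\<lambda>y. ?c (\<i> * complex_of_real y)) \<longlongrightarrow> 0) (at_right 0)" by (simp add: plasma_0)
  moreover have "\<forall>\<^sub>F y in at_right 0. ?c (\<i> * complex_of_real y) = c"
    using eventually_at_right_less[of "0::real"] by eventually_elim (rule c, simp)
  ultimately have "((\<lambda>y. c) \<longlongrightarrow> 0) (at_right (0::real))" by (rule Lim_transform_eventually)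
  hence "c = 0" by (simp add: tendsto_const_iff)
  thus ?thesis using c[of \<zeta>] assms by simp
qed

lemma tendsto_plasma_boundary:
  "((\<lambda>y. cauchy_tr gauss (complex_of_real x + \<i> * complex_of_real y)) \<longlongrightarrow> plasma (complex_of_real x)) (at_right 0)"
proof -
  have "((\<lambda>y. plasma (complex_of_real x + \<i> * complex_of_real y)) \<longlongrightarrow> plasma (complex_of_real x + \<i> * complex_of_real 0)) (at_right 0)"
    by (intro isCont_tendsto_compose[OF plasma_isCont] tendsto_intros)
  moreover have "\<forall>\<^sub>F y in at_right 0. plasma (complex_of_real x + \<i> * complex_of_real y) = cauchy_tr gauss (complex_of_real x + \<i> * complex_of_real y)"
    using eventually_at_right_less[of "0::real"] by eventually_elim (rule cauchy_tr_gauss_plasma[symmetric], simp)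
  ultimately show ?thesis by (simp add: Lim_transform_eventually)
qed

text \<open>On the real line the real part is -2 exp (- x^2) times the integral of exp (t^2) from 0
  to x, that is, minus twice Dawson's function, and this integral is strictly increasing in x. It
  continues \<open>Re_cauchy_tr_gauss\<close> to the boundary.\<close>

lemma Re_plasma_real:
  assumes "x \<noteq> 0" shows "Re (plasma (complex_of_real x)) \<noteq> 0"
proof -
  define f where "f = (\<lambda>x. Re (exp_square_primitive (complex_of_real x)))"
  have d: "(f has_real_derivative exp (x\<^sup>2)) (at x)" for x
  proof -
    have "((\<lambda>x. exp_square_primitive (complex_of_real x)) has_vector_derivative exp ((complex_of_real x)\<^sup>2)) (at x)"
      by (rule has_vector_derivative_real_field[OF exp_square_primitive(2)])
    from bounded_linear.has_vector_derivative[OF bounded_linear_Re this]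
    have "(f has_vector_derivative Re (exp ((complex_of_real x)\<^sup>2))) (at x)" by (simp add: f_def)
    moreover have "Re (exp ((complex_of_real x)\<^sup>2)) = exp (x\<^sup>2)"
      by (simp only: of_real_power[symmetric] exp_of_real Re_complex_of_real)
    ultimately show ?thesis by (simp add: has_real_derivative_iff_has_vector_derivative)
  qed
  have mono: "f a < f b" if "a < b" for a b
    by (rule DERIV_pos_imp_increasing[OF that]) (use d in \<open>auto intro: exp_gt_zero\<close>)
  have "f 0 = 0" by (simp add: f_def exp_square_primitive)
  hence f: "f x \<noteq> 0" using mono[of x 0] mono[of 0 x] assms by (cases "x < 0") auto
  have "exp (- (complex_of_real x)\<^sup>2) = complex_of_real (exp (- x\<^sup>2))" by (simp add: exp_of_real[symmetric])
  hence "Re (plasma (complex_of_real x)) = exp (- x\<^sup>2) * (- 2 * f x)"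
    by (simp add: plasma_def f_def)
  thus ?thesis using f by simp
qed

lemma Im_plasma_decay:
  assumes "Im \<zeta> \<ge> 0"
  shows "Im (plasma \<zeta>) \<le> sqrt pi / cmod (\<zeta> + \<i>)"
proof (rule tendsto_le[OF trivial_limit_at_right_real])
  have ne: "\<zeta> + \<i> * complex_of_real y + \<i> \<noteq> 0" if "y \<ge> 0" for y using assms that by (auto simp: complex_eq_iff)
  have l: "((\<lambda>y. \<zeta> + \<i> * complex_of_real y) \<longlongrightarrow> \<zeta>) (at_right 0)"
  proof -
    have "((\<lambda>y. \<zeta> + \<i> * complex_of_real y) \<longlongrightarrow> \<zeta> + \<i> * complex_of_real 0) (at_right 0)" by (intro tendsto_intros)
    thus ?thesis by simp
  qed
  show "((\<lambda>y. Im (plasma (\<zeta> + \<i> * complex_of_real y))) \<longlongrightarrow> Im (plasma \<zeta>)) (at_right 0)"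
    by (intro tendsto_intros isCont_tendsto_compose[OF plasma_isCont l])
  show "((\<lambda>y. sqrt pi / cmod (\<zeta> + \<i> * complex_of_real y + \<i>)) \<longlongrightarrow> sqrt pi / cmod (\<zeta> + \<i>)) (at_right 0)"
    using ne[of 0] by (intro tendsto_intros l) auto
  show "\<forall>\<^sub>F y in at_right 0. Im (plasma (\<zeta> + \<i> * complex_of_real y)) \<le> sqrt pi / cmod (\<zeta> + \<i> * complex_of_real y + \<i>)"
    using eventually_at_right_less[of "0::real"]
  proof eventually_elim
    case (elim y)
    hence "Im (\<zeta> + \<i> * complex_of_real y) > 0" using assms by simp
    from Im_cauchy_tr_gauss_decay[OF this] cauchy_tr_gauss_plasma[OF this] show ?case by simp
  qed
qed

section \<open>The zero of D in the closed upper half-plane\<close>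

lemma plasma_zero_imaginary:
  assumes "0 < \<xi>" "Im \<zeta> \<ge> 0" "plasma \<zeta> = \<i> * complex_of_real \<xi>"
  shows "Re \<zeta> = 0"
proof (rule ccontr)
  assume n: "Re \<zeta> \<noteq> 0"
  show False
  proof (cases "Im \<zeta> = 0")
    case True
    hence "\<zeta> = complex_of_real (Re \<zeta>)" by (simp add: complex_eq_iff)
    thus False using Re_plasma_real[OF n] assms(3) by simp
  next
    case False
    hence p: "Im \<zeta> > 0" using assms by simp
    have "\<zeta> = complex_of_real (Re \<zeta>) + \<i> * complex_of_real (Im \<zeta>)" by (rule complex_eq)
    thus False using Re_cauchy_tr_gauss[OF p n] cauchy_tr_gauss_plasma[OF p] assms(3) by simp
  qed
qed

definition plasma_imag :: "real \<Rightarrow> real" where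
  "plasma_imag y = Im (plasma (\<i> * complex_of_real y))"

lemma plasma_imag_eq:
  assumes "y \<ge> 0" shows "plasma (\<i> * complex_of_real y) = \<i> * complex_of_real (plasma_imag y)"
proof (cases "y = 0")
  case True thus ?thesis by (simp add: plasma_0 plasma_imag_def)
next
  case False
  hence "cauchy_tr gauss (\<i> * complex_of_real y) = plasma (\<i> * complex_of_real y)"
    using assms by (intro cauchy_tr_gauss_plasma) simp
  thus ?thesis using Re_cauchy_tr_gauss_imag[of y] by (simp add: complex_eq_iff plasma_imag_def)
qed

lemma plasma_imag_mult_less: "y \<ge> 0 \<Longrightarrow> y * plasma_imag y < 1"
  using Im_cauchy_tr_gauss_imag_less[of y] cauchy_tr_gauss_plasma[of "\<i> * complex_of_real y"]
  by (cases "y = 0") (auto simp: plasma_imag_def)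

lemma plasma_imag_deriv: "(plasma_imag has_real_derivative (Im (\<i> * (- 2 - 2 * (\<i> * complex_of_real y) * plasma (\<i> * complex_of_real y))))) (at y)"
proof -
  have "((\<lambda>z. plasma (\<i> * z)) has_field_derivative ((- 2 - 2 * (\<i> * complex_of_real y) * plasma (\<i> * complex_of_real y)) * \<i>)) (at (complex_of_real y))"
    by (rule DERIV_chain2[OF plasma_ODE]) (auto intro!: derivative_eq_intros)
  from bounded_linear.has_vector_derivative[OF bounded_linear_Im has_vector_derivative_real_field[OF this]]
  show ?thesis by (simp add: plasma_imag_def[abs_def] has_real_derivative_iff_has_vector_derivative mult.commute)
qed

text \<open>On the imaginary axis the differential equation reads p' = 2 (y p - 1), and y p <
  1.\<close>

lemma plasma_imag_strict_decreasing:
  assumes "0 \<le> a" "a < b" shows "plasma_imag b < plasma_imag a"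
proof (rule DERIV_neg_imp_decreasing[OF assms(2)])
  fix y assume "a \<le> y" "y \<le> b"
  hence y: "y \<ge> 0" using assms by simp
  have "Im (\<i> * (- 2 - 2 * (\<i> * complex_of_real y) * plasma (\<i> * complex_of_real y))) = 2 * (y * plasma_imag y) - 2"
    unfolding plasma_imag_eq[OF y] by simp
  also have "\<dots> < 0" using plasma_imag_mult_less[OF y] by simp
  finally show "\<exists>d. (plasma_imag has_real_derivative d) (at y) \<and> d < 0" using plasma_imag_deriv by blast
qed

lemma plasma_imag_0: "plasma_imag 0 = sqrt pi" by (simp add: plasma_imag_def plasma_0)

text \<open>Along the imaginary axis the function decreases strictly from sqrt pi at 0, so it takes
  the value \<xi> exactly once. Off the axis the real part does not vanish, which gives uniqueness
  in the whole closed half-plane.\<close>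

lemma plasma_zero_exists:
  assumes "0 < \<xi>" "\<xi> \<le> sqrt pi"
  obtains y0 where "y0 \<ge> 0" "\<xi> < sqrt pi \<Longrightarrow> y0 > 0" "\<xi> = sqrt pi \<Longrightarrow> y0 = 0" "y0 * \<xi> < 1"
    "\<And>\<zeta>. Im \<zeta> \<ge> 0 \<Longrightarrow> plasma \<zeta> = \<i> * complex_of_real \<xi> \<longleftrightarrow> \<zeta> = \<i> * complex_of_real y0"
proof -
  \<comment> \<open>At this height the decay bound is sqrt pi / (b + 1), below sqrt pi / b =
    \<xi>.\<close>
  define b where "b = sqrt pi / \<xi>"
  have b: "b > 0" using assms by (simp add: b_def)
  have "plasma_imag b \<le> sqrt pi / cmod (\<i> * complex_of_real b + \<i>)"
    unfolding plasma_imag_def by (rule Im_plasma_decay) (use b in simp)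
  also have "cmod (\<i> * complex_of_real b + \<i>) = b + 1"
  proof -
    have "\<i> * complex_of_real b + \<i> = \<i> * complex_of_real (b + 1)" by (simp add: algebra_simps)
    thus ?thesis using b by (simp only: norm_mult norm_of_real) simp
  qed
  also have "sqrt pi / (b + 1) \<le> sqrt pi / b" using b by (intro divide_left_mono) auto
  also have "sqrt pi / b = \<xi>" using assms by (simp add: b_def)
  finally have le: "plasma_imag b \<le> \<xi>" .
  have "\<exists>x\<ge>0. x \<le> b \<and> plasma_imag x = \<xi>"
    using le assms b DERIV_isCont[OF plasma_imag_deriv] by (intro IVT2[of plasma_imag]) (auto simp: plasma_imag_0)
  then obtain y0 where y0: "y0 \<ge> 0" "plasma_imag y0 = \<xi>" by blast
  have uni: "y = y0" if "y \<ge> 0" "plasma_imag y = \<xi>" for y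
    using plasma_imag_strict_decreasing[of y y0] plasma_imag_strict_decreasing[of y0 y] that y0
    by (cases y y0 rule: linorder_cases) auto
  show thesis
  proof (rule that[of y0])
    show "y0 \<ge> 0" by fact
    show "y0 > 0" if "\<xi> < sqrt pi" using that y0 plasma_imag_0 by (cases "y0 = 0") auto
    show "y0 = 0" if "\<xi> = sqrt pi" using uni[of 0] that plasma_imag_0 by simp
    show "y0 * \<xi> < 1" using plasma_imag_mult_less[OF y0(1)] y0 by simp
    fix \<zeta> assume z: "Im \<zeta> \<ge> 0"
    show "plasma \<zeta> = \<i> * complex_of_real \<xi> \<longleftrightarrow> \<zeta> = \<i> * complex_of_real y0"
    proof
      assume "\<zeta> = \<i> * complex_of_real y0"
      thus "plasma \<zeta> = \<i> * complex_of_real \<xi>" using plasma_imag_eq[OF y0(1)] y0(2) by simp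
    next
      assume p: "plasma \<zeta> = \<i> * complex_of_real \<xi>"
      have re: "Re \<zeta> = 0" by (rule plasma_zero_imaginary[OF assms(1) z p])
      hence zi: "\<zeta> = \<i> * complex_of_real (Im \<zeta>)" by (simp add: complex_eq_iff)
      have "plasma_imag (Im \<zeta>) = \<xi>" unfolding plasma_imag_def zi[symmetric] p by simp
      from uni[OF z this] zi show "\<zeta> = \<i> * complex_of_real y0" by simp
    qed
  qed
qed

text \<open>On a half-disc D(\<zeta>) / (\<zeta> - \<beta>), continued over \<beta>, is continuous
  without zeros and hence bounded below by compactness; outside, D is at least c while |\<zeta> -
  \<beta>| grows linearly. The zero may lie on the real line, as it does at the critical
  frequency.\<close>

lemma zero_quotient_bound:
  fixes D :: "complex \<Rightarrow> complex"
  assumes hol: "D holomorphic_on UNIV" and z: "D \<beta> = 0" "deriv D \<beta> \<noteq> 0"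
    and nz: "\<And>\<zeta>. Im \<zeta> \<ge> 0 \<Longrightarrow> \<zeta> \<noteq> \<beta> \<Longrightarrow> D \<zeta> \<noteq> 0"
    and inf: "c > 0" "\<And>\<zeta>. Im \<zeta> \<ge> 0 \<Longrightarrow> cmod \<zeta> \<ge> R \<Longrightarrow> c \<le> cmod (D \<zeta>)"
  obtains C where "C \<ge> 0" "\<And>\<zeta>. Im \<zeta> \<ge> 0 \<Longrightarrow> cmod (\<zeta> - \<beta>) \<le> C * (1 + cmod \<zeta>) * cmod (D \<zeta>)"
proof -
  define G where "G = (\<lambda>\<zeta>. if \<zeta> = \<beta> then deriv D \<beta> else (D \<zeta> - D \<beta>) / (\<zeta> - \<beta>))"
  have "G holomorphic_on UNIV" unfolding G_def by (rule pole_lemma_open[OF hol]) simp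
  hence cont: "continuous_on UNIV G" by (rule holomorphic_on_imp_continuous_on)
  have DG: "D \<zeta> = (\<zeta> - \<beta>) * G \<zeta>" for \<zeta> using z by (simp add: G_def)
  let ?K = "cball 0 \<bar>R\<bar> \<inter> {\<zeta>. Im \<zeta> \<ge> 0}"
  have K: "compact ?K" by (intro compact_Int_closed compact_cball closed_halfspace_Im_ge)
  have "0 \<in> ?K" by simp
  hence ne: "?K \<noteq> {}" by blast
  have "continuous_on ?K (\<lambda>\<zeta>. cmod (G \<zeta>))"
    by (intro continuous_on_norm continuous_on_subset[OF cont]) simp
  from continuous_attains_inf[OF K ne this]
  obtain w where w: "w \<in> ?K" "\<And>\<zeta>. \<zeta> \<in> ?K \<Longrightarrow> cmod (G w) \<le> cmod (G \<zeta>)" by blast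
  define m where "m = cmod (G w)"
  have m: "m > 0"
  proof -
    have "G w \<noteq> 0" using nz[of w] w(1) z by (auto simp: G_def)
    thus ?thesis by (simp add: m_def)
  qed
  \<comment> \<open>The first summand serves the half-disc, the second its exterior, where |\<zeta>
    - \<beta>| \<le> (1 + |\<beta>|) (1 + |\<zeta>|).\<close>
  define C where "C = 1 / m + (1 + cmod \<beta>) / c"
  have C: "C \<ge> 1 / m" "C \<ge> (1 + cmod \<beta>) / c" "C \<ge> 0" using m inf by (auto simp: C_def add_nonneg_nonneg)
  show thesis
  proof (rule that[of C])
    fix \<zeta> :: complex assume im: "Im \<zeta> \<ge> 0"
    show "cmod (\<zeta> - \<beta>) \<le> C * (1 + cmod \<zeta>) * cmod (D \<zeta>)"
    proof (cases "cmod \<zeta> \<le> \<bar>R\<bar>")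
      case True
      hence "m \<le> cmod (G \<zeta>)" unfolding m_def using im by (intro w) auto
      hence "cmod (\<zeta> - \<beta>) * m \<le> cmod (D \<zeta>)" unfolding DG norm_mult by (intro mult_left_mono) auto
      hence "cmod (\<zeta> - \<beta>) \<le> 1 / m * 1 * cmod (D \<zeta>)" using m by (simp add: field_simps)
      also have "\<dots> \<le> C * (1 + cmod \<zeta>) * cmod (D \<zeta>)" using C m by (intro mult_right_mono mult_mono) auto
      finally show ?thesis .
    next
      case False
      hence D: "c \<le> cmod (D \<zeta>)" using inf(2)[OF im] by simp
      have "cmod (\<zeta> - \<beta>) \<le> cmod \<zeta> + cmod \<beta>" by (rule norm_triangle_ineq4)
      also have "\<dots> \<le> (1 + cmod \<beta>) * (1 + cmod \<zeta>)" by (simp add: algebra_simps)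
      also have "\<dots> = (1 + cmod \<beta>) / c * (1 + cmod \<zeta>) * c" using inf by simp
      also have "\<dots> \<le> C * (1 + cmod \<zeta>) * cmod (D \<zeta>)"
        using C D inf by (intro mult_mono) (auto intro!: mult_nonneg_nonneg)
      finally show ?thesis .
    qed
  qed (use C in simp)
qed

text \<open>Turns the growth 1 + |\<zeta>| of the preceding bound into the denominator |\<zeta> -
  cnj \<beta>| of the bounded factor in \<open>hardy_blaschke_integral\<close>.\<close>

lemma one_plus_norm_le:
  assumes "Im \<beta> > 0" "Im \<zeta> \<ge> 0"
  shows "1 + cmod \<zeta> \<le> (1 + (1 + cmod \<beta>) / Im \<beta>) * cmod (\<zeta> - cnj \<beta>)"
proof -
  have "Im \<beta> \<le> \<bar>Im (\<zeta> - cnj \<beta>)\<bar>" using assms by simp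
  also have "\<dots> \<le> cmod (\<zeta> - cnj \<beta>)" by (rule abs_Im_le_cmod)
  finally have "1 + cmod \<beta> \<le> (1 + cmod \<beta>) / Im \<beta> * cmod (\<zeta> - cnj \<beta>)"
    using assms mult_left_mono[of "Im \<beta>" "cmod (\<zeta> - cnj \<beta>)" "(1 + cmod \<beta>) / Im \<beta>"] by simp
  moreover have "cmod \<zeta> \<le> cmod (\<zeta> - cnj \<beta>) + cmod \<beta>" using norm_triangle_ineq2[of \<zeta> "cnj \<beta>"] by simp
  ultimately show ?thesis by (simp add: algebra_simps)
qed

text \<open>Being built from the entire function \<open>plasma\<close>, it agrees with D in the
  upper half-plane only. In the lower one D at cnj \<zeta> is the conjugate of
  \<open>dispersion (- \<xi>) \<zeta>\<close>, so both signs of the frequency occur below.\<close>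

definition dispersion :: "real \<Rightarrow> complex \<Rightarrow> complex" where
  "dispersion \<xi> \<zeta> = \<i> * complex_of_real \<xi> - plasma \<zeta>"

lemma dispersion_has_field_derivative:
  "(dispersion \<xi> has_field_derivative (2 + 2 * z * plasma z)) (at z)"
  unfolding dispersion_def[abs_def]
  using DERIV_diff[OF DERIV_const plasma_ODE, of "\<i> * complex_of_real \<xi>" z] by (simp add: add.commute)

lemma dispersion_holomorphic: "dispersion \<xi> holomorphic_on S"
  unfolding holomorphic_on_def field_differentiable_def
  using dispersion_has_field_derivative has_field_derivative_at_within by blast

lemma dispersion_boundary:
  "((\<lambda>y. dispersion \<xi> (complex_of_real x + \<i> * complex_of_real y)) \<longlongrightarrow> dispersion \<xi> (complex_of_real x)) (at_right 0)"
proof -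
  have "((\<lambda>y. dispersion \<xi> (complex_of_real x + \<i> * complex_of_real y)) \<longlongrightarrow> dispersion \<xi> (complex_of_real x + \<i> * complex_of_real 0)) (at_right 0)"
    by (intro isCont_tendsto_compose[OF DERIV_isCont[OF dispersion_has_field_derivative]] tendsto_intros)
  thus ?thesis by simp
qed

lemma dispersion_quotient_bound:
  assumes "0 < \<xi>" "\<xi> \<le> sqrt pi"
  obtains y0 C where "y0 \<ge> 0" "\<xi> < sqrt pi \<Longrightarrow> y0 > 0" "\<xi> = sqrt pi \<Longrightarrow> y0 = 0" "y0 * \<xi> < 1"
    "\<And>\<zeta>. Im \<zeta> \<ge> 0 \<Longrightarrow> dispersion \<xi> \<zeta> = 0 \<longleftrightarrow> \<zeta> = \<i> * complex_of_real y0"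
    "(dispersion \<xi> has_field_derivative complex_of_real (2 - 2 * y0 * \<xi>)) (at (\<i> * complex_of_real y0))"
    "C \<ge> 0" "\<And>\<zeta>. Im \<zeta> \<ge> 0 \<Longrightarrow> cmod (\<zeta> - \<i> * complex_of_real y0) \<le> C * (1 + cmod \<zeta>) * cmod (dispersion \<xi> \<zeta>)"
proof -
  from assms obtain y0 where y0: "y0 \<ge> 0" "\<xi> < sqrt pi \<Longrightarrow> y0 > 0" "\<xi> = sqrt pi \<Longrightarrow> y0 = 0" "y0 * \<xi> < 1"
    "\<And>\<zeta>. Im \<zeta> \<ge> 0 \<Longrightarrow> plasma \<zeta> = \<i> * complex_of_real \<xi> \<longleftrightarrow> \<zeta> = \<i> * complex_of_real y0"
    by (rule plasma_zero_exists) blast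
  have z: "dispersion \<xi> \<zeta> = 0 \<longleftrightarrow> \<zeta> = \<i> * complex_of_real y0" if "Im \<zeta> \<ge> 0" for \<zeta>
    using y0(5)[OF that] by (auto simp: dispersion_def)
  have "plasma (\<i> * complex_of_real y0) = \<i> * complex_of_real \<xi>" using y0 by simp
  hence d: "(dispersion \<xi> has_field_derivative complex_of_real (2 - 2 * y0 * \<xi>)) (at (\<i> * complex_of_real y0))"
    using dispersion_has_field_derivative[of \<xi> "\<i> * complex_of_real y0"] by (simp add: algebra_simps)
  obtain C where C: "C \<ge> 0" "\<And>\<zeta>. Im \<zeta> \<ge> 0 \<Longrightarrow> cmod (\<zeta> - \<i> * complex_of_real y0) \<le> C * (1 + cmod \<zeta>) * cmod (dispersion \<xi> \<zeta>)"
  proof (rule zero_quotient_bound[OF dispersion_holomorphic])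
    show "dispersion \<xi> (\<i> * complex_of_real y0) = 0" using z y0 by simp
    show "deriv (dispersion \<xi>) (\<i> * complex_of_real y0) \<noteq> 0"
      using y0(4) unfolding DERIV_imp_deriv[OF d] of_real_eq_0_iff by (simp add: mult.assoc)
    show "\<xi> / 2 > 0" using assms by simp
    \<comment> \<open>The radius gives |\<zeta> + i| \<ge> 2 sqrt pi / \<xi>, and with the decay
      bound the imaginary part of \<open>plasma\<close> is at most \<xi> / 2.\<close>
    show "\<xi> / 2 \<le> cmod (dispersion \<xi> \<zeta>)" if "Im \<zeta> \<ge> 0" "cmod \<zeta> \<ge> 2 * sqrt pi / \<xi> + 1" for \<zeta>
    proof -
      have "2 * sqrt pi / \<xi> \<le> cmod (\<zeta> + \<i>)" using that(2) norm_triangle_ineq2[of \<zeta> "- \<i>"] by simp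
      moreover have "2 * sqrt pi / \<xi> > 0" using assms by simp
      moreover from calculation have "cmod (\<zeta> + \<i>) > 0" by linarith
      ultimately have "sqrt pi / cmod (\<zeta> + \<i>) \<le> sqrt pi / (2 * sqrt pi / \<xi>)"
        by (intro divide_left_mono mult_pos_pos) simp_all
      also have "\<dots> = \<xi> / 2" using assms by simp
      finally have "Im (plasma \<zeta>) \<le> \<xi> / 2" by (rule order_trans[OF Im_plasma_decay[OF that(1)]])
      hence "\<xi> / 2 \<le> Im (dispersion \<xi> \<zeta>)" by (simp add: dispersion_def)
      also have "\<dots> \<le> cmod (dispersion \<xi> \<zeta>)" using abs_Im_le_cmod[of "dispersion \<xi> \<zeta>"] by simp
      finally show ?thesis .
    qed
    show "dispersion \<xi> \<zeta> \<noteq> 0" if "Im \<zeta> \<ge> 0" "\<zeta> \<noteq> \<i> * complex_of_real y0" for \<zeta> using z[OF that(1)] that(2) by simp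
  qed (rule that, assumption+)
  show thesis by (rule that[OF y0(1-4) z d C]) assumption+
qed

lemma dispersion_bound_supercritical:
  assumes "\<xi> > sqrt pi" "Im \<zeta> > 0"
  shows "\<xi> - sqrt pi \<le> cmod (dispersion \<xi> \<zeta>)"
proof -
  have "\<xi> - sqrt pi \<le> Im (dispersion \<xi> \<zeta>)"
    using Im_cauchy_tr_gauss_bounds(2)[OF assms(2)] cauchy_tr_gauss_plasma[OF assms(2)] by (simp add: dispersion_def)
  also have "\<dots> \<le> cmod (dispersion \<xi> \<zeta>)" using abs_Im_le_cmod[of "dispersion \<xi> \<zeta>"] by simp
  finally show ?thesis .
qed

text \<open>By conjugation this bounds D from below in the lower half-plane, so the lower term has
  no pole to contribute.\<close>

lemma dispersion_bound_negative:
  assumes "\<xi> > 0" "Im \<zeta> > 0"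
  shows "\<xi> \<le> cmod (dispersion (- \<xi>) \<zeta>)"
proof -
  have "\<xi> \<le> - Im (dispersion (- \<xi>) \<zeta>)"
    using Im_cauchy_tr_gauss_bounds(1)[OF assms(2)] cauchy_tr_gauss_plasma[OF assms(2)] by (simp add: dispersion_def)
  also have "\<dots> \<le> cmod (dispersion (- \<xi>) \<zeta>)" using abs_Im_le_cmod[of "dispersion (- \<xi>) \<zeta>"] by simp
  finally show ?thesis .
qed

section \<open>The generalized Fourier transforms for positive frequency\<close>

lemma tendsto_at_left_0_iff:
  "((f :: real \<Rightarrow> 'a::topological_space) \<longlongrightarrow> L) (at_left 0) \<longleftrightarrow> ((\<lambda>x. f (- x)) \<longlongrightarrow> L) (at_right 0)"
  using filterlim_at_left_to_right[of f "nhds L" 0] by simp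

lemma Lim_at_left_0: "Lim (at_left (0::real)) f = Lim (at_right 0) (\<lambda>x. f (- x))"
  by (simp add: t2_space_class.Lim_def tendsto_at_left_0_iff)

text \<open>The Cauchy criterion with countably many test points, so that the set where a limit
  exists is measurable in a parameter. Continuity extends the estimate from the rationals.\<close>

lemma convergent_at_right_0_iff_rational_Cauchy:
  fixes g :: "real \<Rightarrow> complex"
  assumes cont: "continuous_on {0<..} g"
  shows "(\<exists>L. (g \<longlongrightarrow> L) (at_right 0)) \<longleftrightarrow>
    (\<forall>n::nat. \<exists>m::nat. \<forall>p\<in>{0<..<inverse (real (Suc m))} \<inter> \<rat>. \<forall>q\<in>{0<..<inverse (real (Suc m))} \<inter> \<rat>.
      cmod (g p - g q) \<le> inverse (real (Suc n)))" (is "?L \<longleftrightarrow> ?R")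
proof
  assume ?L
  then obtain L where L: "(g \<longlongrightarrow> L) (at_right 0)" ..
  show ?R
  proof
    fix n :: nat
    let ?e = "inverse (real (Suc n)) / 2"
    have "\<forall>\<^sub>F x in at_right 0. dist (g x) L < ?e" by (rule tendstoD[OF L]) simp
    then obtain d where d: "d > 0" "\<And>x. 0 < x \<Longrightarrow> x < d \<Longrightarrow> dist (g x) L < ?e" by (auto simp: eventually_at_right_field)
    obtain m where m: "inverse (real (Suc m)) < d" using reals_Archimedean[OF d(1)] by blast
    show "\<exists>m. \<forall>p\<in>{0<..<inverse (real (Suc m))} \<inter> \<rat>. \<forall>q\<in>{0<..<inverse (real (Suc m))} \<inter> \<rat>. cmod (g p - g q) \<le> inverse (real (Suc n))"
    proof (intro exI[of _ m] ballI)
      fix p q assume "p \<in> {0<..<inverse (real (Suc m))} \<inter> \<rat>" "q \<in> {0<..<inverse (real (Suc m))} \<inter> \<rat>"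
      hence "0 < p" "p < d" "0 < q" "q < d" using m by auto
      hence "dist (g p) L < ?e" "dist (g q) L < ?e" using d(2)[of p] d(2)[of q] by blast+
      hence "dist (g p) (g q) < ?e + ?e" using dist_triangle2[of "g p" "g q" L] by linarith
      thus "cmod (g p - g q) \<le> inverse (real (Suc n))" by (simp only: dist_norm field_sum_of_halves less_imp_le)
    qed
  qed
next
  assume R: ?R
  have all: "\<exists>d>0. \<forall>p q. 0 < p \<longrightarrow> p < d \<longrightarrow> 0 < q \<longrightarrow> q < d \<longrightarrow> cmod (g p - g q) \<le> e" if e: "e > 0" for e
  proof -
    obtain n where n: "inverse (real (Suc n)) < e" using reals_Archimedean[OF e] by blast
    obtain m where m: "\<And>p q. p \<in> {0<..<inverse (real (Suc m))} \<inter> \<rat> \<Longrightarrow> q \<in> {0<..<inverse (real (Suc m))} \<inter> \<rat> \<Longrightarrow>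
      cmod (g p - g q) \<le> inverse (real (Suc n))" using R by meson
    let ?d = "inverse (real (Suc m))"
    have approx: "\<exists>X. (\<forall>k. X k \<in> {0<..<?d} \<inter> \<rat>) \<and> X \<longlonglongrightarrow> p" if p: "0 < p" "p < ?d" for p
    proof -
      have "\<exists>r. r \<in> {0<..<?d} \<inter> \<rat> \<and> \<bar>r - p\<bar> < inverse (real (Suc k))" for k :: nat
      proof -
        have "max 0 (p - inverse (real (Suc k))) < p" using p by simp
        from Rats_dense_in_real[OF this] obtain r where r: "r \<in> \<rat>" "max 0 (p - inverse (real (Suc k))) < r" "r < p" by blast
        thus ?thesis using p by (intro exI[of _ r]) auto
      qed
      then obtain X where X: "\<And>k. X k \<in> {0<..<?d} \<inter> \<rat>" "\<And>k. \<bar>X k - p\<bar> < inverse (real (Suc k))" by metis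
      have "(\<lambda>k. X k - p) \<longlonglongrightarrow> 0"
        by (rule Lim_null_comparison[OF _ LIMSEQ_inverse_real_of_nat]) (use X(2) in \<open>auto intro!: always_eventually less_imp_le\<close>)
      hence "X \<longlonglongrightarrow> p" by (rule LIM_zero_cancel)
      thus ?thesis using X(1) by blast
    qed
    show ?thesis
    proof (intro exI[of _ ?d] conjI allI impI)
      fix p q assume p: "0 < p" "p < ?d" and q: "0 < q" "q < ?d"
      obtain X where X: "\<And>k. X k \<in> {0<..<?d} \<inter> \<rat>" "X \<longlonglongrightarrow> p" using approx[OF p] by blast
      obtain Y where Y: "\<And>k. Y k \<in> {0<..<?d} \<inter> \<rat>" "Y \<longlonglongrightarrow> q" using approx[OF q] by blast
      have gX: "(\<lambda>k. g (X k)) \<longlonglongrightarrow> g p" and gY: "(\<lambda>k. g (Y k)) \<longlonglongrightarrow> g q"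
        using X Y p q by (auto intro!: continuous_on_tendsto_compose[OF cont] always_eventually)
      have "(\<lambda>k. cmod (g (X k) - g (Y k))) \<longlonglongrightarrow> cmod (g p - g q)" by (intro tendsto_intros gX gY)
      hence "cmod (g p - g q) \<le> inverse (real (Suc n))"
        by (rule LIMSEQ_le_const2) (use m X Y in blast)
      thus "cmod (g p - g q) \<le> e" using n by simp
    qed simp
  qed
  define Y where "Y = (\<lambda>k. inverse (real (Suc k)))"
  have Y: "\<And>k. Y k > 0" "Y \<longlonglongrightarrow> 0" unfolding Y_def by (simp, rule LIMSEQ_inverse_real_of_nat)
  have "Cauchy (\<lambda>k. g (Y k))"
  proof (rule metric_CauchyI)
    fix e :: real assume e: "e > 0"
    obtain d where d: "d > 0" "\<And>p q. 0 < p \<Longrightarrow> p < d \<Longrightarrow> 0 < q \<Longrightarrow> q < d \<Longrightarrow> cmod (g p - g q) \<le> e / 2"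
      using all[of "e / 2"] e by (meson half_gt_zero)
    have "\<forall>\<^sub>F k in sequentially. Y k < d" by (rule order_tendstoD(2)[OF Y(2) d(1)])
    then obtain M where M: "\<And>k. k \<ge> M \<Longrightarrow> Y k < d" unfolding eventually_sequentially by blast
    show "\<exists>M. \<forall>m\<ge>M. \<forall>n\<ge>M. dist (g (Y m)) (g (Y n)) < e"
    proof (intro exI[of _ M] allI impI)
      fix m n assume "M \<le> m" "M \<le> n"
      hence "cmod (g (Y m) - g (Y n)) \<le> e / 2" by (intro d(2) Y M)
      thus "dist (g (Y m)) (g (Y n)) < e" using e by (simp add: dist_norm)
    qed
  qed
  then obtain L where L: "(\<lambda>k. g (Y k)) \<longlonglongrightarrow> L" using Cauchy_convergent convergent_def by blast
  have "(g \<longlongrightarrow> L) (at_right 0)"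
    unfolding tendsto_iff
  proof (intro allI impI)
    fix e :: real assume e: "e > 0"
    obtain d where d: "d > 0" "\<And>p q. 0 < p \<Longrightarrow> p < d \<Longrightarrow> 0 < q \<Longrightarrow> q < d \<Longrightarrow> cmod (g p - g q) \<le> e / 2"
      using all[of "e / 2"] e by (meson half_gt_zero)
    show "\<forall>\<^sub>F x in at_right 0. dist (g x) L < e"
      unfolding eventually_at_right_field
    proof (intro exI[of _ d] conjI allI impI d(1))
      fix x assume x: "0 < x" "x < d"
      have "(\<lambda>k. cmod (g x - g (Y k))) \<longlonglongrightarrow> cmod (g x - L)" by (intro tendsto_intros L)
      moreover have "\<forall>\<^sub>F k in sequentially. cmod (g x - g (Y k)) \<le> e / 2"
        using order_tendstoD(2)[OF Y(2) d(1)] by eventually_elim (intro d(2) x Y)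
      ultimately have "cmod (g x - L) \<le> e / 2" by (rule tendsto_upperbound) simp
      thus "dist (g x) L < e" using e by (simp add: dist_norm)
    qed
  qed
  thus ?L ..
qed

text \<open>\<open>Lim\<close> is a definite description: where no limit exists its value is
  \<open>THE L. False\<close>, the same for every such x. The function thus equals a limit of a
  sequence on the measurable set A and a constant off it.\<close>

lemma borel_measurable_Lim_at_right_0:
  fixes G :: "real \<Rightarrow> real \<Rightarrow> complex"
  assumes m: "\<And>y. y > 0 \<Longrightarrow> (\<lambda>x. G y x) \<in> borel_measurable borel"
    and c: "\<And>x. continuous_on {0<..} (\<lambda>y. G y x)"
  shows "(\<lambda>x. Lim (at_right 0) (\<lambda>y. G y x)) \<in> borel_measurable borel"
proof -
  define A where "A = {x. \<forall>n::nat. \<exists>m::nat. \<forall>p\<in>{0<..<inverse (real (Suc m))} \<inter> \<rat>. \<forall>q\<in>{0<..<inverse (real (Suc m))} \<inter> \<rat>.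
      cmod (G p x - G q x) \<le> inverse (real (Suc n))}"
  have A: "x \<in> A \<longleftrightarrow> (\<exists>L. ((\<lambda>y. G y x) \<longlongrightarrow> L) (at_right 0))" for x
    unfolding A_def using convergent_at_right_0_iff_rational_Cauchy[OF c] by simp
  define Y where "Y = (\<lambda>k. inverse (real (Suc k)))"
  have Y: "\<And>k. Y k > 0" "Y \<longlonglongrightarrow> 0" unfolding Y_def by (simp, rule LIMSEQ_inverse_real_of_nat)
  have Y': "filterlim Y (at_right 0) sequentially"
    using Y less_imp_neq[OF Y(1), symmetric] by (auto simp: filterlim_at)
  have Lim: "Lim (at_right 0) (\<lambda>y. G y x) = (if x \<in> A then lim (\<lambda>k. G (Y k) x) else (THE L. False))" for x
  proof (cases "x \<in> A")
    case True
    then obtain L where L: "((\<lambda>y. G y x) \<longlongrightarrow> L) (at_right 0)" using A by blast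
    have "Lim (at_right 0) (\<lambda>y. G y x) = L" by (rule tendsto_Lim[OF trivial_limit_at_right_real L])
    moreover have "lim (\<lambda>k. G (Y k) x) = L" by (rule limI[OF filterlim_compose[OF L Y']])
    ultimately show ?thesis using True by simp
  next
    case False
    hence "((\<lambda>y. G y x) \<longlongrightarrow> L) (at_right 0) = False" for L using A by blast
    thus ?thesis using False by (simp add: t2_space_class.Lim_def)
  qed
  have "Measurable.pred borel (\<lambda>x. cmod (G p x - G q x) \<le> inverse (real (Suc n)))" if "p > 0" "q > 0" for p q n
    using m[OF that(1)] m[OF that(2)] by measurable
  note P = this
  have cnt: "countable ({0<..<inverse (real (Suc m))} \<inter> \<rat>)" for m
    by (rule countable_Int2[OF countable_rat])
  have ball: "Measurable.pred borel (\<lambda>x. \<forall>p\<in>X. R p x)"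
    if "countable X" "\<And>p. p \<in> X \<Longrightarrow> Measurable.pred borel (R p)" for X :: "real set" and R :: "real \<Rightarrow> real \<Rightarrow> bool"
    unfolding pred_def by (rule sets.sets_Collect_countable_All'[OF _ that(1)]) (use that(2) in \<open>simp add: pred_def\<close>)
  have p: "Measurable.pred borel (\<lambda>x. \<forall>n::nat. \<exists>m::nat. \<forall>p\<in>{0<..<inverse (real (Suc m))} \<inter> \<rat>. \<forall>q\<in>{0<..<inverse (real (Suc m))} \<inter> \<rat>.
      cmod (G p x - G q x) \<le> inverse (real (Suc n)))"
    by (intro pred_intros_countable ball[OF cnt] P) auto
  have sA [measurable]: "A \<in> sets borel" unfolding A_def using p by (simp add: pred_def)
  have [measurable]: "(\<lambda>x. lim (\<lambda>k. G (Y k) x)) \<in> borel_measurable borel" using m[OF Y(1)] by measurable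
  show ?thesis unfolding Lim by measurable
qed

text \<open>Conjugation turns the approach from below into an approach from above for the conjugate
  function, the side that \<open>hardy_boundary\<close> covers.\<close>

lemma S_hat_minus:
  "S_hat (- 1) h l = Lim (at_right 0) (\<lambda>y. cnj (cauchy_tr (\<lambda>t. cnj (h t)) (complex_of_real l + \<i> * complex_of_real y)))"
proof -
  have "cauchy_tr h (complex_of_real l + \<i> * complex_of_real (- y)) = cnj (cauchy_tr (\<lambda>t. cnj (h t)) (complex_of_real l + \<i> * complex_of_real y))" for y
    using cauchy_tr_cnj[of "\<lambda>t. cnj (h t)" "complex_of_real l + \<i> * complex_of_real y"] by simp
  thus ?thesis by (simp add: S_hat_def side_def Lim_at_left_0 cauchy_tr_def[symmetric])
qed

lemma S_hat_minus_measurable: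
  assumes h: "integrable lborel h"
  shows "S_hat (- 1) h \<in> borel_measurable borel"
proof -
  let ?k = "\<lambda>t. cnj (h t)"
  have k: "integrable lborel ?k" using h by simp
  show ?thesis
    unfolding S_hat_minus[abs_def]
  proof (rule borel_measurable_Lim_at_right_0)
    fix y :: real assume "y > 0"
    from cauchy_tr_measurable[OF k, of y] this have [measurable]: "(\<lambda>x. cauchy_tr ?k (complex_of_real x + \<i> * complex_of_real y)) \<in> borel_measurable borel" by simp
    show "(\<lambda>x. cnj (cauchy_tr ?k (complex_of_real x + \<i> * complex_of_real y))) \<in> borel_measurable borel"
      by (rule borel_measurable_continuous_on[of cnj]) (auto intro: continuous_intros)
  next
    fix x
    show "continuous_on {0<..} (\<lambda>y. cnj (cauchy_tr ?k (complex_of_real x + \<i> * complex_of_real y)))"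
      by (intro continuous_on_cnj continuous_on_compose2[OF holomorphic_on_imp_continuous_on[OF cauchy_tr_holomorphic[OF k, of "{z. Im z > 0}"]]])
        (auto intro!: continuous_intros)
  qed
qed

lemma S_hat_minus_AE:
  assumes "hardy_boundary (\<lambda>t. cnj (h t)) \<phi>'"
  shows "AE l in lborel. S_hat (- 1) h l = cnj (\<phi>' l)"
proof -
  have "AE l in lborel. ((\<lambda>y. cauchy_tr (\<lambda>t. cnj (h t)) (complex_of_real l + \<i> * complex_of_real y)) \<longlongrightarrow> \<phi>' l) (at_right 0)"
    using assms by (simp add: hardy_boundary_def)
  thus ?thesis
  proof eventually_elim
    case (elim l)
    show ?case unfolding S_hat_minus by (intro tendsto_Lim trivial_limit_at_right_real tendsto_cnj elim)
  qed
qed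

section \<open>The spectral determinant and its boundary values through D\<close>

lemma omega_cauchy_tr:
  assumes "\<xi> \<noteq> 0"
  shows "omega z \<xi> = 1 - cauchy_tr gauss (\<i> * (1 + z) / complex_of_real \<xi>) / (\<i> * complex_of_real \<xi>)"
proof -
  have "\<i> * complex_of_real v * complex_of_real \<xi> + 1 + z = \<i> * complex_of_real \<xi> * (complex_of_real v - \<i> * (1 + z) / complex_of_real \<xi>)" for v
    using assms by (simp add: field_simps)
  hence "complex_of_real (wt v) / (\<i> * complex_of_real v * complex_of_real \<xi> + 1 + z) 
      = (gauss v / (complex_of_real v - \<i> * (1 + z) / complex_of_real \<xi>)) / (\<i> * complex_of_real \<xi>)" for v
    by (simp only: gauss_def divide_divide_eq_left mult.commute)
  thus ?thesis unfolding omega_def cauchy_tr_def by (simp only: integral_divide_zero)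
qed

lemma omega_dispersion:
  assumes "\<xi> > 0" "Re z > -1"
  shows "omega z \<xi> = dispersion \<xi> (\<i> * (1 + z) / complex_of_real \<xi>) / (\<i> * complex_of_real \<xi>)"
proof -
  have "Im (\<i> * (1 + z) / complex_of_real \<xi>) > 0" using assms by (simp add: Im_divide_of_real)
  from cauchy_tr_gauss_plasma[OF this] show ?thesis
    using omega_cauchy_tr[of \<xi> z] assms by (simp add: dispersion_def diff_divide_distrib)
qed

lemma omega_plus_dispersion:
  assumes \<xi>: "\<xi> > 0"
  shows "omega_plus (- 1 - \<i> * complex_of_real l * complex_of_real \<xi>) \<xi> = dispersion \<xi> (complex_of_real l) / (\<i> * complex_of_real \<xi>)"
  unfolding omega_plus_def
proof (rule tendsto_Lim[OF trivial_limit_at_right_real])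
  let ?z = "\<lambda>\<delta>. - 1 - \<i> * complex_of_real l * complex_of_real \<xi> + complex_of_real \<delta>"
  \<comment> \<open>A distance \<delta> from the line Re z = -1 becomes a height \<delta> / \<xi>
    above the real axis.\<close>
  have ar: "\<i> * (1 + ?z \<delta>) / complex_of_real \<xi> = complex_of_real l + \<i> * complex_of_real (\<delta> / \<xi>)" for \<delta>
    using \<xi> by (simp add: field_simps)
  have "filterlim (\<lambda>\<delta>. \<delta> / \<xi>) (at_right 0) (at_right 0)"
    using \<xi> by (auto simp: filterlim_at eventually_at_right_less intro!: tendsto_divide_zero eventually_at_rightI[of 0 1])
  from filterlim_compose[OF dispersion_boundary this]
  have "((\<lambda>\<delta>. dispersion \<xi> (complex_of_real l + \<i> * complex_of_real (\<delta> / \<xi>)) / (\<i> * complex_of_real \<xi>)) \<longlongrightarrow>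
     dispersion \<xi> (complex_of_real l) / (\<i> * complex_of_real \<xi>)) (at_right 0)"
    by (rule tendsto_divide[OF _ tendsto_const]) (use \<xi> in simp)
  moreover have "\<forall>\<^sub>F \<delta> in at_right 0. dispersion \<xi> (complex_of_real l + \<i> * complex_of_real (\<delta> / \<xi>)) / (\<i> * complex_of_real \<xi>) = omega (?z \<delta>) \<xi>"
    using eventually_at_right_less[of "0::real"]
  proof eventually_elim
    case (elim \<delta>)
    thus ?case unfolding ar[symmetric] by (intro omega_dispersion[OF \<xi>, symmetric]) simp
  qed
  ultimately show "((\<lambda>\<delta>. omega (?z \<delta>) \<xi>) \<longlongrightarrow> dispersion \<xi> (complex_of_real l) / (\<i> * complex_of_real \<xi>)) (at_right 0)"
    by (rule Lim_transform_eventually)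
qed

text \<open>At the frequency -\<xi> the approach to Re z = -1 from the left is again an approach to
  the real axis from above, because the map i (1 + z) / (-\<xi>) reverses orientation twice.\<close>

lemma omega_minus_dispersion:
  assumes \<xi>: "\<xi> > 0"
  shows "omega_minus (- 1 + \<i> * complex_of_real l * complex_of_real \<xi>) (- \<xi>) = - dispersion (- \<xi>) (complex_of_real l) / (\<i> * complex_of_real \<xi>)"
  unfolding omega_minus_def
proof (rule tendsto_Lim[OF trivial_limit_at_right_real])
  let ?z = "\<lambda>\<delta>. - 1 + \<i> * complex_of_real l * complex_of_real \<xi> - complex_of_real \<delta>"
  have ar: "\<i> * (1 + ?z \<delta>) / complex_of_real (- \<xi>) = complex_of_real l + \<i> * complex_of_real (\<delta> / \<xi>)" for \<delta>
    using \<xi> by (simp add: field_simps)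
  have "filterlim (\<lambda>\<delta>. \<delta> / \<xi>) (at_right 0) (at_right 0)"
    using \<xi> by (auto simp: filterlim_at eventually_at_right_less intro!: tendsto_divide_zero eventually_at_rightI[of 0 1])
  from filterlim_compose[OF dispersion_boundary this]
  have "((\<lambda>\<delta>. - dispersion (- \<xi>) (complex_of_real l + \<i> * complex_of_real (\<delta> / \<xi>)) / (\<i> * complex_of_real \<xi>)) \<longlongrightarrow>
     - dispersion (- \<xi>) (complex_of_real l) / (\<i> * complex_of_real \<xi>)) (at_right 0)"
    by (intro tendsto_divide[OF tendsto_minus tendsto_const]) (use \<xi> in simp_all)
  moreover have "\<forall>\<^sub>F \<delta> in at_right 0. - dispersion (- \<xi>) (complex_of_real l + \<i> * complex_of_real (\<delta> / \<xi>)) / (\<i> * complex_of_real \<xi>) = omega (?z \<delta>) (- \<xi>)"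
    using eventually_at_right_less[of "0::real"]
  proof eventually_elim
    case (elim \<delta>)
    have p: "Im (complex_of_real l + \<i> * complex_of_real (\<delta> / \<xi>)) > 0" using elim \<xi> by simp
    have "omega (?z \<delta>) (- \<xi>) = 1 - cauchy_tr gauss (complex_of_real l + \<i> * complex_of_real (\<delta> / \<xi>)) / (\<i> * complex_of_real (- \<xi>))"
      unfolding ar[symmetric] by (rule omega_cauchy_tr) (use \<xi> in simp)
    thus ?case unfolding cauchy_tr_gauss_plasma[OF p] using \<xi> by (simp add: dispersion_def field_simps)
  qed
  ultimately show "((\<lambda>\<delta>. omega (?z \<delta>) (- \<xi>)) \<longlongrightarrow> - dispersion (- \<xi>) (complex_of_real l) / (\<i> * complex_of_real \<xi>)) (at_right 0)"
    by (rule Lim_transform_eventually)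
qed

lemma dispersion_real_continuous: "continuous_on UNIV (\<lambda>l. dispersion \<xi> (complex_of_real l))"
  by (rule continuous_on_compose2[OF holomorphic_on_imp_continuous_on[OF dispersion_holomorphic[of \<xi> UNIV]]])
    (auto intro!: continuous_intros)

lemma dispersion_real_measurable [measurable]: "(\<lambda>l. dispersion \<xi> (complex_of_real l)) \<in> borel_measurable borel"
  by (rule borel_measurable_continuous_onI[OF dispersion_real_continuous])

lemma cnj_measurable [measurable]: "f \<in> borel_measurable M \<Longrightarrow> (\<lambda>x. cnj (f x)) \<in> borel_measurable M"
  by (rule borel_measurable_continuous_on[of cnj]) (auto intro: continuous_intros)

lemma B_tr_eq:
  assumes "\<xi> > 0"
  shows "B_tr \<xi> f l = f l + S_hat (- 1) (\<lambda>z. f z * gauss z) l / cnj (dispersion (- \<xi>) (complex_of_real l))"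
  using assms unfolding B_tr_def omega_minus_dispersion[OF assms] by (simp add: gauss_def)

lemma U_tr_eq:
  assumes "\<xi> > 0"
  shows "U_tr \<xi> f l = f l + S_hat (- 1) (\<lambda>z. f z * gauss z) l / cnj (dispersion \<xi> (complex_of_real l))"
  using assms unfolding U_tr_def omega_plus_dispersion[OF assms] by (simp add: gauss_def)

text \<open>The weight is integrable and bounded by 1 / sqrt pi, so f w lies in the unweighted L^1
  and L^2, where the boundary theory applies.\<close>

lemma L2w_weighted:
  assumes "f \<in> L2w"
  shows "integrable lborel (\<lambda>t. f t * gauss t)" "L2_fun (\<lambda>t. f t * gauss t)"
proof -
  have [measurable]: "f \<in> borel_measurable borel" and i: "integrable lborel (\<lambda>v. (cmod (f v))\<^sup>2 * wt v)"
    using assms by (auto simp: L2w_def)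
  have le: "cmod (f t) \<le> (cmod (f t))\<^sup>2 + 1" for t
  proof -
    have "2 * cmod (f t) \<le> (cmod (f t))\<^sup>2 + 1" using zero_le_power2[of "cmod (f t) - 1"] unfolding power2_diff by simp
    thus ?thesis using norm_ge_zero[of "f t"] by linarith
  qed
  show "integrable lborel (\<lambda>t. f t * gauss t)"
  proof (rule Bochner_Integration.integrable_bound[OF Bochner_Integration.integrable_add[OF i wt_integrable]])
    show "AE t in lborel. norm (f t * gauss t) \<le> norm ((cmod (f t))\<^sup>2 * wt t + wt t)"
    proof (intro AE_I2)
      fix t
      have "cmod (f t) * wt t \<le> ((cmod (f t))\<^sup>2 + 1) * wt t" by (intro mult_right_mono le wt_nonneg)
      also have "\<dots> \<le> \<bar>(cmod (f t))\<^sup>2 * wt t + wt t\<bar>" by (simp add: algebra_simps)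
      finally show "norm (f t * gauss t) \<le> norm ((cmod (f t))\<^sup>2 * wt t + wt t)"
        by (simp add: norm_mult gauss_def wt_nonneg)
    qed
  qed measurable
  have "integrable lborel (\<lambda>t. (cmod (f t * gauss t))\<^sup>2)"
  proof (rule Bochner_Integration.integrable_bound)
    show "integrable lborel (\<lambda>t. 1 / sqrt pi * ((cmod (f t))\<^sup>2 * wt t))" using i by (rule integrable_mult_right)
    show "AE t in lborel. norm ((cmod (f t * gauss t))\<^sup>2) \<le> norm (1 / sqrt pi * ((cmod (f t))\<^sup>2 * wt t))"
    proof (intro AE_I2)
      fix t
      have "((cmod (f t))\<^sup>2 * wt t) * wt t \<le> ((cmod (f t))\<^sup>2 * wt t) * (1 / sqrt pi)"
        by (intro mult_left_mono wt_le mult_nonneg_nonneg wt_nonneg) auto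
      moreover have "(cmod (f t * gauss t))\<^sup>2 = ((cmod (f t))\<^sup>2 * wt t) * wt t"
        by (simp add: norm_mult gauss_def wt_nonneg power_mult_distrib power2_eq_square)
      ultimately show "norm ((cmod (f t * gauss t))\<^sup>2) \<le> norm (1 / sqrt pi * ((cmod (f t))\<^sup>2 * wt t))"
        using wt_nonneg[of t] by (simp add: mult.commute)
    qed
  qed measurable
  thus "L2_fun (\<lambda>t. f t * gauss t)" by (simp add: L2_fun_def)
qed

lemma L2w_cnj: "f \<in> L2w \<Longrightarrow> (\<lambda>t. cnj (f t)) \<in> L2w"
  by (auto simp: L2w_def intro: cnj_measurable)

lemma L2w_inner_integrable:
  assumes "f \<in> L2w" "g \<in> L2w"
  shows "integrable lborel (\<lambda>v. f v * cnj (g v) * gauss v)"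
proof -
  have [measurable]: "f \<in> borel_measurable borel" "g \<in> borel_measurable borel"
    and i: "integrable lborel (\<lambda>v. (cmod (f v))\<^sup>2 * wt v)" "integrable lborel (\<lambda>v. (cmod (g v))\<^sup>2 * wt v)"
    using assms by (auto simp: L2w_def)
  show ?thesis
  proof (rule Bochner_Integration.integrable_bound[OF Bochner_Integration.integrable_add[OF i]])
    show "AE t in lborel. norm (f t * cnj (g t) * gauss t) \<le> norm ((cmod (f t))\<^sup>2 * wt t + (cmod (g t))\<^sup>2 * wt t)"
    proof (intro AE_I2)
      fix t
      have "2 * (cmod (f t) * cmod (g t)) \<le> (cmod (f t))\<^sup>2 + (cmod (g t))\<^sup>2"
        using zero_le_power2[of "cmod (f t) - cmod (g t)"] unfolding power2_diff by simp
      moreover have "0 \<le> cmod (f t) * cmod (g t)" by simp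
      ultimately have "cmod (f t) * cmod (g t) \<le> (cmod (f t))\<^sup>2 + (cmod (g t))\<^sup>2" by linarith
      hence "cmod (f t) * cmod (g t) * wt t \<le> ((cmod (f t))\<^sup>2 + (cmod (g t))\<^sup>2) * wt t" by (intro mult_right_mono wt_nonneg)
      also have "\<dots> \<le> \<bar>(cmod (f t))\<^sup>2 * wt t + (cmod (g t))\<^sup>2 * wt t\<bar>" by (simp add: algebra_simps)
      finally show "norm (f t * cnj (g t) * gauss t) \<le> norm ((cmod (f t))\<^sup>2 * wt t + (cmod (g t))\<^sup>2 * wt t)"
        by (simp add: norm_mult gauss_def wt_nonneg)
    qed
  qed measurable
qed

lemma L2w_inner_gauss: "L2w_inner f g = (LINT v|lborel. f v * cnj (g v) * gauss v)"
  by (simp add: L2w_inner_def gauss_def)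

text \<open>Multiplying out with the jump relations \<open>F\<^sub>+ - F\<^sub>- = 2 \<pi> \<i> f w\<close>, and similarly for \<open>K\<close> and \<open>D\<close>,
  the product of the two transforms telescopes.\<close>

lemma jump_identity:
  fixes a b c e d1 d2 F G w P :: complex
  assumes "F * w * P = a - b" "G * w * P = c - e" "w * P = d2 - d1" "d1 \<noteq> 0" "d2 \<noteq> 0" "P \<noteq> 0"
  shows "(F + b / d2) * (G + c / d1) * w = F * G * w + (1 / P) * (a * c / d1 - b * e / d2)"
proof -
  have fw: "F * w = (a - b) / P" "G * w = (c - e) / P" "w = (d2 - d1) / P" using assms by (simp_all add: field_simps)
  have "(F + b / d2) * (G + c / d1) * w = F * G * w + (F * w) * c / d1 + (G * w) * b / d2 + b * c / (d1 * d2) * w"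
    by (simp add: algebra_simps)
  also have "\<dots> = F * G * w + ((a - b) / P) * c / d1 + ((c - e) / P) * b / d2 + b * c / (d1 * d2) * ((d2 - d1) / P)"
    unfolding fw(1,2) by (subst (2) fw(3)) (rule refl)
  also have "\<dots> = F * G * w + (1 / P) * (a * c / d1 - b * e / d2)"
    using assms(4-6) by (simp add: divide_simps) (simp add: algebra_simps)
  finally show ?thesis .
qed

text \<open>The derivative exp (x^2) of the primitive is real on the real line, so its imaginary
  part stays at its value 0 at the origin. This is the jump relation of W at every point of the
  line.\<close>

lemma Im_plasma_real: "Im (plasma (complex_of_real x)) = pi * wt x"
proof -
  define f where "f = (\<lambda>x. Im (exp_square_primitive (complex_of_real x)))"
  have d: "(f has_real_derivative 0) (at x)" for x
  proof -
    have "((\<lambda>x. exp_square_primitive (complex_of_real x)) has_vector_derivative exp ((complex_of_real x)\<^sup>2)) (at x)"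
      by (rule has_vector_derivative_real_field[OF exp_square_primitive(2)])
    from bounded_linear.has_vector_derivative[OF bounded_linear_Im this]
    have "(f has_vector_derivative Im (exp ((complex_of_real x)\<^sup>2))) (at x)" by (simp add: f_def)
    moreover have "Im (exp ((complex_of_real x)\<^sup>2)) = 0"
      by (simp only: of_real_power[symmetric] exp_of_real Im_complex_of_real)
    ultimately show ?thesis by (simp add: has_real_derivative_iff_has_vector_derivative)
  qed
  have "f x = f 0" by (rule DERIV_isconst_all) (use d in blast)
  hence f: "f x = 0" by (simp add: f_def exp_square_primitive)
  have e: "exp (- (complex_of_real x)\<^sup>2) = complex_of_real (exp (- x\<^sup>2))" by (simp add: exp_of_real[symmetric])
  have "Im (plasma (complex_of_real x)) = exp (- x\<^sup>2) * (sqrt pi - 2 * f x)"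
    unfolding plasma_def e by (simp add: f_def)
  also have "\<dots> = pi * wt x" using f real_div_sqrt[of pi] by (simp add: wt_def field_simps)
  finally show ?thesis .
qed

lemma dispersion_negative_real_nonzero:
  assumes "\<xi> > 0" shows "dispersion (- \<xi>) (complex_of_real l) \<noteq> 0"
proof -
  have "Im (dispersion (- \<xi>) (complex_of_real l)) = - \<xi> - pi * wt l" by (simp add: dispersion_def Im_plasma_real)
  also have "\<dots> < 0" using assms wt_nonneg[of l] by (simp add: less_le_trans[of _ 0])
  finally show ?thesis by auto
qed

lemma dispersion_real_nonzero:
  assumes "l \<noteq> 0" shows "dispersion \<xi> (complex_of_real l) \<noteq> 0"
proof -
  have "Re (dispersion \<xi> (complex_of_real l)) = - Re (plasma (complex_of_real l))" by (simp add: dispersion_def)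
  thus ?thesis using Re_plasma_real[OF assms] by auto
qed

section \<open>The product of the two transforms and its integral\<close>

lemma B_tr_measurable:
  assumes "\<xi> > 0" "f \<in> L2w" shows "B_tr \<xi> f \<in> borel_measurable borel"
proof -
  have [measurable]: "f \<in> borel_measurable borel" using assms by (auto simp: L2w_def)
  note [measurable] = S_hat_minus_measurable[OF L2w_weighted(1)[OF assms(2)]]
  show ?thesis unfolding B_tr_eq[OF assms(1), abs_def] by measurable
qed

lemma U_tr_measurable:
  assumes "\<xi> > 0" "f \<in> L2w" shows "U_tr \<xi> f \<in> borel_measurable borel"
proof -
  have [measurable]: "f \<in> borel_measurable borel" using assms by (auto simp: L2w_def)
  note [measurable] = S_hat_minus_measurable[OF L2w_weighted(1)[OF assms(2)]]
  show ?thesis unfolding U_tr_eq[OF assms(1), abs_def] by measurable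
qed

text \<open>The function r is the lower term. It is the conjugate of a product of upper boundary
  values, those of the conjugate functions, over \<open>dispersion (- \<xi>)\<close>; the latter is
  at least \<xi> in modulus, so \<open>hardy_integral_zero\<close> applies.\<close>

lemma transforms_product:
  assumes \<xi>: "\<xi> > 0" and f: "f \<in> L2w" and g: "g \<in> L2w"
  obtains \<phi> \<kappa> r where 
    "hardy_boundary (\<lambda>t. f t * gauss t) \<phi>" "hardy_boundary (\<lambda>t. cnj (g t) * gauss t) \<kappa>"
    "integrable lborel r" "(LINT l|lborel. r l) = 0"
    "AE l in lborel. B_tr \<xi> f l * cnj (U_tr \<xi> g l) * complex_of_real (wt l) =
       f l * cnj (g l) * gauss l + 1 / (2 * \<i> * complex_of_real pi) * (\<phi> l * \<kappa> l / dispersion \<xi> (complex_of_real l) - r l)"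
proof -
  let ?h = "\<lambda>t. f t * gauss t" and ?k = "\<lambda>t. cnj (g t) * gauss t"
  let ?h' = "\<lambda>t. cnj (f t * gauss t)" and ?k' = "\<lambda>t. cnj (cnj (g t) * gauss t)"
  note h = L2w_weighted[OF f]
  note k = L2w_weighted[OF L2w_cnj[OF g]]
  have h': "integrable lborel ?h'" "L2_fun ?h'" using L2w_weighted[OF L2w_cnj[OF f]] by (simp_all add: gauss_cnj)
  have k': "integrable lborel ?k'" "L2_fun ?k'" using L2w_weighted[OF g] by (simp_all add: gauss_cnj)
  obtain \<phi> where phi: "hardy_boundary ?h \<phi>" using hardy_boundary_exists[OF h] .
  obtain \<phi>' where phi': "hardy_boundary ?h' \<phi>'" using hardy_boundary_exists[OF h'] .
  obtain \<kappa> where kap: "hardy_boundary ?k \<kappa>" using hardy_boundary_exists[OF k] .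
  obtain \<kappa>' where kap': "hardy_boundary ?k' \<kappa>'" using hardy_boundary_exists[OF k'] .
  let ?d1 = "\<lambda>l. dispersion \<xi> (complex_of_real l)" and ?d2 = "\<lambda>l. dispersion (- \<xi>) (complex_of_real l)"
  let ?pbd = "\<lambda>l. 1 / ?d2 l"
  have nz: "dispersion (- \<xi>) \<zeta> \<noteq> 0" if "Im \<zeta> > 0" for \<zeta> using dispersion_bound_negative[OF \<xi> that] \<xi> by auto
  have ph: "(\<lambda>\<zeta>. 1 / dispersion (- \<xi>) \<zeta>) holomorphic_on {\<zeta>. Im \<zeta> > 0}"
    using nz by (intro holomorphic_intros dispersion_holomorphic) auto
  have pb: "cmod (1 / dispersion (- \<xi>) \<zeta>) \<le> 1 / \<xi>" if "Im \<zeta> > 0" for \<zeta>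
    using dispersion_bound_negative[OF \<xi> that] \<xi> by (simp add: norm_divide frac_le)
  have pl: "AE x in lborel. ((\<lambda>y. 1 / dispersion (- \<xi>) (complex_of_real x + \<i> * complex_of_real y)) \<longlongrightarrow> ?pbd x) (at_right 0)"
    by (intro AE_I2 tendsto_intros dispersion_boundary dispersion_negative_real_nonzero \<xi>)
  have m: "?pbd \<in> borel_measurable borel" by measurable
  have R: "integrable lborel (\<lambda>l. \<phi>' l * \<kappa>' l * ?pbd l)" "(LINT l|lborel. \<phi>' l * \<kappa>' l * ?pbd l) = 0"
    by (rule hardy_integral_zero[OF h'(1) phi' k'(1) kap' ph pb m pl]; assumption)+
  define r where "r = (\<lambda>l. cnj (\<phi>' l * \<kappa>' l * ?pbd l))"
  have r: "integrable lborel r" "(LINT l|lborel. r l) = 0"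
    unfolding r_def by (rule integrable_cnj[OF R(1)], simp only: Bochner_Integration.integral_cnj R(2) complex_cnj_zero)
  have S1: "AE l in lborel. S_hat (- 1) ?h l = cnj (\<phi>' l)" by (rule S_hat_minus_AE[OF phi'])
  have S2: "AE l in lborel. S_hat (- 1) (\<lambda>z. g z * gauss z) l = cnj (\<kappa> l)"
    by (rule S_hat_minus_AE) (use kap in \<open>simp add: gauss_cnj\<close>)
  have J1: "AE l in lborel. \<phi> l - cnj (\<phi>' l) = 2 * \<i> * complex_of_real pi * ?h l" by (rule plemelj[OF h phi phi'])
  have J2: "AE l in lborel. \<kappa> l - cnj (\<kappa>' l) = 2 * \<i> * complex_of_real pi * ?k l" by (rule plemelj[OF k kap kap'])
  have "AE l in lborel. B_tr \<xi> f l * cnj (U_tr \<xi> g l) * complex_of_real (wt l) =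
       f l * cnj (g l) * gauss l + 1 / (2 * \<i> * complex_of_real pi) * (\<phi> l * \<kappa> l / ?d1 l - r l)"
    using S1 S2 J1 J2 AE_lborel_singleton[of "0::real"]
  proof eventually_elim
    case (elim l)
    have z: "complex_of_real (pi * wt l) = complex_of_real pi * gauss l" by (simp add: gauss_def)
    \<comment> \<open>The jump of D: the conjugate of \<open>?d2 l\<close> is its value from below,
      \<open>?d1 l\<close> its value from above.\<close>
    have j3: "gauss l * (2 * \<i> * complex_of_real pi) = cnj (?d2 l) - ?d1 l"
      by (simp add: complex_eq_iff dispersion_def Im_plasma_real gauss_def)
    have "B_tr \<xi> f l = f l + cnj (\<phi>' l) / cnj (?d2 l)" using elim(1) by (simp add: B_tr_eq[OF \<xi>])
    moreover have "cnj (U_tr \<xi> g l) = cnj (g l) + \<kappa> l / ?d1 l" using elim(2) by (simp add: U_tr_eq[OF \<xi>])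
    moreover have "(f l + cnj (\<phi>' l) / cnj (?d2 l)) * (cnj (g l) + \<kappa> l / ?d1 l) * gauss l
      = f l * cnj (g l) * gauss l + (1 / (2 * \<i> * complex_of_real pi)) * (\<phi> l * \<kappa> l / ?d1 l - cnj (\<phi>' l) * cnj (\<kappa>' l) / cnj (?d2 l))"
    proof (rule jump_identity)
      show "f l * gauss l * (2 * \<i> * complex_of_real pi) = \<phi> l - cnj (\<phi>' l)" using elim(3) by (simp add: mult_ac)
      show "cnj (g l) * gauss l * (2 * \<i> * complex_of_real pi) = \<kappa> l - cnj (\<kappa>' l)" using elim(4) by (simp add: mult_ac)
      show "gauss l * (2 * \<i> * complex_of_real pi) = cnj (?d2 l) - ?d1 l" by (rule j3)
      show "?d1 l \<noteq> 0" by (rule dispersion_real_nonzero) (use elim in simp)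
      show "cnj (?d2 l) \<noteq> 0" using dispersion_negative_real_nonzero[OF \<xi>] by simp
    qed simp
    ultimately show ?case by (simp add: r_def gauss_def)
  qed
  from that[OF phi kap r this] show thesis .
qed

text \<open>Isolates the upper term, whose integral I is 0 above the critical frequency and a
  residue below it. The hypothesis ranges over all boundary functions because
  \<open>transforms_product\<close> yields unspecified ones.\<close>

lemma transforms_integral:
  assumes \<xi>: "\<xi> > 0" and f: "f \<in> L2w" and g: "g \<in> L2w"
    and P: "\<And>\<phi> \<kappa>. hardy_boundary (\<lambda>t. f t * gauss t) \<phi> \<Longrightarrow> hardy_boundary (\<lambda>t. cnj (g t) * gauss t) \<kappa> \<Longrightarrow>
      integrable lborel (\<lambda>l. \<phi> l * \<kappa> l / dispersion \<xi> (complex_of_real l)) \<and>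
      (LINT l|lborel. \<phi> l * \<kappa> l / dispersion \<xi> (complex_of_real l)) = I"
  shows "integrable lborel (\<lambda>l. B_tr \<xi> f l * cnj (U_tr \<xi> g l) * complex_of_real (wt l))"
    and "(LINT l|lborel. B_tr \<xi> f l * cnj (U_tr \<xi> g l) * complex_of_real (wt l)) = L2w_inner f g + 1 / (2 * \<i> * complex_of_real pi) * I"
proof -
  obtain \<phi> \<kappa> r where T: "hardy_boundary (\<lambda>t. f t * gauss t) \<phi>" "hardy_boundary (\<lambda>t. cnj (g t) * gauss t) \<kappa>"
    "integrable lborel r" "(LINT l|lborel. r l) = 0"
    "AE l in lborel. B_tr \<xi> f l * cnj (U_tr \<xi> g l) * complex_of_real (wt l) =
       f l * cnj (g l) * gauss l + 1 / (2 * \<i> * complex_of_real pi) * (\<phi> l * \<kappa> l / dispersion \<xi> (complex_of_real l) - r l)"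
    by (rule transforms_product[OF \<xi> f g])
  let ?R = "\<lambda>l. f l * cnj (g l) * gauss l + 1 / (2 * \<i> * complex_of_real pi) * (\<phi> l * \<kappa> l / dispersion \<xi> (complex_of_real l) - r l)"
  let ?L = "\<lambda>l. B_tr \<xi> f l * cnj (U_tr \<xi> g l) * complex_of_real (wt l)"
  note I = P[OF T(1,2)]
  note i1 = L2w_inner_integrable[OF f g]
  have i2: "integrable lborel (\<lambda>l. 1 / (2 * \<i> * complex_of_real pi) * (\<phi> l * \<kappa> l / dispersion \<xi> (complex_of_real l) - r l))"
    by (intro integrable_mult_right Bochner_Integration.integrable_diff T(3) conjunct1[OF I])
  have i: "integrable lborel ?R" by (rule Bochner_Integration.integrable_add[OF i1 i2])
  note [measurable] = B_tr_measurable[OF \<xi> f] U_tr_measurable[OF \<xi> g]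
  have m: "?L \<in> borel_measurable lborel" by measurable
  have mR: "?R \<in> borel_measurable lborel" by (rule borel_measurable_integrable[OF i])
  show "integrable lborel ?L" using integrable_cong_AE[OF m mR T(5)] i by simp
  have "(LINT l|lborel. ?L l) = (LINT l|lborel. ?R l)" by (rule integral_cong_AE[OF m mR T(5)])
  also have "\<dots> = L2w_inner f g + 1 / (2 * \<i> * complex_of_real pi) * I"
    unfolding Bochner_Integration.integral_add[OF i1 i2] integral_mult_right_zero
      Bochner_Integration.integral_diff[OF conjunct1[OF I] T(3)] T(4) conjunct2[OF I] L2w_inner_gauss by simp
  finally show "(LINT l|lborel. ?L l) = L2w_inner f g + 1 / (2 * \<i> * complex_of_real pi) * I" .
qed

lemma transforms_supercritical:
  assumes \<xi>: "\<xi> > sqrt pi" and f: "f \<in> L2w" and g: "g \<in> L2w"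
  shows "integrable lborel (\<lambda>l. B_tr \<xi> f l * cnj (U_tr \<xi> g l) * complex_of_real (wt l))"
    and "L2w_inner f g = (LINT l|lborel. B_tr \<xi> f l * cnj (U_tr \<xi> g l) * complex_of_real (wt l))"
proof -
  have "0 < sqrt pi" by simp
  with \<xi> have x0: "\<xi> > 0" by linarith
  have ph: "(\<lambda>\<zeta>. 1 / dispersion \<xi> \<zeta>) holomorphic_on {\<zeta>. Im \<zeta> > 0}"
    using dispersion_bound_supercritical[OF \<xi>] \<xi> by (intro holomorphic_intros dispersion_holomorphic) fastforce
  have pb: "cmod (1 / dispersion \<xi> \<zeta>) \<le> 1 / (\<xi> - sqrt pi)" if "Im \<zeta> > 0" for \<zeta>
    using dispersion_bound_supercritical[OF \<xi> that] \<xi> by (simp add: norm_divide frac_le)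
  have pl: "AE x in lborel. ((\<lambda>y. 1 / dispersion \<xi> (complex_of_real x + \<i> * complex_of_real y)) \<longlongrightarrow> 1 / dispersion \<xi> (complex_of_real x)) (at_right 0)"
    using AE_lborel_singleton[of "0::real"]
    by eventually_elim (intro tendsto_intros dispersion_boundary dispersion_real_nonzero)
  have m: "(\<lambda>x. 1 / dispersion \<xi> (complex_of_real x)) \<in> borel_measurable borel" by measurable
  have P: "integrable lborel (\<lambda>l. \<phi> l * \<kappa> l / dispersion \<xi> (complex_of_real l)) \<and>
      (LINT l|lborel. \<phi> l * \<kappa> l / dispersion \<xi> (complex_of_real l)) = 0"
    if "hardy_boundary (\<lambda>t. f t * gauss t) \<phi>" "hardy_boundary (\<lambda>t. cnj (g t) * gauss t) \<kappa>" for \<phi> \<kappa>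
    using hardy_integral_zero[OF L2w_weighted(1)[OF f] that(1) L2w_weighted(1)[OF L2w_cnj[OF g]] that(2) ph pb m pl] by simp
  note T = transforms_integral[OF x0 f g P]
  show "integrable lborel (\<lambda>l. B_tr \<xi> f l * cnj (U_tr \<xi> g l) * complex_of_real (wt l))" by (rule T(1))
  show "L2w_inner f g = (LINT l|lborel. B_tr \<xi> f l * cnj (U_tr \<xi> g l) * complex_of_real (wt l))" using T(2) by simp
qed

text \<open>The point \<gamma> is the zero of D. It equals \<beta> below the critical frequency; at
  the critical one \<gamma> = 0 and \<beta> is the regularization point.\<close>

lemma blaschke_boundary_tendsto:
  assumes "x \<noteq> 0" "Im \<beta> > 0"
  shows "((\<lambda>y. (complex_of_real x + \<i> * complex_of_real y - \<gamma>) / (dispersion \<xi> (complex_of_real x + \<i> * complex_of_real y) * (complex_of_real x + \<i> * complex_of_real y - cnj \<beta>)))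
    \<longlongrightarrow> (complex_of_real x - \<gamma>) / (dispersion \<xi> (complex_of_real x) * (complex_of_real x - cnj \<beta>))) (at_right 0)"
proof -
  have l: "((\<lambda>y. complex_of_real x + \<i> * complex_of_real y) \<longlongrightarrow> complex_of_real x) (at_right 0)"
  proof -
    have "((\<lambda>y. complex_of_real x + \<i> * complex_of_real y) \<longlongrightarrow> complex_of_real x + \<i> * complex_of_real 0) (at_right 0)" by (intro tendsto_intros)
    thus ?thesis by simp
  qed
  have "complex_of_real x - cnj \<beta> \<noteq> 0" using assms(2) by (auto simp: complex_eq_iff)
  thus ?thesis using dispersion_real_nonzero[OF assms(1)]
    by (intro tendsto_intros l dispersion_boundary) auto
qed

text \<open>Since 1 / D has a simple pole at \<beta> = i y0, it is split on the line as ?p times the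
  Blaschke quotient of \<beta>, where ?p = (\<zeta> - \<beta>) / (D(\<zeta>) (\<zeta> - cnj
  \<beta>)) is bounded and holomorphic by the quotient bound. \<open>hardy_blaschke_integral\<close>
  then delivers the residue.\<close>

lemma transforms_subcritical:
  assumes \<xi>: "0 < \<xi>" "\<xi> < sqrt pi" and f: "f \<in> L2w" and g: "g \<in> L2w"
    and y0: "y0 > 0" and z: "\<And>\<zeta>. Im \<zeta> \<ge> 0 \<Longrightarrow> dispersion \<xi> \<zeta> = 0 \<longleftrightarrow> \<zeta> = \<i> * complex_of_real y0"
    and d: "(dispersion \<xi> has_field_derivative d) (at (\<i> * complex_of_real y0))" "d \<noteq> 0"
    and C: "\<And>\<zeta>. Im \<zeta> \<ge> 0 \<Longrightarrow> cmod (\<zeta> - \<i> * complex_of_real y0) \<le> C * (1 + cmod \<zeta>) * cmod (dispersion \<xi> \<zeta>)"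
  shows "integrable lborel (\<lambda>l. B_tr \<xi> f l * cnj (U_tr \<xi> g l) * complex_of_real (wt l))"
    and "L2w_inner f g = (LINT l|lborel. B_tr \<xi> f l * cnj (U_tr \<xi> g l) * complex_of_real (wt l)) -
       cauchy_tr (\<lambda>t. f t * gauss t) (\<i> * complex_of_real y0) * cauchy_tr (\<lambda>t. cnj (g t) * gauss t) (\<i> * complex_of_real y0) / d"
proof -
  define \<beta> where "\<beta> = \<i> * complex_of_real y0"
  have b: "Im \<beta> > 0" "Im \<beta> = y0" using y0 by (auto simp: \<beta>_def)
  define G where "G = (\<lambda>\<zeta>. if \<zeta> = \<beta> then deriv (dispersion \<xi>) \<beta> else (dispersion \<xi> \<zeta> - dispersion \<xi> \<beta>) / (\<zeta> - \<beta>))"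
  have D\<beta>: "dispersion \<xi> \<beta> = 0" using z[of \<beta>] b by (simp add: \<beta>_def)
  have Gh: "G holomorphic_on UNIV" unfolding G_def by (rule pole_lemma_open[OF dispersion_holomorphic]) simp
  have GD: "dispersion \<xi> \<zeta> = (\<zeta> - \<beta>) * G \<zeta>" for \<zeta> using D\<beta> by (simp add: G_def)
  have G\<beta>: "G \<beta> = d" using DERIV_imp_deriv[OF d(1)] by (simp add: G_def \<beta>_def)
  have Gnz: "G \<zeta> \<noteq> 0" if "Im \<zeta> \<ge> 0" for \<zeta>
    using z[OF that] G\<beta> d(2) GD[of \<zeta>] by (cases "\<zeta> = \<beta>") (auto simp: \<beta>_def)
  have cz: "\<zeta> - cnj \<beta> \<noteq> 0" if "Im \<zeta> \<ge> 0" for \<zeta> using that b by (auto simp: complex_eq_iff)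
  let ?p = "\<lambda>\<zeta>::complex. 1 / (G \<zeta> * (\<zeta> - cnj \<beta>))"
  let ?K = "1 + (1 + cmod \<beta>) / Im \<beta>"
  have C0: "C \<ge> 0"
  proof (rule ccontr)
    assume "\<not> 0 \<le> C"
    hence "C * (1 + cmod 0) * cmod (dispersion \<xi> 0) \<le> 0" by (intro mult_nonpos_nonneg) auto
    hence "cmod (0 - \<i> * complex_of_real y0) \<le> 0" by (intro order_trans[OF C]) simp_all
    thus False using y0 by simp
  qed
  have ph: "?p holomorphic_on {\<zeta>. Im \<zeta> > 0}"
    using Gnz cz by (intro holomorphic_intros holomorphic_on_subset[OF Gh]) auto
  have pb: "cmod (?p \<zeta>) \<le> C * ?K" if im: "Im \<zeta> > 0" for \<zeta>
  proof -
    have gb: "1 \<le> C * (1 + cmod w) * cmod (G w)" if "Im w > 0" "w \<noteq> \<beta>" for w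
    proof -
      have "cmod (w - \<beta>) \<le> C * (1 + cmod w) * (cmod (w - \<beta>) * cmod (G w))"
        using C[of w] that(1) unfolding GD norm_mult \<beta>_def[symmetric] by simp
      hence "cmod (w - \<beta>) * 1 \<le> cmod (w - \<beta>) * (C * (1 + cmod w) * cmod (G w))" by (simp add: mult_ac)
      thus ?thesis using that(2) by (subst (asm) mult_le_cancel_left_pos) auto
    qed
    have "1 \<le> C * (1 + cmod \<zeta>) * cmod (G \<zeta>)"
    proof (cases "\<zeta> = \<beta>")
      case False thus ?thesis using gb im by blast
    next
      \<comment> \<open>At \<beta> itself both sides of \<open>C\<close> vanish and say nothing
        about G; there the bound is obtained as a limit from nearby points.\<close>
      case True
      have ct: "isCont G \<beta>" using holomorphic_on_imp_continuous_on[OF Gh] by (simp add: continuous_on_eq_continuous_at)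
      have "((\<lambda>w. C * (1 + cmod w) * cmod (G w)) \<longlongrightarrow> C * (1 + cmod \<beta>) * cmod (G \<beta>)) (at \<beta>)"
        using ct by (intro tendsto_intros) (auto simp: isCont_def)
      moreover have "\<forall>\<^sub>F w in at \<beta>. 1 \<le> C * (1 + cmod w) * cmod (G w)"
        using eventually_at_in_open[of "{w. Im w > 0}" \<beta>] open_halfspace_Im_gt[of 0] b(1)
        by (auto elim!: eventually_mono intro: gb)
      ultimately have "1 \<le> C * (1 + cmod \<beta>) * cmod (G \<beta>)" by (rule tendsto_lowerbound) simp
      thus ?thesis using True by simp
    qed
    also have "\<dots> \<le> C * (?K * cmod (\<zeta> - cnj \<beta>)) * cmod (G \<zeta>)"
      using one_plus_norm_le[OF b(1), of \<zeta>] im C0 by (intro mult_right_mono mult_left_mono) auto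
    finally have "1 \<le> C * ?K * cmod (G \<zeta> * (\<zeta> - cnj \<beta>))" by (simp only: norm_mult mult_ac)
    moreover have "cmod (G \<zeta> * (\<zeta> - cnj \<beta>)) > 0" using Gnz[of \<zeta>] cz[of \<zeta>] im by simp
    ultimately show ?thesis by (simp add: norm_divide pos_divide_le_eq)
  qed
  let ?pbd = "\<lambda>x. (complex_of_real x - \<beta>) / (dispersion \<xi> (complex_of_real x) * (complex_of_real x - cnj \<beta>))"
  have rb: "\<zeta> \<noteq> \<beta> \<Longrightarrow> ?p \<zeta> = (\<zeta> - \<beta>) / (dispersion \<xi> \<zeta> * (\<zeta> - cnj \<beta>))" for \<zeta>
    by (simp add: GD)
  have pl: "AE x in lborel. ((\<lambda>y. ?p (complex_of_real x + \<i> * complex_of_real y)) \<longlongrightarrow> ?pbd x) (at_right 0)"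
    using AE_lborel_singleton[of "0::real"]
  proof eventually_elim
    case (elim x)
    have "complex_of_real x + \<i> * complex_of_real y \<noteq> \<beta>" for y using elim by (auto simp: complex_eq_iff \<beta>_def)
    thus ?case using blaschke_boundary_tendsto[of x \<beta> \<beta> \<xi>] elim b(1) rb by simp
  qed
  have m: "?pbd \<in> borel_measurable borel" by measurable
  have fin: "\<phi> x * \<kappa> x * ?pbd x * ((complex_of_real x - cnj \<beta>) / (complex_of_real x - \<beta>)) = \<phi> x * \<kappa> x / dispersion \<xi> (complex_of_real x)" for \<phi> \<kappa> :: "real \<Rightarrow> complex" and x
  proof -
    have "complex_of_real x - cnj \<beta> \<noteq> 0" "complex_of_real x - \<beta> \<noteq> 0" using b by (auto simp: complex_eq_iff)
    thus ?thesis by simp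
  qed
  let ?FK = "cauchy_tr (\<lambda>t. f t * gauss t) \<beta> * cauchy_tr (\<lambda>t. cnj (g t) * gauss t) \<beta>"
  \<comment> \<open>Because \<beta> - cnj \<beta> = 2 i y0, the constant is -4 pi y0 / (2 i y0 d) =
    2 pi i / d, the usual factor of a residue at a simple zero of D.\<close>
  have pv: "- 4 * complex_of_real (pi * Im \<beta>) * (?p \<beta> * X * Y) = 2 * \<i> * complex_of_real pi * (X * Y / d)" for X Y
  proof -
    have "\<beta> - cnj \<beta> = 2 * \<i> * complex_of_real y0" by (simp add: complex_eq_iff \<beta>_def)
    hence "?p \<beta> = 1 / (d * (2 * \<i> * complex_of_real y0))" by (simp only: G\<beta>)
    thus ?thesis using y0 d(2) by (simp add: b(2) field_simps)
  qed
  have P: "integrable lborel (\<lambda>l. \<phi> l * \<kappa> l / dispersion \<xi> (complex_of_real l)) \<and>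
      (LINT l|lborel. \<phi> l * \<kappa> l / dispersion \<xi> (complex_of_real l)) = 2 * \<i> * complex_of_real pi * (?FK / d)"
    if "hardy_boundary (\<lambda>t. f t * gauss t) \<phi>" "hardy_boundary (\<lambda>t. cnj (g t) * gauss t) \<kappa>" for \<phi> \<kappa>
  proof -
    note HB = hardy_blaschke_integral[OF L2w_weighted(1)[OF f] that(1) L2w_weighted(1)[OF L2w_cnj[OF g]] that(2) ph pb m pl b(1)]
    have i: "integrable lborel (\<lambda>x. (\<phi> x * \<kappa> x * ?pbd x) * ((complex_of_real x - cnj \<beta>) / (complex_of_real x - \<beta>)))"
    proof (rule integrable_bounded_mult(1)[OF HB(1)])
      show "cmod ((complex_of_real x - cnj \<beta>) / (complex_of_real x - \<beta>)) \<le> 1" for x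
      proof -
        have "cmod (complex_of_real x - cnj \<beta>) = cmod (complex_of_real x - \<beta>)"
          by (metis complex_cnj_complex_of_real complex_cnj_diff complex_mod_cnj)
        thus ?thesis by (simp add: norm_divide divide_le_eq_1)
      qed
    qed measurable
    show ?thesis using i HB(2) unfolding fin pv by simp
  qed
  have T2: "(LINT l|lborel. B_tr \<xi> f l * cnj (U_tr \<xi> g l) * complex_of_real (wt l)) = L2w_inner f g + 1 / (2 * \<i> * complex_of_real pi) * (2 * \<i> * complex_of_real pi * (?FK / d))"
    by (rule transforms_integral(2)[OF \<xi>(1) f g P])
  note T = transforms_integral(1)[OF \<xi>(1) f g P]
  show "integrable lborel (\<lambda>l. B_tr \<xi> f l * cnj (U_tr \<xi> g l) * complex_of_real (wt l))" by (rule T(1))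
  show "L2w_inner f g = (LINT l|lborel. B_tr \<xi> f l * cnj (U_tr \<xi> g l) * complex_of_real (wt l)) -
       cauchy_tr (\<lambda>t. f t * gauss t) (\<i> * complex_of_real y0) * cauchy_tr (\<lambda>t. cnj (g t) * gauss t) (\<i> * complex_of_real y0) / d"
    unfolding \<beta>_def[symmetric] T2 by simp
qed

section \<open>The critical frequency\<close>

lemma max_square_has_derivative:
  "((\<lambda>s::real. (max 0 s)\<^sup>2) has_real_derivative 2 * max 0 s) (at s)"
proof (cases s "0::real" rule: linorder_cases)
  case greater
  have "((\<lambda>s. s\<^sup>2) has_real_derivative 2 * max 0 s) (at s)" using greater by (auto intro!: derivative_eq_intros)
  thus ?thesis by (rule has_field_derivative_transform_within_open[of _ _ _ "{0<..}"]) (use greater in auto)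
next
  case less
  have "((\<lambda>s. 0) has_real_derivative 2 * max 0 s) (at s)" using less by (auto intro!: derivative_eq_intros)
  thus ?thesis by (rule has_field_derivative_transform_within_open[of _ _ _ "{..<0}"]) (use less in auto)
next
  case equal
  have "((\<lambda>y. ((max 0 y)\<^sup>2 - (max 0 0)\<^sup>2) / (y - 0)) \<longlongrightarrow> (0::real)) (at 0)"
  proof (rule Lim_null_comparison)
    show "\<forall>\<^sub>F y in at 0. norm (((max 0 y)\<^sup>2 - (max 0 0)\<^sup>2) / (y - 0)) \<le> \<bar>y::real\<bar>"
      by (intro always_eventually allI) (auto simp: max_def power2_eq_square)
    show "((\<lambda>y::real. \<bar>y\<bar>) \<longlongrightarrow> 0) (at 0)" by (rule tendsto_rabs_zero) simp
  qed
  thus ?thesis using equal by (simp add: has_field_derivative_iff)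
qed

text \<open>The square of a positive part is of class C^1, the smoothness demanded by
  \<open>test_function\<close>; the support is [-1, 1] and the value at 0 is 1.\<close>

definition bump :: "real \<Rightarrow> real" where "bump t = (max 0 (1 - t\<^sup>2))\<^sup>2"

definition bump' :: "real \<Rightarrow> real" where "bump' t = 2 * max 0 (1 - t\<^sup>2) * (- 2 * t)"

lemma bump_has_derivative: "(bump has_real_derivative bump' t) (at t)"
proof -
  have "((\<lambda>t. 1 - t\<^sup>2) has_real_derivative (- 2 * t)) (at t)" by (auto intro!: derivative_eq_intros)
  from DERIV_chain2[OF max_square_has_derivative this] show ?thesis by (simp add: bump_def[abs_def] bump'_def)
qed

lemma bump_continuous: "continuous_on UNIV bump" "continuous_on UNIV bump'"
  unfolding bump_def[abs_def] bump'_def[abs_def] by (intro continuous_intros)+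

lemma bump_measurable [measurable]: "bump \<in> borel_measurable borel" "bump' \<in> borel_measurable borel"
  using bump_continuous by (auto intro: borel_measurable_continuous_onI)

lemma square_le_one_iff: "(t::real)\<^sup>2 \<le> 1 \<longleftrightarrow> \<bar>t\<bar> \<le> 1"
  using abs_le_square_iff[of t 1] by simp

text \<open>The estimate |1 - bump t| \<le> 2 |t| keeps (1 - bump t) / (t - i b) bounded by 2
  uniformly in b; it comes from 1 - (1 - t^2)^2 = t^2 (2 - t^2).\<close>

lemma bump_bounds:
  "0 \<le> bump t" "bump t \<le> 1" "\<bar>bump' t\<bar> \<le> 4" "\<bar>1 - bump t\<bar> \<le> 2 * \<bar>t\<bar>"
  "\<bar>t\<bar> > 1 \<Longrightarrow> bump t = 0" "\<bar>t\<bar> > 1 \<Longrightarrow> bump' t = 0"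
proof -
  show "0 \<le> bump t" by (simp add: bump_def)
  consider "\<bar>t\<bar> \<le> 1" | "\<bar>t\<bar> > 1" by linarith
  hence A: "bump t \<le> 1 \<and> \<bar>bump' t\<bar> \<le> 4 \<and> \<bar>1 - bump t\<bar> \<le> 2 * \<bar>t\<bar> \<and> (\<bar>t\<bar> > 1 \<longrightarrow> bump t = 0 \<and> bump' t = 0)"
  proof cases
    case 1
    have t2: "t\<^sup>2 \<le> 1" using 1 square_le_one_iff by blast
    hence m: "max 0 (1 - t\<^sup>2) = 1 - t\<^sup>2" "0 \<le> 1 - t\<^sup>2" "1 - t\<^sup>2 \<le> 1" by auto
    have b1: "bump t \<le> 1" unfolding bump_def m(1) using m by (intro power_le_one) auto
    have "\<bar>bump' t\<bar> = 4 * ((1 - t\<^sup>2) * \<bar>t\<bar>)" unfolding bump'_def m(1) using m by (simp add: abs_mult)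
    also have "(1 - t\<^sup>2) * \<bar>t\<bar> \<le> 1 * 1" using m 1 by (intro mult_mono) auto
    finally have b2: "\<bar>bump' t\<bar> \<le> 4" by simp
    have "1 - bump t = t\<^sup>2 * (2 - t\<^sup>2)" unfolding bump_def m(1) by (simp add: power2_eq_square algebra_simps)
    also have "t\<^sup>2 * (2 - t\<^sup>2) \<le> \<bar>t\<bar> * 2"
    proof (rule mult_mono)
      have "\<bar>t\<bar> * \<bar>t\<bar> \<le> \<bar>t\<bar> * 1" using 1 by (intro mult_left_mono) auto
      thus "t\<^sup>2 \<le> \<bar>t\<bar>" by (simp add: power2_eq_square)
    qed (use t2 in auto)
    finally have "1 - bump t \<le> 2 * \<bar>t\<bar>" by simp
    moreover have "0 \<le> 1 - bump t" using b1 by simp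
    ultimately show ?thesis using 1 b1 b2 by auto
  next
    case 2
    hence "\<not> t\<^sup>2 \<le> 1" using square_le_one_iff[of t] by linarith
    hence "max 0 (1 - t\<^sup>2) = 0" by simp
    hence "bump t = 0" "bump' t = 0" by (auto simp: bump_def bump'_def)
    thus ?thesis using 2 by auto
  qed
  from A show "bump t \<le> 1" "\<bar>bump' t\<bar> \<le> 4" "\<bar>1 - bump t\<bar> \<le> 2 * \<bar>t\<bar>"
    "\<bar>t\<bar> > 1 \<Longrightarrow> bump t = 0" "\<bar>t\<bar> > 1 \<Longrightarrow> bump' t = 0" by blast+
qed

lemma inverse_sqrt_integrable: "integrable lborel (\<lambda>t. indicator {-1..1} t * (1 / sqrt \<bar>t\<bar>))"
proof -
  have "set_integrable lborel (einterval 0 1) (\<lambda>t. 1 / sqrt t)"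
  proof (rule interval_integral_FTC_nonneg[where F="\<lambda>t. 2 * sqrt t" and A=0 and B=2])
    show "((\<lambda>t. 2 * sqrt t) has_real_derivative 1 / sqrt x) (at x)" if "0 < ereal x" for x
      using that by (auto intro!: derivative_eq_intros simp: field_simps)
    show "isCont (\<lambda>t. 1 / sqrt t) x" if "0 < ereal x" for x using that by (intro continuous_intros) auto
    have "((\<lambda>t. 2 * sqrt t) \<longlongrightarrow> 2 * sqrt 0) (at_right 0)" by (intro tendsto_intros)
    thus "(((\<lambda>t. 2 * sqrt t) \<circ> real_of_ereal) \<longlongrightarrow> 0) (at_right 0)"
      unfolding zero_ereal_def by (simp only: ereal_tendsto_simps) simp
    have "((\<lambda>t. 2 * sqrt t) \<longlongrightarrow> 2 * sqrt 1) (at_left 1)" by (intro tendsto_intros)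
    thus "(((\<lambda>t. 2 * sqrt t) \<circ> real_of_ereal) \<longlongrightarrow> 2) (at_left 1)"
      unfolding one_ereal_def by (simp only: ereal_tendsto_simps) simp
  qed auto
  hence i: "integrable lborel (\<lambda>t. indicator {0<..<1} t * (1 / sqrt t))"
    by (simp add: set_integrable_def zero_ereal_def one_ereal_def)
  have i': "integrable lborel (\<lambda>t. indicator {0<..<1} (- t) * (1 / sqrt (- t)))"
    using lborel_integrable_real_affine[OF i, of "-1" 0] by simp
  have m: "(\<lambda>t. indicator {-1..1} t * (1 / sqrt \<bar>t\<bar>)) \<in> borel_measurable lborel" by measurable
  have ae: "AE t in lborel. indicator {0<..<1} t * (1 / sqrt t) + indicator {0<..<1} (- t) * (1 / sqrt (- t)) = indicator {-1..1} t * (1 / sqrt \<bar>t\<bar>)"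
    using AE_lborel_singleton[of "0::real"] AE_lborel_singleton[of "1::real"] AE_lborel_singleton[of "-1::real"]
    by eventually_elim (auto simp: indicator_def)
  show ?thesis
    using integrable_cong_AE[OF borel_measurable_integrable[OF Bochner_Integration.integrable_add[OF i i']] m ae] Bochner_Integration.integrable_add[OF i i'] by simp
qed

text \<open>Four times the inequality ln x \<le> x - 1 at x = r^(-1/4). A fourth root is mild enough
  for the square of the bound to be integrable at 0.\<close>

lemma ln_fourth_root_bound:
  assumes "0 < r" "r \<le> (1::real)" shows "- ln r \<le> 4 * (1 / sqrt (sqrt r))"
proof -
  let ?s = "sqrt (sqrt r)"
  have s: "?s > 0" using assms by simp
  have "ln r = 4 * ln ?s" using assms by (simp add: ln_sqrt)
  hence "- ln r = 4 * ln (1 / ?s)" using s by (simp add: ln_div)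
  also have "ln (1 / ?s) \<le> 1 / ?s - 1" using s by (intro ln_le_minus_one) auto
  finally show ?thesis by simp
qed

text \<open>The real antiderivatives of both the real and the imaginary part of \<open>1 / (t - \<i> b)\<close>
  are dominated near \<open>0\<close>, uniformly in \<open>b\<close>, by the square integrable function \<open>4 / \<bar>t\<bar> ^ (1/4)\<close>.\<close>

lemma localized_limit:
  fixes u :: "real \<Rightarrow> complex" and c :: "real \<Rightarrow> real" and L :: "real \<Rightarrow> real \<Rightarrow> real"
  assumes u: "u \<in> L2w" and c [measurable]: "c \<in> borel_measurable borel" and cb: "\<And>t. \<bar>c t\<bar> \<le> 6" "\<And>t. \<bar>t\<bar> > 1 \<Longrightarrow> c t = 0"
    and Lm: "\<And>b. b > 0 \<Longrightarrow> L b \<in> borel_measurable borel"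
    and Lb: "\<And>b t. b > 0 \<Longrightarrow> t \<noteq> 0 \<Longrightarrow> \<bar>t\<bar> \<le> 1 \<Longrightarrow> \<bar>L b t\<bar> \<le> 4 * (1 / sqrt (sqrt \<bar>t\<bar>))"
    and L0m [measurable]: "L0 \<in> borel_measurable borel"
    and Ll: "\<And>t. t \<noteq> 0 \<Longrightarrow> ((\<lambda>b. L b t) \<longlongrightarrow> L0 t) (at_right 0)"
  shows "\<And>b. b > 0 \<Longrightarrow> integrable lborel (\<lambda>t. u t * gauss t * complex_of_real (c t * L b t))"
    and "((\<lambda>b. LINT t|lborel. u t * gauss t * complex_of_real (c t * L b t)) \<longlongrightarrow> (LINT t|lborel. u t * gauss t * complex_of_real (c t * L0 t))) (at_right 0)"
proof -
  have [measurable]: "u \<in> borel_measurable borel" and i: "integrable lborel (\<lambda>v. (cmod (u v))\<^sup>2 * wt v)"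
    using u by (auto simp: L2w_def)
  \<comment> \<open>With l the bound on L, |u| l \<le> |u|^2 + l^2 and l^2 = 16 / sqrt |t|. The
    factor 6 bounds c, and the weight on l^2 is at most 1.\<close>
  let ?w = "\<lambda>t. 6 * ((cmod (u t))\<^sup>2 * wt t + 16 * (indicator {-1..1} t * (1 / sqrt \<bar>t\<bar>)))"
  have iw: "integrable lborel ?w"
    by (intro integrable_mult_right Bochner_Integration.integrable_add i inverse_sqrt_integrable)
  have wt1: "wt t \<le> 1" for t
  proof -
    have "1 \<le> sqrt pi" using pi_ge_two by (simp add: real_le_rsqrt)
    hence "1 / sqrt pi \<le> 1" by simp
    thus ?thesis using wt_le[of t] by linarith
  qed
  have dom: "cmod (u t * gauss t * complex_of_real (c t * L b t)) \<le> ?w t" if b: "b > 0" and t: "t \<noteq> 0" for b t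
  proof (cases "\<bar>t\<bar> \<le> 1")
    case True
    let ?l = "4 * (1 / sqrt (sqrt \<bar>t\<bar>))"
    have l2: "?l\<^sup>2 = 16 * (1 / sqrt \<bar>t\<bar>)" by (simp add: power_mult_distrib power_divide)
    have "cmod (u t * gauss t * complex_of_real (c t * L b t)) = cmod (u t) * wt t * (\<bar>c t\<bar> * \<bar>L b t\<bar>)"
      by (simp add: norm_mult gauss_def wt_nonneg abs_mult)
    also have "\<dots> \<le> cmod (u t) * wt t * (6 * ?l)"
      using cb(1)[of t] Lb[OF b t True] by (intro mult_left_mono mult_mono mult_nonneg_nonneg wt_nonneg) auto
    also have "\<dots> = 6 * (wt t * (cmod (u t) * ?l))" by simp
    also have "cmod (u t) * ?l \<le> (cmod (u t))\<^sup>2 + ?l\<^sup>2"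
    proof -
      have "2 * (cmod (u t) * ?l) \<le> (cmod (u t))\<^sup>2 + ?l\<^sup>2"
        using zero_le_power2[of "cmod (u t) - ?l"] unfolding power2_diff by simp
      moreover have "0 \<le> cmod (u t) * ?l" by simp
      ultimately show ?thesis by linarith
    qed
    hence "6 * (wt t * (cmod (u t) * ?l)) \<le> 6 * (wt t * ((cmod (u t))\<^sup>2 + ?l\<^sup>2))"
      by (intro mult_left_mono wt_nonneg) auto
    also have "wt t * ((cmod (u t))\<^sup>2 + ?l\<^sup>2) \<le> (cmod (u t))\<^sup>2 * wt t + 1 * ?l\<^sup>2"
      unfolding distrib_left using mult_right_mono[OF wt1[of t], of "?l\<^sup>2"] by (simp add: mult.commute)
    finally show ?thesis using True unfolding l2 by (simp add: indicator_def abs_le_iff)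
  next
    case False
    hence "c t = 0" using cb(2)[of t] by simp
    thus ?thesis using wt_nonneg[of t] by (simp add: indicator_def)
  qed
  have mm: "(\<lambda>t. u t * gauss t * complex_of_real (c t * L b t)) \<in> borel_measurable lborel" if "b > 0" for b
    using Lm[OF that] by measurable
  have aedom: "AE t in lborel. cmod (u t * gauss t * complex_of_real (c t * L b t)) \<le> ?w t" if b: "b > 0" for b
    using AE_lborel_singleton[of "0::real"] by eventually_elim (rule dom[OF b])
  show "integrable lborel (\<lambda>t. u t * gauss t * complex_of_real (c t * L b t))" if b: "b > 0" for b
    by (rule Bochner_Integration.integrable_bound[OF iw mm[OF b]])
      (rule AE_mp[OF aedom[OF b]], intro AE_I2 impI, simp only: real_norm_def order_trans[OF _ abs_ge_self])
  show "((\<lambda>b. LINT t|lborel. u t * gauss t * complex_of_real (c t * L b t)) \<longlongrightarrow> (LINT t|lborel. u t * gauss t * complex_of_real (c t * L0 t))) (at_right 0)"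
  proof (rule at_right_0_seqI)
    fix Y :: "nat \<Rightarrow> real" assume Y: "\<And>n. Y n > 0" "Y \<longlonglongrightarrow> 0"
    have Y': "filterlim Y (at_right 0) sequentially"
      using Y less_imp_neq[OF Y(1), symmetric] by (auto simp: filterlim_at)
    show "(\<lambda>n. LINT t|lborel. u t * gauss t * complex_of_real (c t * L (Y n) t)) \<longlonglongrightarrow> (LINT t|lborel. u t * gauss t * complex_of_real (c t * L0 t))"
    proof (rule integral_dominated_convergence[OF _ mm[OF Y(1)] iw])
      show "AE t in lborel. (\<lambda>n. u t * gauss t * complex_of_real (c t * L (Y n) t)) \<longlonglongrightarrow> u t * gauss t * complex_of_real (c t * L0 t)"
        using AE_lborel_singleton[of "0::real"]
        by eventually_elim (intro tendsto_intros filterlim_compose[OF Ll Y'])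
    qed (use aedom[OF Y(1)] in \<open>auto\<close>)
  qed
qed

text \<open>The weak derivative is tested against \<open>bump t * wt t * L t\<close>. The term -2 t
  w, the derivative of w, joins that of the cut-off in the factor
  \<open>bump' t - 2 * t * bump t\<close>.\<close>

lemma weak_derivative_localized:
  fixes L L' :: "real \<Rightarrow> real"
  assumes f: "f \<in> L2w" and f': "f' \<in> L2w" "weak_derivative f f'"
    and L: "\<And>t. (L has_real_derivative L' t) (at t)" "continuous_on UNIV L'" "\<And>t. \<bar>t\<bar> \<le> 1 \<Longrightarrow> \<bar>L' t\<bar> \<le> B"
    and i: "integrable lborel (\<lambda>t. f t * gauss t * complex_of_real ((bump' t - 2 * t * bump t) * L t))"
  shows "(LINT t|lborel. f t * gauss t * complex_of_real (bump t * L' t)) =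
    - (LINT t|lborel. f' t * gauss t * complex_of_real (bump t * L t)) - (LINT t|lborel. f t * gauss t * complex_of_real ((bump' t - 2 * t * bump t) * L t))"
proof -
  define \<phi> where "\<phi> = (\<lambda>t. bump t * wt t * L t)"
  define D where "D = (\<lambda>t. wt t * ((bump' t - 2 * t * bump t) * L t) + wt t * (bump t * L' t))"
  have wd: "(wt has_real_derivative (- 2 * t * wt t)) (at t)" for t
    unfolding wt_def[abs_def] by (auto intro!: derivative_eq_intros simp: field_simps)
  have dphi: "(\<phi> has_real_derivative D t) (at t)" for t
    unfolding \<phi>_def D_def
    by (rule DERIV_cong[OF DERIV_mult[OF DERIV_mult[OF bump_has_derivative wd] L(1)]]) (simp add: algebra_simps)
  have wc: "continuous_on UNIV wt" unfolding wt_def[abs_def] by (intro continuous_intros) auto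
  have Lc: "continuous_on UNIV L" by (rule continuous_at_imp_continuous_on) (use L(1) DERIV_isCont in blast)
  have Dc: "continuous_on UNIV D" unfolding D_def by (intro continuous_intros wc Lc L(2) bump_continuous)
  have test: "test_function \<phi>"
    unfolding test_function_def
  proof
    show "\<phi> C1_differentiable_on UNIV"
      unfolding C1_differentiable_on_def
      using dphi Dc by (intro exI[of _ D]) (simp add: has_real_derivative_iff_has_vector_derivative)
    have "{x. \<phi> x \<noteq> 0} \<subseteq> {-1..1}"
    proof
      fix x assume "x \<in> {x. \<phi> x \<noteq> 0}"
      hence "bump x \<noteq> 0" by (auto simp: \<phi>_def)
      hence "\<not> \<bar>x\<bar> > 1" using bump_bounds(5)[of x] by blast
      thus "x \<in> {-1..1}" by (auto simp: abs_le_iff)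
    qed
    hence "closure {x. \<phi> x \<noteq> 0} \<subseteq> {-1..1}" by (rule closure_minimal) simp
    thus "compact (closure {x. \<phi> x \<noteq> 0})" by (meson bounded_closed_interval bounded_subset closed_closure compact_eq_bounded_closed)
  qed
  have dv: "deriv \<phi> t = D t" for t by (rule DERIV_imp_deriv[OF dphi])
  have B: "integrable lborel (\<lambda>t. f t * gauss t * complex_of_real (bump t * L' t))"
  proof (rule integrable_bounded_mult(1)[OF L2w_weighted(1)[OF f]])
    have [measurable]: "L' \<in> borel_measurable borel" by (rule borel_measurable_continuous_onI[OF L(2)])
    show "(\<lambda>t. complex_of_real (bump t * L' t)) \<in> borel_measurable borel" by measurable
    have B0: "B \<ge> 0" using L(3)[of 0] by simp
    show "cmod (complex_of_real (bump t * L' t)) \<le> B" for t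
    proof (cases "\<bar>t\<bar> \<le> 1")
      case True
      have "\<bar>bump t\<bar> * \<bar>L' t\<bar> \<le> 1 * B"
        using bump_bounds(1,2)[of t] L(3)[OF True] by (intro mult_mono) auto
      thus ?thesis by (simp only: norm_of_real abs_mult mult_1)
    next
      case False
      hence "bump t = 0" using bump_bounds(5)[of t] by simp
      thus ?thesis using B0 by simp
    qed
  qed
  have "(LINT v|lborel. f v * complex_of_real (deriv \<phi> v)) = - (LINT v|lborel. f' v * complex_of_real (\<phi> v))"
    using f'(2) test unfolding weak_derivative_def by blast
  moreover have "f v * complex_of_real (deriv \<phi> v) = f v * gauss v * complex_of_real ((bump' v - 2 * v * bump v) * L v) + f v * gauss v * complex_of_real (bump v * L' v)" for v
    unfolding dv D_def gauss_def of_real_add of_real_mult[of "wt v"] by (simp only: algebra_simps)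
  moreover have "f' v * complex_of_real (\<phi> v) = f' v * gauss v * complex_of_real (bump v * L v)" for v
    by (simp add: \<phi>_def gauss_def)
  ultimately have "(LINT v|lborel. f v * gauss v * complex_of_real ((bump' v - 2 * v * bump v) * L v)) + (LINT v|lborel. f v * gauss v * complex_of_real (bump v * L' v))
     = - (LINT t|lborel. f' t * gauss t * complex_of_real (bump t * L t))"
    using Bochner_Integration.integral_add[OF i B] by simp
  thus ?thesis by (simp add: algebra_simps)
qed

text \<open>\<open>L' b\<close> will be the real or imaginary part of 1 / (t - i b), which has no
  integrable majorant uniform in b. Integration by parts moves the singularity to
  \<open>L b\<close>, where \<open>localized_limit\<close> applies once to f' and once to f.\<close>

lemma weak_derivative_localized_limit:
  fixes L L' :: "real \<Rightarrow> real \<Rightarrow> real"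
  assumes f: "f \<in> H1w"
    and L: "\<And>b t. b > 0 \<Longrightarrow> (L b has_real_derivative L' b t) (at t)" "\<And>b. b > 0 \<Longrightarrow> continuous_on UNIV (L' b)" 
      "\<And>b t. b > 0 \<Longrightarrow> \<bar>t\<bar> \<le> 1 \<Longrightarrow> \<bar>L' b t\<bar> \<le> B b"
    and Lb: "\<And>b t. b > 0 \<Longrightarrow> t \<noteq> 0 \<Longrightarrow> \<bar>t\<bar> \<le> 1 \<Longrightarrow> \<bar>L b t\<bar> \<le> 4 * (1 / sqrt (sqrt \<bar>t\<bar>))"
    and L0m: "L0 \<in> borel_measurable borel"
    and Ll: "\<And>t. t \<noteq> 0 \<Longrightarrow> ((\<lambda>b. L b t) \<longlongrightarrow> L0 t) (at_right 0)"
  shows "\<exists>l. ((\<lambda>b. LINT t|lborel. f t * gauss t * complex_of_real (bump t * L' b t)) \<longlongrightarrow> l) (at_right 0)"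
proof -
  obtain f' where f': "f \<in> L2w" "f' \<in> L2w" "weak_derivative f f'" using f by (auto simp: H1w_def)
  have Lm: "L b \<in> borel_measurable borel" if "b > 0" for b
  proof (rule borel_measurable_continuous_onI, rule continuous_at_imp_continuous_on)
    show "\<forall>x\<in>UNIV. isCont (L b) x" using L(1)[OF that] DERIV_isCont by blast
  qed
  have b1: "\<bar>bump t\<bar> \<le> 6" for t using bump_bounds(1,2)[of t] by simp
  \<comment> \<open>4 from \<open>bump'\<close> and 2 from the other term; this is the constant 6 of
    \<open>localized_limit\<close>.\<close>
  have b2: "\<bar>bump' t - 2 * t * bump t\<bar> \<le> 6" for t
  proof (cases "\<bar>t\<bar> \<le> 1")
    case True
    have "\<bar>t\<bar> * \<bar>bump t\<bar> \<le> 1 * 1" using True bump_bounds(1,2)[of t] by (intro mult_mono) auto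
    hence "\<bar>2 * t * bump t\<bar> \<le> 2" by (simp add: abs_mult)
    thus ?thesis using bump_bounds(3)[of t] by linarith
  qed (use bump_bounds(5,6)[of t] in simp)
  have b3: "\<bar>t\<bar> > 1 \<Longrightarrow> bump' t - 2 * t * bump t = 0" for t using bump_bounds(5,6)[of t] by simp
  have m2: "(\<lambda>t. bump' t - 2 * t * bump t) \<in> borel_measurable borel" by measurable
  note A1 = localized_limit[of f' bump L L0, OF f'(2) bump_measurable(1) b1 bump_bounds(5) Lm Lb L0m Ll]
  note A2 = localized_limit[of f "\<lambda>t. bump' t - 2 * t * bump t" L L0, OF f'(1) m2 b2 b3 Lm Lb L0m Ll]
  let ?l = "- (LINT t|lborel. f' t * gauss t * complex_of_real (bump t * L0 t)) - (LINT t|lborel. f t * gauss t * complex_of_real ((bump' t - 2 * t * bump t) * L0 t))"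
  have "((\<lambda>b. - (LINT t|lborel. f' t * gauss t * complex_of_real (bump t * L b t)) - (LINT t|lborel. f t * gauss t * complex_of_real ((bump' t - 2 * t * bump t) * L b t))) \<longlongrightarrow> ?l) (at_right 0)"
    by (intro tendsto_diff tendsto_minus A1(2) A2(2))
  moreover have "\<forall>\<^sub>F b in at_right 0. - (LINT t|lborel. f' t * gauss t * complex_of_real (bump t * L b t)) - (LINT t|lborel. f t * gauss t * complex_of_real ((bump' t - 2 * t * bump t) * L b t))
     = (LINT t|lborel. f t * gauss t * complex_of_real (bump t * L' b t))"
    using eventually_at_right_less[of "0::real"]
  proof eventually_elim
    case (elim b)
    show ?case
      by (rule weak_derivative_localized[OF f'(1,2,3) L(1)[OF elim] L(2)[OF elim] L(3)[OF elim], symmetric])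
        (assumption, rule A2(1), insert elim, assumption+)
  qed
  ultimately show ?thesis by (intro exI[of _ ?l]) (rule Lim_transform_eventually)
qed

section \<open>Limits of Cauchy transforms at the origin for \<open>H1w\<close>\<close>

lemma imaginary_axis_kernel:
  assumes "b > 0"
  shows "1 / (complex_of_real t - \<i> * complex_of_real b) = complex_of_real (t / (t\<^sup>2 + b\<^sup>2)) + \<i> * complex_of_real (b / (t\<^sup>2 + b\<^sup>2))"
proof -
  have nz: "complex_of_real t - \<i> * complex_of_real b \<noteq> 0" using assms by (auto simp: complex_eq_iff)
  have s: "t\<^sup>2 + b\<^sup>2 \<noteq> 0" using assms by (simp add: sum_power2_eq_zero_iff)
  have "(t / (t\<^sup>2 + b\<^sup>2)) * t + (b / (t\<^sup>2 + b\<^sup>2)) * b = (t\<^sup>2 + b\<^sup>2) / (t\<^sup>2 + b\<^sup>2)"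
    by (simp only: times_divide_eq_left add_divide_distrib[symmetric] power2_eq_square)
  hence e: "(t / (t\<^sup>2 + b\<^sup>2)) * t + (b / (t\<^sup>2 + b\<^sup>2)) * b = 1" using s by simp
  have "(complex_of_real p + \<i> * complex_of_real q) * (complex_of_real t - \<i> * complex_of_real b) = 1"
    if "p * t + q * b = 1" "q * t = p * b" for p q using that by (simp add: complex_eq_iff)
  from this[OF e] have "(complex_of_real (t / (t\<^sup>2 + b\<^sup>2)) + \<i> * complex_of_real (b / (t\<^sup>2 + b\<^sup>2))) * (complex_of_real t - \<i> * complex_of_real b) = 1"
    by simp
  hence "1 = (complex_of_real (t / (t\<^sup>2 + b\<^sup>2)) + \<i> * complex_of_real (b / (t\<^sup>2 + b\<^sup>2))) * (complex_of_real t - \<i> * complex_of_real b)" by (rule sym)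
  thus ?thesis unfolding nonzero_divide_eq_eq[OF nz] .
qed

text \<open>Dividing by 1 + b^2 inside the logarithm keeps its argument between t^2 and 1 for |t|
  \<le> 1, so the antiderivative lies between ln |t| and 0, uniformly in b.\<close>

lemma H1w_log_limit:
  assumes "f \<in> H1w"
  shows "\<exists>l. ((\<lambda>b. LINT t|lborel. f t * gauss t * complex_of_real (bump t * (t / (t\<^sup>2 + b\<^sup>2)))) \<longlongrightarrow> l) (at_right 0)"
proof (rule weak_derivative_localized_limit[OF assms, of "\<lambda>b t. 1 / 2 * ln ((t\<^sup>2 + b\<^sup>2) / (1 + b\<^sup>2))" _ "\<lambda>b. 1 / b\<^sup>2" "\<lambda>t. 1 / 2 * ln (t\<^sup>2)"])
  fix b :: real assume b: "b > 0"
  have p: "t\<^sup>2 + b\<^sup>2 > 0" "1 + b\<^sup>2 > 0" for t using b by (auto simp: add_nonneg_pos add_pos_nonneg)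
  show "((\<lambda>t. 1 / 2 * ln ((t\<^sup>2 + b\<^sup>2) / (1 + b\<^sup>2))) has_real_derivative t / (t\<^sup>2 + b\<^sup>2)) (at t)" for t
  proof -
    have e: "1 / 2 * ln ((t\<^sup>2 + b\<^sup>2) / (1 + b\<^sup>2)) = 1 / 2 * (ln (t\<^sup>2 + b\<^sup>2) - ln (1 + b\<^sup>2))" for t
      using p by (simp add: ln_div)
    have "((\<lambda>t. 1 / 2 * (ln (t\<^sup>2 + b\<^sup>2) - ln (1 + b\<^sup>2))) has_real_derivative 1 / 2 * (1 / (t\<^sup>2 + b\<^sup>2) * (2 * t) - 0)) (at t)"
    proof (intro DERIV_cmult DERIV_diff DERIV_const)
      have "((\<lambda>t. t\<^sup>2 + b\<^sup>2) has_real_derivative 2 * t) (at t)" by (auto intro!: derivative_eq_intros)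
      from DERIV_chain2[where f=ln and g="\<lambda>t. t\<^sup>2 + b\<^sup>2", OF DERIV_ln_divide[OF p(1)[of t]] this]
      show "((\<lambda>t. ln (t\<^sup>2 + b\<^sup>2)) has_real_derivative 1 / (t\<^sup>2 + b\<^sup>2) * (2 * t)) (at t)" .
    qed
    moreover have "1 / 2 * (1 / (t\<^sup>2 + b\<^sup>2) * (2 * t) - 0) = t / (t\<^sup>2 + b\<^sup>2)" by simp
    ultimately show ?thesis unfolding e by (simp only:)
  qed
  show "continuous_on UNIV (\<lambda>t. t / (t\<^sup>2 + b\<^sup>2))" using p by (intro continuous_intros) (auto simp: less_imp_neq[symmetric])
  show "\<bar>t / (t\<^sup>2 + b\<^sup>2)\<bar> \<le> 1 / b\<^sup>2" if "\<bar>t\<bar> \<le> 1" for t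
  proof -
    have "\<bar>t\<bar> / (t\<^sup>2 + b\<^sup>2) \<le> 1 / b\<^sup>2" using that b by (intro frac_le) auto
    thus ?thesis using p(1)[of t] by (simp add: abs_divide)
  qed
  show "\<bar>1 / 2 * ln ((t\<^sup>2 + b\<^sup>2) / (1 + b\<^sup>2))\<bar> \<le> 4 * (1 / sqrt (sqrt \<bar>t\<bar>))" if t: "t \<noteq> 0" "\<bar>t\<bar> \<le> 1" for t
  proof -
    let ?q = "(t\<^sup>2 + b\<^sup>2) / (1 + b\<^sup>2)"
    have t2: "t\<^sup>2 \<le> 1" "t\<^sup>2 > 0" using t square_le_one_iff by auto
    have "t\<^sup>2 * b\<^sup>2 \<le> 1 * b\<^sup>2" using t2 by (intro mult_right_mono) auto
    hence q1: "t\<^sup>2 \<le> ?q" using p by (simp add: pos_le_divide_eq algebra_simps)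
    have q2: "?q \<le> 1" using p t2 by (simp add: divide_le_eq_1)
    have "ln (t\<^sup>2) \<le> ln ?q" using q1 t2 by (intro ln_mono) auto
    moreover have "ln ?q \<le> 0" using q2 less_le_trans[OF t2(2) q1] by (subst ln_le_zero_iff)
    ultimately have "\<bar>1 / 2 * ln ?q\<bar> \<le> - (1 / 2 * ln (t\<^sup>2))" by simp
    also have "ln (t\<^sup>2) = 2 * ln \<bar>t\<bar>" using ln_realpow[of "\<bar>t\<bar>" 2] t by simp
    finally have "\<bar>1 / 2 * ln ?q\<bar> \<le> - ln \<bar>t\<bar>" by simp
    also have "\<dots> \<le> 4 * (1 / sqrt (sqrt \<bar>t\<bar>))" using t by (intro ln_fourth_root_bound) auto
    finally show ?thesis .
  qed
next
  fix t :: real assume t: "t \<noteq> 0"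
  have "((\<lambda>b. 1 / 2 * ln ((t\<^sup>2 + b\<^sup>2) / (1 + b\<^sup>2))) \<longlongrightarrow> 1 / 2 * ln ((t\<^sup>2 + 0\<^sup>2) / (1 + 0\<^sup>2))) (at_right 0)"
    using t by (intro tendsto_intros) auto
  thus "((\<lambda>b. 1 / 2 * ln ((t\<^sup>2 + b\<^sup>2) / (1 + b\<^sup>2))) \<longlongrightarrow> 1 / 2 * ln (t\<^sup>2)) (at_right 0)" by simp
qed measurable

text \<open>The kernel b / (t^2 + b^2) tends to pi times the Dirac mass at 0, and arctan (t / b)
  correspondingly to pi / 2 times the sign.\<close>

lemma H1w_arctan_limit:
  assumes "f \<in> H1w"
  shows "\<exists>l. ((\<lambda>b. LINT t|lborel. f t * gauss t * complex_of_real (bump t * (b / (t\<^sup>2 + b\<^sup>2)))) \<longlongrightarrow> l) (at_right 0)"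
proof (rule weak_derivative_localized_limit[OF assms, of "\<lambda>b t. arctan (t / b)" _ "\<lambda>b. b / b\<^sup>2" "\<lambda>t. pi / 2 * sgn t"])
  fix b :: real assume b: "b > 0"
  have p: "t\<^sup>2 + b\<^sup>2 > 0" for t using b by (auto simp: add_nonneg_pos)
  show "((\<lambda>t. arctan (t / b)) has_real_derivative b / (t\<^sup>2 + b\<^sup>2)) (at t)" for t
  proof -
    have "1 / b * inverse (1 + (t / b)\<^sup>2) = b / (t\<^sup>2 + b\<^sup>2)"
      using b p[of t] by (simp add: field_simps power2_eq_square)
    moreover have "((\<lambda>t. arctan (t / b)) has_real_derivative 1 / b * inverse (1 + (t / b)\<^sup>2)) (at t)"
      using b by (auto intro!: derivative_eq_intros)
    ultimately show ?thesis by simp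
  qed
  show "continuous_on UNIV (\<lambda>t. b / (t\<^sup>2 + b\<^sup>2))" using p by (intro continuous_intros) (auto simp: less_imp_neq[symmetric])
  show "\<bar>b / (t\<^sup>2 + b\<^sup>2)\<bar> \<le> b / b\<^sup>2" for t
  proof -
    have "b / (t\<^sup>2 + b\<^sup>2) \<le> b / b\<^sup>2" using b p[of t] by (intro divide_left_mono) auto
    thus ?thesis using b p[of t] by simp
  qed
  show "\<bar>arctan (t / b)\<bar> \<le> 4 * (1 / sqrt (sqrt \<bar>t\<bar>))" if t: "t \<noteq> 0" "\<bar>t\<bar> \<le> 1" for t
  proof -
    have "\<bar>arctan (t / b)\<bar> \<le> 4" using arctan_bounded[of "t / b"] pi_less_4 by auto
    moreover have "sqrt (sqrt \<bar>t\<bar>) \<le> 1" "sqrt (sqrt \<bar>t\<bar>) > 0" using t by auto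
    hence "1 \<le> 1 / sqrt (sqrt \<bar>t\<bar>)" by (simp add: pos_le_divide_eq)
    ultimately show ?thesis by linarith
  qed
next
  fix t :: real assume t: "t \<noteq> 0"
  have pos: "((\<lambda>b. arctan (s / b)) \<longlongrightarrow> pi / 2) (at_right 0)" if "s > 0" for s :: real
  proof (rule filterlim_compose[OF tendsto_arctan_at_top])
    have "filterlim (\<lambda>b. s * inverse b) at_top (at_right 0)"
      by (rule filterlim_tendsto_pos_mult_at_top[OF tendsto_const that filterlim_inverse_at_top_right])
    thus "filterlim (\<lambda>b. s / b) at_top (at_right 0)" by (simp add: divide_inverse)
  qed
  show "((\<lambda>b. arctan (t / b)) \<longlongrightarrow> pi / 2 * sgn t) (at_right 0)"
  proof (cases "t > 0")
    case True thus ?thesis using pos[OF True] by simp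
  next
    case False
    hence "- t > 0" using t by simp
    from tendsto_minus[OF pos[OF this]] show ?thesis using False t by (simp add: arctan_minus)
  qed
qed measurable

text \<open>The cut-off splits 1 / (t - i b). Away from 0 the kernel is bounded by 2 and dominated
  convergence applies; near 0 its real and imaginary parts are the two preceding lemmas.\<close>

theorem H1w_cauchy_tr_limit:
  assumes f: "f \<in> H1w"
  obtains l where "((\<lambda>b. cauchy_tr (\<lambda>t. f t * gauss t) (\<i> * complex_of_real b)) \<longlongrightarrow> l) (at_right 0)"
proof -
  have fw: "f \<in> L2w" using f by (simp add: H1w_def)
  note h = L2w_weighted(1)[OF fw]
  have [measurable]: "f \<in> borel_measurable borel" using fw by (simp add: L2w_def)
  obtain l1 where l1: "((\<lambda>b. LINT t|lborel. f t * gauss t * complex_of_real (bump t * (t / (t\<^sup>2 + b\<^sup>2)))) \<longlongrightarrow> l1) (at_right 0)"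
    using H1w_log_limit[OF f] by blast
  obtain l2 where l2: "((\<lambda>b. LINT t|lborel. f t * gauss t * complex_of_real (bump t * (b / (t\<^sup>2 + b\<^sup>2)))) \<longlongrightarrow> l2) (at_right 0)"
    using H1w_arctan_limit[OF f] by blast
  let ?r = "\<lambda>b t. complex_of_real (1 - bump t) * (1 / (complex_of_real t - \<i> * complex_of_real b))"
  have rb: "cmod (?r b t) \<le> 2" for b t
  proof (cases "t = 0")
    case True
    hence "bump t = 1" by (simp add: bump_def)
    thus ?thesis by simp
  next
    case False
    have "\<bar>t\<bar> \<le> cmod (complex_of_real t - \<i> * complex_of_real b)" using abs_Re_le_cmod[of "complex_of_real t - \<i> * complex_of_real b"] by simp
    hence "\<bar>1 - bump t\<bar> / cmod (complex_of_real t - \<i> * complex_of_real b) \<le> (2 * \<bar>t\<bar>) / \<bar>t\<bar>"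
      using False bump_bounds(4)[of t] by (intro frac_le) auto
    also have "\<dots> = 2" using False by simp
    finally show ?thesis by (simp only: norm_mult norm_divide norm_of_real norm_one times_divide_eq_right mult_1_right)
  qed
  let ?l3 = "LINT t|lborel. f t * gauss t * ?r 0 t"
  have l3: "((\<lambda>b. LINT t|lborel. f t * gauss t * ?r b t) \<longlongrightarrow> ?l3) (at_right 0)"
  proof (rule at_right_0_seqI)
    fix Y :: "nat \<Rightarrow> real" assume Y: "\<And>n. Y n > 0" "Y \<longlonglongrightarrow> 0"
    show "(\<lambda>n. LINT t|lborel. f t * gauss t * ?r (Y n) t) \<longlonglongrightarrow> ?l3"
    proof (rule integral_dominated_convergence[where w="\<lambda>t. 2 * cmod (f t * gauss t)"])
      show "integrable lborel (\<lambda>t. 2 * cmod (f t * gauss t))" using h by (intro integrable_mult_right integrable_norm)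
      show "AE t in lborel. (\<lambda>n. f t * gauss t * ?r (Y n) t) \<longlonglongrightarrow> f t * gauss t * ?r 0 t"
        using AE_lborel_singleton[of "0::real"] by eventually_elim (intro tendsto_intros Y, simp)
      show "AE t in lborel. cmod (f t * gauss t * ?r (Y n) t) \<le> 2 * cmod (f t * gauss t)" for n
      proof (intro AE_I2)
        fix t
        have "cmod (f t * gauss t) * cmod (?r (Y n) t) \<le> cmod (f t * gauss t) * 2" by (intro mult_left_mono rb) auto
        thus "cmod (f t * gauss t * ?r (Y n) t) \<le> 2 * cmod (f t * gauss t)" by (simp only: norm_mult mult.commute)
      qed
    qed measurable
  qed
  have bd: "\<bar>bump t * s\<bar> \<le> 1 * B" if "\<bar>t\<bar> \<le> 1 \<Longrightarrow> \<bar>s\<bar> \<le> B" "B \<ge> 0" for t s B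
  proof (cases "\<bar>t\<bar> \<le> 1")
    case True
    thus ?thesis unfolding abs_mult using bump_bounds(1,2)[of t] that(1)[OF True] by (intro mult_mono) auto
  next
    case False
    thus ?thesis using bump_bounds(5)[of t] that(2) by simp
  qed
  have ev: "\<forall>\<^sub>F b in at_right 0. (LINT t|lborel. f t * gauss t * ?r b t) + (LINT t|lborel. f t * gauss t * complex_of_real (bump t * (t / (t\<^sup>2 + b\<^sup>2))))
      + \<i> * (LINT t|lborel. f t * gauss t * complex_of_real (bump t * (b / (t\<^sup>2 + b\<^sup>2)))) = cauchy_tr (\<lambda>t. f t * gauss t) (\<i> * complex_of_real b)"
    using eventually_at_right_less[of "0::real"]
  proof eventually_elim
    case (elim b)
    have p: "t\<^sup>2 + b\<^sup>2 > 0" for t using elim by (auto simp: add_nonneg_pos)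
    have i1: "integrable lborel (\<lambda>t. f t * gauss t * ?r b t)" by (rule integrable_bounded_mult(1)[OF h _ rb]) measurable
    have i2: "integrable lborel (\<lambda>t. f t * gauss t * complex_of_real (bump t * (t / (t\<^sup>2 + b\<^sup>2))))"
    proof (rule integrable_bounded_mult(1)[OF h])
      fix t
      have "\<bar>bump t * (t / (t\<^sup>2 + b\<^sup>2))\<bar> \<le> 1 * (1 / b\<^sup>2)"
      proof (rule bd)
        assume "\<bar>t\<bar> \<le> 1"
        hence "\<bar>t\<bar> / (t\<^sup>2 + b\<^sup>2) \<le> 1 / b\<^sup>2" using elim by (intro frac_le) auto
        thus "\<bar>t / (t\<^sup>2 + b\<^sup>2)\<bar> \<le> 1 / b\<^sup>2" using p[of t] by (simp add: abs_divide)
      qed simp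
      thus "cmod (complex_of_real (bump t * (t / (t\<^sup>2 + b\<^sup>2)))) \<le> 1 / b\<^sup>2" by (simp only: norm_of_real mult_1)
    qed measurable
    have i3: "integrable lborel (\<lambda>t. f t * gauss t * complex_of_real (bump t * (b / (t\<^sup>2 + b\<^sup>2))))"
    proof (rule integrable_bounded_mult(1)[OF h])
      fix t
      have "\<bar>bump t * (b / (t\<^sup>2 + b\<^sup>2))\<bar> \<le> 1 * (b / b\<^sup>2)"
      proof (rule bd)
        have "b / (t\<^sup>2 + b\<^sup>2) \<le> b / b\<^sup>2" using elim p[of t] by (intro divide_left_mono) auto
        thus "\<bar>b / (t\<^sup>2 + b\<^sup>2)\<bar> \<le> b / b\<^sup>2" using elim p[of t] by simp
      qed (use elim in simp)
      thus "cmod (complex_of_real (bump t * (b / (t\<^sup>2 + b\<^sup>2)))) \<le> b / b\<^sup>2" by (simp only: norm_of_real mult_1)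
    qed measurable
    have pt: "f t * gauss t / (complex_of_real t - \<i> * complex_of_real b) = (f t * gauss t * ?r b t + f t * gauss t * complex_of_real (bump t * (t / (t\<^sup>2 + b\<^sup>2))))
       + \<i> * (f t * gauss t * complex_of_real (bump t * (b / (t\<^sup>2 + b\<^sup>2))))" for t
    proof -
      let ?c = "complex_of_real (t / (t\<^sup>2 + b\<^sup>2))" and ?e = "complex_of_real (b / (t\<^sup>2 + b\<^sup>2))"
      have "f t * gauss t / (complex_of_real t - \<i> * complex_of_real b) = f t * gauss t * (1 / (complex_of_real t - \<i> * complex_of_real b))" by simp
      also have "\<dots> = f t * gauss t * (complex_of_real (1 - bump t) * (?c + \<i> * ?e) + complex_of_real (bump t) * (?c + \<i> * ?e))"
        unfolding imaginary_axis_kernel[OF elim] by (simp only: distrib_right[symmetric] of_real_add[symmetric]) simp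
      also have "\<dots> = (f t * gauss t * ?r b t + f t * gauss t * (complex_of_real (bump t) * ?c)) + \<i> * (f t * gauss t * (complex_of_real (bump t) * ?e))"
        unfolding imaginary_axis_kernel[OF elim] by (simp only: algebra_simps)
      finally show ?thesis by (simp only: of_real_mult)
    qed
    show ?case
      unfolding cauchy_tr_def pt
        Bochner_Integration.integral_add[OF Bochner_Integration.integrable_add[OF i1 i2] integrable_mult_right[OF i3]]
        Bochner_Integration.integral_add[OF i1 i2] integral_mult_right_zero ..
  qed
  have "((\<lambda>b. (LINT t|lborel. f t * gauss t * ?r b t) + (LINT t|lborel. f t * gauss t * complex_of_real (bump t * (t / (t\<^sup>2 + b\<^sup>2))))
      + \<i> * (LINT t|lborel. f t * gauss t * complex_of_real (bump t * (b / (t\<^sup>2 + b\<^sup>2))))) \<longlongrightarrow> ?l3 + l1 + \<i> * l2) (at_right 0)"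
    by (intro tendsto_intros l1 l2 l3)
  from Lim_transform_eventually[OF this ev] show thesis by (rule that)
qed

lemma H1w_cnj: assumes "f \<in> H1w" shows "(\<lambda>t. cnj (f t)) \<in> H1w"
proof -
  obtain f' where f': "f \<in> L2w" "f' \<in> L2w" "weak_derivative f f'" using assms by (auto simp: H1w_def)
  have "weak_derivative (\<lambda>t. cnj (f t)) (\<lambda>t. cnj (f' t))"
    unfolding weak_derivative_def
  proof (intro allI impI)
    fix \<phi> assume "test_function \<phi>"
    hence e: "(LINT v|lborel. f v * complex_of_real (deriv \<phi> v)) = - (LINT v|lborel. f' v * complex_of_real (\<phi> v))"
      using f'(3) by (simp add: weak_derivative_def)
    have "(LINT v|lborel. cnj (f v) * complex_of_real (deriv \<phi> v)) = cnj (LINT v|lborel. f v * complex_of_real (deriv \<phi> v))"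
      unfolding Bochner_Integration.integral_cnj[symmetric] by simp
    also have "\<dots> = - cnj (LINT v|lborel. f' v * complex_of_real (\<phi> v))" unfolding e by simp
    also have "\<dots> = - (LINT v|lborel. cnj (f' v) * complex_of_real (\<phi> v))"
      unfolding Bochner_Integration.integral_cnj[symmetric] by simp
    finally show "(LINT v|lborel. cnj (f v) * complex_of_real (deriv \<phi> v)) = - (LINT v|lborel. cnj (f' v) * complex_of_real (\<phi> v))" .
  qed
  thus ?thesis using L2w_cnj[OF f'(1)] L2w_cnj[OF f'(2)] by (auto simp: H1w_def)
qed

text \<open>The regularizing factor l / (l - i b) cancels the zero of D at 0 and creates a pole at
  \<beta> = i b, where cnj \<beta> = -\<beta>. With the bounded factor \<zeta> / (D(\<zeta>)
  (\<zeta> - cnj \<beta>)) the Blaschke formula gives -2 pi b / D(i b) times the two transforms at i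
  b.\<close>

lemma transforms_critical:
  assumes \<xi>: "\<xi> = sqrt pi" and f: "f \<in> L2w" and g: "g \<in> L2w"
    and F0: "((\<lambda>b. cauchy_tr (\<lambda>t. f t * gauss t) (\<i> * complex_of_real b)) \<longlongrightarrow> F0) (at_right 0)"
    and K0: "((\<lambda>b. cauchy_tr (\<lambda>t. cnj (g t) * gauss t) (\<i> * complex_of_real b)) \<longlongrightarrow> K0) (at_right 0)"
  shows "\<And>b. b > 0 \<Longrightarrow> integrable lborel (reg_integrand b (B_tr \<xi> f) (U_tr \<xi> g))"
    and "((\<lambda>b. LINT l|lborel. reg_integrand b (B_tr \<xi> f) (U_tr \<xi> g) l) \<longlongrightarrow> L2w_inner f g + F0 * K0 / 2) (at_right 0)"
proof -
  have x0: "\<xi> > 0" using \<xi> by simp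
  obtain y0 C where y0: "\<xi> = sqrt pi \<Longrightarrow> y0 = 0"
    "\<And>\<zeta>. Im \<zeta> \<ge> 0 \<Longrightarrow> dispersion \<xi> \<zeta> = 0 \<longleftrightarrow> \<zeta> = \<i> * complex_of_real y0"
    "(dispersion \<xi> has_field_derivative complex_of_real (2 - 2 * y0 * \<xi>)) (at (\<i> * complex_of_real y0))"
    "C \<ge> 0" "\<And>\<zeta>. Im \<zeta> \<ge> 0 \<Longrightarrow> cmod (\<zeta> - \<i> * complex_of_real y0) \<le> C * (1 + cmod \<zeta>) * cmod (dispersion \<xi> \<zeta>)"
    by (rule dispersion_quotient_bound[of \<xi>]) (use \<xi> in auto)
  have z: "dispersion \<xi> \<zeta> = 0 \<longleftrightarrow> \<zeta> = 0" if "Im \<zeta> \<ge> 0" for \<zeta> using y0(2)[OF that] y0(1)[OF \<xi>] by simp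
  have d: "(dispersion \<xi> has_field_derivative 2) (at 0)" using y0(3) y0(1)[OF \<xi>] by simp
  have Cb: "cmod \<zeta> \<le> C * (1 + cmod \<zeta>) * cmod (dispersion \<xi> \<zeta>)" if "Im \<zeta> \<ge> 0" for \<zeta> using y0(5)[OF that] y0(1)[OF \<xi>] by simp
  obtain \<phi> \<kappa> r where T: "hardy_boundary (\<lambda>t. f t * gauss t) \<phi>" "hardy_boundary (\<lambda>t. cnj (g t) * gauss t) \<kappa>"
    "integrable lborel r" "(LINT l|lborel. r l) = 0"
    "AE l in lborel. B_tr \<xi> f l * cnj (U_tr \<xi> g l) * complex_of_real (wt l) =
       f l * cnj (g l) * gauss l + 1 / (2 * \<i> * complex_of_real pi) * (\<phi> l * \<kappa> l / dispersion \<xi> (complex_of_real l) - r l)"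
    by (rule transforms_product[OF x0 f g])
  let ?m = "\<lambda>b l. complex_of_real l / (complex_of_real l - \<i> * complex_of_real b)"
  let ?F = "\<lambda>b. cauchy_tr (\<lambda>t. f t * gauss t) (\<i> * complex_of_real b)"
  let ?K = "\<lambda>b. cauchy_tr (\<lambda>t. cnj (g t) * gauss t) (\<i> * complex_of_real b)"
  have m1: "cmod (?m b l) \<le> 1" for b l
  proof -
    have "\<bar>l\<bar> \<le> cmod (complex_of_real l - \<i> * complex_of_real b)" using abs_Re_le_cmod[of "complex_of_real l - \<i> * complex_of_real b"] by simp
    thus ?thesis by (simp add: norm_divide divide_le_eq_1)
  qed
  have mi: "integrable lborel (\<lambda>l. s l * ?m b l)" if "integrable lborel s" for s b
    by (rule integrable_bounded_mult(1)[OF that _ m1]) measurable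
  have mlim: "((\<lambda>b. LINT l|lborel. s l * ?m b l) \<longlongrightarrow> (LINT l|lborel. s l)) (at_right 0)" if s: "integrable lborel s" for s
  proof (rule at_right_0_seqI)
    fix Y :: "nat \<Rightarrow> real" assume Y: "\<And>n. Y n > 0" "Y \<longlonglongrightarrow> 0"
    show "(\<lambda>n. LINT l|lborel. s l * ?m (Y n) l) \<longlonglongrightarrow> (LINT l|lborel. s l)"
    proof (rule integral_dominated_convergence[where w="\<lambda>l. cmod (s l)"])
      show "AE l in lborel. (\<lambda>n. s l * ?m (Y n) l) \<longlonglongrightarrow> s l"
        using AE_lborel_singleton[of "0::real"]
      proof eventually_elim
        case (elim l)
        have "(\<lambda>n. s l * ?m (Y n) l) \<longlonglongrightarrow> s l * (complex_of_real l / (complex_of_real l - \<i> * complex_of_real 0))"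
          by (intro tendsto_intros Y) (use elim in simp)
        thus ?case using elim by simp
      qed
      show "AE l in lborel. cmod (s l * ?m (Y n) l) \<le> cmod (s l)" for n
      proof (intro AE_I2)
        fix l
        have "cmod (s l) * cmod (?m (Y n) l) \<le> cmod (s l) * 1" by (intro mult_left_mono m1) auto
        thus "cmod (s l * ?m (Y n) l) \<le> cmod (s l)" by (simp only: norm_mult mult_1_right)
      qed
      show "(\<lambda>l. s l * ?m (Y n) l) \<in> borel_measurable lborel" for n by (rule borel_measurable_integrable[OF mi[OF s]])
    qed (use s in auto)
  qed
  let ?E = "\<lambda>l. \<phi> l * \<kappa> l / dispersion \<xi> (complex_of_real l)"
  have E: "integrable lborel (\<lambda>l. ?E l * ?m b l)"
    "(LINT l|lborel. ?E l * ?m b l) = - 2 * complex_of_real pi * (complex_of_real b / dispersion \<xi> (\<i> * complex_of_real b)) * (?F b * ?K b)"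
    if b: "b > 0" for b
  proof -
    define \<beta> where "\<beta> = \<i> * complex_of_real b"
    have ib: "Im \<beta> > 0" "Im \<beta> = b" "cnj \<beta> = - \<beta>" using b by (auto simp: \<beta>_def)
    have cz: "\<zeta> - cnj \<beta> \<noteq> 0" if "Im \<zeta> \<ge> 0" for \<zeta> using that ib by (auto simp: complex_eq_iff)
    have Dz: "dispersion \<xi> \<zeta> \<noteq> 0" if "Im \<zeta> > 0" for \<zeta> using z[of \<zeta>] that by auto
    let ?p = "\<lambda>\<zeta>::complex. (\<zeta> - 0) / (dispersion \<xi> \<zeta> * (\<zeta> - cnj \<beta>))"
    let ?pbd = "\<lambda>x::real. (complex_of_real x - 0) / (dispersion \<xi> (complex_of_real x) * (complex_of_real x - cnj \<beta>))"
    have ph: "?p holomorphic_on {\<zeta>. Im \<zeta> > 0}"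
      using Dz cz by (intro holomorphic_intros dispersion_holomorphic) auto
    have pb: "cmod (?p \<zeta>) \<le> C * (1 + (1 + cmod \<beta>) / Im \<beta>)" if im: "Im \<zeta> > 0" for \<zeta>
    proof -
      have "cmod \<zeta> \<le> C * (1 + cmod \<zeta>) * cmod (dispersion \<xi> \<zeta>)" by (rule Cb) (use im in simp)
      also have "\<dots> \<le> C * ((1 + (1 + cmod \<beta>) / Im \<beta>) * cmod (\<zeta> - cnj \<beta>)) * cmod (dispersion \<xi> \<zeta>)"
        using one_plus_norm_le[OF ib(1), of \<zeta>] im y0(4) by (intro mult_right_mono mult_left_mono) auto
      finally have "cmod \<zeta> \<le> C * (1 + (1 + cmod \<beta>) / Im \<beta>) * (cmod (dispersion \<xi> \<zeta>) * cmod (\<zeta> - cnj \<beta>))" by (simp only: mult_ac)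
      moreover have "cmod (dispersion \<xi> \<zeta>) * cmod (\<zeta> - cnj \<beta>) > 0" using Dz[OF im] cz[of \<zeta>] im by simp
      ultimately show ?thesis by (simp add: norm_divide norm_mult pos_divide_le_eq)
    qed
    have pl: "AE x in lborel. ((\<lambda>y. ?p (complex_of_real x + \<i> * complex_of_real y)) \<longlongrightarrow> ?pbd x) (at_right 0)"
      using AE_lborel_singleton[of "0::real"] by eventually_elim (rule blaschke_boundary_tendsto[OF _ ib(1)])
    have m: "?pbd \<in> borel_measurable borel" by measurable
    note HB = hardy_blaschke_integral[OF L2w_weighted(1)[OF f] T(1) L2w_weighted(1)[OF L2w_cnj[OF g]] T(2) ph pb m pl ib(1)]
    have fin: "(\<phi> x * \<kappa> x * ?pbd x) * ((complex_of_real x - cnj \<beta>) / (complex_of_real x - \<beta>)) = ?E x * ?m b x" for x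
    proof -
      have "complex_of_real x - cnj \<beta> \<noteq> 0" "complex_of_real x - \<beta> \<noteq> 0" using ib by (auto simp: complex_eq_iff)
      thus ?thesis unfolding \<beta>_def[symmetric] by (simp add: mult_ac)
    qed
    show "integrable lborel (\<lambda>l. ?E l * ?m b l)"
      unfolding fin[symmetric]
    proof (rule integrable_bounded_mult(1)[OF HB(1)])
      show "cmod ((complex_of_real x - cnj \<beta>) / (complex_of_real x - \<beta>)) \<le> 1" for x
      proof -
        have "cmod (complex_of_real x - cnj \<beta>) = cmod (complex_of_real x - \<beta>)"
          by (metis complex_cnj_complex_of_real complex_cnj_diff complex_mod_cnj)
        thus ?thesis by (simp add: norm_divide divide_le_eq_1)
      qed
    qed measurable
    have "(LINT l|lborel. ?E l * ?m b l) = - 4 * complex_of_real (pi * Im \<beta>) * (?p \<beta> * cauchy_tr (\<lambda>t. f t * gauss t) \<beta> * cauchy_tr (\<lambda>t. cnj (g t) * gauss t) \<beta>)"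
      unfolding fin[symmetric] by (rule HB(2))
    also have "\<beta> \<noteq> 0" using b by (simp add: \<beta>_def)
    hence "?p \<beta> = 1 / (2 * dispersion \<xi> \<beta>)" using ib(3) by (simp add: mult_2[symmetric])
    finally show "(LINT l|lborel. ?E l * ?m b l) = - 2 * complex_of_real pi * (complex_of_real b / dispersion \<xi> (\<i> * complex_of_real b)) * (?F b * ?K b)"
      unfolding \<beta>_def[symmetric] by (simp add: ib(2))
  qed
  have Elim: "((\<lambda>b. LINT l|lborel. ?E l * ?m b l) \<longlongrightarrow> \<i> * complex_of_real pi * (F0 * K0)) (at_right 0)"
  \<comment> \<open>D(0) = 0 and D'(0) = 2, so b / D(i b) tends to 1 / (2 i). The limit is i pi F0
    K0, and the factor 1 / (2 pi i) in front of it leaves F0 K0 / 2.\<close>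
  proof -
    have "((\<lambda>h. dispersion \<xi> h / h) \<longlongrightarrow> 2) (at 0)"
      using d z[of 0] by (simp add: has_field_derivative_iff)
    moreover have "filterlim (\<lambda>b. \<i> * complex_of_real b) (at 0) (at_right 0)"
    proof -
      have "((\<lambda>b. \<i> * complex_of_real b) \<longlongrightarrow> \<i> * complex_of_real 0) (at_right 0)" by (intro tendsto_intros)
      moreover have "\<forall>\<^sub>F b in at_right 0. \<i> * complex_of_real b \<noteq> 0"
        using eventually_at_right_less[of "0::real"] by eventually_elim simp
      ultimately show ?thesis by (simp add: filterlim_at)
    qed
    ultimately have "((\<lambda>b. dispersion \<xi> (\<i> * complex_of_real b) / (\<i> * complex_of_real b)) \<longlongrightarrow> 2) (at_right 0)"
      by (rule filterlim_compose)
    hence "((\<lambda>b. - 2 * complex_of_real pi * ((1 / \<i>) / (dispersion \<xi> (\<i> * complex_of_real b) / (\<i> * complex_of_real b))) * (?F b * ?K b)) \<longlongrightarrow>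
      - 2 * complex_of_real pi * ((1 / \<i>) / 2) * (F0 * K0)) (at_right 0)"
      by (intro tendsto_intros F0 K0) simp_all
    moreover have "\<forall>\<^sub>F b in at_right 0. - 2 * complex_of_real pi * ((1 / \<i>) / (dispersion \<xi> (\<i> * complex_of_real b) / (\<i> * complex_of_real b))) * (?F b * ?K b) = (LINT l|lborel. ?E l * ?m b l)"
      using eventually_at_right_less[of "0::real"]
    proof eventually_elim
      case (elim b)
      have "(1 / \<i>) / (dispersion \<xi> (\<i> * complex_of_real b) / (\<i> * complex_of_real b)) = complex_of_real b / dispersion \<xi> (\<i> * complex_of_real b)"
        by simp
      thus ?case unfolding E(2)[OF elim] by (simp only:)
    qed
    ultimately have "((\<lambda>b. LINT l|lborel. ?E l * ?m b l) \<longlongrightarrow> - 2 * complex_of_real pi * ((1 / \<i>) / 2) * (F0 * K0)) (at_right 0)"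
      by (rule Lim_transform_eventually)
    thus ?thesis by (simp add: mult_ac)
  qed
  let ?A = "\<lambda>l. f l * cnj (g l) * gauss l" and ?c = "1 / (2 * \<i> * complex_of_real pi)"
  have A: "integrable lborel ?A" by (rule L2w_inner_integrable[OF f g])
  note [measurable] = B_tr_measurable[OF x0 f] U_tr_measurable[OF x0 g]
  have rm: "reg_integrand b (B_tr \<xi> f) (U_tr \<xi> g) \<in> borel_measurable lborel" for b
    unfolding reg_integrand_def[abs_def] by measurable
  have ae: "AE l in lborel. reg_integrand b (B_tr \<xi> f) (U_tr \<xi> g) l = ?A l * ?m b l + ?c * (?E l * ?m b l - r l * ?m b l)" for b
    using T(5)
  proof eventually_elim
    case (elim l)
    have "reg_integrand b (B_tr \<xi> f) (U_tr \<xi> g) l = (B_tr \<xi> f l * cnj (U_tr \<xi> g l) * complex_of_real (wt l)) * ?m b l"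
      by (simp add: reg_integrand_def)
    thus ?case unfolding elim by (simp only: distrib_right left_diff_distrib mult.assoc)
  qed
  have i2: "integrable lborel (\<lambda>l. ?c * (?E l * ?m b l - r l * ?m b l))" if "b > 0" for b
    by (intro integrable_mult_right Bochner_Integration.integrable_diff E(1)[OF that] mi T(3))
  have i: "integrable lborel (\<lambda>l. ?A l * ?m b l + ?c * (?E l * ?m b l - r l * ?m b l))" if "b > 0" for b
    by (rule Bochner_Integration.integrable_add[OF mi[OF A] i2[OF that]])
  show "integrable lborel (reg_integrand b (B_tr \<xi> f) (U_tr \<xi> g))" if b: "b > 0" for b
    using integrable_cong_AE[OF rm borel_measurable_integrable[OF i[OF b]] ae] i[OF b] by simp
  have val: "(LINT l|lborel. ?A l * ?m b l) + ?c * ((LINT l|lborel. ?E l * ?m b l) - (LINT l|lborel. r l * ?m b l)) = (LINT l|lborel. reg_integrand b (B_tr \<xi> f) (U_tr \<xi> g) l)" if b: "b > 0" for b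
    unfolding integral_cong_AE[OF rm borel_measurable_integrable[OF i[OF b]] ae]
      Bochner_Integration.integral_add[OF mi[OF A] i2[OF b]] integral_mult_right_zero
      Bochner_Integration.integral_diff[OF E(1)[OF b] mi[OF T(3)]] ..
  have "((\<lambda>b. (LINT l|lborel. ?A l * ?m b l) + ?c * ((LINT l|lborel. ?E l * ?m b l) - (LINT l|lborel. r l * ?m b l))) \<longlongrightarrow>
     L2w_inner f g + ?c * (\<i> * complex_of_real pi * (F0 * K0) - 0)) (at_right 0)"
    using mlim[OF A] mlim[OF T(3)] unfolding T(4) L2w_inner_gauss[symmetric] by (intro tendsto_intros Elim)
  hence "((\<lambda>b. LINT l|lborel. reg_integrand b (B_tr \<xi> f) (U_tr \<xi> g) l) \<longlongrightarrow> L2w_inner f g + ?c * (\<i> * complex_of_real pi * (F0 * K0) - 0)) (at_right 0)"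
  proof (rule Lim_transform_eventually)
    show "\<forall>\<^sub>F b in at_right 0. (LINT l|lborel. ?A l * ?m b l) + ?c * ((LINT l|lborel. ?E l * ?m b l) - (LINT l|lborel. r l * ?m b l)) = (LINT l|lborel. reg_integrand b (B_tr \<xi> f) (U_tr \<xi> g) l)"
      using eventually_at_right_less[of "0::real"] by eventually_elim (rule val)
  qed
  thus "((\<lambda>b. LINT l|lborel. reg_integrand b (B_tr \<xi> f) (U_tr \<xi> g) l) \<longlongrightarrow> L2w_inner f g + F0 * K0 / 2) (at_right 0)" by simp
qed

section \<open>Resolvent and Riesz projection\<close>

lemma L2w_add: assumes "f \<in> L2w" "g \<in> L2w" shows "(\<lambda>v. f v + g v) \<in> L2w"
proof -
  have [measurable]: "f \<in> borel_measurable borel" "g \<in> borel_measurable borel" using assms by (auto simp: L2w_def)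
  have i: "integrable lborel (\<lambda>v. 2 * ((cmod (f v))\<^sup>2 * wt v) + 2 * ((cmod (g v))\<^sup>2 * wt v))"
    using assms by (auto simp: L2w_def intro!: Bochner_Integration.integrable_add integrable_mult_right)
  have "integrable lborel (\<lambda>v. (cmod (f v + g v))\<^sup>2 * wt v)"
  proof (rule Bochner_Integration.integrable_bound[OF i])
    show "AE v in lborel. norm ((cmod (f v + g v))\<^sup>2 * wt v) \<le> norm (2 * ((cmod (f v))\<^sup>2 * wt v) + 2 * ((cmod (g v))\<^sup>2 * wt v))"
    proof (intro AE_I2)
      fix v
      have "(cmod (f v + g v))\<^sup>2 * wt v \<le> (2 * (cmod (f v))\<^sup>2 + 2 * (cmod (g v))\<^sup>2) * wt v"
        by (intro mult_right_mono cmod_add_power2_le wt_nonneg)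
      also have "\<dots> \<le> \<bar>2 * ((cmod (f v))\<^sup>2 * wt v) + 2 * ((cmod (g v))\<^sup>2 * wt v)\<bar>" by (simp add: algebra_simps)
      finally show "norm ((cmod (f v + g v))\<^sup>2 * wt v) \<le> norm (2 * ((cmod (f v))\<^sup>2 * wt v) + 2 * ((cmod (g v))\<^sup>2 * wt v))"
        by (simp add: wt_nonneg)
    qed
  qed measurable
  thus ?thesis by (simp add: L2w_def)
qed

lemma L2w_bounded_mult:
  assumes f: "f \<in> L2w" and m [measurable]: "m \<in> borel_measurable borel" and b: "\<And>v. cmod (m v) \<le> B"
  shows "(\<lambda>v. f v * m v) \<in> L2w"
proof -
  have [measurable]: "f \<in> borel_measurable borel" and i: "integrable lborel (\<lambda>v. (cmod (f v))\<^sup>2 * wt v)" using f by (auto simp: L2w_def)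
  have "integrable lborel (\<lambda>v. (cmod (f v * m v))\<^sup>2 * wt v)"
  proof (rule Bochner_Integration.integrable_bound[OF integrable_mult_right[OF i, of "B\<^sup>2"]])
    show "AE v in lborel. norm ((cmod (f v * m v))\<^sup>2 * wt v) \<le> norm (B\<^sup>2 * ((cmod (f v))\<^sup>2 * wt v))"
    proof (intro AE_I2)
      fix v
      have "(cmod (m v))\<^sup>2 * ((cmod (f v))\<^sup>2 * wt v) \<le> B\<^sup>2 * ((cmod (f v))\<^sup>2 * wt v)"
        using b by (intro mult_right_mono power_mono) (auto simp: wt_nonneg)
      thus "norm ((cmod (f v * m v))\<^sup>2 * wt v) \<le> norm (B\<^sup>2 * ((cmod (f v))\<^sup>2 * wt v))"
        by (simp add: norm_mult power_mult_distrib wt_nonneg mult_ac)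
    qed
  qed measurable
  thus ?thesis by (simp add: L2w_def)
qed

lemma L2w_const: "(\<lambda>_. c) \<in> L2w"
  by (simp add: L2w_def wt_integrable)

lemma L2w_cmult: "f \<in> L2w \<Longrightarrow> (\<lambda>v. c * f v) \<in> L2w"
  using L2w_bounded_mult[of f "\<lambda>_. c" "cmod c"] by (simp add: mult.commute)

lemma L2w_diff: "f \<in> L2w \<Longrightarrow> g \<in> L2w \<Longrightarrow> (\<lambda>v. f v - g v) \<in> L2w"
  using L2w_add[of f "\<lambda>v. - 1 * g v"] L2w_cmult[of g "-1"] by simp

lemma L2w_inner_diff:
  assumes "f \<in> L2w" "g \<in> L2w" "k \<in> L2w"
  shows "L2w_inner (\<lambda>v. f v - g v) k = L2w_inner f k - L2w_inner g k"
  unfolding L2w_inner_gauss left_diff_distrib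
  by (rule Bochner_Integration.integral_diff[OF L2w_inner_integrable[OF assms(1,3)] L2w_inner_integrable[OF assms(2,3)]])

lemma L2w_inner_AE_cong:
  assumes "f \<in> L2w" "f' \<in> L2w" "g \<in> L2w" "AE v in lborel. f v = f' v"
  shows "L2w_inner f g = L2w_inner f' g"
  unfolding L2w_inner_gauss
proof (rule integral_cong_AE[OF borel_measurable_integrable[OF L2w_inner_integrable[OF assms(1,3)]] borel_measurable_integrable[OF L2w_inner_integrable[OF assms(2,3)]]])
  show "AE v in lborel. f v * cnj (g v) * gauss v = f' v * cnj (g v) * gauss v" using assms(4) by eventually_elim simp
qed

lemma L2w_sq_zero:
  assumes "f \<in> L2w" "(LINT v|lborel. (cmod (f v))\<^sup>2 * wt v) = 0"
  shows "AE v in lborel. f v = 0"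
proof -
  have i: "integrable lborel (\<lambda>v. (cmod (f v))\<^sup>2 * wt v)" using assms(1) by (simp add: L2w_def)
  have "AE v in lborel. (cmod (f v))\<^sup>2 * wt v = 0"
    using integral_nonneg_eq_0_iff_AE[OF i] assms(2) by (simp add: wt_nonneg)
  thus ?thesis by eventually_elim (use wt_pos in \<open>simp add: less_imp_neq[symmetric]\<close>)
qed

section \<open>The resolvent in closed form\<close>

definition res_kernel :: "real \<Rightarrow> complex \<Rightarrow> real \<Rightarrow> complex" where
  "res_kernel \<xi> z v = 1 / (\<i> * complex_of_real v * complex_of_real \<xi> + 1 + z)"

text \<open>Bilinear rather than sesquilinear: the weight and a possible conjugation are part of h,
  which makes it holomorphic in z.\<close>

definition res_form :: "real \<Rightarrow> (real \<Rightarrow> complex) \<Rightarrow> complex \<Rightarrow> complex" where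
  "res_form \<xi> h z = (LINT v|lborel. h v * res_kernel \<xi> z v)"

lemma res_kernel_measurable [measurable]: "res_kernel \<xi> z \<in> borel_measurable borel"
  unfolding res_kernel_def[abs_def] by measurable

lemma res_kernel_denominator:
  assumes "Re z > -1" shows "\<i> * complex_of_real v * complex_of_real \<xi> + 1 + z \<noteq> 0" 
    "Re z + 1 \<le> cmod (\<i> * complex_of_real v * complex_of_real \<xi> + 1 + z)"
proof -
  have "Re (\<i> * complex_of_real v * complex_of_real \<xi> + 1 + z) = Re z + 1" by simp
  thus "Re z + 1 \<le> cmod (\<i> * complex_of_real v * complex_of_real \<xi> + 1 + z)" using complex_Re_le_cmod by metis
  thus "\<i> * complex_of_real v * complex_of_real \<xi> + 1 + z \<noteq> 0" using assms by auto
qed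

lemma res_kernel_bound:
  assumes "Re z > -1" shows "cmod (res_kernel \<xi> z v) \<le> 1 / (Re z + 1)"
  unfolding res_kernel_def norm_divide norm_one
  using res_kernel_denominator[OF assms] assms by (intro frac_le) auto

lemma res_form_cauchy_tr:
  assumes "\<xi> \<noteq> 0"
  shows "res_form \<xi> h z = cauchy_tr h (\<i> * (1 + z) / complex_of_real \<xi>) / (\<i> * complex_of_real \<xi>)"
proof -
  have "\<i> * complex_of_real v * complex_of_real \<xi> + 1 + z = \<i> * complex_of_real \<xi> * (complex_of_real v - \<i> * (1 + z) / complex_of_real \<xi>)" for v
    using assms by (simp add: field_simps)
  hence "h v * res_kernel \<xi> z v = (h v / (complex_of_real v - \<i> * (1 + z) / complex_of_real \<xi>)) / (\<i> * complex_of_real \<xi>)" for v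
    by (simp only: res_kernel_def times_divide_eq_right mult_1_right mult_1_left divide_divide_eq_left mult.commute)
  thus ?thesis unfolding res_form_def cauchy_tr_def by (simp only: integral_divide_zero)
qed

lemma res_form_holomorphic:
  assumes "\<xi> \<noteq> 0" "integrable lborel h"
  shows "res_form \<xi> h holomorphic_on {z. Re z > -1}"
proof -
  have "(cauchy_tr h \<circ> (\<lambda>z. \<i> * (1 + z) / complex_of_real \<xi>)) holomorphic_on {z. Re z > -1}"
  proof (rule holomorphic_on_compose_gen[OF _ cauchy_tr_holomorphic[OF assms(2), of "{z. Im z \<noteq> 0}"]])
    show "(\<lambda>z. \<i> * (1 + z) / complex_of_real \<xi>) holomorphic_on {z. Re z > -1}"
      using assms by (intro holomorphic_intros) auto
    show "(\<lambda>z. \<i> * (1 + z) / complex_of_real \<xi>) ` {z. Re z > -1} \<subseteq> {z. Im z \<noteq> 0}"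
      using assms by (auto simp: Im_divide_of_real)
  qed simp
  hence "(\<lambda>z. cauchy_tr h (\<i> * (1 + z) / complex_of_real \<xi>) / (\<i> * complex_of_real \<xi>)) holomorphic_on {z. Re z > -1}"
    using assms by (intro holomorphic_intros) (auto simp: o_def)
  thus ?thesis unfolding res_form_cauchy_tr[OF assms(1), abs_def] .
qed

lemma omega_res_form: "omega z \<xi> = 1 - res_form \<xi> gauss z"
  by (simp add: omega_def res_form_def res_kernel_def gauss_def)

lemma res_form_integrable:
  assumes "integrable lborel h" "Re z > -1"
  shows "integrable lborel (\<lambda>v. h v * res_kernel \<xi> z v)"
  by (rule integrable_bounded_mult(1)[OF assms(1) _ res_kernel_bound[OF assms(2)]]) measurable

text \<open>The operator is a multiplication operator plus a rank one term. With c the unknown (f,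
  1), the equation (L - z) f = g reads f = (c - g) times the kernel, and pairing it with 1 leaves
  the scalar equation c \<omega> = - \<open>res_form\<close> of g w.\<close>

definition res_solution :: "real \<Rightarrow> complex \<Rightarrow> (real \<Rightarrow> complex) \<Rightarrow> real \<Rightarrow> complex" where
  "res_solution \<xi> z g v = (- res_form \<xi> (\<lambda>t. g t * gauss t) z / omega z \<xi> - g v) * res_kernel \<xi> z v"

lemma L_op_shift: "L_op \<xi> f v - z * f v = L2w_inner f (\<lambda>_. 1) - (\<i> * complex_of_real v * complex_of_real \<xi> + 1 + z) * f v"
  by (simp add: L_op_def V_op_def algebra_simps)

lemma affine_res_kernel_L2w:
  assumes "g \<in> L2w" "Re z > -1" shows "(\<lambda>v. (c - g v) * res_kernel \<xi> z v) \<in> L2w"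
  by (rule L2w_bounded_mult[OF L2w_diff[OF L2w_const assms(1)] _ res_kernel_bound[OF assms(2)]]) measurable

lemma affine_res_kernel_inner:
  assumes g: "g \<in> L2w" and k: "k \<in> L2w" and z: "Re z > -1"
  shows "L2w_inner (\<lambda>v. (c - g v) * res_kernel \<xi> z v) k = c * res_form \<xi> (\<lambda>v. cnj (k v) * gauss v) z - res_form \<xi> (\<lambda>v. g v * cnj (k v) * gauss v) z"
proof -
  have i1: "integrable lborel (\<lambda>v. c * (cnj (k v) * gauss v * res_kernel \<xi> z v))"
    by (intro integrable_mult_right res_form_integrable L2w_weighted(1)[OF L2w_cnj[OF k]] z)
  have i2: "integrable lborel (\<lambda>v. g v * cnj (k v) * gauss v * res_kernel \<xi> z v)"
    by (intro res_form_integrable L2w_inner_integrable g k z)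
  have "L2w_inner (\<lambda>v. (c - g v) * res_kernel \<xi> z v) k = (LINT v|lborel. c * (cnj (k v) * gauss v * res_kernel \<xi> z v) - g v * cnj (k v) * gauss v * res_kernel \<xi> z v)"
    unfolding L2w_inner_gauss by (intro Bochner_Integration.integral_cong refl) (simp add: algebra_simps)
  thus ?thesis unfolding res_form_def Bochner_Integration.integral_diff[OF i1 i2] integral_mult_right_zero .
qed

lemma res_solution:
  assumes z: "Re z > -1" "omega z \<xi> \<noteq> 0" and g: "g \<in> L2w"
  shows "res_solution \<xi> z g \<in> L_dom \<xi>" "L_op \<xi> (res_solution \<xi> z g) v - z * res_solution \<xi> z g v = g v"
proof -
  let ?f = "res_solution \<xi> z g" and ?c = "- res_form \<xi> (\<lambda>t. g t * gauss t) z / omega z \<xi>"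
  have f: "?f \<in> L2w" unfolding res_solution_def[abs_def] by (rule affine_res_kernel_L2w[OF g z(1)])
  have "L2w_inner ?f (\<lambda>_. 1) = ?c * res_form \<xi> gauss z - res_form \<xi> (\<lambda>t. g t * gauss t) z"
    using affine_res_kernel_inner[OF g L2w_const[of 1] z(1), of ?c \<xi>] unfolding res_solution_def[abs_def] by simp
  also have "\<dots> = ?c * (1 - omega z \<xi>) - res_form \<xi> (\<lambda>t. g t * gauss t) z" by (simp add: omega_res_form)
  also have "\<dots> = ?c" using z(2) by (simp add: field_simps)
  finally have c: "L2w_inner ?f (\<lambda>_. 1) = ?c" .
  have eq: "L_op \<xi> ?f v - z * ?f v = g v" for v
    unfolding L_op_shift c using res_kernel_denominator(1)[OF z(1), of v \<xi>]
    by (simp add: res_solution_def res_kernel_def)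
  thus "L_op \<xi> ?f v - z * ?f v = g v" .
  have "L_op \<xi> ?f v = g v + z * ?f v" for v using eq[of v] by (simp add: algebra_simps)
  hence "L_op \<xi> ?f = (\<lambda>v. g v + z * ?f v)" by auto
  thus "?f \<in> L_dom \<xi>" using f L2w_add[OF g L2w_cmult[OF f, of z]] by (simp add: L_dom_def)
qed

lemma res_solution_unique:
  assumes z: "Re z > -1" "omega z \<xi> \<noteq> 0" and g: "g \<in> L2w" and f: "f \<in> L2w"
    and eq: "AE v in lborel. L_op \<xi> f v - z * f v = g v"
  shows "AE v in lborel. f v = res_solution \<xi> z g v"
proof -
  let ?c = "L2w_inner f (\<lambda>_. 1)"
  have ae: "AE v in lborel. f v = (?c - g v) * res_kernel \<xi> z v"
    using eq
  proof eventually_elim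
    case (elim v)
    hence "?c - g v = (\<i> * complex_of_real v * complex_of_real \<xi> + 1 + z) * f v" unfolding L_op_shift by (simp add: algebra_simps)
    thus ?case using res_kernel_denominator(1)[OF z(1), of v \<xi>] by (simp add: res_kernel_def)
  qed
  have "?c = L2w_inner (\<lambda>v. (?c - g v) * res_kernel \<xi> z v) (\<lambda>_. 1)"
    by (rule L2w_inner_AE_cong[OF f affine_res_kernel_L2w[OF g z(1)] L2w_const ae])
  also have "\<dots> = ?c * res_form \<xi> gauss z - res_form \<xi> (\<lambda>t. g t * gauss t) z"
    using affine_res_kernel_inner[OF g L2w_const[of 1] z(1), of ?c \<xi>] by simp
  also have "\<dots> = ?c * (1 - omega z \<xi>) - res_form \<xi> (\<lambda>t. g t * gauss t) z" by (simp add: omega_res_form)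
  finally have "?c * omega z \<xi> = - res_form \<xi> (\<lambda>t. g t * gauss t) z" by (simp add: algebra_simps eq_neg_iff_add_eq_0)
  hence "?c = - res_form \<xi> (\<lambda>t. g t * gauss t) z / omega z \<xi>" unfolding nonzero_eq_divide_eq[OF z(2)] .
  thus ?thesis using ae by (simp add: res_solution_def)
qed

lemma L2w_norm_bound:
  assumes g: "g \<in> L2w" and z: "Re z > -1"
  shows "(cmod (res_form \<xi> (\<lambda>t. g t * gauss t) z))\<^sup>2 \<le> (1 / (Re z + 1))\<^sup>2 * (L2w_norm g)\<^sup>2"
proof -
  have [measurable]: "g \<in> borel_measurable borel" and i: "integrable lborel (\<lambda>v. (cmod (g v))\<^sup>2 * wt v)" using g by (auto simp: L2w_def)
  have N: "(L2w_norm g)\<^sup>2 = (LINT v|lborel. (cmod (g v))\<^sup>2 * wt v)"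
    unfolding L2w_norm_def by (rule real_sqrt_pow2) (intro integral_nonneg_AE AE_I2 mult_nonneg_nonneg wt_nonneg, simp)
  have le: "wt v * (cmod (g v * res_kernel \<xi> z v))\<^sup>2 \<le> (1 / (Re z + 1))\<^sup>2 * ((cmod (g v))\<^sup>2 * wt v)" for v
  proof -
    have "(cmod (res_kernel \<xi> z v))\<^sup>2 * ((cmod (g v))\<^sup>2 * wt v) \<le> (1 / (Re z + 1))\<^sup>2 * ((cmod (g v))\<^sup>2 * wt v)"
      by (intro mult_right_mono power_mono res_kernel_bound z mult_nonneg_nonneg wt_nonneg) auto
    thus ?thesis by (simp add: norm_mult power_mult_distrib mult_ac)
  qed
  have i2: "integrable lborel (\<lambda>v. wt v * (cmod (g v * res_kernel \<xi> z v))\<^sup>2)"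
  proof (rule Bochner_Integration.integrable_bound[OF integrable_mult_right[OF i]])
    show "AE v in lborel. norm (wt v * (cmod (g v * res_kernel \<xi> z v))\<^sup>2) \<le> norm ((1 / (Re z + 1))\<^sup>2 * ((cmod (g v))\<^sup>2 * wt v))"
    proof (intro AE_I2)
      fix v
      have "0 \<le> wt v * (cmod (g v * res_kernel \<xi> z v))\<^sup>2" by (simp add: wt_nonneg)
      thus "norm (wt v * (cmod (g v * res_kernel \<xi> z v))\<^sup>2) \<le> norm ((1 / (Re z + 1))\<^sup>2 * ((cmod (g v))\<^sup>2 * wt v))"
        unfolding real_norm_def using le[of v] by linarith
    qed
  qed measurable
  have "(cmod (LINT v|lborel. complex_of_real (wt v) * (g v * res_kernel \<xi> z v)))\<^sup>2 \<le> (LINT v|lborel. wt v) * (LINT v|lborel. wt v * (cmod (g v * res_kernel \<xi> z v))\<^sup>2)"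
    by (rule integral_Cauchy_Schwarz_weighted(2)[OF _ _ wt_nonneg wt_integrable i2]) measurable
  also have "\<dots> \<le> 1 * (LINT v|lborel. (1 / (Re z + 1))\<^sup>2 * ((cmod (g v))\<^sup>2 * wt v))"
    unfolding wt_integral by (intro mult_left_mono integral_mono i2 integrable_mult_right i le) simp
  also have "\<dots> = (1 / (Re z + 1))\<^sup>2 * (L2w_norm g)\<^sup>2" unfolding N integral_mult_right_zero mult_1 ..
  finally show ?thesis by (simp add: res_form_def gauss_def mult_ac)
qed

lemma resolvent_set_member:
  assumes z: "Re z > -1" "omega z \<xi> \<noteq> 0"
  shows "z \<in> resolvent_set \<xi>"
  unfolding resolvent_set_def
proof (intro CollectI conjI)
  show "\<forall>g\<in>L2w. \<exists>f\<in>L_dom \<xi>. AE v in lborel. L_op \<xi> f v - z * f v = g v"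
    using res_solution[OF z] by (intro ballI bexI[of _ "res_solution \<xi> z _"] AE_I2) auto
  let ?a = "1 / (Re z + 1)"
  \<comment> \<open>With |kernel| \<le> ?a, the square of f is at most ?a^2 (2 |c|^2 + 2 |g|^2), and
    |c|^2 is at most ?a^2 / |\<omega>|^2 times the squared norm of g.\<close>
  let ?K = "?a\<^sup>2 * (2 * (?a\<^sup>2 / (cmod (omega z \<xi>))\<^sup>2) + 2)"
  show "\<exists>C. \<forall>f\<in>L_dom \<xi>. L2w_norm f \<le> C * L2w_norm (\<lambda>v. L_op \<xi> f v - z * f v)"
  proof (intro exI[of _ "sqrt ?K"] ballI)
    fix f assume f: "f \<in> L_dom \<xi>"
    define g where "g = (\<lambda>v. L_op \<xi> f v - z * f v)"
    have fL: "f \<in> L2w" using f by (simp add: L_dom_def)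
    have g: "g \<in> L2w" unfolding g_def using f by (intro L2w_diff L2w_cmult) (auto simp: L_dom_def)
    have [measurable]: "f \<in> borel_measurable borel" "g \<in> borel_measurable borel" using fL g by (auto simp: L2w_def)
    have i: "integrable lborel (\<lambda>v. (cmod (g v))\<^sup>2 * wt v)" "integrable lborel (\<lambda>v. (cmod (f v))\<^sup>2 * wt v)" using fL g by (auto simp: L2w_def)
    have ae: "AE v in lborel. f v = res_solution \<xi> z g v"
      by (rule res_solution_unique[OF z g fL]) (simp add: g_def)
    let ?c = "- res_form \<xi> (\<lambda>t. g t * gauss t) z / omega z \<xi>"
    let ?R = "\<lambda>v. ?a\<^sup>2 * ((2 * (cmod ?c)\<^sup>2) * wt v + 2 * ((cmod (g v))\<^sup>2 * wt v))"
    have iR: "integrable lborel ?R"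
      by (intro integrable_mult_right Bochner_Integration.integrable_add wt_integrable i)
    have N: "(L2w_norm h)\<^sup>2 = (LINT v|lborel. (cmod (h v))\<^sup>2 * wt v)" for h
      unfolding L2w_norm_def by (rule real_sqrt_pow2) (intro integral_nonneg_AE AE_I2 mult_nonneg_nonneg wt_nonneg, simp)
    have "(L2w_norm f)\<^sup>2 \<le> (LINT v|lborel. ?R v)"
      unfolding N
    proof (rule integral_mono_AE[OF i(2) iR])
      show "AE v in lborel. (cmod (f v))\<^sup>2 * wt v \<le> ?R v"
        using ae
      proof eventually_elim
        case (elim v)
        have "(cmod (?c - g v))\<^sup>2 \<le> 2 * (cmod ?c)\<^sup>2 + 2 * (cmod (g v))\<^sup>2" using cmod_add_power2_le[of ?c "- g v"] by simp
        hence "(cmod (res_kernel \<xi> z v))\<^sup>2 * (cmod (?c - g v))\<^sup>2 \<le> ?a\<^sup>2 * (2 * (cmod ?c)\<^sup>2 + 2 * (cmod (g v))\<^sup>2)"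
          by (intro mult_mono power_mono res_kernel_bound z) auto
        hence "(cmod (res_kernel \<xi> z v))\<^sup>2 * (cmod (?c - g v))\<^sup>2 * wt v \<le> ?a\<^sup>2 * (2 * (cmod ?c)\<^sup>2 + 2 * (cmod (g v))\<^sup>2) * wt v"
          by (intro mult_right_mono wt_nonneg)
        also have "\<dots> = ?R v" by (simp only: distrib_right mult.assoc)
        finally show ?case unfolding elim res_solution_def norm_mult power_mult_distrib by (simp only: mult_ac)
      qed
    qed
    also have "\<dots> = ?a\<^sup>2 * (2 * (cmod ?c)\<^sup>2 + 2 * (L2w_norm g)\<^sup>2)"
      unfolding integral_mult_right_zero N
      by (subst Bochner_Integration.integral_add[OF integrable_mult_right[OF wt_integrable] integrable_mult_right[OF i(1)]])
        (simp only: integral_mult_right_zero wt_integral mult_1_right)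
    also have "(cmod ?c)\<^sup>2 \<le> ?a\<^sup>2 / (cmod (omega z \<xi>))\<^sup>2 * (L2w_norm g)\<^sup>2"
      using divide_right_mono[OF L2w_norm_bound[OF g z(1), of \<xi>], of "(cmod (omega z \<xi>))\<^sup>2"]
      by (simp add: norm_divide power_divide)
    hence "?a\<^sup>2 * (2 * (cmod ?c)\<^sup>2 + 2 * (L2w_norm g)\<^sup>2) \<le> ?a\<^sup>2 * (2 * (?a\<^sup>2 / (cmod (omega z \<xi>))\<^sup>2 * (L2w_norm g)\<^sup>2) + 2 * (L2w_norm g)\<^sup>2)"
      by (intro mult_left_mono add_mono order_refl) auto
    also have "\<dots> = ?K * (L2w_norm g)\<^sup>2" by (simp only: algebra_simps)
    finally have "sqrt ((L2w_norm f)\<^sup>2) \<le> sqrt (?K * (L2w_norm g)\<^sup>2)" by (rule real_sqrt_le_mono)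
    moreover have "L2w_norm h \<ge> 0" for h
      unfolding L2w_norm_def by (rule real_sqrt_ge_zero) (intro integral_nonneg_AE AE_I2 mult_nonneg_nonneg wt_nonneg, simp)
    ultimately show "L2w_norm f \<le> sqrt ?K * L2w_norm (\<lambda>v. L_op \<xi> f v - z * f v)"
      unfolding g_def[symmetric] by (simp add: real_sqrt_mult)
  qed
qed

text \<open>\<open>resolvent\<close> is an arbitrary choice, but solutions agree almost everywhere
  and inner products ignore null sets. The only singularity in Re z > -1 comes from the division by
  \<omega>.\<close>

lemma resolvent_inner:
  assumes z: "Re z > -1" "omega z \<xi> \<noteq> 0" and f: "f \<in> L2w" and g: "g \<in> L2w"
  shows "L2w_inner (resolvent \<xi> z f) g = - (res_form \<xi> (\<lambda>t. f t * gauss t) z * res_form \<xi> (\<lambda>t. cnj (g t) * gauss t) z) / omega z \<xi>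
     - res_form \<xi> (\<lambda>t. f t * cnj (g t) * gauss t) z"
proof -
  have "resolvent \<xi> z f \<in> L_dom \<xi> \<and> (AE v in lborel. L_op \<xi> (resolvent \<xi> z f) v - z * resolvent \<xi> z f v = f v)"
    unfolding resolvent_def by (rule someI[of _ "res_solution \<xi> z f"]) (use res_solution[OF z f] in auto)
  hence r: "resolvent \<xi> z f \<in> L2w" "AE v in lborel. resolvent \<xi> z f v = res_solution \<xi> z f v"
    using res_solution_unique[OF z f] by (auto simp: L_dom_def)
  have s: "res_solution \<xi> z f \<in> L2w" using res_solution(1)[OF z f] by (simp add: L_dom_def)
  show ?thesis
    unfolding L2w_inner_AE_cong[OF r(1) s g r(2)] unfolding res_solution_def[abs_def] affine_res_kernel_inner[OF f g z(1)] by simp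
qed

section \<open>The zero of the spectral determinant as an eigenvalue\<close>

lemma omega_even: assumes "\<xi> \<noteq> 0" shows "omega z (- \<xi>) = omega z \<xi>"
proof -
  have "\<i> * (1 + z) / complex_of_real (- \<xi>) = - (\<i> * (1 + z) / complex_of_real \<xi>)" by simp
  thus ?thesis using omega_cauchy_tr[of "- \<xi>" z] omega_cauchy_tr[OF assms, of z] assms cauchy_tr_gauss_neg by simp
qed

lemma omega_abs: "\<xi> \<noteq> 0 \<Longrightarrow> omega z \<bar>\<xi>\<bar> = omega z \<xi>"
  using omega_even[of \<xi> z] by (simp add: abs_if)

text \<open>For Re z < -1 the point i (1 + z) / \<xi> lies in the lower half-plane, where W has
  negative imaginary part, while a zero would require W = i \<xi> with \<xi> > 0.\<close>

lemma omega_nonzero_left: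
  assumes \<xi>: "\<xi> > 0" and z: "Re z < -1"
  shows "omega z \<xi> \<noteq> 0"
proof
  assume 0: "omega z \<xi> = 0"
  let ?w = "\<i> * (1 + z) / complex_of_real \<xi>"
  have "Im ?w < 0" using z \<xi> by (simp add: Im_divide_of_real divide_neg_pos)
  moreover have "Im (cnj w) = - Im w" for w by simp
  ultimately have "Im (cnj ?w) > 0" by (simp only: neg_0_less_iff_less)
  from Im_cauchy_tr_gauss_bounds(1)[OF this] have "Im (cauchy_tr gauss ?w) < 0" unfolding cauchy_tr_gauss_cnj by simp
  moreover have "cauchy_tr gauss ?w = \<i> * complex_of_real \<xi>"
  proof -
    have "\<i> * complex_of_real \<xi> \<noteq> 0" using \<xi> by simp
    thus ?thesis using 0 omega_cauchy_tr[of \<xi> z] \<xi> by (simp add: divide_eq_eq)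
  qed
  ultimately show False using \<xi> by simp
qed

text \<open>By evenness everything is read at |\<xi>|, where the zero i y0 of D corresponds to i (1
  + z) / |\<xi>| = i y0. The chain rule turns the derivative d of D into d (i / |\<xi>|) / (i
  |\<xi>|) = d / \<xi>^2.\<close>

lemma lambda_star_props:
  assumes \<xi>: "\<xi> \<in> {- sqrt pi<..<0} \<union> {0<..<sqrt pi}"
    and y0: "y0 > 0" "y0 * \<bar>\<xi>\<bar> < 1" 
    and zero: "\<And>\<zeta>. Im \<zeta> \<ge> 0 \<Longrightarrow> dispersion \<bar>\<xi>\<bar> \<zeta> = 0 \<longleftrightarrow> \<zeta> = \<i> * complex_of_real y0"
    and d: "(dispersion \<bar>\<xi>\<bar> has_field_derivative complex_of_real d) (at (\<i> * complex_of_real y0))"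
  shows "lambda_star \<xi> = y0 * \<bar>\<xi>\<bar> - 1" "lambda_star \<xi> \<in> {-1<..<0}"
    and "\<And>z. Re z > -1 \<Longrightarrow> omega z \<xi> = 0 \<longleftrightarrow> z = complex_of_real (lambda_star \<xi>)"
    and "((\<lambda>z. omega z \<xi>) has_field_derivative complex_of_real (d / \<xi>\<^sup>2)) (at (complex_of_real (lambda_star \<xi>)))"
proof -
  have x0: "\<xi> \<noteq> 0" and a: "\<bar>\<xi>\<bar> > 0" using \<xi> by auto
  let ?l = "y0 * \<bar>\<xi>\<bar> - 1"
  have right: "omega z \<xi> = 0 \<longleftrightarrow> z = complex_of_real ?l" if z: "Re z > -1" for z
  proof -
    let ?w = "\<i> * (1 + z) / complex_of_real \<bar>\<xi>\<bar>"
    have "Im ?w > 0" using z a by (simp add: Im_divide_of_real)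
    hence Z: "dispersion \<bar>\<xi>\<bar> ?w = 0 \<longleftrightarrow> ?w = \<i> * complex_of_real y0" by (intro zero) (rule less_imp_le)
    have "\<i> * complex_of_real \<bar>\<xi>\<bar> \<noteq> 0" using x0 by simp
    hence "omega z \<xi> = 0 \<longleftrightarrow> ?w = \<i> * complex_of_real y0"
      unfolding omega_abs[OF x0, symmetric] omega_dispersion[OF a z] divide_eq_0_iff Z by blast
    also have "\<dots> \<longleftrightarrow> \<i> * (1 + z) = \<i> * complex_of_real (y0 * \<bar>\<xi>\<bar>)"
      using x0 by (subst nonzero_divide_eq_eq) (simp_all add: mult.assoc)
    also have "\<dots> \<longleftrightarrow> 1 + z = complex_of_real (y0 * \<bar>\<xi>\<bar>)" by (rule mult_left_cancel) simp
    also have "\<dots> \<longleftrightarrow> z = complex_of_real ?l" by (auto simp: algebra_simps)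
    finally show ?thesis .
  qed
  have yp: "y0 * \<bar>\<xi>\<bar> > 0" using y0 a by simp
  have all: "omega z \<xi> = 0 \<longleftrightarrow> z = complex_of_real ?l" if z: "Re z \<noteq> -1" for z
  proof (cases "Re z > -1")
    case False
    hence "Re z < -1" using z by simp
    hence "omega z \<xi> \<noteq> 0" unfolding omega_abs[OF x0, symmetric] by (rule omega_nonzero_left[OF a])
    moreover have "z \<noteq> complex_of_real ?l" using \<open>Re z < -1\<close> yp by auto
    ultimately show ?thesis by simp
  qed (rule right)
  have L: "lambda_star \<xi> = ?l"
    unfolding lambda_star_def
  proof (rule the_equality)
    show "?l \<in> {-1<..0} \<and> (\<forall>z. Re z \<noteq> -1 \<longrightarrow> (omega z \<xi> = 0 \<longleftrightarrow> z = complex_of_real ?l))"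
      using all yp y0(2) by auto
    fix l assume l: "l \<in> {-1<..0} \<and> (\<forall>z. Re z \<noteq> -1 \<longrightarrow> (omega z \<xi> = 0 \<longleftrightarrow> z = complex_of_real l))"
    have r: "Re (complex_of_real l) \<noteq> -1" using l by auto
    hence "omega (complex_of_real l) \<xi> = 0" using l by blast
    hence "complex_of_real l = complex_of_real ?l" using all[OF r] by blast
    thus "l = ?l" by (simp only: of_real_eq_iff)
  qed
  show "lambda_star \<xi> = ?l" by (rule L)
  show "lambda_star \<xi> \<in> {-1<..<0}" unfolding L using yp y0 by simp
  show "omega z \<xi> = 0 \<longleftrightarrow> z = complex_of_real (lambda_star \<xi>)" if "Re z > -1" for z unfolding L by (rule right[OF that])
  let ?w = "\<lambda>z. \<i> * (1 + z) / complex_of_real \<bar>\<xi>\<bar>"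
  have wl: "?w (complex_of_real ?l) = \<i> * complex_of_real y0" using x0 by (simp add: field_simps)
  have "(?w has_field_derivative (\<i> / complex_of_real \<bar>\<xi>\<bar>)) (at (complex_of_real ?l))"
    using x0 by (auto intro!: derivative_eq_intros)
  from DERIV_cdivide[OF DERIV_chain2[where f="dispersion \<bar>\<xi>\<bar>" and g="?w", OF d[folded wl] this], of "\<i> * complex_of_real \<bar>\<xi>\<bar>"]
  have "((\<lambda>z. dispersion \<bar>\<xi>\<bar> (?w z) / (\<i> * complex_of_real \<bar>\<xi>\<bar>)) has_field_derivative complex_of_real d * (\<i> / complex_of_real \<bar>\<xi>\<bar>) / (\<i> * complex_of_real \<bar>\<xi>\<bar>)) (at (complex_of_real ?l))" .
  moreover have "complex_of_real d * (\<i> / complex_of_real \<bar>\<xi>\<bar>) / (\<i> * complex_of_real \<bar>\<xi>\<bar>) = complex_of_real (d / \<xi>\<^sup>2)"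
  proof -
    have "complex_of_real \<bar>\<xi>\<bar> * complex_of_real \<bar>\<xi>\<bar> = complex_of_real (\<xi>\<^sup>2)"
      unfolding of_real_mult[symmetric] by (simp add: power2_eq_square)
    thus ?thesis by simp
  qed
  ultimately have "((\<lambda>z. dispersion \<bar>\<xi>\<bar> (?w z) / (\<i> * complex_of_real \<bar>\<xi>\<bar>)) has_field_derivative complex_of_real (d / \<xi>\<^sup>2)) (at (complex_of_real ?l))" by (simp only:)
  thus "((\<lambda>z. omega z \<xi>) has_field_derivative complex_of_real (d / \<xi>\<^sup>2)) (at (complex_of_real (lambda_star \<xi>)))"
    unfolding L
  proof (rule has_field_derivative_transform_within_open)
    show "open {z. Re z > -1}" by (rule open_halfspace_Re_gt)
    show "complex_of_real ?l \<in> {z. Re z > -1}" using yp by simp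
    show "dispersion \<bar>\<xi>\<bar> (?w z) / (\<i> * complex_of_real \<bar>\<xi>\<bar>) = omega z \<xi>" if "z \<in> {z. Re z > -1}" for z
      using omega_dispersion[OF a, of z] omega_abs[OF x0, of z] that by simp
  qed
qed

text \<open>The kernel itself is an eigenfunction: its inner product with 1 is 1 - \<omega> = 1,
  exactly what the multiplication part leaves over. It violates the lower bound required of points
  of the resolvent set.\<close>

lemma eigenvalue_at_omega_zero:
  assumes l: "Re l > -1" and 0: "omega l \<xi> = 0"
  shows "eigenvalue \<xi> l" "l \<in> L_spectrum \<xi>"
proof -
  let ?e = "res_kernel \<xi> l"
  have e: "?e \<in> L2w" using L2w_bounded_mult[OF L2w_const[of 1] res_kernel_measurable res_kernel_bound[OF l]] by simp
  have "L2w_inner ?e (\<lambda>_. 1) = res_form \<xi> gauss l"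
    by (simp add: L2w_inner_gauss res_form_def mult.commute)
  hence V: "L2w_inner ?e (\<lambda>_. 1) = 1" using 0 by (simp add: omega_res_form)
  have eig: "L_op \<xi> ?e v - l * ?e v = 0" for v
    unfolding L_op_shift V using res_kernel_denominator(1)[OF l, of v \<xi>] by (simp add: res_kernel_def)
  hence eig': "L_op \<xi> ?e v = l * ?e v" for v by simp
  hence "L_op \<xi> ?e = (\<lambda>v. l * ?e v)" by auto
  hence dom: "?e \<in> L_dom \<xi>" using e L2w_cmult[OF e, of l] by (simp add: L_dom_def)
  have nz: "?e v \<noteq> 0" for v using res_kernel_denominator(1)[OF l, of v \<xi>] by (simp add: res_kernel_def)
  have nae: "\<not> (AE v in lborel. ?e v = 0)"
  proof
    assume "AE v in lborel. ?e v = 0"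
    hence "AE v in (lborel :: real measure). False" by eventually_elim (use nz in simp)
    thus False by (simp add: eventually_False ae_filter_eq_bot_iff)
  qed
  show "eigenvalue \<xi> l" unfolding eigenvalue_def using dom nae eig' by (intro bexI[of _ ?e]) auto
  show "l \<in> L_spectrum \<xi>"
    unfolding L_spectrum_def
  proof
    assume "l \<in> resolvent_set \<xi>"
    then obtain C where "L2w_norm ?e \<le> C * L2w_norm (\<lambda>v. L_op \<xi> ?e v - l * ?e v)" using dom by (auto simp: resolvent_set_def)
    hence "L2w_norm ?e \<le> 0" unfolding eig by (simp add: L2w_norm_def)
    hence "(LINT v|lborel. (cmod (?e v))\<^sup>2 * wt v) \<le> 0" by (simp add: L2w_norm_def)
    moreover have "(LINT v|lborel. (cmod (?e v))\<^sup>2 * wt v) \<ge> 0" by (intro integral_nonneg_AE AE_I2 mult_nonneg_nonneg wt_nonneg) simp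
    ultimately have "AE v in lborel. ?e v = 0" by (intro L2w_sq_zero[OF e]) simp
    thus False using nae by blast
  qed
qed

lemma isolated_eigenvalue_at_omega_zero:
  assumes l: "Re l > -1" and zero: "\<And>z. Re z > -1 \<Longrightarrow> omega z \<xi> = 0 \<longleftrightarrow> z = l"
  shows "isolated_eigenvalue \<xi> l"
proof -
  have 0: "omega l \<xi> = 0" using zero[OF l] by simp
  have "{z. Re z > -1} \<inter> L_spectrum \<xi> = {l}"
    using eigenvalue_at_omega_zero(2)[OF l 0] l resolvent_set_member zero unfolding L_spectrum_def by blast
  thus ?thesis unfolding isolated_eigenvalue_def
    using eigenvalue_at_omega_zero[OF l 0] isolated_inI open_halfspace_Re_gt by blast
qed

text \<open>Writing \<omega> = (z - l) E with E free of zeros in the half-plane, the first term of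
  \<open>resolvent_inner\<close> becomes -q(z) / (z - l) for Cauchy's integral formula, and the
  second is holomorphic. The bound on r keeps the closed disc inside Re z > -1.\<close>

lemma riesz_contour:
  assumes \<xi>: "\<xi> \<noteq> 0" and l: "Re l > -1" and zero: "\<And>z. Re z > -1 \<Longrightarrow> omega z \<xi> = 0 \<longleftrightarrow> z = l"
    and d: "((\<lambda>z. omega z \<xi>) has_field_derivative D) (at l)" "D \<noteq> 0"
    and f: "f \<in> L2w" and g: "g \<in> L2w" and r: "0 < r" "r < Re l + 1"
  shows "((\<lambda>z. L2w_inner (resolvent \<xi> z f) g) has_contour_integral
    - (2 * complex_of_real pi * \<i>) * (res_form \<xi> (\<lambda>t. f t * gauss t) l * res_form \<xi> (\<lambda>t. cnj (g t) * gauss t) l / D)) (circlepath l r)"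
proof -
  let ?S = "{z. Re z > -1}"
  have op: "open ?S" by (rule open_halfspace_Re_gt)
  have sub: "cball l r \<subseteq> ?S"
  proof
    fix z assume "z \<in> cball l r"
    hence "\<bar>Re (l - z)\<bar> \<le> r" using abs_Re_le_cmod[of "l - z"] by (simp add: dist_norm)
    thus "z \<in> ?S" using r by simp
  qed
  let ?A = "res_form \<xi> (\<lambda>t. f t * gauss t)" and ?B = "res_form \<xi> (\<lambda>t. cnj (g t) * gauss t)" and ?H = "res_form \<xi> (\<lambda>t. f t * cnj (g t) * gauss t)"
  have A: "?A holomorphic_on ?S" and B: "?B holomorphic_on ?S" and H: "?H holomorphic_on ?S"
    by (intro res_form_holomorphic \<xi> L2w_weighted(1) f L2w_cnj g L2w_inner_integrable)+
  have om: "(\<lambda>z. omega z \<xi>) holomorphic_on ?S"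
    unfolding omega_res_form by (intro holomorphic_intros res_form_holomorphic \<xi> gauss_integrable)
  define E where "E = (\<lambda>z. if z = l then deriv (\<lambda>z. omega z \<xi>) l else (omega z \<xi> - omega l \<xi>) / (z - l))"
  have Eh: "E holomorphic_on ?S" unfolding E_def by (rule pole_lemma_open[OF om op])
  have El: "E l = D" using DERIV_imp_deriv[OF d(1)] by (simp add: E_def)
  have oE: "omega z \<xi> = (z - l) * E z" for z using zero[OF l] by (simp add: E_def)
  have Enz: "E z \<noteq> 0" if "z \<in> ?S" for z using that zero[of z] oE[of z] El d(2) by (cases "z = l") auto
  let ?q = "\<lambda>z. ?A z * ?B z / E z"
  have q: "?q holomorphic_on ?S" by (intro holomorphic_intros A B Eh Enz)
  have "((\<lambda>z. ?q z / (z - l)) has_contour_integral 2 * complex_of_real pi * \<i> * ?q l) (circlepath l r)"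
    by (rule Cauchy_integral_circlepath_simple[OF holomorphic_on_subset[OF q sub]]) (use r in auto)
  moreover have "(?H has_contour_integral 0) (circlepath l r)"
    by (rule Cauchy_theorem_convex_simple[OF H convex_halfspace_Re_gt]) (use sub r in auto)
  ultimately have "((\<lambda>z. - (?q z / (z - l)) - ?H z) has_contour_integral - (2 * complex_of_real pi * \<i> * ?q l) - 0) (circlepath l r)"
    by (intro has_contour_integral_diff has_contour_integral_neg)
  hence "((\<lambda>z. L2w_inner (resolvent \<xi> z f) g) has_contour_integral - (2 * complex_of_real pi * \<i> * ?q l) - 0) (circlepath l r)"
  proof (rule has_contour_integral_eq)
    fix z assume "z \<in> path_image (circlepath l r)"
    hence zr: "dist l z = r" using r by (simp add: sphere_def)
    have zS: "Re z > -1" using sub zr by (auto simp: subset_iff)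
    have "z \<noteq> l" using zr r by auto
    hence "omega z \<xi> \<noteq> 0" using zero[OF zS] by simp
    from resolvent_inner[OF zS this f g]
    show "- (?q z / (z - l)) - ?H z = L2w_inner (resolvent \<xi> z f) g" by (simp add: oE mult.commute)
  qed
  thus ?thesis by (simp add: El)
qed

text \<open>The explicit h meets the specification behind the \<open>SOME\<close>, so the chosen
  element meets it as well. Both then have the same inner products with all of \<open>L2w\<close>,
  and testing with their difference identifies them almost everywhere.\<close>

lemma riesz_projection_explicit:
  assumes \<xi>: "\<xi> \<noteq> 0" and l: "Re l > -1" and zero: "\<And>z. Re z > -1 \<Longrightarrow> omega z \<xi> = 0 \<longleftrightarrow> z = l"
    and d: "((\<lambda>z. omega z \<xi>) has_field_derivative D) (at l)" "D \<noteq> 0" and f: "f \<in> L2w"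
  shows "riesz_projection \<xi> l f \<in> L2w"
    "AE v in lborel. riesz_projection \<xi> l f v = res_form \<xi> (\<lambda>t. f t * gauss t) l / D * res_kernel \<xi> l v"
    "g \<in> L2w \<Longrightarrow> L2w_inner (riesz_projection \<xi> l f) g = res_form \<xi> (\<lambda>t. f t * gauss t) l * res_form \<xi> (\<lambda>t. cnj (g t) * gauss t) l / D"
proof -
  let ?c = "res_form \<xi> (\<lambda>t. f t * gauss t) l / D"
  define h where "h = (\<lambda>v. ?c * res_kernel \<xi> l v)"
  define P where "P = (\<lambda>h. h \<in> L2w \<and>
     (\<forall>\<^sub>F r in at_right 0. \<forall>g \<in> L2w.
        (\<lambda>z. L2w_inner (resolvent \<xi> z f) g) contour_integrable_on circlepath l r \<and>
        L2w_inner h g = - 1 / (2 * complex_of_real pi * \<i>) *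
            contour_integral (circlepath l r) (\<lambda>z. L2w_inner (resolvent \<xi> z f) g)))"
  have h: "h \<in> L2w" unfolding h_def
    using L2w_bounded_mult[OF L2w_const[of ?c] res_kernel_measurable res_kernel_bound[OF l]] by simp
  have hin: "L2w_inner h g = res_form \<xi> (\<lambda>t. f t * gauss t) l * res_form \<xi> (\<lambda>t. cnj (g t) * gauss t) l / D" for g
  proof -
    have "L2w_inner h g = (LINT v|lborel. ?c * (cnj (g v) * gauss v * res_kernel \<xi> l v))"
      unfolding L2w_inner_gauss h_def by (intro Bochner_Integration.integral_cong refl) (simp add: mult_ac)
    thus ?thesis unfolding integral_mult_right_zero by (simp add: res_form_def)
  qed
  have "P h"
    unfolding P_def
  proof (intro conjI h)
    have "\<forall>\<^sub>F r in at_right 0. 0 < r \<and> r < Re l + 1"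
      unfolding eventually_at_right_field using l by (intro exI[of _ "Re l + 1"]) auto
    thus "\<forall>\<^sub>F r in at_right 0. \<forall>g \<in> L2w. (\<lambda>z. L2w_inner (resolvent \<xi> z f) g) contour_integrable_on circlepath l r \<and>
        L2w_inner h g = - 1 / (2 * complex_of_real pi * \<i>) * contour_integral (circlepath l r) (\<lambda>z. L2w_inner (resolvent \<xi> z f) g)"
    proof eventually_elim
      case (elim r)
      show ?case
      proof
        fix g assume g: "g \<in> L2w"
        note C = riesz_contour[OF \<xi> l zero d f g conjunct1[OF elim] conjunct2[OF elim]]
        show "(\<lambda>z. L2w_inner (resolvent \<xi> z f) g) contour_integrable_on circlepath l r \<and>
        L2w_inner h g = - 1 / (2 * complex_of_real pi * \<i>) * contour_integral (circlepath l r) (\<lambda>z. L2w_inner (resolvent \<xi> z f) g)"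
          using C contour_integral_unique[OF C] hin[of g] by (auto simp: contour_integrable_on_def)
      qed
    qed
  qed
  hence "P (riesz_projection \<xi> l f)"
    unfolding riesz_projection_def P_def[symmetric] by (rule someI[of P])
  note ev = conjunct2[OF this[unfolded P_def]] conjunct2[OF \<open>P h\<close>[unfolded P_def]]
  have hr: "riesz_projection \<xi> l f \<in> L2w" by (rule conjunct1[OF \<open>P (riesz_projection \<xi> l f)\<close>[unfolded P_def]])
  \<comment> \<open>Both descriptions hold for all small r; one common radius is enough to compare
    them.\<close>
  have "\<forall>\<^sub>F r in at_right (0::real). \<forall>g \<in> L2w. L2w_inner (riesz_projection \<xi> l f) g = L2w_inner h g"
    using ev by eventually_elim simp
  hence "\<exists>r::real. \<forall>g \<in> L2w. L2w_inner (riesz_projection \<xi> l f) g = L2w_inner h g"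
    by (rule eventually_happens'[OF trivial_limit_at_right_real])
  hence eq: "L2w_inner (riesz_projection \<xi> l f) g = L2w_inner h g" if "g \<in> L2w" for g
    using that by blast
  show "riesz_projection \<xi> l f \<in> L2w" by (rule hr)
  show "L2w_inner (riesz_projection \<xi> l f) g = res_form \<xi> (\<lambda>t. f t * gauss t) l * res_form \<xi> (\<lambda>t. cnj (g t) * gauss t) l / D" if "g \<in> L2w"
    unfolding eq[OF that] by (rule hin)
  let ?u = "\<lambda>v. riesz_projection \<xi> l f v - h v"
  have u: "?u \<in> L2w" by (rule L2w_diff[OF hr h])
  have "L2w_inner ?u ?u = 0" unfolding L2w_inner_diff[OF hr h u] eq[OF u] by simp
  moreover have "L2w_inner ?u ?u = complex_of_real (LINT v|lborel. (cmod (?u v))\<^sup>2 * wt v)"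
  proof -
    have "?u v * cnj (?u v) * complex_of_real (wt v) = complex_of_real ((cmod (?u v))\<^sup>2 * wt v)" for v
      unfolding complex_norm_square[symmetric] of_real_mult of_real_power by (simp only: mult.commute)
    thus ?thesis unfolding L2w_inner_def by (simp only: integral_complex_of_real)
  qed
  ultimately have "(LINT v|lborel. (cmod (?u v))\<^sup>2 * wt v) = 0" by (simp only: of_real_eq_0_iff)
  from L2w_sq_zero[OF u this]
  show "AE v in lborel. riesz_projection \<xi> l f v = ?c * res_kernel \<xi> l v"
    by eventually_elim (simp add: h_def)
qed

lemma simple_eigenvalue_at_omega_zero:
  assumes \<xi>: "\<xi> \<noteq> 0" and l: "Re l > -1" and zero: "\<And>z. Re z > -1 \<Longrightarrow> omega z \<xi> = 0 \<longleftrightarrow> z = l"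
    and d: "((\<lambda>z. omega z \<xi>) has_field_derivative D) (at l)" "D \<noteq> 0"
  shows "simple_eigenvalue \<xi> l"
  unfolding simple_eigenvalue_def
proof (intro conjI)
  have 0: "omega l \<xi> = 0" using zero[OF l] by simp
  show "eigenvalue \<xi> l" by (rule eigenvalue_at_omega_zero(1)[OF l 0])
  let ?e = "res_kernel \<xi> l"
  have e: "?e \<in> L2w" using L2w_bounded_mult[OF L2w_const[of 1] res_kernel_measurable res_kernel_bound[OF l]] by simp
  \<comment> \<open>For this choice the coefficient in front of the eigenfunction is the integral of
    |?e|^2 w, which is positive, up to the division by D.\<close>
  let ?f0 = "\<lambda>v. cnj (?e v)"
  have f0: "?f0 \<in> L2w" by (rule L2w_cnj[OF e])
  let ?A = "\<lambda>f. res_form \<xi> (\<lambda>t. f t * gauss t) l"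
  have nz: "?e v \<noteq> 0" for v using res_kernel_denominator(1)[OF l, of v \<xi>] by (simp add: res_kernel_def)
  have "?A ?f0 = complex_of_real (LINT v|lborel. (cmod (?e v))\<^sup>2 * wt v)"
  proof -
    have "cnj (?e v) * gauss v * ?e v = complex_of_real ((cmod (?e v))\<^sup>2 * wt v)" for v
      unfolding of_real_mult complex_norm_square gauss_def by (simp only: mult_ac)
    thus ?thesis unfolding res_form_def by (simp only: integral_complex_of_real)
  qed
  moreover have "(LINT v|lborel. (cmod (?e v))\<^sup>2 * wt v) > 0"
    by (rule integral_pos[of _ 0]) (use e nz wt_pos in \<open>auto simp: L2w_def\<close>)
  ultimately have A0: "?A ?f0 \<noteq> 0" by simp
  have R: "AE v in lborel. riesz_projection \<xi> l f v = ?A f / D * ?e v" if "f \<in> L2w" for f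
    by (rule riesz_projection_explicit(2)[OF \<xi> l zero d that])
  show "\<exists>f\<^sub>0\<in>L2w. \<not> (AE v in lborel. riesz_projection \<xi> l f\<^sub>0 v = 0) \<and>
        (\<forall>f\<in>L2w. \<exists>c. AE v in lborel. riesz_projection \<xi> l f v = c * riesz_projection \<xi> l f\<^sub>0 v)"
  proof (intro bexI[of _ ?f0] conjI ballI f0)
    show "\<not> (AE v in lborel. riesz_projection \<xi> l ?f0 v = 0)"
    proof
      assume "AE v in lborel. riesz_projection \<xi> l ?f0 v = 0"
      hence "AE v in (lborel :: real measure). False" using R[OF f0] by eventually_elim (use nz A0 d(2) in simp)
      thus False by (simp add: eventually_False ae_filter_eq_bot_iff)
    qed
    fix f assume f: "f \<in> L2w"
    show "\<exists>c. AE v in lborel. riesz_projection \<xi> l f v = c * riesz_projection \<xi> l ?f0 v"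
    proof (intro exI[of _ "?A f / ?A ?f0"])
      show "AE v in lborel. riesz_projection \<xi> l f v = ?A f / ?A ?f0 * riesz_projection \<xi> l ?f0 v"
        using R[OF f] R[OF f0]
      proof eventually_elim
        case (elim v)
        have "?A f / D * ?e v = ?A f / ?A ?f0 * (?A ?f0 / D * ?e v)" using A0 by simp
        thus ?case using elim by (simp only:)
      qed
    qed
  qed
qed

section \<open>Negative frequency and the transform identities\<close>

lemma S_hat_plus: "S_hat 1 h l = Lim (at_right 0) (\<lambda>y. cauchy_tr h (complex_of_real l + \<i> * complex_of_real y))"
  by (simp add: S_hat_def side_def cauchy_tr_def)

lemma S_hat_plus_measurable:
  assumes h: "integrable lborel h"
  shows "S_hat 1 h \<in> borel_measurable borel"
  unfolding S_hat_plus[abs_def]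
proof (rule borel_measurable_Lim_at_right_0)
  fix y :: real assume "y > 0"
  thus "(\<lambda>x. cauchy_tr h (complex_of_real x + \<i> * complex_of_real y)) \<in> borel_measurable borel"
    using cauchy_tr_measurable[OF h, of y] by simp
next
  fix x
  show "continuous_on {0<..} (\<lambda>y. cauchy_tr h (complex_of_real x + \<i> * complex_of_real y))"
    by (intro continuous_on_compose2[OF holomorphic_on_imp_continuous_on[OF cauchy_tr_holomorphic[OF h, of "{z. Im z > 0}"]]])
      (auto intro!: continuous_intros)
qed

lemma S_hat_plus_AE:
  assumes "hardy_boundary h \<phi>"
  shows "AE l in lborel. S_hat 1 h l = \<phi> l"
proof -
  have "AE l in lborel. ((\<lambda>y. cauchy_tr h (complex_of_real l + \<i> * complex_of_real y)) \<longlongrightarrow> \<phi> l) (at_right 0)"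
    using assms by (simp add: hardy_boundary_def)
  thus ?thesis by eventually_elim (unfold S_hat_plus, rule tendsto_Lim[OF trivial_limit_at_right_real])
qed

text \<open>W is odd and commutes with conjugation; together these reflect the upper half-plane in
  the imaginary axis.\<close>

lemma dispersion_reflect:
  "dispersion \<xi> (complex_of_real (- l)) = - cnj (dispersion \<xi> (complex_of_real l))"
proof -
  have "((\<lambda>y. - cnj (cauchy_tr gauss (complex_of_real l + \<i> * complex_of_real y))) \<longlongrightarrow> - cnj (plasma (complex_of_real l))) (at_right 0)"
    by (intro tendsto_intros tendsto_plasma_boundary)
  moreover have "- cnj (cauchy_tr gauss (complex_of_real l + \<i> * complex_of_real y)) = cauchy_tr gauss (complex_of_real (- l) + \<i> * complex_of_real y)" for y
    using cauchy_tr_gauss_neg[of "complex_of_real l - \<i> * complex_of_real y"] cauchy_tr_gauss_cnj[of "complex_of_real l + \<i> * complex_of_real y"] by simp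
  ultimately have "((\<lambda>y. cauchy_tr gauss (complex_of_real (- l) + \<i> * complex_of_real y)) \<longlongrightarrow> - cnj (plasma (complex_of_real l))) (at_right 0)"
    by simp
  from tendsto_unique[OF trivial_limit_at_right_real tendsto_plasma_boundary this]
  show ?thesis by (simp add: dispersion_def)
qed

text \<open>Changing the signs of both l and \<xi> leaves the point -1 + i l \<xi> unchanged and
  \<omega> is even, so the boundary value known for positive frequency applies at -l.\<close>

lemma B_tr_neg_eq:
  assumes "\<xi> < 0"
  shows "B_tr \<xi> f l = f l + S_hat 1 (\<lambda>z. f z * gauss z) l / dispersion \<xi> (complex_of_real l)"
proof -
  have n: "- \<xi> > 0" using assms by simp
  have "omega_minus (- 1 + \<i> * complex_of_real l * complex_of_real \<xi>) (- \<xi>) = omega_minus (- 1 + \<i> * complex_of_real (- l) * complex_of_real (- \<xi>)) (- (- \<xi>))"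
    unfolding omega_minus_def using omega_even[of \<xi>] assms by simp
  also have "\<dots> = cnj (dispersion \<xi> (complex_of_real l)) / (\<i> * complex_of_real (- \<xi>))"
    unfolding omega_minus_dispersion[OF n] dispersion_reflect by simp
  finally have e: "omega_minus (- 1 + \<i> * complex_of_real l * complex_of_real \<xi>) (- \<xi>) = cnj (dispersion \<xi> (complex_of_real l)) / (\<i> * complex_of_real (- \<xi>))" .
  show ?thesis unfolding B_tr_def e using assms by (simp add: gauss_def)
qed

lemma U_tr_neg_eq:
  assumes "\<xi> < 0"
  shows "U_tr \<xi> f l = f l + S_hat 1 (\<lambda>z. f z * gauss z) l / dispersion (- \<xi>) (complex_of_real l)"
proof -
  have n: "- \<xi> > 0" using assms by simp
  have "omega_plus (- 1 - \<i> * complex_of_real l * complex_of_real \<xi>) \<xi> = omega_plus (- 1 - \<i> * complex_of_real (- l) * complex_of_real (- \<xi>)) (- \<xi>)"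
    unfolding omega_plus_def using omega_even[of \<xi>] assms by simp
  also have "\<dots> = - cnj (dispersion (- \<xi>) (complex_of_real l)) / (\<i> * complex_of_real (- \<xi>))"
    unfolding omega_plus_dispersion[OF n] dispersion_reflect ..
  finally have e: "omega_plus (- 1 - \<i> * complex_of_real l * complex_of_real \<xi>) \<xi> = - cnj (dispersion (- \<xi>) (complex_of_real l)) / (\<i> * complex_of_real (- \<xi>))" .
  show ?thesis unfolding U_tr_def e using assms by (simp add: gauss_def)
qed

lemma transforms_neg_measurable:
  assumes "\<xi> < 0" "f \<in> L2w" shows "B_tr \<xi> f \<in> borel_measurable borel" "U_tr \<xi> f \<in> borel_measurable borel"
proof -
  have [measurable]: "f \<in> borel_measurable borel" using assms by (auto simp: L2w_def)
  note [measurable] = S_hat_plus_measurable[OF L2w_weighted(1)[OF assms(2)]]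
  show "B_tr \<xi> f \<in> borel_measurable borel" unfolding B_tr_neg_eq[OF assms(1), abs_def] by measurable
  show "U_tr \<xi> f \<in> borel_measurable borel" unfolding U_tr_neg_eq[OF assms(1), abs_def] by measurable
qed

text \<open>The relation is claimed almost everywhere only: where the limit in \<open>S_hat\<close>
  fails to exist, the default value of \<open>Lim\<close> need not respect conjugation.\<close>

lemma transforms_neg_AE:
  assumes \<xi>: "\<xi> < 0" and f: "f \<in> L2w"
  shows "AE l in lborel. B_tr \<xi> f l = cnj (B_tr (- \<xi>) (\<lambda>v. cnj (f v)) l)"
    "AE l in lborel. U_tr \<xi> f l = cnj (U_tr (- \<xi>) (\<lambda>v. cnj (f v)) l)"
proof -
  have n: "- \<xi> > 0" using \<xi> by simp
  obtain \<phi> where phi: "hardy_boundary (\<lambda>t. f t * gauss t) \<phi>" using hardy_boundary_exists[OF L2w_weighted[OF f]] .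
  note S1 = S_hat_plus_AE[OF phi]
  have S2: "AE l in lborel. S_hat (- 1) (\<lambda>z. cnj (f z) * gauss z) l = cnj (\<phi> l)"
    by (rule S_hat_minus_AE) (use phi in \<open>simp add: gauss_cnj\<close>)
  show "AE l in lborel. B_tr \<xi> f l = cnj (B_tr (- \<xi>) (\<lambda>v. cnj (f v)) l)"
    using S1 S2 by eventually_elim (simp add: B_tr_neg_eq[OF \<xi>] B_tr_eq[OF n])
  show "AE l in lborel. U_tr \<xi> f l = cnj (U_tr (- \<xi>) (\<lambda>v. cnj (f v)) l)"
    using S1 S2 by eventually_elim (simp add: U_tr_neg_eq[OF \<xi>] U_tr_eq[OF n])
qed

lemma transforms_neg_integral:
  assumes \<xi>: "\<xi> < 0" and f: "f \<in> L2w" and g: "g \<in> L2w"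
    and i: "integrable lborel (\<lambda>l. B_tr (- \<xi>) (\<lambda>v. cnj (f v)) l * cnj (U_tr (- \<xi>) (\<lambda>v. cnj (g v)) l) * complex_of_real (wt l))"
  shows "integrable lborel (\<lambda>l. B_tr \<xi> f l * cnj (U_tr \<xi> g l) * complex_of_real (wt l))"
    "(LINT l|lborel. B_tr \<xi> f l * cnj (U_tr \<xi> g l) * complex_of_real (wt l)) = cnj (LINT l|lborel. B_tr (- \<xi>) (\<lambda>v. cnj (f v)) l * cnj (U_tr (- \<xi>) (\<lambda>v. cnj (g v)) l) * complex_of_real (wt l))"
proof -
  note [measurable] = transforms_neg_measurable(1)[OF \<xi> f] transforms_neg_measurable(2)[OF \<xi> g]
  have m: "(\<lambda>l. B_tr \<xi> f l * cnj (U_tr \<xi> g l) * complex_of_real (wt l)) \<in> borel_measurable lborel" by measurable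
  have ic: "integrable lborel (\<lambda>l. cnj (B_tr (- \<xi>) (\<lambda>v. cnj (f v)) l * cnj (U_tr (- \<xi>) (\<lambda>v. cnj (g v)) l) * complex_of_real (wt l)))" by (rule integrable_cnj[OF i])
  have ae: "AE l in lborel. B_tr \<xi> f l * cnj (U_tr \<xi> g l) * complex_of_real (wt l) = cnj (B_tr (- \<xi>) (\<lambda>v. cnj (f v)) l * cnj (U_tr (- \<xi>) (\<lambda>v. cnj (g v)) l) * complex_of_real (wt l))"
    using transforms_neg_AE(1)[OF \<xi> f] transforms_neg_AE(2)[OF \<xi> g] by eventually_elim simp
  show "integrable lborel (\<lambda>l. B_tr \<xi> f l * cnj (U_tr \<xi> g l) * complex_of_real (wt l))" using integrable_cong_AE[OF m borel_measurable_integrable[OF ic] ae] ic by simp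
  show "(LINT l|lborel. B_tr \<xi> f l * cnj (U_tr \<xi> g l) * complex_of_real (wt l)) = cnj (LINT l|lborel. B_tr (- \<xi>) (\<lambda>v. cnj (f v)) l * cnj (U_tr (- \<xi>) (\<lambda>v. cnj (g v)) l) * complex_of_real (wt l))"
    unfolding integral_cong_AE[OF m borel_measurable_integrable[OF ic] ae] by (rule Bochner_Integration.integral_cnj)
qed

section \<open>The three identities for both signs of the frequency\<close>

lemma L2w_inner_cnj: "L2w_inner (\<lambda>v. cnj (f v)) (\<lambda>v. cnj (g v)) = cnj (L2w_inner f g)"
  unfolding L2w_inner_def Bochner_Integration.integral_cnj[symmetric] by simp

lemma res_form_cnj:
  "res_form (- \<xi>) (\<lambda>v. cnj (h v)) (complex_of_real l) = cnj (res_form \<xi> h (complex_of_real l))"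
  unfolding res_form_def Bochner_Integration.integral_cnj[symmetric] by (simp add: res_kernel_def)

theorem transform_identity_supercritical:
  assumes \<xi>: "\<bar>\<xi>\<bar> > sqrt pi" and f: "f \<in> L2w" and g: "g \<in> L2w"
  shows "integrable lborel (\<lambda>l. B_tr \<xi> f l * cnj (U_tr \<xi> g l) * complex_of_real (wt l))"
    and "L2w_inner f g = (LINT l|lborel. B_tr \<xi> f l * cnj (U_tr \<xi> g l) * complex_of_real (wt l))"
proof -
  have "integrable lborel (\<lambda>l. B_tr \<xi> f l * cnj (U_tr \<xi> g l) * complex_of_real (wt l)) \<and>
    L2w_inner f g = (LINT l|lborel. B_tr \<xi> f l * cnj (U_tr \<xi> g l) * complex_of_real (wt l))"
  proof (cases "\<xi> > 0")
    case True
    hence "\<xi> > sqrt pi" using \<xi> by simp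
    from transforms_supercritical[OF this f g] show ?thesis by blast
  next
    case False
    have "0 < sqrt pi" by simp
    hence n: "\<xi> < 0" "- \<xi> > sqrt pi" using \<xi> False by linarith+
    note T = transforms_supercritical[OF n(2) L2w_cnj[OF f] L2w_cnj[OF g]]
    note N = transforms_neg_integral[OF n(1) f g T(1)]
    have "cnj (L2w_inner f g) = cnj (LINT l|lborel. B_tr \<xi> f l * cnj (U_tr \<xi> g l) * complex_of_real (wt l))"
      unfolding N(2) L2w_inner_cnj[symmetric] T(2) by simp
    thus ?thesis using N(1) by simp
  qed
  thus "integrable lborel (\<lambda>l. B_tr \<xi> f l * cnj (U_tr \<xi> g l) * complex_of_real (wt l))"
    and "L2w_inner f g = (LINT l|lborel. B_tr \<xi> f l * cnj (U_tr \<xi> g l) * complex_of_real (wt l))" by blast+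
qed

theorem transform_identity_subcritical:
  assumes \<xi>: "\<xi> \<in> {- sqrt pi<..<0} \<union> {0<..<sqrt pi}"
  shows "lambda_star \<xi> \<in> {-1<..<0}"
    and "isolated_eigenvalue \<xi> (complex_of_real (lambda_star \<xi>))"
    and "simple_eigenvalue \<xi> (complex_of_real (lambda_star \<xi>))"
    and "f \<in> L2w \<Longrightarrow> g \<in> L2w \<Longrightarrow> integrable lborel (\<lambda>l. B_tr \<xi> f l * cnj (U_tr \<xi> g l) * complex_of_real (wt l))"
    and "f \<in> L2w \<Longrightarrow> g \<in> L2w \<Longrightarrow> L2w_inner f g = (LINT l|lborel. B_tr \<xi> f l * cnj (U_tr \<xi> g l) * complex_of_real (wt l)) +
             L2w_inner (riesz_projection \<xi> (complex_of_real (lambda_star \<xi>)) f) g"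
proof -
  have a: "0 < \<bar>\<xi>\<bar>" "\<bar>\<xi>\<bar> < sqrt pi" and x0: "\<xi> \<noteq> 0" using \<xi> by auto
  obtain y0 C where y0: "y0 \<ge> 0" "\<bar>\<xi>\<bar> < sqrt pi \<Longrightarrow> y0 > 0" "y0 * \<bar>\<xi>\<bar> < 1"
    "\<And>\<zeta>. Im \<zeta> \<ge> 0 \<Longrightarrow> dispersion \<bar>\<xi>\<bar> \<zeta> = 0 \<longleftrightarrow> \<zeta> = \<i> * complex_of_real y0"
    "(dispersion \<bar>\<xi>\<bar> has_field_derivative complex_of_real (2 - 2 * y0 * \<bar>\<xi>\<bar>)) (at (\<i> * complex_of_real y0))"
    "C \<ge> 0" "\<And>\<zeta>. Im \<zeta> \<ge> 0 \<Longrightarrow> cmod (\<zeta> - \<i> * complex_of_real y0) \<le> C * (1 + cmod \<zeta>) * cmod (dispersion \<bar>\<xi>\<bar> \<zeta>)"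
    by (rule dispersion_quotient_bound[of "\<bar>\<xi>\<bar>"]) (use a in auto)
  have yp: "y0 > 0" by (rule y0(2)[OF a(2)])
  define d where "d = 2 - 2 * y0 * \<bar>\<xi>\<bar>"
  have d0: "d \<noteq> 0" using y0(3) by (simp add: d_def)
  note D = y0(5)[folded d_def]
  let ?l = "complex_of_real (lambda_star \<xi>)" and ?o = "complex_of_real (d / \<xi>\<^sup>2)"
  note L = lambda_star_props[OF \<xi> yp y0(3) y0(4) D]
  show l: "lambda_star \<xi> \<in> {-1<..<0}" by (rule L(2); assumption)
  have zero: "omega z \<xi> = 0 \<longleftrightarrow> z = ?l" if "Re z > -1" for z by (rule L(3)[OF _ that])
  have der: "((\<lambda>z. omega z \<xi>) has_field_derivative ?o) (at ?l)" by (rule L(4); assumption)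
  have lv: "lambda_star \<xi> = y0 * \<bar>\<xi>\<bar> - 1" by (rule L(1); assumption)
  have re: "Re ?l > -1" using l by simp
  have o0: "?o \<noteq> 0" using d0 x0 by simp
  show "isolated_eigenvalue \<xi> ?l" by (rule isolated_eigenvalue_at_omega_zero[OF re zero])
  show "simple_eigenvalue \<xi> ?l" by (rule simple_eigenvalue_at_omega_zero[OF x0 re zero der o0])
  have riesz: "L2w_inner (riesz_projection \<xi> ?l f) g = res_form \<xi> (\<lambda>t. f t * gauss t) ?l * res_form \<xi> (\<lambda>t. cnj (g t) * gauss t) ?l / ?o"
    if "f \<in> L2w" "g \<in> L2w" for f g
    by (rule riesz_projection_explicit(3)[OF x0 re zero der o0 that])
  have arg: "\<i> * (1 + ?l) / complex_of_real \<bar>\<xi>\<bar> = \<i> * complex_of_real y0"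
    unfolding lv using a(1) by simp
  have ct: "cauchy_tr h (\<i> * complex_of_real y0) = \<i> * complex_of_real \<bar>\<xi>\<bar> * res_form \<bar>\<xi>\<bar> h ?l" for h
    using res_form_cauchy_tr[of "\<bar>\<xi>\<bar>" h ?l] x0 unfolding arg by simp
  \<comment> \<open>Each transform at i y0 is i |\<xi>| times a resolvent form, so their product is
    -\<xi>^2 times the product of the forms. The sign turns minus the residue into the Riesz term,
    and d / \<xi>^2 is the derivative of \<omega> at the eigenvalue.\<close>
  have val: "- (cauchy_tr h (\<i> * complex_of_real y0) * cauchy_tr k (\<i> * complex_of_real y0) / complex_of_real d) = res_form \<bar>\<xi>\<bar> h ?l * res_form \<bar>\<xi>\<bar> k ?l / ?o" for h k
  proof -
    have x2: "complex_of_real \<bar>\<xi>\<bar> * complex_of_real \<bar>\<xi>\<bar> = complex_of_real (\<xi>\<^sup>2)"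
      unfolding of_real_mult[symmetric] by (simp add: power2_eq_square)
    have "cauchy_tr h (\<i> * complex_of_real y0) * cauchy_tr k (\<i> * complex_of_real y0) = - ((complex_of_real \<bar>\<xi>\<bar> * complex_of_real \<bar>\<xi>\<bar>) * (res_form \<bar>\<xi>\<bar> h ?l * res_form \<bar>\<xi>\<bar> k ?l))"
      unfolding ct by (simp add: algebra_simps)
    thus ?thesis unfolding x2 by simp
  qed
  have pos: "integrable lborel (\<lambda>l. B_tr \<bar>\<xi>\<bar> f l * cnj (U_tr \<bar>\<xi>\<bar> g l) * complex_of_real (wt l)) \<and>
     L2w_inner f g = (LINT l|lborel. B_tr \<bar>\<xi>\<bar> f l * cnj (U_tr \<bar>\<xi>\<bar> g l) * complex_of_real (wt l)) +
       res_form \<bar>\<xi>\<bar> (\<lambda>t. f t * gauss t) ?l * res_form \<bar>\<xi>\<bar> (\<lambda>t. cnj (g t) * gauss t) ?l / ?o" if f: "f \<in> L2w" and g: "g \<in> L2w" for f g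
  proof -
    have dc: "complex_of_real d \<noteq> 0" using d0 by simp
    have "integrable lborel (\<lambda>l. B_tr \<bar>\<xi>\<bar> f l * cnj (U_tr \<bar>\<xi>\<bar> g l) * complex_of_real (wt l))"
      by (rule transforms_subcritical(1)[OF a f g yp y0(4) D dc y0(7)])
    moreover have "L2w_inner f g = (LINT l|lborel. B_tr \<bar>\<xi>\<bar> f l * cnj (U_tr \<bar>\<xi>\<bar> g l) * complex_of_real (wt l)) -
       cauchy_tr (\<lambda>t. f t * gauss t) (\<i> * complex_of_real y0) * cauchy_tr (\<lambda>t. cnj (g t) * gauss t) (\<i> * complex_of_real y0) / complex_of_real d"
      by (rule transforms_subcritical(2)[OF a f g yp y0(4) D dc y0(7)])
    ultimately show ?thesis using val[of "\<lambda>t. f t * gauss t" "\<lambda>t. cnj (g t) * gauss t"] by (simp only: diff_conv_add_uminus)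
  qed
  have all: "integrable lborel (\<lambda>l. B_tr \<xi> f l * cnj (U_tr \<xi> g l) * complex_of_real (wt l)) \<and>
     L2w_inner f g = (LINT l|lborel. B_tr \<xi> f l * cnj (U_tr \<xi> g l) * complex_of_real (wt l)) +
       L2w_inner (riesz_projection \<xi> ?l f) g" if f: "f \<in> L2w" and g: "g \<in> L2w" for f g
  proof (cases "\<xi> > 0")
    case True
    thus ?thesis using pos[OF f g] unfolding riesz[OF f g] by simp
  next
    case False
    hence n: "\<xi> < 0" "\<bar>\<xi>\<bar> = - \<xi>" using x0 by auto
    note T = pos[OF L2w_cnj[OF f] L2w_cnj[OF g], unfolded n(2)]
    note N = transforms_neg_integral[OF n(1) f g conjunct1[OF T]]
    \<comment> \<open>The weight is real, so the positive frequency result for cnj f and cnj g is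
      the conjugate of the wanted one; the eigenvalue and the derivative of \<omega> there are
      real.\<close>
    have e1: "(\<lambda>t. cnj (f t) * gauss t) = (\<lambda>t. cnj (f t * gauss t))" "(\<lambda>t. cnj (cnj (g t)) * gauss t) = (\<lambda>t. cnj (cnj (g t) * gauss t))"
      by (simp_all add: gauss_cnj)
    have "cnj (L2w_inner f g) = cnj (LINT l|lborel. B_tr \<xi> f l * cnj (U_tr \<xi> g l) * complex_of_real (wt l)) +
       cnj (res_form \<xi> (\<lambda>t. f t * gauss t) ?l) * cnj (res_form \<xi> (\<lambda>t. cnj (g t) * gauss t) ?l) / ?o"
      unfolding N(2) complex_cnj_cnj L2w_inner_cnj[symmetric] res_form_cnj[symmetric]
      using conjunct2[OF T] unfolding e1 by simp
    also have "\<dots> = cnj ((LINT l|lborel. B_tr \<xi> f l * cnj (U_tr \<xi> g l) * complex_of_real (wt l)) + L2w_inner (riesz_projection \<xi> ?l f) g)"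
      unfolding riesz[OF f g] by simp
    finally show ?thesis using N(1) unfolding complex_cnj_cancel_iff by blast
  qed
  show "integrable lborel (\<lambda>l. B_tr \<xi> f l * cnj (U_tr \<xi> g l) * complex_of_real (wt l))" if "f \<in> L2w" "g \<in> L2w"
    using all[OF that] by blast
  show "L2w_inner f g = (LINT l|lborel. B_tr \<xi> f l * cnj (U_tr \<xi> g l) * complex_of_real (wt l)) +
             L2w_inner (riesz_projection \<xi> (complex_of_real (lambda_star \<xi>)) f) g" if "f \<in> L2w" "g \<in> L2w"
    using all[OF that] by blast
qed

text \<open>D(i (1 + z) / |\<xi>|) / (i |\<xi>|) is entire and agrees with \<omega> for Re z > -1,
  so the identity theorem makes the description unique. At z = -1 the argument is 0, where D' = 2,
  and the inner and outer factors combine to 1 / |\<xi>|^2 = 1 / pi.\<close>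

lemma deriv_omega_continuation:
  assumes "\<bar>\<xi>\<bar> = sqrt pi"
  shows "deriv (omega_continuation \<xi>) (- 1) = complex_of_real (2 / pi)"
proof -
  have a: "\<bar>\<xi>\<bar> > 0" and x0: "\<xi> \<noteq> 0" using assms by auto
  let ?w = "\<lambda>z. \<i> * (1 + z) / complex_of_real \<bar>\<xi>\<bar>"
  let ?F = "\<lambda>z. dispersion \<bar>\<xi>\<bar> (?w z) / (\<i> * complex_of_real \<bar>\<xi>\<bar>)"
  have wd: "(?w has_field_derivative (\<i> / complex_of_real \<bar>\<xi>\<bar>)) (at z)" for z
    using x0 by (auto intro!: derivative_eq_intros)
  have Fd: "(?F has_field_derivative (2 + 2 * ?w z * plasma (?w z)) * (\<i> / complex_of_real \<bar>\<xi>\<bar>) / (\<i> * complex_of_real \<bar>\<xi>\<bar>)) (at z)" for z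
    by (rule DERIV_cdivide[OF DERIV_chain2[where f="dispersion \<bar>\<xi>\<bar>" and g="?w", OF dispersion_has_field_derivative wd]])
  hence Fh: "?F holomorphic_on UNIV" by (auto simp: holomorphic_on_def field_differentiable_def)
  have Fe: "?F z = omega z \<xi>" if "Re z > -1" for z
    using omega_dispersion[OF a that] omega_abs[OF x0, of z] by simp
  have "omega_continuation \<xi> = ?F"
    unfolding omega_continuation_def
  proof (rule the_equality)
    show "?F holomorphic_on UNIV \<and> (\<forall>z. -1 < Re z \<longrightarrow> ?F z = omega z \<xi>)" using Fh Fe by blast
    fix G assume G: "G holomorphic_on UNIV \<and> (\<forall>z. -1 < Re z \<longrightarrow> G z = omega z \<xi>)"
    show "G = ?F"
    proof
      fix z
      show "G z = ?F z"
      proof (rule analytic_continuation_open[where s="{z. Re z > -1}" and s'=UNIV and f=G and g="?F"])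
        show "open {z. Re z > -1}" by (rule open_halfspace_Re_gt)
        have "0 \<in> {z. Re z > -1}" by simp
        thus "{z. Re z > -1} \<noteq> {}" by blast
        show "G w = ?F w" if "w \<in> {z. Re z > -1}" for w using G Fe[of w] that by simp
      qed (use G Fh in auto)
    qed
  qed
  hence "deriv (omega_continuation \<xi>) (- 1) = (2 + 2 * ?w (-1) * plasma (?w (-1))) * (\<i> / complex_of_real \<bar>\<xi>\<bar>) / (\<i> * complex_of_real \<bar>\<xi>\<bar>)"
    using DERIV_imp_deriv[OF Fd] by simp
  also have "\<dots> = 2 / (complex_of_real \<bar>\<xi>\<bar> * complex_of_real \<bar>\<xi>\<bar>)" by simp
  also have "complex_of_real \<bar>\<xi>\<bar> * complex_of_real \<bar>\<xi>\<bar> = complex_of_real pi"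
    unfolding assms of_real_mult[symmetric] by simp
  finally show ?thesis by simp
qed

lemma P_minus_one_limit:
  assumes \<xi>: "\<bar>\<xi>\<bar> = sqrt pi"
    and F: "((\<lambda>b. cauchy_tr (\<lambda>t. f t * gauss t) (\<i> * complex_of_real b)) \<longlongrightarrow> F0) (side \<xi>)"
    and K: "((\<lambda>b. cauchy_tr (\<lambda>t. cnj (g t) * gauss t) (\<i> * complex_of_real b)) \<longlongrightarrow> K0) (side \<xi>)"
  shows "P_minus_one \<xi> f g = - (F0 * K0 / 2)"
proof -
  have x0: "\<xi> \<noteq> 0" using \<xi> by auto
  have nt: "side \<xi> \<noteq> bot" by (simp add: side_def)
  have e: "(LINT v|lborel. h v * complex_of_real (wt v) / (\<i> * complex_of_real \<xi> * (complex_of_real v - \<i> * complex_of_real b)))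
     = cauchy_tr (\<lambda>t. h t * gauss t) (\<i> * complex_of_real b) / (\<i> * complex_of_real \<xi>)" for h b
  proof -
    have "h v * complex_of_real (wt v) / (\<i> * complex_of_real \<xi> * (complex_of_real v - \<i> * complex_of_real b))
      = h v * gauss v / (complex_of_real v - \<i> * complex_of_real b) / (\<i> * complex_of_real \<xi>)" for v
      by (simp only: gauss_def divide_divide_eq_left mult.commute)
    thus ?thesis unfolding cauchy_tr_def by (simp only: integral_divide_zero)
  qed
  have nz: "\<i> * complex_of_real \<xi> \<noteq> 0" using x0 by simp
  have L1: "Lim (side \<xi>) (\<lambda>b. LINT v|lborel. f v * complex_of_real (wt v) / (\<i> * complex_of_real \<xi> * (complex_of_real v - \<i> * complex_of_real b))) = F0 / (\<i> * complex_of_real \<xi>)"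
    unfolding e by (intro tendsto_Lim nt tendsto_divide F tendsto_const nz)
  have L2: "Lim (side \<xi>) (\<lambda>b. LINT v|lborel. cnj (g v) * complex_of_real (wt v) / (\<i> * complex_of_real \<xi> * (complex_of_real v - \<i> * complex_of_real b))) = K0 / (\<i> * complex_of_real \<xi>)"
    unfolding e[of "\<lambda>v. cnj (g v)"] by (intro tendsto_Lim nt tendsto_divide K tendsto_const nz)
  have "\<xi> * \<xi> = \<bar>\<xi>\<bar> * \<bar>\<xi>\<bar>" by simp
  also have "\<dots> = pi" unfolding \<xi> by simp
  finally have "complex_of_real \<xi> * complex_of_real \<xi> = complex_of_real pi" unfolding of_real_mult[symmetric] by (rule arg_cong)
  \<comment> \<open>The two denominators multiply to -pi, and the prefactor pi / 2 leaves -F0 K0 /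
    2, which cancels the excess in \<open>transforms_critical\<close>.\<close>
  hence xx: "(\<i> * complex_of_real \<xi>) * (\<i> * complex_of_real \<xi>) = - complex_of_real pi" by (simp add: algebra_simps)
  have "P_minus_one \<xi> f g = 1 / complex_of_real (2 / pi) * ((F0 * K0) / ((\<i> * complex_of_real \<xi>) * (\<i> * complex_of_real \<xi>)))"
    unfolding P_minus_one_def L1 L2 deriv_omega_continuation[OF \<xi>] by (simp only: times_divide_times_eq mult.assoc)
  thus ?thesis unfolding xx by simp
qed

theorem transform_identity_critical:
  assumes \<xi>: "\<xi> = sqrt pi \<or> \<xi> = - sqrt pi" and f: "f \<in> H1w" and g: "g \<in> H1w"
  shows "reg_integrable \<xi> (B_tr \<xi> f) (U_tr \<xi> g)"
    and "L2w_inner f g = reg_integral \<xi> (B_tr \<xi> f) (U_tr \<xi> g) + P_minus_one \<xi> f g"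
proof -
  have fL: "f \<in> L2w" and gL: "g \<in> L2w" using f g by (auto simp: H1w_def)
  have ax: "\<bar>\<xi>\<bar> = sqrt pi" using \<xi> by auto
  have nt: "side \<xi> \<noteq> bot" by (simp add: side_def)
  have "\<exists>F0 K0. (\<forall>\<^sub>F b in side \<xi>. integrable lborel (reg_integrand b (B_tr \<xi> f) (U_tr \<xi> g))) \<and>
      ((\<lambda>b. LINT l|lborel. reg_integrand b (B_tr \<xi> f) (U_tr \<xi> g) l) \<longlongrightarrow> L2w_inner f g + F0 * K0 / 2) (side \<xi>) \<and>
      P_minus_one \<xi> f g = - (F0 * K0 / 2)"
  proof (cases "\<xi> = sqrt pi")
    case True
    have s: "side \<xi> = at_right 0" using True by (simp add: side_def)
    obtain F0 where F0: "((\<lambda>b. cauchy_tr (\<lambda>t. f t * gauss t) (\<i> * complex_of_real b)) \<longlongrightarrow> F0) (at_right 0)"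
      using H1w_cauchy_tr_limit[OF f] .
    obtain K0 where K0: "((\<lambda>b. cauchy_tr (\<lambda>t. cnj (g t) * gauss t) (\<i> * complex_of_real b)) \<longlongrightarrow> K0) (at_right 0)"
      using H1w_cauchy_tr_limit[OF H1w_cnj[OF g]] .
    note T = transforms_critical[OF True fL gL F0 K0]
    have "\<forall>\<^sub>F b in at_right 0. integrable lborel (reg_integrand b (B_tr \<xi> f) (U_tr \<xi> g))"
      using eventually_at_right_less[of "0::real"] by eventually_elim (rule T(1))
    thus ?thesis using T(2) P_minus_one_limit[OF ax, unfolded s, OF F0 K0] unfolding s by blast
  next
    case False
    hence xm: "\<xi> = - sqrt pi" using \<xi> by blast
    have n: "\<xi> < 0" "- \<xi> = sqrt pi" using xm by auto
    have s: "side \<xi> = at_left 0" using n by (simp add: side_def)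
    let ?f = "\<lambda>v. cnj (f v)" and ?g = "\<lambda>v. cnj (g v)"
    obtain F0 where F0: "((\<lambda>b. cauchy_tr (\<lambda>t. ?f t * gauss t) (\<i> * complex_of_real b)) \<longlongrightarrow> F0) (at_right 0)"
      using H1w_cauchy_tr_limit[OF H1w_cnj[OF f]] .
    obtain K0 where K0: "((\<lambda>b. cauchy_tr (\<lambda>t. cnj (?g t) * gauss t) (\<i> * complex_of_real b)) \<longlongrightarrow> K0) (at_right 0)"
      using H1w_cauchy_tr_limit[OF H1w_cnj[OF H1w_cnj[OF g]]] .
    note T = transforms_critical[OF n(2) L2w_cnj[OF fL] L2w_cnj[OF gL] F0 K0]
    \<comment> \<open>For negative \<xi> the regularization runs through b < 0; conjugation
      exchanges -b with b and reduces every limit from the left to one from the right.\<close>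
    have cc: "cauchy_tr (\<lambda>t. h t * gauss t) (\<i> * complex_of_real (- b)) = cnj (cauchy_tr (\<lambda>t. cnj (h t) * gauss t) (\<i> * complex_of_real b))" for h b
      using cauchy_tr_cnj[of "\<lambda>t. cnj (h t) * gauss t" "\<i> * complex_of_real b"] by (simp add: gauss_cnj)
    have F1: "((\<lambda>b. cauchy_tr (\<lambda>t. f t * gauss t) (\<i> * complex_of_real b)) \<longlongrightarrow> cnj F0) (side \<xi>)"
      unfolding s tendsto_at_left_0_iff cc by (intro tendsto_cnj F0)
    have K1: "((\<lambda>b. cauchy_tr (\<lambda>t. cnj (g t) * gauss t) (\<i> * complex_of_real b)) \<longlongrightarrow> cnj K0) (side \<xi>)"
      unfolding s tendsto_at_left_0_iff cc[of "\<lambda>t. cnj (g t)"] by (intro tendsto_cnj K0)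
    note [measurable] = transforms_neg_measurable(1)[OF n(1) fL] transforms_neg_measurable(2)[OF n(1) gL]
    have m: "reg_integrand b (B_tr \<xi> f) (U_tr \<xi> g) \<in> borel_measurable lborel" for b
      unfolding reg_integrand_def[abs_def] by measurable
    let ?R = "\<lambda>b. reg_integrand b (B_tr (- \<xi>) ?f) (U_tr (- \<xi>) ?g)"
    have ae: "AE l in lborel. reg_integrand (- b) (B_tr \<xi> f) (U_tr \<xi> g) l = cnj (?R b l)" for b
      using transforms_neg_AE(1)[OF n(1) fL] transforms_neg_AE(2)[OF n(1) gL]
      by eventually_elim (simp add: reg_integrand_def)
    have I: "integrable lborel (reg_integrand (- b) (B_tr \<xi> f) (U_tr \<xi> g))"
      "(LINT l|lborel. reg_integrand (- b) (B_tr \<xi> f) (U_tr \<xi> g) l) = cnj (LINT l|lborel. ?R b l)" if "b > 0" for b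
    proof -
      have i: "integrable lborel (\<lambda>l. cnj (?R b l))" by (rule integrable_cnj[OF T(1)[OF that]])
      show "integrable lborel (reg_integrand (- b) (B_tr \<xi> f) (U_tr \<xi> g))"
        using integrable_cong_AE[OF m borel_measurable_integrable[OF i] ae] i by simp
      show "(LINT l|lborel. reg_integrand (- b) (B_tr \<xi> f) (U_tr \<xi> g) l) = cnj (LINT l|lborel. ?R b l)"
        unfolding integral_cong_AE[OF m borel_measurable_integrable[OF i] ae] by (rule Bochner_Integration.integral_cnj)
    qed
    have "\<forall>\<^sub>F b in side \<xi>. integrable lborel (reg_integrand b (B_tr \<xi> f) (U_tr \<xi> g))"
      unfolding s eventually_at_left_field by (intro exI[of _ "-1"]) (use I(1)[of "- b" for b] in auto)
    moreover have "((\<lambda>b. LINT l|lborel. reg_integrand b (B_tr \<xi> f) (U_tr \<xi> g) l) \<longlongrightarrow> L2w_inner f g + cnj F0 * cnj K0 / 2) (side \<xi>)"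
    proof -
      have "((\<lambda>b. cnj (LINT l|lborel. ?R b l)) \<longlongrightarrow> cnj (L2w_inner ?f ?g + F0 * K0 / 2)) (at_right 0)"
        by (intro tendsto_cnj T(2))
      moreover have "\<forall>\<^sub>F b in at_right 0. cnj (LINT l|lborel. ?R b l) = (LINT l|lborel. reg_integrand (- b) (B_tr \<xi> f) (U_tr \<xi> g) l)"
        using eventually_at_right_less[of "0::real"] by eventually_elim (rule I(2)[symmetric])
      ultimately have "((\<lambda>b. LINT l|lborel. reg_integrand (- b) (B_tr \<xi> f) (U_tr \<xi> g) l) \<longlongrightarrow> cnj (L2w_inner ?f ?g + F0 * K0 / 2)) (at_right 0)"
        by (rule Lim_transform_eventually)
      thus ?thesis unfolding s tendsto_at_left_0_iff L2w_inner_cnj by simp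
    qed
    ultimately show ?thesis using P_minus_one_limit[OF ax F1 K1] by blast
  qed
  then obtain F0 K0 where A: "\<forall>\<^sub>F b in side \<xi>. integrable lborel (reg_integrand b (B_tr \<xi> f) (U_tr \<xi> g))"
      "((\<lambda>b. LINT l|lborel. reg_integrand b (B_tr \<xi> f) (U_tr \<xi> g) l) \<longlongrightarrow> L2w_inner f g + F0 * K0 / 2) (side \<xi>)"
      "P_minus_one \<xi> f g = - (F0 * K0 / 2)" by blast
  show "reg_integrable \<xi> (B_tr \<xi> f) (U_tr \<xi> g)" unfolding reg_integrable_def using A(1,2) by blast
  show "L2w_inner f g = reg_integral \<xi> (B_tr \<xi> f) (U_tr \<xi> g) + P_minus_one \<xi> f g"
    unfolding reg_integral_def A(3) tendsto_Lim[OF nt A(2)] by simp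
qed

theorem theorem7p5:
  fixes \<xi> :: real
  assumes "\<xi> \<noteq> 0"
  shows
    "(\<xi> \<in> {- sqrt pi<..<0} \<union> {0<..<sqrt pi} \<longrightarrow>
        lambda_star \<xi> \<in> {-1<..<0} \<and>
        isolated_eigenvalue \<xi> (complex_of_real (lambda_star \<xi>)) \<and>
        simple_eigenvalue \<xi> (complex_of_real (lambda_star \<xi>)) \<and>
        (\<forall>f \<in> L2w. \<forall>g \<in> L2w.
           integrable lborel (\<lambda>l. B_tr \<xi> f l * cnj (U_tr \<xi> g l) * complex_of_real (wt l)) \<and>
           L2w_inner f g =
             (LINT l|lborel. B_tr \<xi> f l * cnj (U_tr \<xi> g l) * complex_of_real (wt l)) +
             L2w_inner (riesz_projection \<xi> (complex_of_real (lambda_star \<xi>)) f) g)) \<and>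
     (\<xi> = sqrt pi \<or> \<xi> = - sqrt pi \<longrightarrow>
        (\<forall>f \<in> H1w. \<forall>g \<in> H1w.
           reg_integrable \<xi> (B_tr \<xi> f) (U_tr \<xi> g) \<and>
           L2w_inner f g = reg_integral \<xi> (B_tr \<xi> f) (U_tr \<xi> g) + P_minus_one \<xi> f g)) \<and>
     (\<xi> \<notin> {- sqrt pi..sqrt pi} \<longrightarrow>
        (\<forall>f \<in> L2w. \<forall>g \<in> L2w.
           integrable lborel (\<lambda>l. B_tr \<xi> f l * cnj (U_tr \<xi> g l) * complex_of_real (wt l)) \<and>
           L2w_inner f g =
             (LINT l|lborel. B_tr \<xi> f l * cnj (U_tr \<xi> g l) * complex_of_real (wt l))))"
  using transform_identity_subcritical[of \<xi>] transform_identity_critical[of \<xi>] transform_identity_supercritical[of \<xi>]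
  by auto

end
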